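(* Let $n=2$ and let $\mu,g,f$ satisfy the structural assumptions $(S)$. Let $u$ be $C^2_{\rm loc}$ in the interior of $\mathbb{R}^{3}_+$, and assume that $u$ is a bounded and stable weak solution of $$\begin{cases} -{\rm div}\,(\mu(x)\nabla u)+g(x,u)=0 & \text{on } \mathbb{R}^{3}_+,\\ -\mu(x)u_x=f(u) & \text{on } \partial\mathbb{R}^{3}_+,\end{cases}$$ with $|\nabla_y u|\in L^\infty(\overline{B_r^+})$ for all $r>0$. Suppose also that at least one of the following two conditions holds: (a) for any $M>0$ the map $(0,+\infty)\ni x\mapsto\sup_{|t|\le M}|g(x,t)|$ is in $L^1((0,+\infty))$; (b) $\inf_{x>0,\ t\in\mathbb{R}}\,g(x,t)\,t\ge 0$. Suppose moreover that there exists $C>0$ such that $\int_0^R\mu(x)\,dx\le CR^2$ for any $R\ge 1$. Then there exist $\omega\in {\rm S}^1$ and $u_o:\mathbb{R}\times[0,+\infty)\to\mathbb{R}$ such that $$u(y,x)=u_o(\omega\cdot y,x)\qquad\text{for any }(y,x)\in\mathbb{R}^3_+ .$$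
   Context: Notation (with $n=2$). Points of $\mathbb{R}^{n+1}_+:=\mathbb{R}^n\times(0,+\infty)$ are written $(y,x)$ with $y\in\mathbb{R}^n$, $x>0$; $\partial\mathbb{R}^{n+1}_+=\mathbb{R}^n\times\{0\}$. $\nabla$ is the full gradient in $(y,x)$, $\nabla_y$ the gradient in $y$, $u_x=\partial_x u$. $B_R$ is the ball of radius $R$ centered at $0$ in $\mathbb{R}^{n+1}$ and $B_R^+:=B_R\cap\mathbb{R}^{n+1}_+$. ${\rm S}^1$ is the unit circle in $\mathbb{R}^2$. Structural assumptions $(S)$ on $\mu:(0,+\infty)\to\mathbb{R}$, $g:(0,+\infty)\times\mathbb{R}\to\mathbb{R}$, $f:\mathbb{R}\to\mathbb{R}$: (i) $\mu\in L^1((0,r))$ for any $r>0$, and for every $K\Subset\mathbb{R}^{n+1}_+$ there are $\mu_1,\mu_2>0$, possibly depending on $K$, with $\mu_1\le\mu(x)\le\mu_2$ for all $(y,x)\in K$. (ii) $\mu$ is an $A_2$-Muckenhoupt weight: there exists $\kappa>0$ such that $\int_a^b\mu(x)\,dx\int_a^b\frac{1}{\mu(x)}\,dx\le\kappa(b-a)^2$ for any $b\ge a\ge 0$. (iii) The map $x\mapsto g(x,0)$ belongs to $L^\infty((0,r))$ for any $r>0$; for any $x>0$ the map $u\mapsto g(x,u)$ is locally Lipschitz; and for any $R,M>0$ there exists $C>0$, possibly depending on $R$ and $M$, such that $\sup_{0<x<R,\,|u|<M}|g_u(x,u)|\le C$. (iv) $f$ is locally Lipschitz in $\mathbb{R}$.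 Here $g_u=\partial g/\partial u$ and $f'$ are the derivatives of these locally Lipschitz functions (existing almost everywhere). Admissible test functions: for some $R>0$, $\xi$ is a real function on $\mathbb{R}^{n+1}_+$ that is bounded, locally Lipschitz in the interior of $\mathbb{R}^{n+1}_+$, vanishes on $\mathbb{R}^{n+1}_+\setminus B_R$, and satisfies $\mu(x)|\nabla\xi|^2\in L^1(B_R^+)$. Weak solution: $u\in L^\infty_{\rm loc}(\overline{\mathbb{R}^{n+1}_+})$, $\mu(x)|\nabla u|^2\in L^1(B_R^+)$ for any $R>0$, and $$\int_{\mathbb{R}^{n+1}_+}\mu(x)\nabla u\cdot\nabla\xi+\int_{\mathbb{R}^{n+1}_+}g(x,u)\,\xi=\int_{\partial\mathbb{R}^{n+1}_+}f(u)\,\xi$$ for every admissible $\xi$. Stable: for every admissible $\xi$ (vanishing outside $B_R$), $$\int_{B_R^+}\mu(x)|\nabla\xi|^2+\int_{B_R^+}g_u(x,u)\xi^2-\int_{B_R\cap\partial\mathbb{R}^{n+1}_+}f'(u)\xi^2\ge 0 .$$ *)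

theory Defs
  imports "HOL-Analysis.Analysis"
begin

type_synonym point = "(real^2) \<times> real"

definition half_space :: "point set" where
  "half_space = {z. 0 < snd z}"

definition half_ball :: "real \<Rightarrow> point set" where
  "half_ball R = ball 0 R \<inter> half_space"

text \<open>The intersection of the ball with the plane \<open>x = 0\<close>, as a subset of the plane.\<close>

definition boundary_disc :: "real \<Rightarrow> (real^2) set" where
  "boundary_disc R = {y. (y, 0 :: real) \<in> ball 0 R}"

text \<open>The trace on the plane \<open>x = 0\<close>, as the limit along the normal line.  If a weight is of class
  \<open>A\<^sub>2\<close>, then every locally Lipschitz function on the open half-space whose gradient is locally
  square integrable up to the boundary with that weight has integrable normal derivative near
  \<open>x = 0\<close> on almost every normal line (Cauchy-Schwarz and Fubini), so this limit exists for almost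
  every \<open>y\<close> and is the usual Sobolev trace.\<close>

definition trace0 :: "(point \<Rightarrow> real) \<Rightarrow> real^2 \<Rightarrow> real" where
  "trace0 v y = Lim (at_right 0) (\<lambda>x. v (y, x))"

text \<open>The full gradient in \<open>(y, x)\<close>; its components are \<open>fst (grad v z)\<close>, the gradient in \<open>y\<close>, and
  \<open>snd (grad v z)\<close>.  It is unspecified where \<open>v\<close> is not differentiable; for locally Lipschitz \<open>v\<close>
  this is a null set by Rademacher's theorem, hence irrelevant under Lebesgue integrals.\<close>

definition grad :: "(point \<Rightarrow> real) \<Rightarrow> point \<Rightarrow> point" where
  "grad v z = (THE D. GDERIV v z :> D)"

definition C2_on :: "point set \<Rightarrow> (point \<Rightarrow> real) \<Rightarrow> bool" where
  "C2_on S v \<longleftrightarrow>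
     (\<exists>G (H :: point \<Rightarrow> point \<Rightarrow>\<^sub>L point).
        (\<forall>z\<in>S. GDERIV v z :> G z) \<and>
        (\<forall>z\<in>S. (G has_derivative blinfun_apply (H z)) (at z)) \<and>
        continuous_on S H)"

text \<open>Library notion with a dummy time parameter.\<close>

definition locally_lipschitz_on :: "'a::metric_space set \<Rightarrow> ('a \<Rightarrow> real) \<Rightarrow> bool" where
  "locally_lipschitz_on S v \<longleftrightarrow> local_lipschitz {0::real} S (\<lambda>_. v)"

definition Linfty_on :: "'a::euclidean_space set \<Rightarrow> ('a \<Rightarrow> 'b::real_normed_vector) \<Rightarrow> bool" where
  "Linfty_on S v \<longleftrightarrow>
     set_borel_measurable lebesgue S v \<and> (\<exists>C. AE z in lebesgue. z \<in> S \<longrightarrow> norm (v z) \<le> C)"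

definition locally_bounded_weight :: "(real \<Rightarrow> real) \<Rightarrow> bool" where
  "locally_bounded_weight \<mu> \<longleftrightarrow>
     (\<forall>r>0. set_integrable lebesgue {0<..<r} \<mu>) \<and>
     (\<forall>K. compact (closure K) \<and> closure K \<subseteq> half_space \<longrightarrow>
        (\<exists>\<mu>1>0. \<exists>\<mu>2>0. \<forall>(y, x)\<in>K. \<mu> x \<in> {\<mu>1..\<mu>2}))"

text \<open>Extended nonnegative integrals, because the real-valued integral of a nonintegrable
  \<open>1 / \<mu>\<close> would be \<open>0\<close>.\<close>

definition A2_weight :: "(real \<Rightarrow> real) \<Rightarrow> bool" where
  "A2_weight \<mu> \<longleftrightarrow>
     (\<exists>\<kappa>>0. \<forall>a b. 0 \<le> a \<and> a \<le> b \<longrightarrow>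
        (\<integral>\<^sup>+x\<in>{a<..<b}. ennreal (\<mu> x) \<partial>lebesgue) * (\<integral>\<^sup>+x\<in>{a<..<b}. ennreal (1 / \<mu> x) \<partial>lebesgue)
          \<le> ennreal (\<kappa> * (b - a)\<^sup>2))"

text \<open>The bound on \<open>g\<^sub>u\<close> is imposed at the points where this derivative exists.\<close>

definition structural_assumptions ::
    "(real \<Rightarrow> real) \<Rightarrow> (real \<Rightarrow> real \<Rightarrow> real) \<Rightarrow> (real \<Rightarrow> real) \<Rightarrow> bool" where
  "structural_assumptions \<mu> g f \<longleftrightarrow>
     locally_bounded_weight \<mu> \<and>
     A2_weight \<mu> \<and>
     (\<forall>r>0. Linfty_on {0<..<r} (\<lambda>x. g x 0)) \<and>
     (\<forall>x>0. locally_lipschitz_on UNIV (g x)) \<and>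
     (\<forall>R>0. \<forall>M>0. \<exists>C>0. \<forall>x t D. 0 < x \<and> x < R \<and> \<bar>t\<bar> < M \<and> (g x has_real_derivative D) (at t)
        \<longrightarrow> \<bar>D\<bar> \<le> C) \<and>
     locally_lipschitz_on UNIV f"

definition admissible :: "(real \<Rightarrow> real) \<Rightarrow> real \<Rightarrow> (point \<Rightarrow> real) \<Rightarrow> bool" where
  "admissible \<mu> R \<xi> \<longleftrightarrow>
     R > 0 \<and>
     bounded (\<xi> ` half_space) \<and>
     locally_lipschitz_on half_space \<xi> \<and>
     (\<forall>z\<in>half_space - ball 0 R. \<xi> z = 0) \<and>
     set_integrable lebesgue (half_ball R) (\<lambda>z. \<mu> (snd z) * (norm (grad \<xi> z))\<^sup>2)"

text \<open>The gradient of \<open>u\<close> is the classical one, so the following is meant for \<open>u\<close> that are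
  locally Lipschitz in the open half-space (in particular \<open>C\<^sup>2\<close>).  An identity or
  inequality between integrals includes the claim that the integrals exist; here this only amounts
  to measurability of the integrands.\<close>

definition weak_solution ::
    "(real \<Rightarrow> real) \<Rightarrow> (real \<Rightarrow> real \<Rightarrow> real) \<Rightarrow> (real \<Rightarrow> real) \<Rightarrow> (point \<Rightarrow> real) \<Rightarrow> bool" where
  "weak_solution \<mu> g f u \<longleftrightarrow>
     (\<forall>K. compact K \<and> K \<subseteq> closure half_space \<longrightarrow> Linfty_on K u) \<and>
     (\<forall>R>0. set_integrable lebesgue (half_ball R) (\<lambda>z. \<mu> (snd z) * (norm (grad u z))\<^sup>2)) \<and>
     (\<forall>R \<xi>. admissible \<mu> R \<xi> \<longrightarrow>
        set_integrable lebesgue half_space (\<lambda>z. \<mu> (snd z) * (grad u z \<bullet> grad \<xi> z)) \<and>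
        set_integrable lebesgue half_space (\<lambda>z. g (snd z) (u z) * \<xi> z) \<and>
        integrable lebesgue (\<lambda>y. f (trace0 u y) * trace0 \<xi> y) \<and>
        (LINT z:half_space|lebesgue. \<mu> (snd z) * (grad u z \<bullet> grad \<xi> z)) +
        (LINT z:half_space|lebesgue. g (snd z) (u z) * \<xi> z) =
        (LINT y|lebesgue. f (trace0 u y) * trace0 \<xi> y))"

text \<open>At points where \<open>f\<close> or \<open>g x\<close> is not differentiable, \<open>deriv\<close> returns an unspecified
  constant.\<close>

definition stable_solution ::
    "(real \<Rightarrow> real) \<Rightarrow> (real \<Rightarrow> real \<Rightarrow> real) \<Rightarrow> (real \<Rightarrow> real) \<Rightarrow> (point \<Rightarrow> real) \<Rightarrow> bool" where
  "stable_solution \<mu> g f u \<longleftrightarrow>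
     (\<forall>R \<xi>. admissible \<mu> R \<xi> \<longrightarrow>
        set_integrable lebesgue (half_ball R) (\<lambda>z. deriv (g (snd z)) (u z) * (\<xi> z)\<^sup>2) \<and>
        set_integrable lebesgue (boundary_disc R) (\<lambda>y. deriv f (trace0 u y) * (trace0 \<xi> y)\<^sup>2) \<and>
        (LINT z:half_ball R|lebesgue. \<mu> (snd z) * (norm (grad \<xi> z))\<^sup>2) +
        (LINT z:half_ball R|lebesgue. deriv (g (snd z)) (u z) * (\<xi> z)\<^sup>2) -
        (LINT y:boundary_disc R|lebesgue. deriv f (trace0 u y) * (trace0 \<xi> y)\<^sup>2) \<ge> 0)"

end

theory Submission
  imports Defs
begin

text \<open>Let \<open>v\<close> be the gradient of \<open>u\<close> in \<open>y\<close> and \<open>w = \<bar>v\<bar>\<close>. Testing the equation with \<open>u \<Phi>\<^sup>2\<close> bounds the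
  weighted Dirichlet energy on balls of radius \<open>R\<close> by \<open>C R\<^sup>2\<close>. Difference quotients show that the components of
  \<open>v\<close> solve the linearized equation, and comparing it, tested with \<open>v\<^sub>i \<Phi>\<^sup>2\<close>, with the stability inequality
  for \<open>w \<Phi>\<close> gives
  \<open>\<integral>\<mu> \<Phi>\<^sup>2 (\<Sum>\<^sub>i \<bar>\<nabla>v\<^sub>i\<bar>\<^sup>2 - \<bar>\<nabla>w\<bar>\<^sup>2) \<le> \<integral>\<mu> w\<^sup>2 \<bar>\<nabla>\<Phi>\<bar>\<^sup>2\<close>. With logarithmic cutoffs the right-hand side tends
  to \<open>0\<close> by the energy bound, so \<open>v\<^sub>1 \<nabla>v\<^sub>2 = v\<^sub>2 \<nabla>v\<^sub>1\<close>: the direction of \<open>v\<close> is locally constant where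
  \<open>w \<noteq> 0\<close>. Hence \<open>v\<close> is constant on horizontal lines orthogonal to it, and two such lines with different directions
  would meet, so \<open>v\<close> has one direction on each slice \<open>x = const\<close>. The same cutoffs show that \<open>w\<close> solves the linearized
  equation in the interior; averaged over discs, this excludes that \<open>w\<close> vanishes on one slice without vanishing
  identically, and so the directions on different slices agree.\<close>

subsection \<open>Functions of one real variable\<close>

text \<open>Three obstacles shape the proof. First, \<open>f\<close> and \<open>g x\<close> are only
  locally Lipschitz, and \<open>u\<close> may take values at which they are not differentiable on a
  set of positive measure. There the default value of \<open>deriv\<close> enters the stability
  form, but at almost every such point the derivative of \<open>u\<close> in a given horizontal
  direction vanishes, so the products in the linearized equation do not see it. Second, the
  derivatives of \<open>v\<close> are controlled up to \<open>x = 0\<close> only in weighted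
  \<open>L2\<close>. The differenced equation is bounded in this norm, traces of \<open>v\<close>
  exist for almost every \<open>y\<close>, and the limit is taken by weak convergence. Third,
  \<open>\<mu>\<close> is merely measurable and locally bounded, so \<open>w\<close> satisfies its
  equation only in integrated form. The averages \<open>W r x\<close> of \<open>w\<close> over discs
  take the place of a maximum principle: in the vertical coordinate with differential
  \<open>dx / \<mu> x\<close> the flux of \<open>w\<close> is exactly a difference of values of
  \<open>W r\<close>, and on a short interval around a zero of \<open>W r\<close> this forces
  \<open>W r = 0\<close>.\<close>

lemma negligible_not_DERIV_integral:
  fixes F h :: "real \<Rightarrow> real"
  assumes F: "\<And>a b. a \<le> b \<Longrightarrow> (h has_integral (F b - F a)) {a..b}"
  shows "negligible {x. \<not> (F has_real_derivative h x) (at x)}"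
proof -
  have i1: "h integrable_on cbox a b" for a b
    using F[of a b] by (cases "a \<le> b") (auto simp: integrable_on_def)
  \<comment> \<open>The differentiation theorem averages over \<open>{x..x + k}\<close> with
    \<open>0 < k\<close> only. Left difference quotients are right averages of the reflected
    function at \<open>- x\<close>, so the exceptional set consists of \<open>N1\<close> and the
    mirror image of \<open>N2\<close>.\<close>
  have R: "((\<lambda>x. h (- x)) has_integral (F (-a) - F (-b))) {a..b}" if "a \<le> b" for a b
    using F[of "-b" "-a"] that has_integral_reflect_real[of h "F (-a) - F (-b)" "-a" "-b"] by simp
  have i2: "(\<lambda>x. h (- x)) integrable_on cbox a b" for a b
    using R[of a b] by (cases "a \<le> b") (auto simp: integrable_on_def)
  obtain N1 where N1: "negligible N1" "\<And>x e. \<lbrakk>x \<notin> N1; 0 < e\<rbrakk> \<Longrightarrow> \<exists>d>0. \<forall>k. 0 < k \<and> k < d \<longrightarrow>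
        norm (integral (cbox x (x + k *\<^sub>R One)) h /\<^sub>R k ^ DIM(real) - h x) < e"
    using integrable_ccontinuous_explicit[OF i1] by blast
  obtain N2 where N2: "negligible N2" "\<And>x e. \<lbrakk>x \<notin> N2; 0 < e\<rbrakk> \<Longrightarrow> \<exists>d>0. \<forall>k. 0 < k \<and> k < d \<longrightarrow>
        norm (integral (cbox x (x + k *\<^sub>R One)) (\<lambda>x. h (- x)) /\<^sub>R k ^ DIM(real) - h (- x)) < e"
    using integrable_ccontinuous_explicit[OF i2] by blast
  have "negligible (uminus ` N2)"
    by (rule negligible_locally_Lipschitz_image[OF _ N2(1)]) (auto intro!: exI[of _ "UNIV :: real set"] exI[of _ "1::real"])
  then have "negligible (N1 \<union> uminus ` N2)" using N1(1) by simp
  moreover have "{x. \<not> (F has_real_derivative h x) (at x)} \<subseteq> N1 \<union> uminus ` N2"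
  proof (rule ccontr)
    assume "\<not> ?thesis"
    then obtain x where nd: "\<not> (F has_real_derivative h x) (at x)" and x1: "x \<notin> N1" and x2: "- x \<notin> N2"
      by (force simp: image_iff)
    have "(\<lambda>k. (F (x + k) - F x) / k) \<midarrow>0\<rightarrow> h x"
      unfolding LIM_eq
    proof safe
      fix e :: real assume "0 < e"
      obtain d1 where d1: "d1 > 0" "\<And>k. 0 < k \<Longrightarrow> k < d1 \<Longrightarrow> norm (integral (cbox x (x + k *\<^sub>R One)) h /\<^sub>R k ^ DIM(real) - h x) < e"
        using N1(2)[OF x1 \<open>0 < e\<close>] by blast
      obtain d2 where d2: "d2 > 0" "\<And>k. 0 < k \<Longrightarrow> k < d2 \<Longrightarrow>
         norm (integral (cbox (-x) (-x + k *\<^sub>R One)) (\<lambda>x. h (- x)) /\<^sub>R k ^ DIM(real) - h (- (- x))) < e"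
        using N2(2)[OF x2 \<open>0 < e\<close>] by blast
      have "norm ((F (x + k) - F x) / k - h x) < e" if k: "k \<noteq> 0" "norm (k - 0) < min d1 d2" for k
      proof (cases "k > 0")
        case True
        then have "integral (cbox x (x + k *\<^sub>R One)) h = F (x + k) - F x"
          using F[of x "x + k"] by (simp add: integral_unique)
        then show ?thesis using d1(2)[of k] True k by (simp add: divide_inverse mult.commute)
      next
        case False
        then have "integral (cbox (-x) (-x + (-k) *\<^sub>R One)) (\<lambda>x. h (- x)) = F x - F (x + k)"
          using R[of "-x" "-k - x"] by (simp add: integral_unique add.commute)
        then show ?thesis using d2(2)[of "-k"] False k
          by (simp add: divide_inverse mult.commute) (smt (verit, ccfv_SIG) minus_mult_right)
      qed
      then show "\<exists>s>0. \<forall>k. k \<noteq> 0 \<and> norm (k - 0) < s \<longrightarrow> norm ((F (x + k) - F x) / k - h x) < e"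
        using d1(1) d2(1) by (intro exI[of _ "min d1 d2"]) auto
    qed
    then show False using nd by (simp add: DERIV_def)
  qed
  ultimately show ?thesis by (rule negligible_subset)
qed

text \<open>Adding a multiple of the identity makes the function an expanding bijection; the image measure
  of its inverse is absolutely continuous, and its Radon-Nikodym density is the derivative.\<close>

lemma lipschitz_real_FTC:
  fixes f :: "real \<Rightarrow> real"
  assumes L: "L-lipschitz_on UNIV f"
  obtains h where "\<And>a b. a \<le> b \<Longrightarrow> (h has_integral (f b - f a)) {a..b}"
    and "negligible {x. \<not> (f has_real_derivative h x) (at x)}"
proof -
  \<comment> \<open>The slope \<open>L + 1\<close> makes \<open>F\<close> expand distances by a
    factor of at least 1, so that its inverse \<open>K\<close> is 1-Lipschitz; the slope
    \<open>L\<close> would give monotonicity only.\<close>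
  define F where "F = (\<lambda>x. f x + (L + 1) * x)"
  have L0: "0 \<le> L" using L lipschitz_on_nonneg by blast
  have lip: "\<bar>f x - f y\<bar> \<le> L * \<bar>x - y\<bar>" for x y
    using lipschitz_onD[OF L, of x y] by (simp add: dist_real_def)
  have exp: "y - x \<le> F y - F x" if "x \<le> y" for x y
    using lip[of x y] that by (simp add: F_def algebra_simps abs_if split: if_splits)
  have smono: "F x < F y \<longleftrightarrow> x < y" for x y
    using exp[of x y] exp[of y x] by linarith
  have mono: "F x \<le> F y \<longleftrightarrow> x \<le> y" for x y
    using smono[of y x] by linarith
  have contF: "continuous_on UNIV F"
    unfolding F_def using lipschitz_on_continuous_on[OF L] by (auto intro!: continuous_intros)
  have ex: "\<exists>x. F x = y" for y
  proof -
    define r where "r = \<bar>y - F 0\<bar>"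
    have "F (-r) \<le> y" "y \<le> F r" using exp[of "-r" 0] exp[of 0 r] by (auto simp: r_def)
    then have "\<exists>x. -r \<le> x \<and> x \<le> r \<and> F x = y"
      by (intro IVT') (auto intro: continuous_on_subset[OF contF] simp: r_def)
    then show ?thesis by blast
  qed
  define K where "K y = (SOME x. F x = y)" for y
  have FK: "F (K y) = y" for y unfolding K_def using someI_ex[OF ex[of y]] .
  have KF: "K (F x) = x" for x using FK[of "F x"] smono by (metis linorder_neq_iff)
  have "\<bar>K x - K y\<bar> \<le> \<bar>x - y\<bar>" for x y
    using exp[of "K x" "K y"] exp[of "K y" "K x"] FK by (smt (verit))
  then have "continuous_on UNIV K"
    by (intro lipschitz_on_continuous_on[of 1]) (auto simp: lipschitz_on_def dist_real_def)
  then have Km[measurable]: "K \<in> borel_measurable borel" by (rule borel_measurable_continuous_onI)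
  define m where "m = distr lborel borel K"
  have vim: "K -` A = F ` A" for A
    using FK KF by (auto simp: image_iff) metis
  have vimI: "K -` {a<..b} = {F a<..F b}" for a b
  proof -
    have "x \<in> K -` {a<..b} \<longleftrightarrow> x \<in> {F a<..F b}" for x
      using smono[of a "K x"] mono[of "K x" b] FK[of x] by auto
    then show ?thesis by blast
  qed
  have em: "emeasure m {a<..b} = ennreal (F b - F a)" if "a \<le> b" for a b
  proof -
    have "emeasure m {a<..b} = emeasure lborel (K -` {a<..b})"
      unfolding m_def by (subst emeasure_distr) auto
    also have "\<dots> = ennreal (F b - F a)" unfolding vimI using that mono by simp
    finally show ?thesis .
  qed
  \<comment> \<open>The preimage of a null set under \<open>K\<close> is its image under the
    Lipschitz map \<open>F\<close>, hence null.\<close>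
  have ac: "absolutely_continuous lborel m"
    unfolding absolutely_continuous_def
  proof
    fix A :: "real set" assume A: "A \<in> null_sets lborel"
    have nA: "negligible A" using A by (simp add: negligible_iff_null_sets null_sets_completionI)
    have "negligible (F ` A)"
    proof (rule negligible_locally_Lipschitz_image[OF _ nA])
      fix x assume "x \<in> A"
      have "norm (F y - F x) \<le> (2 * L + 1) * norm (y - x)" for y
        using lip[of y x] by (simp add: F_def algebra_simps abs_if split: if_splits)
      then show "\<exists>T B. open T \<and> x \<in> T \<and> (\<forall>y\<in>A \<inter> T. norm (F y - F x) \<le> B * norm (y - x))"
        by (intro exI[of _ UNIV] exI[of _ "2 * L + 1"]) auto
    qed simp
    then have n: "K -` A \<in> null_sets lebesgue" by (simp add: vim negligible_iff_null_sets)
    have sA: "A \<in> sets borel" using A by auto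
    have "K -` A \<in> sets borel" using measurable_sets[OF Km sA] by simp
    then have "emeasure lborel (K -` A) = 0" using n by (simp add: null_sets_def)
    then show "A \<in> null_sets m" using sA by (auto simp: null_sets_def m_def emeasure_distr)
  qed
  define h0 where "h0 = RN_deriv lborel m"
  have dens: "density lborel h0 = m"
    unfolding h0_def by (rule sigma_finite_measure.density_RN_deriv[OF sigma_finite_lborel ac]) (simp add: m_def)
  have h0m[measurable]: "h0 \<in> borel_measurable lborel" unfolding h0_def by simp
  have hF: "((\<lambda>x. enn2real (h0 x)) has_integral (F b - F a)) {a..b}" if "a \<le> b" for a b
  proof -
    have fin: "(\<integral>\<^sup>+x. h0 x * indicator {a<..b} x \<partial>lborel) = ennreal (F b - F a)"
      using em[OF that] by (simp add: dens[symmetric] emeasure_density)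
    \<comment> \<open>\<open>enn2real\<close> sends infinity to 0. This is harmless, since the
      density has finite integral over bounded intervals and is therefore finite almost everywhere
      on them.\<close>
    have "AE x in lborel. h0 x * indicator {a<..b} x \<noteq> \<infinity>"
      by (rule nn_integral_noteq_infinite) (auto simp: fin)
    then have "(\<integral>\<^sup>+x. ennreal (enn2real (h0 x) * indicator {a<..b} x) \<partial>lborel) = (\<integral>\<^sup>+x. h0 x * indicator {a<..b} x \<partial>lborel)"
    proof (intro nn_integral_cong_AE, eventually_elim)
      case (elim x)
      then show ?case by (cases "x \<in> {a<..b}") (auto simp: less_top)
    qed
    then have ii: "(\<integral>\<^sup>+x. ennreal (enn2real (h0 x) * indicator {a<..b} x) \<partial>lborel) = ennreal (F b - F a)"
      using fin by simp
    have "((\<lambda>x. enn2real (h0 x) * indicator {a<..b} x) has_integral (F b - F a)) UNIV"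
    proof (intro nn_integral_has_integral)
      show "(\<lambda>x. enn2real (h0 x) * indicator {a<..b} x) \<in> borel_measurable borel" using h0m by simp
      show "0 \<le> F b - F a" using mono[of a b] that by simp
    qed (use ii in auto)
    moreover have "(\<lambda>x. enn2real (h0 x) * indicator {a<..b} x) = (\<lambda>x. if x \<in> {a<..b} then enn2real (h0 x) else 0)"
      by (auto simp: indicator_def)
    ultimately have "((\<lambda>x. enn2real (h0 x)) has_integral (F b - F a)) {a<..b}"
      by (simp only: has_integral_restrict_UNIV)
    then show ?thesis
      by (rule has_integral_spike_set_eq[THEN iffD1, rotated 2])
         (auto intro: negligible_subset[of "{a}"])
  qed
  have hf: "((\<lambda>x. enn2real (h0 x) - (L + 1)) has_integral (f b - f a)) {a..b}" if "a \<le> b" for a b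
  proof -
    have "((\<lambda>x. enn2real (h0 x) - (L + 1)) has_integral (F b - F a - (b - a) *\<^sub>R (L + 1))) {a..b}"
      using has_integral_diff[OF hF[OF that] has_integral_const_real[of "L+1" a b]] that by simp
    then show ?thesis by (simp add: F_def algebra_simps)
  qed
  show thesis using that[OF hf negligible_not_DERIV_integral[OF hf]] by blast
qed

text \<open>Near a point with nonzero derivative \<open>U\<close> shrinks distances by at most some
  factor \<open>Suc n\<close>. The line is cut into countably many pieces on which this factor is
  uniform; on each of them \<open>U\<close> is injective with Lipschitz inverse, so the piece is a
  Lipschitz image of a subset of \<open>N\<close>. This lets the chain rule survive at values where
  the outer function has no derivative.\<close>

lemma negligible_vimage_DERIV_nonzero:
  fixes U :: "real \<Rightarrow> real"
  assumes N: "negligible N"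
  shows "negligible {t. U t \<in> N \<and> (\<exists>D. D \<noteq> 0 \<and> (U has_real_derivative D) (at t))}"
proof -
  define E where "E n = {t. U t \<in> N \<and> (\<forall>s. \<bar>s - t\<bar> < 1 / real (Suc n) \<longrightarrow> \<bar>s - t\<bar> \<le> real (Suc n) * \<bar>U s - U t\<bar>)}" for n
  \<comment> \<open>\<open>E n\<close> compares \<open>t\<close> only with points at distance less
    than \<open>1 / Suc n\<close>; in a ball of half that radius any two points can be
    compared.\<close>
  define P where "P n q = E n \<inter> ball (of_rat q) (1 / (2 * real (Suc n)))" for n and q :: rat
  have "negligible (P n q)" for n q
  proof -
    have near: "\<bar>s - t\<bar> \<le> real (Suc n) * \<bar>U s - U t\<bar>" if "s \<in> P n q" "t \<in> P n q" for s t
    proof -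
      have "\<bar>of_rat q - s\<bar> < 1 / (2 * real (Suc n))" "\<bar>of_rat q - t\<bar> < 1 / (2 * real (Suc n))"
        using that by (auto simp: P_def dist_real_def)
      then have "\<bar>s - t\<bar> < 1 / (2 * real (Suc n)) + 1 / (2 * real (Suc n))" by linarith
      also have "\<dots> = 1 / real (Suc n)" by (simp add: field_simps)
      finally show ?thesis using that by (auto simp: P_def E_def)
    qed
    define I where "I y = (SOME t. t \<in> P n q \<and> U t = y)" for y
    have I: "I (U t) = t" if "t \<in> P n q" for t
    proof -
      have "I (U t) \<in> P n q \<and> U (I (U t)) = U t" unfolding I_def by (rule someI[of _ t]) (use that in auto)
      then show ?thesis using near[of "I (U t)" t] that by simp
    qed
    have "negligible (I ` (U ` P n q))"
    proof (rule negligible_locally_Lipschitz_image)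
      show "negligible (U ` P n q)"
        by (rule negligible_subset[OF N]) (auto simp: P_def E_def)
      fix x assume "x \<in> U ` P n q"
      then show "\<exists>T B. open T \<and> x \<in> T \<and> (\<forall>y\<in>U ` P n q \<inter> T. norm (I y - I x) \<le> B * norm (y - x))"
        by (intro exI[of _ UNIV] exI[of _ "real (Suc n)"]) (auto simp: I near simp del: of_nat_Suc)
    qed simp
    moreover have "I ` (U ` P n q) = P n q" using I by (force simp: image_iff)
    ultimately show ?thesis by simp
  qed
  then have "negligible (\<Union>(range (\<lambda>i. P (fst i) (snd i))))"
    by (intro negligible_countable_Union) auto
  then show ?thesis
  proof (rule negligible_subset, safe)
    fix t D assume t: "U t \<in> N" and D: "D \<noteq> 0" and d: "(U has_real_derivative D) (at t)"
    have "(\<lambda>h. (U (t + h) - U t) / h) \<midarrow>0\<rightarrow> D" using d by (simp add: DERIV_def)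
    then obtain s where s: "s > 0" "\<And>h. h \<noteq> 0 \<Longrightarrow> \<bar>h\<bar> < s \<Longrightarrow> \<bar>(U (t + h) - U t) / h - D\<bar> < \<bar>D\<bar> / 2"
      using D unfolding LIM_eq by (metis diff_zero half_gt_zero real_norm_def zero_less_abs_iff)
    obtain n where n: "max (1 / s) (2 / \<bar>D\<bar>) < real n" using reals_Archimedean2 by blast
    then have n1: "1 / real (Suc n) < s" "1 / real (Suc n) \<le> \<bar>D\<bar> / 2"
    proof -
      have "1 / s < real (Suc n)" "2 / \<bar>D\<bar> < real (Suc n)" using n by auto
      then show "1 / real (Suc n) < s" "1 / real (Suc n) \<le> \<bar>D\<bar> / 2"
        using s(1) D by (auto simp: field_simps simp del: of_nat_Suc)
    qed
    have "\<bar>r - t\<bar> \<le> real (Suc n) * \<bar>U r - U t\<bar>" if r: "\<bar>r - t\<bar> < 1 / real (Suc n)" for r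
    proof (cases "r = t")
      case False
      then have "\<bar>(U r - U t) / (r - t) - D\<bar> < \<bar>D\<bar> / 2" using s(2)[of "r - t"] r n1 by simp
      then have "1 / real (Suc n) \<le> \<bar>(U r - U t) / (r - t)\<bar>" using n1(2) by arith
      then have "1 / real (Suc n) \<le> \<bar>U r - U t\<bar> / \<bar>r - t\<bar>" by (simp add: abs_divide)
      then show ?thesis using False by (simp add: field_simps del: of_nat_Suc)
    qed simp
    then have "t \<in> E n" using t by (auto simp: E_def)
    moreover obtain q :: rat where "t - 1 / (2 * real (Suc n)) < of_rat q" "of_rat q < t + 1 / (2 * real (Suc n))"
      using of_rat_dense[of "t - 1 / (2 * real (Suc n))" "t + 1 / (2 * real (Suc n))"] by auto
    ultimately have "t \<in> P (fst (n, q)) (snd (n, q))" by (auto simp: P_def dist_real_def)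
    then show "t \<in> (\<Union>i. P (fst i) (snd i))" by blast
  qed
qed

subsection \<open>Translations, lines and second differences\<close>

lemma AE_lebesgue_translate:
  fixes e :: "'a::euclidean_space"
  assumes "AE z in lebesgue. P z"
  shows "AE z in lebesgue. P (z + e)"
proof -
  obtain N where N: "negligible N" "{z. \<not> P z} \<subseteq> N"
    using assms by (auto simp: eventually_ae_filter negligible_iff_null_sets)
  have "negligible ((+) (- e) ` N)" by (rule negligible_translation[OF N(1)])
  moreover have "{z. \<not> P (z + e)} \<subseteq> (+) (- e) ` N"
    using N(2) by (force simp: image_iff)
  ultimately show ?thesis
    by (auto simp: eventually_ae_filter negligible_iff_null_sets)
qed

text \<open>Tonelli in the parameter: for fixed \<open>t\<close> the points \<open>z\<close> with
  \<open>z + t *\<^sub>R e\<close> in a null set form a translate of it, so the double integral of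
  the indicator is 0.\<close>

lemma AE_lebesgue_lines:
  fixes e :: "'a::euclidean_space"
  assumes "AE z in lebesgue. P z"
  shows "AE z in lebesgue. AE t in lebesgue. P (z + t *\<^sub>R e)"
proof -
  have "AE z in lborel. P z" using assms by (simp add: AE_completion_iff)
  then obtain N where N: "N \<in> null_sets lborel" "{z. \<not> P z} \<subseteq> N"
    by (auto simp: eventually_ae_filter)
  have [measurable]: "N \<in> sets borel" using N by auto
  have "(\<integral>\<^sup>+z. (\<integral>\<^sup>+t. indicator N (z + t *\<^sub>R e) \<partial>lborel) \<partial>lborel) =
        (\<integral>\<^sup>+t. (\<integral>\<^sup>+z. indicator N (z + t *\<^sub>R e) \<partial>lborel) \<partial>(lborel :: real measure))"
    by (rule lborel_pair.Fubini') measurable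
  also have "\<dots> = (\<integral>\<^sup>+(t::real). 0 \<partial>lborel)"
  proof (rule nn_integral_cong)
    fix t :: real
    have "(\<integral>\<^sup>+z. indicator N (z + t *\<^sub>R e) \<partial>lborel) = (\<integral>\<^sup>+z. indicator N z \<partial>distr lborel borel ((+) (t *\<^sub>R e)))"
      by (subst nn_integral_distr) (auto simp: add.commute)
    also have "\<dots> = 0" using null_setsD1[OF N(1)] by (simp add: lborel_distr_plus)
    finally show "(\<integral>\<^sup>+z. indicator N (z + t *\<^sub>R e) \<partial>lborel) = 0" .
  qed
  finally have "AE z in lborel. (\<integral>\<^sup>+t. indicator N (z + t *\<^sub>R e) \<partial>lborel) = 0"
    by (simp add: nn_integral_0_iff_AE)
  then have "AE z in lborel. AE t in lborel. P (z + t *\<^sub>R e)"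
  proof eventually_elim
    case (elim z)
    then have "AE t in lborel. indicator N (z + t *\<^sub>R e) = (0::ennreal)"
      by (simp add: nn_integral_0_iff_AE)
    then show ?case using N(2) by (auto elim!: eventually_mono simp: indicator_def split: if_splits)
  qed
  then show ?thesis by (auto intro!: AE_completion elim!: eventually_mono)
qed

text \<open>Tonelli read the other way: with \<open>t\<close> restricted to \<open>{0..1}\<close>,
  the translates of \<open>S\<close> contribute its measure exactly once. A set that is null on all
  parallel lines need not be null unless it is measurable, which is why the exceptional sets of the
  chain rules are first proved measurable.\<close>

lemma negligible_lines:
  fixes S :: "'a::euclidean_space set"
  assumes S: "S \<in> sets lebesgue" and l: "AE z in lebesgue. negligible {t. z + t *\<^sub>R e \<in> S}"
  shows "negligible S"
proof -
  obtain B N N' where B: "S = B \<union> N" "N \<subseteq> N'" "N' \<in> null_sets lborel" "B \<in> sets lborel"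
    using sets_completionE[OF S] by metis
  have [measurable]: "B \<in> sets borel" using B by auto
  have lB: "AE z in lborel. negligible {t. z + t *\<^sub>R e \<in> B}"
    using l B(1) by (auto simp: AE_completion_iff elim!: eventually_mono intro: negligible_subset)
  have "(\<integral>\<^sup>+z. (\<integral>\<^sup>+t. indicator B (z + t *\<^sub>R e) * indicator {0..1} t \<partial>lborel) \<partial>lborel) = (\<integral>\<^sup>+(z::'a). 0 \<partial>lborel)"
  proof (rule nn_integral_cong_AE, rule AE_mp[OF lB], rule AE_I2, rule impI)
    fix z assume n: "negligible {t. z + t *\<^sub>R e \<in> B}"
    have "{t. z + t *\<^sub>R e \<in> B} = (\<lambda>t. z + t *\<^sub>R e) -` B \<inter> space borel" by auto
    also have "\<dots> \<in> sets borel" by measurable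
    finally have "{t. z + t *\<^sub>R e \<in> B} \<in> sets borel" .
    then have "{t. z + t *\<^sub>R e \<in> B} \<in> null_sets lborel"
      using n by (auto simp: negligible_iff_null_sets null_sets_def)
    then have "AE t in lborel. t \<notin> {t. z + t *\<^sub>R e \<in> B}" by (rule AE_not_in)
    then have "AE t in lborel. indicator B (z + t *\<^sub>R e) * indicator {0..1} t = (0::ennreal)"
      by (auto elim!: eventually_mono)
    then show "(\<integral>\<^sup>+t. indicator B (z + t *\<^sub>R e) * indicator {0..1} t \<partial>lborel) = 0"
      by (subst nn_integral_0_iff_AE) auto
  qed
  also have "(\<integral>\<^sup>+z. (\<integral>\<^sup>+t. indicator B (z + t *\<^sub>R e) * indicator {0..1} t \<partial>lborel) \<partial>lborel) =
        (\<integral>\<^sup>+t. (\<integral>\<^sup>+z. indicator B (z + t *\<^sub>R e) * indicator {0..1} t \<partial>lborel) \<partial>(lborel :: real measure))"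
    by (rule lborel_pair.Fubini') measurable
  also have "\<dots> = (\<integral>\<^sup>+(t::real). emeasure lborel B * indicator {0..1} t \<partial>lborel)"
  proof (rule nn_integral_cong)
    fix t :: real
    have "(\<integral>\<^sup>+z. indicator B (z + t *\<^sub>R e) \<partial>lborel) = (\<integral>\<^sup>+z. indicator B z \<partial>distr lborel borel ((+) (t *\<^sub>R e)))"
      by (subst nn_integral_distr) (auto simp: add.commute)
    then show "(\<integral>\<^sup>+z. indicator B (z + t *\<^sub>R e) * indicator {0..1} t \<partial>lborel) = emeasure lborel B * indicator {0..1} t"
      by (simp add: lborel_distr_plus nn_integral_multc)
  qed
  also have "\<dots> = emeasure lborel B"
    by (subst nn_integral_cmult_indicator) auto
  finally have "B \<in> null_sets lborel" using B(4) by (simp add: null_sets_def)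
  then have "negligible B" by (simp add: negligible_iff_null_sets null_sets_completionI)
  moreover have "negligible N"
    using B(2,3) by (meson negligible_iff_null_sets negligible_subset null_sets_completionI)
  ultimately show ?thesis using B(1) by simp
qed

section \<open>Symmetry of second derivatives\<close>

lemma mixed_difference:
  fixes u :: "'a::real_inner \<Rightarrow> real"
  assumes s: "0 < s"
    and u: "\<And>\<rho> \<sigma>. \<rho> \<in> {0..s} \<Longrightarrow> \<sigma> \<in> {0..s} \<Longrightarrow> GDERIV u (z + \<rho> *\<^sub>R a + \<sigma> *\<^sub>R b) :> G (z + \<rho> *\<^sub>R a + \<sigma> *\<^sub>R b)"
    and G: "\<And>\<rho> \<sigma>. \<rho> \<in> {0..s} \<Longrightarrow> \<sigma> \<in> {0..s} \<Longrightarrow> (G has_derivative H (z + \<rho> *\<^sub>R a + \<sigma> *\<^sub>R b)) (at (z + \<rho> *\<^sub>R a + \<sigma> *\<^sub>R b))"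
  shows "\<exists>\<rho>\<in>{0..s}. \<exists>\<sigma>\<in>{0..s}. u (z + s *\<^sub>R a + s *\<^sub>R b) - u (z + s *\<^sub>R a) - (u (z + s *\<^sub>R b) - u z)
     = s^2 * (a \<bullet> H (z + \<rho> *\<^sub>R a + \<sigma> *\<^sub>R b) b)"
proof -
  define \<phi> where "\<phi> r = u (z + r *\<^sub>R a + s *\<^sub>R b) - u (z + r *\<^sub>R a)" for r
  have d: "((\<lambda>r. u (z + r *\<^sub>R a + \<sigma> *\<^sub>R b)) has_real_derivative a \<bullet> G (z + r *\<^sub>R a + \<sigma> *\<^sub>R b)) (at r)"
    if "r \<in> {0..s}" "\<sigma> \<in> {0..s}" for r \<sigma>
  proof -
    have "((\<lambda>r. u (z + r *\<^sub>R a + \<sigma> *\<^sub>R b)) has_derivative (\<lambda>h. (h *\<^sub>R a) \<bullet> G (z + r *\<^sub>R a + \<sigma> *\<^sub>R b))) (at r)"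
      by (rule has_derivative_compose[of "\<lambda>r. z + r *\<^sub>R a + \<sigma> *\<^sub>R b" "\<lambda>h. h *\<^sub>R a" r UNIV u, OF _ u[OF that, unfolded gderiv_def]])
         (auto intro!: derivative_eq_intros)
    moreover have "(\<lambda>h. (h *\<^sub>R a) \<bullet> G (z + r *\<^sub>R a + \<sigma> *\<^sub>R b)) = (*) (a \<bullet> G (z + r *\<^sub>R a + \<sigma> *\<^sub>R b))"
      by (auto simp: mult.commute)
    ultimately show ?thesis by (simp add: has_field_derivative_def)
  qed
  have "(\<phi> has_real_derivative a \<bullet> G (z + r *\<^sub>R a + s *\<^sub>R b) - a \<bullet> G (z + r *\<^sub>R a)) (at r)" if "0 \<le> r" "r \<le> s" for r
    unfolding \<phi>_def using DERIV_diff[OF d[of r s] d[of r 0]] that s by simp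
  from MVT2[OF s this] obtain \<rho> where \<rho>: "0 < \<rho>" "\<rho> < s"
    "\<phi> s - \<phi> 0 = (s - 0) * (a \<bullet> G (z + \<rho> *\<^sub>R a + s *\<^sub>R b) - a \<bullet> G (z + \<rho> *\<^sub>R a))" by blast
  have "((\<lambda>r. a \<bullet> G (z + \<rho> *\<^sub>R a + r *\<^sub>R b)) has_real_derivative a \<bullet> H (z + \<rho> *\<^sub>R a + r *\<^sub>R b) b) (at r)" if "0 \<le> r" "r \<le> s" for r
  proof -
    have Hd: "(G has_derivative H (z + \<rho> *\<^sub>R a + r *\<^sub>R b)) (at (z + \<rho> *\<^sub>R a + r *\<^sub>R b))" using G that \<rho> by auto
    have "((\<lambda>r. G (z + \<rho> *\<^sub>R a + r *\<^sub>R b)) has_derivative (\<lambda>h. H (z + \<rho> *\<^sub>R a + r *\<^sub>R b) (h *\<^sub>R b))) (at r)"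
      by (rule has_derivative_compose[of "\<lambda>r. z + \<rho> *\<^sub>R a + r *\<^sub>R b" "\<lambda>h. h *\<^sub>R b" r UNIV G, OF _ Hd])
         (auto intro!: derivative_eq_intros)
    then have "((\<lambda>r. a \<bullet> G (z + \<rho> *\<^sub>R a + r *\<^sub>R b)) has_derivative (\<lambda>h. a \<bullet> H (z + \<rho> *\<^sub>R a + r *\<^sub>R b) (h *\<^sub>R b))) (at r)"
      by (rule has_derivative_inner_right)
    moreover have "(\<lambda>h. a \<bullet> H (z + \<rho> *\<^sub>R a + r *\<^sub>R b) (h *\<^sub>R b)) = (*) (a \<bullet> H (z + \<rho> *\<^sub>R a + r *\<^sub>R b) b)"
      using has_derivative_bounded_linear[OF Hd] by (auto simp: bounded_linear.linear linear_cmul)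
    ultimately show ?thesis by (simp add: has_field_derivative_def)
  qed
  from MVT2[OF s this] obtain \<sigma> where \<sigma>: "0 < \<sigma>" "\<sigma> < s"
    "a \<bullet> G (z + \<rho> *\<^sub>R a + s *\<^sub>R b) - a \<bullet> G (z + \<rho> *\<^sub>R a + 0 *\<^sub>R b) = (s - 0) * (a \<bullet> H (z + \<rho> *\<^sub>R a + \<sigma> *\<^sub>R b) b)" by blast
  show ?thesis
    using \<rho> \<sigma> by (intro bexI[of _ \<rho>] bexI[of _ \<sigma>]) (auto simp: \<phi>_def power2_eq_square)
qed

text \<open>The second difference does not change when \<open>a\<close> and \<open>b\<close> are
  exchanged. \<open>mixed_difference\<close> evaluates it in both orders at points near
  \<open>z\<close>, and continuity of \<open>H\<close> brings both values to
  \<open>z\<close>.\<close>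

lemma second_derivative_symmetric:
  fixes u :: "'a::euclidean_space \<Rightarrow> real"
  assumes "open S" "z \<in> S"
    and u: "\<And>z. z \<in> S \<Longrightarrow> GDERIV u z :> G z"
    and G: "\<And>z. z \<in> S \<Longrightarrow> (G has_derivative blinfun_apply (H z)) (at z)"
    and H: "continuous_on S H"
  shows "a \<bullet> H z b = b \<bullet> H z a"
proof (rule ccontr)
  assume "\<not> ?thesis"
  then have ne: "\<bar>a \<bullet> H z b - b \<bullet> H z a\<bar> > 0" by simp
  define \<epsilon> where "\<epsilon> = \<bar>a \<bullet> H z b - b \<bullet> H z a\<bar> / (2 * (norm a * norm b + 1))"
  have p1: "norm a * norm b + 1 > 0" by (smt (verit) mult_nonneg_nonneg norm_ge_zero)
  have "\<epsilon> > 0" using ne p1 by (simp add: \<epsilon>_def)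
  obtain d1 where d1: "d1 > 0" "ball z d1 \<subseteq> S" using assms(1,2) open_contains_ball by blast
  obtain d2 where d2: "d2 > 0" "\<And>y. y \<in> S \<Longrightarrow> dist y z < d2 \<Longrightarrow> dist (H y) (H z) < \<epsilon>"
    using H \<open>z \<in> S\<close> \<open>\<epsilon> > 0\<close> unfolding continuous_on_iff by metis
  define s where "s = min d1 d2 / (1 + norm a + norm b)"
  have n1: "1 + norm a + norm b > 0" by (smt (verit) norm_ge_zero)
  then have s: "s > 0" using d1 d2 by (simp add: s_def)
  have near: "z + \<rho> *\<^sub>R x + \<sigma> *\<^sub>R y \<in> S \<and> dist (z + \<rho> *\<^sub>R x + \<sigma> *\<^sub>R y) z < d2"
    if "\<rho> \<in> {0..s}" "\<sigma> \<in> {0..s}" "(x = a \<and> y = b) \<or> (x = b \<and> y = a)" for \<rho> \<sigma> x y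
  proof -
    have "norm (\<rho> *\<^sub>R x + \<sigma> *\<^sub>R y) \<le> \<rho> * norm x + \<sigma> * norm y"
      using that by (metis (no_types, lifting) abs_of_nonneg atLeastAtMost_iff norm_scaleR norm_triangle_ineq)
    also have "\<dots> \<le> s * norm x + s * norm y" using that by (intro add_mono mult_right_mono) auto
    also have "\<dots> = s * (norm a + norm b)" using that(3) by (auto simp: algebra_simps)
    also have "\<dots> < s * (1 + norm a + norm b)" using s by simp
    also have "\<dots> = min d1 d2" using n1 by (simp add: s_def)
    finally have "dist (z + \<rho> *\<^sub>R x + \<sigma> *\<^sub>R y) z < min d1 d2" by (simp add: dist_norm algebra_simps)
    then show ?thesis using d1(2) by (auto simp: dist_commute)
  qed
  define \<Delta> where "\<Delta> = u (z + s *\<^sub>R a + s *\<^sub>R b) - u (z + s *\<^sub>R a) - (u (z + s *\<^sub>R b) - u z)"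
  have "\<exists>\<rho>\<in>{0..s}. \<exists>\<sigma>\<in>{0..s}. \<Delta> = s^2 * (a \<bullet> H (z + \<rho> *\<^sub>R a + \<sigma> *\<^sub>R b) b)"
    unfolding \<Delta>_def by (rule mixed_difference[OF s, of u z a b G]) (auto intro!: u G simp: near)
  then obtain p where p: "p \<in> S" "dist p z < d2" "\<Delta> = s^2 * (a \<bullet> H p b)" using near by blast
  have ac: "z + s *\<^sub>R b + s *\<^sub>R a = z + s *\<^sub>R a + s *\<^sub>R b" by (simp add: ac_simps)
  have "\<exists>\<rho>\<in>{0..s}. \<exists>\<sigma>\<in>{0..s}. u (z + s *\<^sub>R b + s *\<^sub>R a) - u (z + s *\<^sub>R b) - (u (z + s *\<^sub>R a) - u z) = s^2 * (b \<bullet> H (z + \<rho> *\<^sub>R b + \<sigma> *\<^sub>R a) a)"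
    by (rule mixed_difference[OF s, of u z b a G]) (auto intro!: u G simp: near)
  then have "\<exists>\<rho>\<in>{0..s}. \<exists>\<sigma>\<in>{0..s}. \<Delta> = s^2 * (b \<bullet> H (z + \<rho> *\<^sub>R b + \<sigma> *\<^sub>R a) a)"
    unfolding \<Delta>_def by (simp add: ac) (smt (verit))
  then obtain q where q: "q \<in> S" "dist q z < d2" "\<Delta> = s^2 * (b \<bullet> H q a)" using near by blast
  have eq: "a \<bullet> H p b = b \<bullet> H q a" using p(3) q(3) s by simp
  have bd: "\<bar>x \<bullet> H r y - x \<bullet> H z y\<bar> \<le> \<epsilon> * (norm x * norm y)" if "r \<in> S" "dist r z < d2" for r x y
  proof -
    have "\<bar>x \<bullet> H r y - x \<bullet> H z y\<bar> = \<bar>x \<bullet> ((H r - H z) y)\<bar>" by (simp add: blinfun.diff_left inner_diff_right)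
    also have "\<dots> \<le> norm x * (norm (H r - H z) * norm y)"
      by (meson Cauchy_Schwarz_ineq2 mult_left_mono norm_blinfun norm_ge_zero order_trans)
    also have "\<dots> \<le> norm x * (\<epsilon> * norm y)"
      using d2(2)[OF that] by (intro mult_left_mono mult_right_mono) (auto simp: dist_norm)
    finally show ?thesis by (simp add: algebra_simps)
  qed
  have "\<bar>a \<bullet> H z b - b \<bullet> H z a\<bar> \<le> 2 * (\<epsilon> * (norm a * norm b))"
    using bd[OF p(1,2), of a b] bd[OF q(1,2), of b a] eq by (simp add: mult.commute[of "norm b"])
  also have "\<dots> < 2 * (\<epsilon> * (norm a * norm b + 1))" using \<open>\<epsilon> > 0\<close> by simp
  also have "\<dots> = \<bar>a \<bullet> H z b - b \<bullet> H z a\<bar>"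
  proof -
    have "2 * (X / (2 * Y) * Y) = X" if "Y > 0" for X Y :: real using that by simp
    from this[OF p1] show ?thesis unfolding \<epsilon>_def .
  qed
  finally show False by simp
qed

text \<open>The integrand is split where \<open>\<bar>F\<^sub>n - F\<bar> > k \<bar>B\<bar>\<close>: there it is at most \<open>\<bar>F\<^sub>n - F\<bar>\<^sup>2 / k\<close>, elsewhere it is
  dominated by \<open>k \<bar>B\<bar>\<^sup>2\<close>.\<close>

lemma tendsto_integral_inner_L2_bounded:
  fixes F :: "nat \<Rightarrow> 'b \<Rightarrow> 'a::euclidean_space"
  assumes [measurable]: "\<And>n. F n \<in> borel_measurable M" "f \<in> borel_measurable M" "B \<in> borel_measurable M"
    and lim: "AE z in M. (\<lambda>n. F n z) \<longlonglongrightarrow> f z"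
    and int: "\<And>n. integrable M (\<lambda>z. (norm (F n z))\<^sup>2)" and K: "\<And>n. (\<integral>z. (norm (F n z))\<^sup>2 \<partial>M) \<le> K"
    and f: "integrable M (\<lambda>z. (norm (f z))\<^sup>2)" and B: "integrable M (\<lambda>z. (norm (B z))\<^sup>2)"
  shows "(\<lambda>n. \<integral>z. F n z \<bullet> B z \<partial>M) \<longlonglongrightarrow> (\<integral>z. f z \<bullet> B z \<partial>M)"
proof -
  have ip: "integrable M (\<lambda>z. X z \<bullet> B z)" if [measurable]: "X \<in> borel_measurable M" and X: "integrable M (\<lambda>z. (norm (X z))\<^sup>2)" for X :: "'b \<Rightarrow> 'a"
  proof (rule Bochner_Integration.integrable_bound[OF Bochner_Integration.integrable_add[OF X B]])
    have "\<bar>X z \<bullet> B z\<bar> \<le> (norm (X z))\<^sup>2 + (norm (B z))\<^sup>2" for z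
    proof -
      have "\<bar>X z \<bullet> B z\<bar> \<le> norm (X z) * norm (B z)" by (rule Cauchy_Schwarz_ineq2)
      also have "\<dots> \<le> (norm (X z))\<^sup>2 + (norm (B z))\<^sup>2"
        using sum_squares_bound[of "norm (X z)" "norm (B z)"] mult_nonneg_nonneg[OF norm_ge_zero[of "X z"] norm_ge_zero[of "B z"]]
        by linarith
      finally show ?thesis .
    qed
    then show "AE z in M. norm (X z \<bullet> B z) \<le> norm ((norm (X z))\<^sup>2 + (norm (B z))\<^sup>2)" by auto
  qed measurable
  define D where "D n z = F n z - f z" for n z
  have [measurable]: "D n \<in> borel_measurable M" for n unfolding D_def by measurable
  define K' where "K' = 2 * \<bar>K\<bar> + 2 * (\<integral>z. (norm (f z))\<^sup>2 \<partial>M)"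
  have Db: "(norm (D n z))\<^sup>2 \<le> 2 * (norm (F n z))\<^sup>2 + 2 * (norm (f z))\<^sup>2" for n z
  proof -
    have "(norm (D n z))\<^sup>2 \<le> (norm (F n z) + norm (f z))\<^sup>2"
      unfolding D_def by (intro power_mono norm_triangle_ineq4) auto
    also have "\<dots> \<le> 2 * (norm (F n z))\<^sup>2 + 2 * (norm (f z))\<^sup>2"
      using sum_squares_bound[of "norm (F n z)" "norm (f z)"] by (simp add: power2_sum)
    finally show ?thesis .
  qed
  have Di: "integrable M (\<lambda>z. (norm (D n z))\<^sup>2)" for n
    by (rule Bochner_Integration.integrable_bound[of M "\<lambda>z. 2 * (norm (F n z))\<^sup>2 + 2 * (norm (f z))\<^sup>2"])
       (use Db int f in auto)
  have DK: "(\<integral>z. (norm (D n z))\<^sup>2 \<partial>M) \<le> K'" for n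
  proof -
    have "(\<integral>z. (norm (D n z))\<^sup>2 \<partial>M) \<le> (\<integral>z. 2 * (norm (F n z))\<^sup>2 + 2 * (norm (f z))\<^sup>2 \<partial>M)"
      using Db Di int f by (intro integral_mono) auto
    also have "\<dots> = 2 * (\<integral>z. (norm (F n z))\<^sup>2 \<partial>M) + 2 * (\<integral>z. (norm (f z))\<^sup>2 \<partial>M)"
      using int f by (subst Bochner_Integration.integral_add) auto
    also have "\<dots> \<le> K'" using K[of n] by (simp add: K'_def)
    finally show ?thesis .
  qed
  have K'0: "K' \<ge> 0" unfolding K'_def by simp
  have "(\<lambda>n. \<integral>z. D n z \<bullet> B z \<partial>M) \<longlonglongrightarrow> 0"
  proof (rule LIMSEQ_I)
    fix \<epsilon> :: real assume \<epsilon>: "0 < \<epsilon>"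
    \<comment> \<open>Makes \<open>K' / k\<close>, the contribution of the set with large
      \<open>D n\<close>, less than \<open>\<epsilon> / 2\<close>; the \<open>+ 1\<close> keeps
      \<open>k\<close> positive when \<open>K' = 0\<close>.\<close>
    define k where "k = 2 * (K' + 1) / \<epsilon>"
    have k: "k > 0" using \<epsilon> K'0 by (simp add: k_def)
    have Kk: "K' / k < \<epsilon> / 2" using \<epsilon> K'0 by (simp add: k_def field_simps)
    have i1: "integrable M (\<lambda>z. k * (norm (B z))\<^sup>2)" using B by simp
    have "(\<lambda>n. \<integral>z. min \<bar>D n z \<bullet> B z\<bar> (k * (norm (B z))\<^sup>2) \<partial>M) \<longlonglongrightarrow> (\<integral>z. 0 \<partial>M)"
    proof (rule integral_dominated_convergence[OF _ _ i1])
      show "AE z in M. (\<lambda>n. min \<bar>D n z \<bullet> B z\<bar> (k * (norm (B z))\<^sup>2)) \<longlonglongrightarrow> 0"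
        using lim
      proof eventually_elim
        case (elim z)
        have "(\<lambda>n. min \<bar>D n z \<bullet> B z\<bar> (k * (norm (B z))\<^sup>2)) \<longlonglongrightarrow> min \<bar>(f z - f z) \<bullet> B z\<bar> (k * (norm (B z))\<^sup>2)"
          unfolding D_def by (intro tendsto_intros elim)
        then show ?case using k by simp
      qed
      show "AE z in M. norm (min \<bar>D n z \<bullet> B z\<bar> (k * (norm (B z))\<^sup>2)) \<le> k * (norm (B z))\<^sup>2" for n
        using k by auto
    qed measurable
    from LIMSEQ_D[OF this half_gt_zero[OF \<epsilon>]]
    obtain N where N: "\<And>n. n \<ge> N \<Longrightarrow> \<bar>\<integral>z. min \<bar>D n z \<bullet> B z\<bar> (k * (norm (B z))\<^sup>2) \<partial>M\<bar> < \<epsilon> / 2"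
      unfolding integral_zero diff_zero real_norm_def by blast
    have "norm ((\<integral>z. D n z \<bullet> B z \<partial>M) - 0) < \<epsilon>" if n: "n \<ge> N" for n
    proof -
      have pt: "\<bar>D n z \<bullet> B z\<bar> \<le> min \<bar>D n z \<bullet> B z\<bar> (k * (norm (B z))\<^sup>2) + (norm (D n z))\<^sup>2 / k" for z
      proof (cases "\<bar>D n z \<bullet> B z\<bar> \<le> k * (norm (B z))\<^sup>2")
        case False
        have cs: "\<bar>D n z \<bullet> B z\<bar> \<le> norm (D n z) * norm (B z)" by (rule Cauchy_Schwarz_ineq2)
        with False have "k * norm (B z) * norm (B z) < norm (D n z) * norm (B z)" by (simp add: power2_eq_square)
        then have "k * norm (B z) < norm (D n z)" by (simp add: mult_less_cancel_right)
        then have "norm (B z) \<le> norm (D n z) / k" using k by (simp add: field_simps)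
        then have "norm (D n z) * norm (B z) \<le> norm (D n z) * (norm (D n z) / k)"
          by (intro mult_left_mono) auto
        also have "\<dots> = (norm (D n z))\<^sup>2 / k" by (simp add: power2_eq_square)
        finally have "\<bar>D n z \<bullet> B z\<bar> \<le> (norm (D n z))\<^sup>2 / k" using cs by linarith
        moreover have "0 \<le> min \<bar>D n z \<bullet> B z\<bar> (k * (norm (B z))\<^sup>2)" using k by simp
        ultimately show ?thesis by linarith
      qed (use k in simp)
      have im: "integrable M (\<lambda>z. min \<bar>D n z \<bullet> B z\<bar> (k * (norm (B z))\<^sup>2))"
        by (rule Bochner_Integration.integrable_bound[OF i1]) (use k in auto)
      have "\<bar>\<integral>z. D n z \<bullet> B z \<partial>M\<bar> \<le> (\<integral>z. \<bar>D n z \<bullet> B z\<bar> \<partial>M)" by (rule integral_abs_bound)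
      also have "\<dots> \<le> (\<integral>z. min \<bar>D n z \<bullet> B z\<bar> (k * (norm (B z))\<^sup>2) + (norm (D n z))\<^sup>2 / k \<partial>M)"
        using pt im Di ip[OF _ Di] by (intro integral_mono) auto
      also have "\<dots> = (\<integral>z. min \<bar>D n z \<bullet> B z\<bar> (k * (norm (B z))\<^sup>2) \<partial>M) + (\<integral>z. (norm (D n z))\<^sup>2 \<partial>M) / k"
        using im Di by (subst Bochner_Integration.integral_add) auto
      also have "\<dots> < \<epsilon> / 2 + \<epsilon> / 2"
        using N[OF n] Kk divide_right_mono[OF DK[of n] less_imp_le[OF k]] by linarith
      finally show ?thesis by simp
    qed
    then show "\<exists>no. \<forall>n\<ge>no. norm ((\<integral>z. D n z \<bullet> B z \<partial>M) - 0) < \<epsilon>" by blast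
  qed
  moreover have "(\<integral>z. D n z \<bullet> B z \<partial>M) = (\<integral>z. F n z \<bullet> B z \<partial>M) - (\<integral>z. f z \<bullet> B z \<partial>M)" for n
    unfolding D_def inner_diff_left using ip[OF _ int] ip[OF _ f] by (subst Bochner_Integration.integral_diff) auto
  ultimately show ?thesis by (simp add: LIM_zero_iff)
qed

section \<open>Lebesgue measure under translations\<close>

lemma measurable_lebesgue_translation: "(+) (c::'a::euclidean_space) \<in> lebesgue \<rightarrow>\<^sub>M lebesgue"
proof (rule measurableI)
  fix A :: "'a set" assume "A \<in> sets lebesgue"
  moreover have "(+) c -` A = (+) (- c) ` A" by (force simp: image_iff)
  ultimately show "(+) c -` A \<inter> space lebesgue \<in> sets lebesgue"
    using lebesgue_sets_translation[of A "- c"] by simp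
qed simp

lemma distr_lebesgue_translation: "distr lebesgue lebesgue ((+) (c::'a::euclidean_space)) = lebesgue"
proof (rule measure_eqI)
  fix A :: "'a set" assume "A \<in> sets (distr lebesgue lebesgue ((+) c))"
  then have A: "A \<in> sets lebesgue" by simp
  have v: "(+) c -` A = (\<lambda>x. 1 *\<^sub>R x + (- c)) ` A" by (force simp: image_iff)
  show "emeasure (distr lebesgue lebesgue ((+) c)) A = emeasure lebesgue A"
    using emeasure_lebesgue_affine[of 1 "- c" A] A
    by (subst emeasure_distr[OF measurable_lebesgue_translation]) (auto simp: v)
qed simp

lemma
  fixes F :: "'a::euclidean_space \<Rightarrow> 'b::{banach, second_countable_topology}"
  shows integrable_lebesgue_translation: "integrable lebesgue F \<Longrightarrow> integrable lebesgue (\<lambda>z. F (z + c))"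
    and integral_lebesgue_translation: "F \<in> borel_measurable lebesgue \<Longrightarrow> (\<integral>z. F (z + c) \<partial>lebesgue) = (\<integral>z. F z \<partial>lebesgue)"
proof -
  show "integrable lebesgue (\<lambda>z. F (z + c))" if "integrable lebesgue F"
    using integrable_distr[OF measurable_lebesgue_translation[of c], of F] that
    by (simp add: distr_lebesgue_translation add.commute)
  show "(\<integral>z. F (z + c) \<partial>lebesgue) = (\<integral>z. F z \<partial>lebesgue)" if "F \<in> borel_measurable lebesgue"
    using integral_distr[OF measurable_lebesgue_translation[of c] that] that
    by (simp add: distr_lebesgue_translation add.commute)
qed

lemma borel_measurable_lebesgue_translation:
  "F \<in> borel_measurable lebesgue \<Longrightarrow> (\<lambda>z. F (z + (c::'a::euclidean_space))) \<in> borel_measurable lebesgue"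
  using measurable_compose[OF measurable_lebesgue_translation, of F borel c] by (simp add: add.commute)

text \<open>Integration by parts without boundary terms: every difference quotient of
  \<open>F\<close> has integral 0 by translation invariance, and domination passes this to the
  limit. The derivative is asked for almost everywhere only, which suits \<open>w\<close> with its
  possible corners.\<close>

lemma integral_directional_derivative_eq_0:
  fixes F F' B :: "'a::euclidean_space \<Rightarrow> real"
  assumes F: "integrable lebesgue F"
    and lim: "AE z in lebesgue. (\<lambda>n. real (Suc n) * (F (z + e /\<^sub>R real (Suc n)) - F z)) \<longlonglongrightarrow> F' z"
    and B: "integrable lebesgue B"
    and dom: "\<And>n. AE z in lebesgue. \<bar>real (Suc n) * (F (z + e /\<^sub>R real (Suc n)) - F z)\<bar> \<le> B z"
    and F': "F' \<in> borel_measurable lebesgue"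
  shows "(\<integral>z. F' z \<partial>lebesgue) = 0"
proof -
  have m: "F \<in> borel_measurable lebesgue" using F by simp
  have "(\<lambda>n. \<integral>z. real (Suc n) * (F (z + e /\<^sub>R real (Suc n)) - F z) \<partial>lebesgue) \<longlonglongrightarrow> (\<integral>z. F' z \<partial>lebesgue)"
  proof (rule integral_dominated_convergence[OF F' _ B lim])
    show "(\<lambda>z. real (Suc n) * (F (z + e /\<^sub>R real (Suc n)) - F z)) \<in> borel_measurable lebesgue" for n
      using m borel_measurable_lebesgue_translation[OF m, of "e /\<^sub>R real (Suc n)"] by measurable
  qed (use dom in auto)
  moreover have "(\<integral>z. real (Suc n) * (F (z + e /\<^sub>R real (Suc n)) - F z) \<partial>lebesgue) = 0" for n
    using F integrable_lebesgue_translation[OF F, of "e /\<^sub>R real (Suc n)"] integral_lebesgue_translation[OF m, of "e /\<^sub>R real (Suc n)"]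
    by (simp add: Bochner_Integration.integral_diff del: of_nat_Suc)
  ultimately show ?thesis by (simp add: LIMSEQ_const_iff)
qed

subsection \<open>Locally Lipschitz functions\<close>

lemma locally_lipschitz_on_iff:
  "locally_lipschitz_on S v \<longleftrightarrow> (\<forall>x\<in>S. \<exists>e>0. \<exists>L. L-lipschitz_on (cball x e \<inter> S) v)"
  unfolding locally_lipschitz_on_def local_lipschitz_def by simp (meson less_imp_le)

lemma lipschitz_on_cball_C1:
  fixes F :: "'a::real_normed_vector \<Rightarrow> 'b::real_normed_vector"
  assumes "open S" "x \<in> S" and F: "\<And>z. z \<in> S \<Longrightarrow> (F has_derivative F' z) (at z)"
    and b: "\<And>z. z \<in> S \<Longrightarrow> onorm (F' z) \<le> b z" and bc: "continuous_on S b"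
  shows "\<exists>e>0. \<exists>L. L-lipschitz_on (cball x e \<inter> S) F"
proof -
  obtain d1 where d1: "d1 > 0" "cball x d1 \<subseteq> S" using assms(1,2) open_contains_cball by blast
  obtain d2 where d2: "d2 > 0" "\<And>y. y \<in> S \<Longrightarrow> dist y x < d2 \<Longrightarrow> dist (b y) (b x) < 1"
    using bc \<open>x \<in> S\<close> unfolding continuous_on_iff by (metis zero_less_one)
  define e where "e = min d1 (d2 / 2)"
  have e: "e > 0" "e \<le> d1" "e < d2" using d1 d2 by (auto simp: e_def)
  have sub: "cball x e \<subseteq> S" using d1 e by (meson order_trans subset_cball)
  have B: "onorm (F' z) \<le> \<bar>b x\<bar> + 1" if "z \<in> cball x e" for z
    using d2(2)[of z] b[of z] that sub e by (auto simp: dist_commute dist_real_def subset_iff)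
  have "(\<bar>b x\<bar> + 1)-lipschitz_on (cball x e \<inter> S) F"
  proof (rule lipschitz_onI)
    fix y z assume "y \<in> cball x e \<inter> S" "z \<in> cball x e \<inter> S"
    then have "norm (F y - F z) \<le> (\<bar>b x\<bar> + 1) * norm (y - z)"
      using B has_derivative_at_withinI[OF F] sub by (intro differentiable_bound[of "cball x e" F F']) blast+
    then show "dist (F y) (F z) \<le> (\<bar>b x\<bar> + 1) * dist y z" by (simp add: dist_norm)
  qed simp
  then show ?thesis using e by blast
qed

lemma locally_lipschitz_on_GDERIV:
  assumes "open S" and "\<And>z. z \<in> S \<Longrightarrow> GDERIV v z :> X z" and "continuous_on S X"
  shows "locally_lipschitz_on S v"
  unfolding locally_lipschitz_on_iff
proof
  have on: "onorm (\<lambda>h. h \<bullet> X z) \<le> norm (X z)" for z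
    by (rule onorm_bound) (simp_all add: mult.commute[of "norm (X z)"] Cauchy_Schwarz_ineq2)
  fix x assume "x \<in> S"
  then show "\<exists>e>0. \<exists>L. L-lipschitz_on (cball x e \<inter> S) v"
    by (intro lipschitz_on_cball_C1[OF assms(1), where F' = "\<lambda>z h. h \<bullet> X z" and b = "\<lambda>z. norm (X z)"])
       (use assms(2,3) on in \<open>auto simp: gderiv_def intro!: continuous_intros\<close>)
qed

lemma locally_lipschitz_on_add:
  assumes "locally_lipschitz_on S f" "locally_lipschitz_on S g"
  shows "locally_lipschitz_on S (\<lambda>z. f z + g z)"
  unfolding locally_lipschitz_on_iff
proof
  fix x assume "x \<in> S"
  obtain e1 L1 where 1: "e1 > 0" "L1-lipschitz_on (cball x e1 \<inter> S) f" using assms(1) \<open>x \<in> S\<close> locally_lipschitz_on_iff by blast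
  obtain e2 L2 where 2: "e2 > 0" "L2-lipschitz_on (cball x e2 \<inter> S) g" using assms(2) \<open>x \<in> S\<close> locally_lipschitz_on_iff by blast
  have "L1-lipschitz_on (cball x (min e1 e2) \<inter> S) f" "L2-lipschitz_on (cball x (min e1 e2) \<inter> S) g"
    using 1 2 by (auto elim!: lipschitz_on_subset)
  from lipschitz_on_add[OF this] show "\<exists>e>0. \<exists>L. L-lipschitz_on (cball x e \<inter> S) (\<lambda>z. f z + g z)"
    using 1 2 by (intro exI[of _ "min e1 e2"]) auto
qed

lemma locally_lipschitz_on_mult:
  assumes "locally_lipschitz_on S f" "locally_lipschitz_on S g"
  shows "locally_lipschitz_on S (\<lambda>z. f z * g z)"
  unfolding locally_lipschitz_on_iff
proof
  fix x assume "x \<in> S"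
  obtain e1 L1 where 1: "e1 > 0" "L1-lipschitz_on (cball x e1 \<inter> S) f" using assms(1) \<open>x \<in> S\<close> locally_lipschitz_on_iff by blast
  obtain e2 L2 where 2: "e2 > 0" "L2-lipschitz_on (cball x e2 \<inter> S) g" using assms(2) \<open>x \<in> S\<close> locally_lipschitz_on_iff by blast
  define e where "e = min e1 e2"
  define A where "A = cball x e \<inter> S"
  have e: "e > 0" using 1 2 by (simp add: e_def)
  have f: "L1-lipschitz_on A f" and g: "L2-lipschitz_on A g"
    using 1 2 by (auto simp: A_def e_def elim!: lipschitz_on_subset)
  have L: "0 \<le> L1" "0 \<le> L2" using f g lipschitz_on_nonneg by blast+
  have xA: "x \<in> A" using \<open>x \<in> S\<close> e by (simp add: A_def)
  have fb: "\<bar>f z\<bar> \<le> \<bar>f x\<bar> + L1 * e" if "z \<in> A" for z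
  proof -
    have "\<bar>f z - f x\<bar> \<le> L1 * dist z x" using lipschitz_onD[OF f that xA] by (simp add: dist_real_def)
    also have "\<dots> \<le> L1 * e" using that L by (intro mult_left_mono) (auto simp: A_def dist_commute)
    finally show ?thesis by linarith
  qed
  have gb: "\<bar>g z\<bar> \<le> \<bar>g x\<bar> + L2 * e" if "z \<in> A" for z
  proof -
    have "\<bar>g z - g x\<bar> \<le> L2 * dist z x" using lipschitz_onD[OF g that xA] by (simp add: dist_real_def)
    also have "\<dots> \<le> L2 * e" using that L by (intro mult_left_mono) (auto simp: A_def dist_commute)
    finally show ?thesis by linarith
  qed
  have "((\<bar>f x\<bar> + L1 * e) * L2 + (\<bar>g x\<bar> + L2 * e) * L1)-lipschitz_on A (\<lambda>z. f z * g z)"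
  proof (rule lipschitz_onI)
    fix y z assume yz: "y \<in> A" "z \<in> A"
    have "\<bar>f y * g y - f z * g z\<bar> = \<bar>f y * (g y - g z) + g z * (f y - f z)\<bar>" by (simp add: algebra_simps)
    also have "\<dots> \<le> \<bar>f y\<bar> * \<bar>g y - g z\<bar> + \<bar>g z\<bar> * \<bar>f y - f z\<bar>"
      by (metis abs_mult abs_triangle_ineq)
    also have "\<dots> \<le> (\<bar>f x\<bar> + L1 * e) * (L2 * dist y z) + (\<bar>g x\<bar> + L2 * e) * (L1 * dist y z)"
      using lipschitz_onD[OF f yz] lipschitz_onD[OF g yz] fb[OF yz(1)] gb[OF yz(2)] L e
      by (intro add_mono mult_mono) (auto simp: dist_real_def)
    finally show "dist (f y * g y) (f z * g z) \<le> ((\<bar>f x\<bar> + L1 * e) * L2 + (\<bar>g x\<bar> + L2 * e) * L1) * dist y z"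
      by (simp add: dist_real_def algebra_simps)
  qed (use L e in auto)
  then show "\<exists>e>0. \<exists>L. L-lipschitz_on (cball x e \<inter> S) (\<lambda>z. f z * g z)"
    using e unfolding A_def by blast
qed

lemma locally_lipschitz_on_const: "locally_lipschitz_on S (\<lambda>z. c)"
  unfolding locally_lipschitz_on_iff using lipschitz_on_constant zero_less_one by blast

lemma locally_lipschitz_on_imp_continuous_on:
  assumes "locally_lipschitz_on S v" shows "continuous_on S v"
  using local_lipschitz_continuous_on[of "{0}" S "\<lambda>_. v" 0] assms by (simp add: locally_lipschitz_on_def)

text \<open>A local Lipschitz condition is uniform on the compact interval, and composing with the
  projection onto it extends the constant to the whole line. Results on globally Lipschitz functions
  thus apply inside \<open>{a..b}\<close>.\<close>

lemma locally_lipschitz_on_clamp: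
  fixes f :: "real \<Rightarrow> real"
  assumes "locally_lipschitz_on UNIV f" "a \<le> b"
  obtains L where "L-lipschitz_on UNIV (\<lambda>t. f (min b (max a t)))"
proof -
  have "local_lipschitz {0::real} {a..b} (\<lambda>_. f)"
    using assms(1) local_lipschitz_subset unfolding locally_lipschitz_on_def by (metis subset_UNIV subset_refl)
  then obtain L where L: "L-lipschitz_on {a..b} f"
    using local_lipschitz_compact_implies_lipschitz[of "{0::real}" "{a..b}" "\<lambda>_. f"]
    by (auto intro: continuous_intros)
  have "L-lipschitz_on UNIV (\<lambda>t. f (min b (max a t)))"
  proof (rule lipschitz_onI)
    fix x y :: real
    have "dist (f (min b (max a x))) (f (min b (max a y))) \<le> L * dist (min b (max a x)) (min b (max a y))"
      using assms(2) by (intro lipschitz_onD[OF L]) auto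
    also have "\<dots> \<le> L * dist x y"
      using lipschitz_on_nonneg[OF L] by (intro mult_left_mono) (auto simp: dist_real_def)
    finally show "dist (f (min b (max a x))) (f (min b (max a y))) \<le> L * dist x y" .
  qed (rule lipschitz_on_nonneg[OF L])
  then show thesis by (rule that)
qed

lemma negligible_not_differentiable_locally_lipschitz:
  fixes f :: "real \<Rightarrow> real"
  assumes "locally_lipschitz_on UNIV f"
  shows "negligible {t. \<not> (f has_real_derivative deriv f t) (at t)}"
proof -
  define N where "N n = {t. \<not> (\<exists>D. ((\<lambda>t. f (min (real n) (max (- real n) t))) has_real_derivative D) (at t))}" for n
  have "negligible (N n)" for n
  proof -
    obtain L where "L-lipschitz_on UNIV (\<lambda>t. f (min (real n) (max (- real n) t)))"
      using locally_lipschitz_on_clamp[OF assms, of "- real n" "real n"] by auto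
    then obtain h where "negligible {x. \<not> ((\<lambda>t. f (min (real n) (max (- real n) t))) has_real_derivative h x) (at x)}"
      by (rule lipschitz_real_FTC)
    then show ?thesis by (rule negligible_subset) (auto simp: N_def)
  qed
  then have "negligible (\<Union>(range N))" by (intro negligible_countable_Union) auto
  then show ?thesis
  proof (rule negligible_subset, safe)
    fix t assume t: "\<not> (f has_real_derivative deriv f t) (at t)"
    obtain n where n: "\<bar>t\<bar> < real n" using reals_Archimedean2 by blast
    have "t \<in> N n"
    proof (rule ccontr)
      assume "t \<notin> N n"
      then obtain D where "((\<lambda>t. f (min (real n) (max (- real n) t))) has_real_derivative D) (at t)" by (auto simp: N_def)
      then have "(f has_real_derivative D) (at t)"
        by (rule has_field_derivative_transform_within[where d = "real n - \<bar>t\<bar>"]) (use n in \<open>auto simp: dist_real_def min_def max_def\<close>)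
      then show False using t DERIV_imp_deriv by fastforce
    qed
    then show "t \<in> \<Union>(range N)" by blast
  qed
qed

text \<open>The derivative is bounded only where it exists, so integration of the almost everywhere
  derivative replaces the mean value theorem. The bound on the derivative of \<open>g x\<close>
  thereby becomes a Lipschitz constant uniform in \<open>x\<close>.\<close>

lemma locally_lipschitz_derivative_bound:
  fixes f :: "real \<Rightarrow> real"
  assumes f: "locally_lipschitz_on UNIV f" and st: "s \<in> {a..b}" "t \<in> {a..b}"
    and C: "\<And>r D. r \<in> {a<..<b} \<Longrightarrow> (f has_real_derivative D) (at r) \<Longrightarrow> \<bar>D\<bar> \<le> C"
  shows "\<bar>f s - f t\<bar> \<le> C * \<bar>s - t\<bar>"
proof -
  have *: "\<bar>f y - f x\<bar> \<le> C * (y - x)" if xy: "x < y" "x \<in> {a..b}" "y \<in> {a..b}" for x y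
  proof -
    have ab: "a \<le> b" using xy by auto
    obtain L where "L-lipschitz_on UNIV (\<lambda>t. f (min b (max a t)))" using locally_lipschitz_on_clamp[OF f ab] .
    then obtain h where h: "\<And>c d. c \<le> d \<Longrightarrow> (h has_integral (f (min b (max a d)) - f (min b (max a c)))) {c..d}"
      and N: "negligible {x. \<not> ((\<lambda>t. f (min b (max a t))) has_real_derivative h x) (at x)}"
      by (rule lipschitz_real_FTC) (rule that)
    have I: "(h has_integral (f y - f x)) {x..y}" using h[of x y] xy by simp
    define S where "S = {x. \<not> ((\<lambda>t. f (min b (max a t))) has_real_derivative h x) (at x)} \<union> {x, y}"
    have nS: "negligible S" using N unfolding S_def by (intro negligible_Un) auto
    have hC: "\<bar>h r\<bar> \<le> C" if r: "r \<in> {x..y} - S" for r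
    proof -
      have "((\<lambda>t. f (min b (max a t))) has_real_derivative h r) (at r)" using r by (auto simp: S_def)
      then have "(f has_real_derivative h r) (at r)"
      proof (rule has_field_derivative_transform_within)
        show "0 < min (r - a) (b - r)" using r xy by (auto simp: S_def)
        fix q :: real assume "dist q r < min (r - a) (b - r)"
        then have "a \<le> q \<and> q \<le> b" by (auto simp: dist_real_def abs_less_iff)
        then show "f (min b (max a q)) = f q" by simp
      qed simp
      then show ?thesis using C[of r] r xy by (auto simp: S_def)
    qed
    have I2: "((\<lambda>r. if r \<in> S then 0 else h r) has_integral (f y - f x)) {x..y}"
      by (rule has_integral_spike[OF nS _ I]) auto
    \<comment> \<open>For negative \<open>C\<close> the derivative could exist nowhere inside the
      interval, which would then be a null set.\<close>
    have "C \<ge> 0"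
    proof (rule ccontr)
      assume "\<not> 0 \<le> C"
      then have "{x..y} \<subseteq> S" using hC by force
      then have "negligible {x..y}" using nS negligible_subset by blast
      then show False using xy by (simp add: negligible_interval(1)[of x y, unfolded cbox_interval box_real(2)])
    qed
    then have "norm (f y - f x) \<le> C * measure lborel (cbox x y)"
      by (rule has_integral_bound[OF _ I2[folded cbox_interval]]) (use hC \<open>C \<ge> 0\<close> in auto)
    then show ?thesis using xy by simp
  qed
  show ?thesis
    using *[of s t] *[of t s] st by (cases s t rule: linorder_cases) (auto simp: abs_minus_commute)
qed

text \<open>Caratheodory's slope function \<open>k\<close> avoids a division by
  \<open>x n - a\<close>, which may be 0.\<close>

lemma LIMSEQ_difference_quotient:
  fixes f :: "real \<Rightarrow> real"
  assumes f: "(f has_real_derivative D) (at a)" and x: "(\<lambda>n. real (Suc n) * (x n - a)) \<longlonglongrightarrow> v"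
  shows "(\<lambda>n. real (Suc n) * (f (x n) - f a)) \<longlonglongrightarrow> D * v"
proof -
  obtain k where k: "\<And>z. f z - f a = k z * (z - a)" "isCont k a" "k a = D"
    using f by (auto simp: CARAT_DERIV)
  have "(\<lambda>n. real (Suc n) * (x n - a) * inverse (real (Suc n))) \<longlonglongrightarrow> v * 0"
    by (intro tendsto_mult x LIMSEQ_inverse_real_of_nat)
  moreover have "real (Suc n) * (x n - a) * inverse (real (Suc n)) = x n - a" for n
    by (simp add: field_simps del: of_nat_Suc)
  ultimately have "x \<longlonglongrightarrow> a" by (simp add: LIM_zero_iff del: of_nat_Suc)
  then have "(\<lambda>n. k (x n)) \<longlonglongrightarrow> D" using k(2,3) isCont_tendsto_compose by metis
  from tendsto_mult[OF this x] show ?thesis by (simp add: k(1) mult.left_commute)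
qed

text \<open>The complementary case of the chain rule: where the inner difference quotient tends to
  0, a local Lipschitz constant takes the place of differentiability of the outer function.\<close>

lemma LIMSEQ_difference_quotient_0:
  fixes f :: "real \<Rightarrow> real"
  assumes f: "locally_lipschitz_on UNIV f" and x: "(\<lambda>n. real (Suc n) * (x n - a)) \<longlonglongrightarrow> 0"
  shows "(\<lambda>n. real (Suc n) * (f (x n) - f a)) \<longlonglongrightarrow> 0"
proof -
  obtain e L where e: "e > 0" "L-lipschitz_on (cball a e) f" using f unfolding locally_lipschitz_on_iff by (metis UNIV_I inf_top.right_neutral)
  have "(\<lambda>n. real (Suc n) * (x n - a) * inverse (real (Suc n))) \<longlonglongrightarrow> 0 * 0"
    by (intro tendsto_mult x LIMSEQ_inverse_real_of_nat)
  moreover have "real (Suc n) * (x n - a) * inverse (real (Suc n)) = x n - a" for n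
    by (simp add: field_simps del: of_nat_Suc)
  ultimately have "x \<longlonglongrightarrow> a" by (simp add: LIM_zero_iff del: of_nat_Suc)
  then have "\<forall>\<^sub>F n in sequentially. dist (x n) a < e" using e(1) tendstoD by blast
  then have "\<forall>\<^sub>F n in sequentially. norm (real (Suc n) * (f (x n) - f a)) \<le> norm (real (Suc n) * (x n - a)) * L"
  proof eventually_elim
    case (elim n)
    then have "\<bar>f (x n) - f a\<bar> \<le> L * \<bar>x n - a\<bar>"
      using lipschitz_onD[OF e(2), of "x n" a] e(1) by (simp add: dist_real_def dist_commute abs_minus_commute)
    then have "real (Suc n) * \<bar>f (x n) - f a\<bar> \<le> real (Suc n) * (L * \<bar>x n - a\<bar>)" by (intro mult_left_mono) auto
    then show ?case by (simp add: abs_mult mult_ac del: of_nat_Suc)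
  qed
  moreover have "(\<lambda>n. norm (real (Suc n) * (x n - a)) * L) \<longlonglongrightarrow> 0"
    using tendsto_mult_left_zero[OF tendsto_norm_zero[OF x]] .
  ultimately show ?thesis by (rule Lim_null_comparison)
qed

subsection \<open>Cutoff functions\<close>

lemma DERIV_max_0_power:
  "((\<lambda>t. (max 0 t) ^ Suc (Suc n)) has_real_derivative real (Suc (Suc n)) * (max 0 t) ^ Suc n) (at t)"
proof -
  consider "t > 0" | "t < 0" | "t = 0" by linarith
  then show ?thesis
  proof cases
    case 1
    have "((\<lambda>t. t ^ Suc (Suc n)) has_real_derivative real (Suc (Suc n)) * (max 0 t) ^ Suc n) (at t)"
      using DERIV_pow[of "Suc (Suc n)" t UNIV] 1 by simp
    then show ?thesis
      by (rule has_field_derivative_transform_within[where d = t]) (use 1 in \<open>auto simp: dist_real_def max_def abs_less_iff\<close>)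
  next
    case 2
    have "((\<lambda>t. 0) has_real_derivative real (Suc (Suc n)) * (max 0 t) ^ Suc n) (at t)" using 2 by simp
    then show ?thesis
      by (rule has_field_derivative_transform_within[where d = "- t"]) (use 2 in \<open>auto simp: dist_real_def max_def abs_less_iff\<close>)
  next
    case 3
    show ?thesis
      unfolding CARAT_DERIV 3
    proof (intro exI[of _ "\<lambda>z. (max 0 z) ^ Suc n"] conjI allI)
      show "isCont (\<lambda>z::real. (max 0 z) ^ Suc n) 0" by (intro continuous_intros)
    qed (auto simp: max_def)
  qed
qed

text \<open>Profile of the cutoffs in the variable \<open>s\<close>, the squared norm over
  \<open>R\<^sup>2\<close>: it is 1 up to \<open>s = 1\<close> and 0 from \<open>s = 4\<close> on,
  that is, from twice the radius. Squares of positive parts make it continuously differentiable, and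
  the squared norm has no corner at the origin.\<close>

definition bump :: "real \<Rightarrow> real" where
  "bump s = (max 0 (1 - (max 0 ((s - 1) / 3))\<^sup>2))\<^sup>2"

definition bump' :: "real \<Rightarrow> real" where
  "bump' s = - (4 / 3) * max 0 (1 - (max 0 ((s - 1) / 3))\<^sup>2) * max 0 ((s - 1) / 3)"

lemma DERIV_bump: "(bump has_real_derivative bump' s) (at s)"
proof -
  have q: "((\<lambda>t. (max 0 t)\<^sup>2) has_real_derivative 2 * max 0 t) (at t)" for t :: real
    using DERIV_max_0_power[of 0 t] by (simp add: numeral_2_eq_2)
  have "((\<lambda>s. (s - 1) / 3) has_real_derivative 1 / 3) (at s)" by (auto intro!: derivative_eq_intros)
  from DERIV_diff[OF DERIV_const DERIV_chain2[OF q this]]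
  have "((\<lambda>s. 1 - (max 0 ((s - 1) / 3))\<^sup>2) has_real_derivative - (2 * max 0 ((s - 1) / 3) * (1 / 3))) (at s)"
    by simp
  from DERIV_chain2[OF q this] show ?thesis
    by (simp add: bump_def[abs_def] bump'_def algebra_simps)
qed

lemma bump_bounds: "0 \<le> bump s" "bump s \<le> 1"
  unfolding bump_def by (auto intro!: power_le_one)

lemma bump_eq_1: "s \<le> 1 \<Longrightarrow> bump s = 1" and bump'_eq_0: "s \<le> 1 \<Longrightarrow> bump' s = 0"
  by (auto simp: bump_def bump'_def max_def)

lemma bump_eq_0: assumes "4 \<le> s" shows "bump s = 0" "bump' s = 0"
proof -
  have "1 \<le> (max 0 ((s - 1) / 3))\<^sup>2" using assms by (simp add: one_le_power)
  then show "bump s = 0" "bump' s = 0" by (auto simp: bump_def bump'_def)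
qed

lemma bump'_bound: "\<bar>bump' s\<bar> \<le> 4 / 3"
proof (cases "s < 4")
  case True
  have "max 0 (1 - (max 0 ((s - 1) / 3))\<^sup>2) * max 0 ((s - 1) / 3) \<le> 1 * 1"
    using True by (intro mult_mono) auto
  moreover have "\<bar>bump' s\<bar> = 4 / 3 * (max 0 (1 - (max 0 ((s - 1) / 3))\<^sup>2) * max 0 ((s - 1) / 3))"
    unfolding bump'_def by (simp add: abs_mult)
  ultimately show ?thesis by linarith
qed (use bump_eq_0 in auto)

lemma continuous_on_bump': "continuous_on S bump'"
  unfolding bump'_def[abs_def] by (intro continuous_intros) auto

definition cut :: "real \<Rightarrow> 'a::euclidean_space \<Rightarrow> real" where
  "cut R z = bump (z \<bullet> z / R\<^sup>2)"

definition cutg :: "real \<Rightarrow> 'a::euclidean_space \<Rightarrow> 'a" where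
  "cutg R z = (2 * bump' (z \<bullet> z / R\<^sup>2) / R\<^sup>2) *\<^sub>R z"

lemma GDERIV_inner_self: "GDERIV (\<lambda>z. z \<bullet> z * c) z :> (2 * c) *\<^sub>R z"
  unfolding gderiv_def
  by (rule derivative_eq_intros refl ext | simp add: algebra_simps inner_commute)+

lemma GDERIV_cut: "GDERIV (cut R) z :> cutg R z"
  using GDERIV_DERIV_compose[OF GDERIV_inner_self[of "1 / R\<^sup>2" z] DERIV_bump[of "z \<bullet> z * (1 / R\<^sup>2)"]]
  by (simp add: cut_def[abs_def] cutg_def algebra_simps)

lemma continuous_on_cutg: "continuous_on S (cutg R)"
proof -
  have "continuous_on S (\<lambda>z. bump' (z \<bullet> z * inverse (R\<^sup>2)))"
    by (rule continuous_on_compose2[OF continuous_on_bump'[of UNIV]]) (auto intro!: continuous_intros)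
  then show ?thesis unfolding cutg_def[abs_def] divide_inverse by (intro continuous_intros)
qed

lemma continuous_on_cut: "continuous_on S (cut R)"
  by (meson GDERIV_cut continuous_at_imp_continuous_on gderiv_def has_derivative_continuous)

lemma cut_bounds: "0 \<le> cut R z" "cut R z \<le> 1"
  by (auto simp: cut_def bump_bounds)

lemma inner_div_le: "norm z \<le> R \<Longrightarrow> z \<bullet> z / R\<^sup>2 \<le> (1::real)"
  by (cases "R = 0") (auto simp: divide_simps power2_norm_eq_inner[symmetric] intro: power_mono)

lemma inner_div_ge: "0 < R \<Longrightarrow> 2 * R \<le> norm z \<Longrightarrow> (4::real) \<le> z \<bullet> z / R\<^sup>2"
  using power_mono[of "2 * R" "norm z" 2]
  by (simp add: divide_simps power2_norm_eq_inner[symmetric] power_mult_distrib)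

lemma cut_eq_1: "norm z \<le> R \<Longrightarrow> cut R z = 1" and cutg_eq_0': "norm z \<le> R \<Longrightarrow> cutg R z = 0"
  unfolding cut_def cutg_def using inner_div_le[of z R] by (simp_all add: bump_eq_1 bump'_eq_0)

lemma cut_eq_0: "0 < R \<Longrightarrow> 2 * R \<le> norm z \<Longrightarrow> cut R z = 0" and cutg_eq_0: "0 < R \<Longrightarrow> 2 * R \<le> norm z \<Longrightarrow> cutg R z = 0"
  unfolding cut_def cutg_def using inner_div_ge[of R z] by (simp_all add: bump_eq_0)

lemma norm_cutg_le: assumes "0 < R" shows "norm (cutg R z) \<le> 6 / R"
proof (cases "norm z < 2 * R")
  case True
  have "norm (cutg R z) = 2 * \<bar>bump' (z \<bullet> z / R\<^sup>2)\<bar> / R\<^sup>2 * norm z" by (simp add: cutg_def abs_mult)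
  \<comment> \<open>The product is \<open>16 / (3 * R)\<close>, rounded up below to
    \<open>6 / R\<close>.\<close>
  also have "\<dots> \<le> 2 * (4 / 3) / R\<^sup>2 * (2 * R)"
    using True assms bump'_bound by (intro mult_mono divide_right_mono) auto
  also have "\<dots> \<le> 6 / R" using assms by (simp add: field_simps power2_eq_square)
  finally show ?thesis .
qed (use assms cutg_eq_0[of R z] in auto)

text \<open>A discrete logarithmic cutoff: the gradients of the dyadic pieces have disjoint supports, so its
  Dirichlet energy gains a factor \<open>1/N\<close> against an energy growing quadratically.\<close>

definition lcut :: "nat \<Rightarrow> nat \<Rightarrow> 'a::euclidean_space \<Rightarrow> real" where
  "lcut m N z = (\<Sum>k<N. cut (2 ^ (m + k)) z) / real N"

definition lcutg :: "nat \<Rightarrow> nat \<Rightarrow> 'a::euclidean_space \<Rightarrow> 'a" where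
  "lcutg m N z = (\<Sum>k<N. cutg (2 ^ (m + k)) z) /\<^sub>R real N"

lemma GDERIV_lcut: "GDERIV (lcut m N) z :> lcutg m N z"
proof -
  have "GDERIV (\<lambda>z. \<Sum>k<n. cut (2 ^ (m + k)) z) z :> (\<Sum>k<n. cutg (2 ^ (m + k)) z)" for n
    by (induction n) (auto intro!: GDERIV_const GDERIV_add GDERIV_cut)
  from GDERIV_mult[OF this GDERIV_const[of "inverse (real N)"], of N] show ?thesis
    by (simp add: lcut_def[abs_def] lcutg_def divide_inverse)
qed

lemma continuous_on_lcutg: "continuous_on S (lcutg m N)"
  unfolding lcutg_def[abs_def] by (intro continuous_intros continuous_on_cutg)

lemma lcut_bounds: "0 \<le> lcut m N z" "lcut m N z \<le> 1"
proof -
  show "0 \<le> lcut m N z" by (auto simp: lcut_def intro!: divide_nonneg_nonneg sum_nonneg cut_bounds)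
  have "(\<Sum>k<N. cut (2 ^ (m + k)) z) \<le> (\<Sum>k<N. 1)" by (intro sum_mono cut_bounds)
  then show "lcut m N z \<le> 1" by (cases "N = 0") (auto simp: lcut_def divide_simps)
qed

lemma lcut_eq_1: assumes "norm z \<le> 2 ^ m" "0 < N" shows "lcut m N z = 1"
proof -
  have "norm z \<le> 2 ^ (m + k)" for k
    using assms(1) order_trans power_increasing[of m "m + k" "2::real"] by fastforce
  then show ?thesis using assms(2) by (simp add: lcut_def cut_eq_1)
qed

lemma lcut_eq_0: assumes "2 ^ (m + N) \<le> norm z" shows "lcut m N z = 0" "lcutg m N z = 0"
proof -
  have "2 * 2 ^ (m + k) \<le> norm z" if "k < N" for k
  proof -
    have "(2::real) * 2 ^ (m + k) = 2 ^ (Suc (m + k))" by simp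
    also have "\<dots> \<le> 2 ^ (m + N)" using that by (intro power_increasing) auto
    finally show ?thesis using assms by simp
  qed
  then show "lcut m N z = 0" "lcutg m N z = 0" by (auto simp: lcut_def lcutg_def cut_eq_0 cutg_eq_0)
qed

text \<open>The gradient of the piece with index \<open>k\<close> lives in the annulus between the
  radii \<open>2 ^ (m + k)\<close> and \<open>2 * 2 ^ (m + k)\<close>. These annuli are disjoint, so
  at most one summand is nonzero at each point and the square has no mixed terms. The annuli are
  then enlarged to balls, where the energy bound is available.\<close>

lemma norm_lcutg_le:
  "(norm (lcutg m N z))\<^sup>2 \<le> (\<Sum>k<N. 36 / 4 ^ (m + k) * indicator (ball 0 (2 * 2 ^ (m + k))) z) / (real N)\<^sup>2"
proof (cases "\<exists>k<N. cutg (2 ^ (m + k)) z \<noteq> 0")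
  case True
  then obtain k where k: "k < N" "cutg (2 ^ (m + k)) z \<noteq> 0" by blast
  have ann: "2 ^ (m + j) < norm z \<and> norm z < 2 * 2 ^ (m + j)" if "cutg (2 ^ (m + j)) z \<noteq> 0" for j
    using that cutg_eq_0'[of z "2 ^ (m + j)"] cutg_eq_0[of "2 ^ (m + j)" z] by force
  have z0: "cutg (2 ^ (m + j)) z = 0" if "j \<noteq> k" for j
  proof (rule ccontr)
    assume "cutg (2 ^ (m + j)) z \<noteq> 0"
    then have "(2::real) ^ (m + j) < 2 ^ Suc (m + k)" "(2::real) ^ (m + k) < 2 ^ Suc (m + j)"
      using ann[of j] ann[OF k(2)] by auto
    then have "m + j < Suc (m + k)" "m + k < Suc (m + j)"
      by (metis one_less_numeral_iff power_less_imp_less_exp semiring_norm(76))+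
    then show False using that by simp
  qed
  have "(\<Sum>j<N. cutg (2 ^ (m + j)) z) = cutg (2 ^ (m + k)) z"
    using k(1) z0 by (subst sum.remove[of _ k]) (auto intro!: sum.neutral)
  then have "(norm (lcutg m N z))\<^sup>2 = (norm (cutg (2 ^ (m + k)) z))\<^sup>2 / (real N)\<^sup>2"
    by (simp add: lcutg_def power_divide divide_inverse power_mult_distrib power_inverse mult.commute)
  also have "\<dots> \<le> (6 / 2 ^ (m + k))\<^sup>2 / (real N)\<^sup>2"
    by (intro divide_right_mono power_mono norm_cutg_le) auto
  also have "(6 / 2 ^ (m + k))\<^sup>2 = (36 / 4 ^ (m + k) * indicator (ball 0 (2 * 2 ^ (m + k))) z :: real)"
    using ann[OF k(2)] by (simp add: power2_eq_square flip: power_mult_distrib)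
  also have "36 / 4 ^ (m + k) * indicator (ball 0 (2 * 2 ^ (m + k))) z / (real N)\<^sup>2
     \<le> (\<Sum>k<N. 36 / 4 ^ (m + k) * indicator (ball 0 (2 * 2 ^ (m + k))) z) / (real N)\<^sup>2"
    using k(1) by (intro divide_right_mono member_le_sum) auto
  finally show ?thesis .
next
  case False
  then have "lcutg m N z = 0" by (simp add: lcutg_def)
  then show ?thesis by (auto intro!: divide_nonneg_nonneg sum_nonneg)
qed

subsection \<open>A bump function in the plane with controlled Laplacian\<close>

text \<open>The exponent 3 makes the function twice continuously differentiable across the circle of
  radius \<open>r\<close>. Its Laplacian is positive inside near that circle, so the negative part
  of the Laplacian is bounded by a multiple of the function itself, as the averages of
  \<open>w\<close> over discs require.\<close>

definition hat :: "real \<Rightarrow> real^2 \<Rightarrow> real" where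
  "hat r y = (max 0 (1 - y \<bullet> y / r\<^sup>2)) ^ 3"

definition hatg :: "real \<Rightarrow> real^2 \<Rightarrow> real^2" where
  "hatg r y = (- (6 / r\<^sup>2) * (max 0 (1 - y \<bullet> y / r\<^sup>2))\<^sup>2) *\<^sub>R y"

definition hatd2 :: "real \<Rightarrow> real^2 \<Rightarrow> real^2 \<Rightarrow> real" where
  "hatd2 r e y = - (6 / r\<^sup>2) * (max 0 (1 - y \<bullet> y / r\<^sup>2))\<^sup>2 * (e \<bullet> e)
     + 24 / r ^ 4 * max 0 (1 - y \<bullet> y / r\<^sup>2) * (y \<bullet> e)\<^sup>2"

lemma GDERIV_hat: "GDERIV (hat r) y :> hatg r y"
proof -
  have 1: "GDERIV (\<lambda>y. 1 + y \<bullet> y * (- 1 / r\<^sup>2)) y :> 0 + (2 * (- 1 / r\<^sup>2)) *\<^sub>R y" 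
    by (intro GDERIV_add GDERIV_const GDERIV_inner_self)
  have 2: "((\<lambda>t. (max 0 t) ^ 3) has_real_derivative 3 * (max 0 t)\<^sup>2) (at t)" for t :: real
    using DERIV_max_0_power[of 1 t] by (simp add: numeral_3_eq_3 numeral_2_eq_2)
  show ?thesis using GDERIV_DERIV_compose[OF 1 2] by (simp add: hat_def[abs_def] hatg_def algebra_simps)
qed

lemma continuous_on_hatg: "continuous_on S (hatg r)"
  unfolding hatg_def[abs_def] divide_inverse by (intro continuous_intros)

lemma continuous_on_hat: "continuous_on S (hat r)"
  unfolding hat_def[abs_def] divide_inverse by (intro continuous_intros)

lemma continuous_on_hatd2: "continuous_on S (hatd2 r e)"
  unfolding hatd2_def[abs_def] divide_inverse by (intro continuous_intros)

lemma hat_nonneg: "0 \<le> hat r y" by (simp add: hat_def)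

lemma hat_le_1: "hat r y \<le> 1" unfolding hat_def by (intro power_le_one) auto

lemma hat_pos: assumes "norm y < r" shows "0 < hat r y"
proof -
  have r: "0 < r" using assms norm_ge_zero[of y] by linarith
  have "(norm y)\<^sup>2 < r\<^sup>2" using assms by (intro power_strict_mono) auto
  then have "y \<bullet> y / r\<^sup>2 < 1" using r by (simp add: power2_norm_eq_inner divide_simps)
  then show ?thesis by (simp add: hat_def)
qed

lemma hat_eq_0: assumes "0 < r" "r \<le> norm y" shows "hat r y = 0" "hatg r y = 0" "hatd2 r e y = 0"
proof -
  have "r\<^sup>2 \<le> (norm y)\<^sup>2" using assms by (intro power_mono) auto
  then have "1 - y \<bullet> y / r\<^sup>2 \<le> 0" using assms(1) by (simp add: power2_norm_eq_inner divide_simps)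
  then show "hat r y = 0" "hatg r y = 0" "hatd2 r e y = 0" by (auto simp: hat_def hatg_def hatd2_def max_def)
qed

lemma DERIV_hatg_line:
  "((\<lambda>t. hatg r (y + t *\<^sub>R e) \<bullet> e) has_real_derivative hatd2 r e (y + t *\<^sub>R e)) (at t)"
proof -
  have 2: "((\<lambda>t. (max 0 t)\<^sup>2) has_real_derivative 2 * max 0 t) (at t)" for t :: real
    using DERIV_max_0_power[of 0 t] by (simp add: numeral_2_eq_2)
  define N where "N t = 1 - (y \<bullet> y + 2 * t * (y \<bullet> e) + t\<^sup>2 * (e \<bullet> e)) / r\<^sup>2" for t
  have N: "1 - (y + t *\<^sub>R e) \<bullet> (y + t *\<^sub>R e) / r\<^sup>2 = N t" for t
    by (simp add: N_def inner_add_left inner_add_right inner_commute power2_eq_square algebra_simps)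
  have dN: "(N has_real_derivative - (2 * ((y + t *\<^sub>R e) \<bullet> e)) / r\<^sup>2) (at t)"
    unfolding N_def by (cases "r = 0") (auto intro!: derivative_eq_intros simp: inner_add_left field_simps)
  have "((\<lambda>t. y \<bullet> e + t * (e \<bullet> e)) has_real_derivative e \<bullet> e) (at t)"
    by (auto intro!: derivative_eq_intros)
  from DERIV_mult[OF DERIV_cmult[OF DERIV_chain2[OF 2 dN], of "- (6 / r\<^sup>2)"] this]
  have "((\<lambda>t. - (6 / r\<^sup>2) * (max 0 (N t))\<^sup>2 * (y \<bullet> e + t * (e \<bullet> e))) has_real_derivative
     - (6 / r\<^sup>2) * (2 * max 0 (N t) * (- (2 * ((y + t *\<^sub>R e) \<bullet> e)) / r\<^sup>2)) * (y \<bullet> e + t * (e \<bullet> e))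
     + e \<bullet> e * (- (6 / r\<^sup>2) * (max 0 (N t))\<^sup>2)) (at t)" .
  moreover have "- (6 / r\<^sup>2) * (2 * max 0 (N t) * (- (2 * ((y + t *\<^sub>R e) \<bullet> e)) / r\<^sup>2)) * (y \<bullet> e + t * (e \<bullet> e))
     = 24 / r ^ 4 * max 0 (N t) * ((y + t *\<^sub>R e) \<bullet> e)\<^sup>2"
    by (simp add: inner_add_left power2_eq_square eval_nat_numeral divide_inverse algebra_simps)
  moreover have "(\<lambda>t. hatg r (y + t *\<^sub>R e) \<bullet> e) = (\<lambda>t. - (6 / r\<^sup>2) * (max 0 (N t))\<^sup>2 * (y \<bullet> e + t * (e \<bullet> e)))"
    unfolding hatg_def N by (simp add: inner_add_left)
  moreover have "hatd2 r e (y + t *\<^sub>R e) = e \<bullet> e * (- (6 / r\<^sup>2) * (max 0 (N t))\<^sup>2)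
     + 24 / r ^ 4 * max 0 (N t) * ((y + t *\<^sub>R e) \<bullet> e)\<^sup>2"
    unfolding hatd2_def N by simp
  ultimately show ?thesis by (simp only: add.commute)
qed

text \<open>With \<open>q\<close> the positive part, \<open>hat\<close> is \<open>q ^ 3\<close> and
  its Laplacian is \<open>q * (24 - 36 * q) / r\<^sup>2\<close>. The constant 14 is the least
  integer for which \<open>14 * q\<^sup>2 - 36 * q + 24\<close> has no real zero.\<close>

lemma hat_laplacian_ge:
  assumes "0 < r"
  shows "- (14 / r\<^sup>2) * hat r y \<le> hatd2 r (axis 1 1) y + hatd2 r (axis 2 1) y"
proof -
  define q where "q = max 0 (1 - y \<bullet> y / r\<^sup>2)"
  have q0: "0 \<le> q" by (simp add: q_def)
  have yy: "(y \<bullet> axis 1 1)\<^sup>2 + (y \<bullet> axis 2 1)\<^sup>2 = y \<bullet> y"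
    by (simp add: inner_axis inner_vec_def sum_2 power2_eq_square axis_def)
  have e: "axis i (1::real) \<bullet> axis i 1 = 1" for i :: 2 by (simp add: inner_axis)
  have s: "hatd2 r (axis 1 1) y + hatd2 r (axis 2 1) y = - (12 / r\<^sup>2) * q\<^sup>2 + 24 / r ^ 4 * q * (y \<bullet> y)"
  proof -
    have "hatd2 r (axis 1 1) y + hatd2 r (axis 2 1) y
      = - (12 / r\<^sup>2) * q\<^sup>2 + 24 / r ^ 4 * q * ((y \<bullet> axis 1 1)\<^sup>2 + (y \<bullet> axis 2 1)\<^sup>2)"
      unfolding hatd2_def q_def[symmetric] e by (simp add: algebra_simps)
    then show ?thesis unfolding yy .
  qed
  show ?thesis
  proof (cases "q = 0")
    case True
    then show ?thesis unfolding s by (simp add: hat_def q_def[symmetric])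
  next
    case False
    then have "y \<bullet> y / r\<^sup>2 = 1 - q" by (auto simp: q_def max_def split: if_splits)
    then have yq: "y \<bullet> y = (1 - q) * r\<^sup>2" using assms by (simp add: field_simps)
    have "hatd2 r (axis 1 1) y + hatd2 r (axis 2 1) y = (q * (24 - 36 * q)) / r\<^sup>2"
      unfolding s yq using assms by (simp add: field_simps eval_nat_numeral)
    moreover have "- 14 * q ^ 3 \<le> q * (24 - 36 * q)"
    proof -
      have "0 \<le> q * (14 * (q - 9 / 7)\<^sup>2 + 6 / 7)" using q0 by simp
      also have "\<dots> = q * (24 - 36 * q) + 14 * q ^ 3" by (simp add: power2_eq_square eval_nat_numeral algebra_simps)
      finally show ?thesis by simp
    qed
    then have "(- 14 * q ^ 3) / r\<^sup>2 \<le> (q * (24 - 36 * q)) / r\<^sup>2" by (intro divide_right_mono) auto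
    ultimately show ?thesis by (simp add: hat_def q_def[symmetric])
  qed
qed

subsection \<open>Integration over the half-space\<close>

abbreviation HM :: "point measure" where "HM \<equiv> lebesgue_on half_space"

lemma open_half_space: "open half_space"
  unfolding half_space_def by (intro open_Collect_less continuous_intros)

lemma half_space_sets [measurable, simp]: "half_space \<in> sets lebesgue" "half_space \<in> sets borel"
  using open_half_space by auto

lemma half_space_shift [simp]: "z + (d, 0) \<in> half_space \<longleftrightarrow> z \<in> half_space"
  by (simp add: half_space_def)

lemma mem_half_space [simp]: "(y, x) \<in> half_space \<longleftrightarrow> 0 < x" by (simp add: half_space_def)

lemma space_HM [simp]: "space HM = half_space" by (simp add: space_restrict_space)

lemma point_borel [measurable]:
  "snd \<in> borel_measurable (borel :: point measure)" "fst \<in> borel_measurable (borel :: point measure)"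
  by (intro borel_measurable_continuous_onI continuous_intros)+

lemma convex_half_space: "convex half_space"
proof -
  have eq: "half_space = {z. (0, 1) \<bullet> z > 0}" by (auto simp: half_space_def inner_prod_def)
  show ?thesis unfolding eq by (rule convex_halfspace_gt)
qed

lemma AE_HM_iff: "(AE z in HM. P z) \<longleftrightarrow> (AE z in lebesgue. z \<in> half_space \<longrightarrow> P z)"
  by (rule AE_restrict_space_iff) simp

lemma AE_HM_I: "(\<And>z. z \<in> half_space \<Longrightarrow> P z) \<Longrightarrow> AE z in HM. P z"
  unfolding AE_HM_iff by (intro AE_I2) blast

lemma HM_integrable_iff: "integrable HM F \<longleftrightarrow> set_integrable lebesgue half_space F"
  for F :: "point \<Rightarrow> real"
  unfolding set_integrable_def by (rule integrable_restrict_space) simp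

lemma HM_integral_eq: "(\<integral>z. F z \<partial>HM) = (LINT z:half_space|lebesgue. F z)"
  for F :: "point \<Rightarrow> real"
  unfolding set_lebesgue_integral_def by (rule integral_restrict_space) simp

lemma HM_measurable_iff: "F \<in> borel_measurable HM \<longleftrightarrow> (\<lambda>z. indicator half_space z *\<^sub>R F z) \<in> borel_measurable lebesgue"
  for F :: "point \<Rightarrow> 'b::real_normed_vector"
  by (rule borel_measurable_restrict_space_iff) simp

lemma HM_measurable_continuous: "continuous_on half_space F \<Longrightarrow> F \<in> borel_measurable HM"
  by (rule continuous_imp_measurable_on_sets_lebesgue) auto

lemma HM_nn_integral: "(\<integral>\<^sup>+z. F z \<partial>HM) = (\<integral>\<^sup>+z. F z * indicator half_space z \<partial>lborel)"
proof -
  have "(\<integral>\<^sup>+z. F z \<partial>HM) = (\<integral>\<^sup>+z. F z * indicator half_space z \<partial>lebesgue)"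
    by (rule nn_integral_restrict_space) simp
  then show ?thesis unfolding nn_integral_completion .
qed

lemma indicator_ball_measurable [measurable]: "(indicator (ball c R) :: point \<Rightarrow> real) \<in> borel_measurable HM"
  by (rule measurable_restrict_space1[OF borel_measurable_indicator]) simp

lemma HM_set_ball:
  fixes F :: "point \<Rightarrow> real"
  assumes "\<And>z. z \<in> half_space \<Longrightarrow> z \<notin> ball 0 R \<Longrightarrow> F z = 0"
  shows "set_integrable lebesgue (half_ball R) F \<longleftrightarrow> integrable HM F"
    and "(LINT z:half_ball R|lebesgue. F z) = (\<integral>z. F z \<partial>HM)"
proof -
  have "indicator (half_ball R) z *\<^sub>R F z = indicator half_space z *\<^sub>R F z" for z
    using assms[of z] by (auto simp: half_ball_def indicator_def)
  then show "set_integrable lebesgue (half_ball R) F \<longleftrightarrow> integrable HM F"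
    "(LINT z:half_ball R|lebesgue. F z) = (\<integral>z. F z \<partial>HM)"
    by (simp_all only: HM_integrable_iff HM_integral_eq set_integrable_def set_lebesgue_integral_def)
qed

lemma HM_shift_measurable: "F \<in> borel_measurable HM \<Longrightarrow> (\<lambda>z. F (z + (d, 0))) \<in> borel_measurable HM"
  for F :: "point \<Rightarrow> 'b::real_normed_vector"
  unfolding HM_measurable_iff using borel_measurable_lebesgue_translation[of "\<lambda>z. indicator half_space z *\<^sub>R F z" "(d, 0)"]
  by (simp add: indicator_def)

lemma HM_shift_integrable: "integrable HM F \<Longrightarrow> integrable HM (\<lambda>z. F (z + (d, 0)))"
  for F :: "point \<Rightarrow> real"
  unfolding HM_integrable_iff set_integrable_def
  using integrable_lebesgue_translation[of "\<lambda>z. indicator half_space z *\<^sub>R F z" "(d, 0)"]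
  by (simp add: indicator_def)

lemma HM_shift_integral: "F \<in> borel_measurable HM \<Longrightarrow> (\<integral>z. F (z + (d, 0)) \<partial>HM) = (\<integral>z. F z \<partial>HM)"
  for F :: "point \<Rightarrow> real"
  unfolding HM_measurable_iff HM_integral_eq set_lebesgue_integral_def
  using integral_lebesgue_translation[of "\<lambda>z. indicator half_space z *\<^sub>R F z" "(d, 0)"]
  by (simp add: indicator_def)

lemma HM_shift_AE: "AE z in HM. P z \<Longrightarrow> AE z in HM. P (z + (d, 0))"
  unfolding AE_HM_iff using AE_lebesgue_translate[of "\<lambda>z. z \<in> half_space \<longrightarrow> P z" "(d, 0)"] by simp

lemma GDERIV_unique: "GDERIV v z :> X \<Longrightarrow> GDERIV v z :> Y \<Longrightarrow> X = Y" for X Y :: "'a::euclidean_space"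
proof -
  assume "GDERIV v z :> X" "GDERIV v z :> Y"
  then have "(\<lambda>h. h \<bullet> X) = (\<lambda>h. h \<bullet> Y)" unfolding gderiv_def by (rule has_derivative_unique)
  then have "\<forall>h. h \<bullet> X = h \<bullet> Y" by (simp add: fun_eq_iff)
  then show "X = Y" unfolding vector_eq_ldot .
qed

lemma grad_eqI: "GDERIV v z :> X \<Longrightarrow> grad v z = X"
  unfolding grad_def by (rule the_equality) (auto intro: GDERIV_unique)

lemma GDERIV_shift: "GDERIV v (z + c) :> X \<Longrightarrow> GDERIV (\<lambda>z. v (z + c)) z :> X"
  unfolding gderiv_def
  by (rule has_derivative_compose[of "\<lambda>z. z + c" "\<lambda>h. h" z UNIV v "\<lambda>h. h \<bullet> X"]) (auto intro!: derivative_eq_intros)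

lemma trace0_eqI: "((\<lambda>x. v (y, x)) \<longlongrightarrow> l) (at_right 0) \<Longrightarrow> trace0 v y = l"
  unfolding trace0_def by (rule tendsto_Lim) (simp_all add: trivial_limit_at_right_real)

text \<open>The set where a continuous function exceeds the bound is open, and a nonempty open set
  is not null. This turns almost everywhere statements about gradients into statements at every
  point.\<close>

lemma AE_bound_imp_bound:
  fixes \<phi> :: "'a::euclidean_space \<Rightarrow> real"
  assumes "open S" "continuous_on S \<phi>" "AE z in lebesgue. z \<in> S \<longrightarrow> \<phi> z \<le> C" "z \<in> S"
  shows "\<phi> z \<le> C"
proof (rule ccontr)
  assume "\<not> \<phi> z \<le> C"
  define T where "T = {z \<in> S. C < \<phi> z}"
  have "open T"
    using continuous_open_preimage[OF assms(2,1) open_greaterThan[of C]]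
    by (simp add: T_def vimage_def Int_def conj_commute greaterThan_def)
  moreover have "z \<in> T" using assms(4) \<open>\<not> \<phi> z \<le> C\<close> by (simp add: T_def)
  moreover have "negligible T"
  proof -
    have "AE z in lebesgue. z \<notin> T" using assms(3) by eventually_elim (auto simp: T_def)
    moreover have "T \<in> sets lebesgue" using \<open>open T\<close> by auto
    ultimately show ?thesis by (simp add: negligible_iff_null_sets AE_iff_null_sets)
  qed
  ultimately show False using open_not_negligible by blast
qed

lemma AE_snd: assumes "AE x in lborel. P x" shows "AE z in (lborel :: point measure). P (snd z)"
proof -
  obtain N where N: "N \<in> null_sets lborel" "{x. \<not> P x} \<subseteq> N"
    using assms by (auto simp: eventually_ae_filter)
  have [measurable]: "N \<in> sets borel" using N by auto
  define S :: "point set" where "S = snd -` N \<inter> space borel"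
  have S: "S \<in> sets borel" unfolding S_def by measurable
  have "negligible {t. z + t *\<^sub>R (0, 1) \<in> S}" for z :: point
  proof -
    have "{t. z + t *\<^sub>R (0, 1) \<in> S} = (+) (- snd z) ` N" by (force simp: S_def image_iff)
    then show ?thesis
      using negligible_translation[of N "- snd z"] N(1) by (simp add: negligible_iff_null_sets null_sets_completionI)
  qed
  then have "negligible S" using S by (intro negligible_lines[of S "(0, 1)"]) auto
  then have "S \<in> null_sets lborel" using S by (auto simp: negligible_iff_null_sets null_sets_def)
  then show ?thesis by (rule AE_I') (use N(2) in \<open>auto simp: S_def\<close>)
qed

text \<open>Besides the hypotheses, the locale fixes a classical gradient \<open>G\<close> of
  \<open>u\<close> and its derivative \<open>H\<close>. The operator \<open>grad\<close> with its
  unspecified values then occurs only where the hypotheses are unfolded.\<close>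

locale stable_layer =
  fixes \<mu> :: "real \<Rightarrow> real" and g :: "real \<Rightarrow> real \<Rightarrow> real" and f :: "real \<Rightarrow> real" and u :: "point \<Rightarrow> real"
    and G :: "point \<Rightarrow> point" and H :: "point \<Rightarrow> point \<Rightarrow>\<^sub>L point"
  assumes struct: "structural_assumptions \<mu> g f"
    and G: "\<And>z. z \<in> half_space \<Longrightarrow> GDERIV u z :> G z"
    and H: "\<And>z. z \<in> half_space \<Longrightarrow> (G has_derivative blinfun_apply (H z)) (at z)"
    and H_continuous: "continuous_on half_space H"
    and u_bounded: "bounded (u ` half_space)"
    and weak: "weak_solution \<mu> g f u"
    and stable: "stable_solution \<mu> g f u"
    and grad_y_Linfty: "\<forall>r>0. Linfty_on (closure (half_ball r)) (\<lambda>z. fst (grad u z))"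
    and g_alternative: "(\<forall>M>0. set_integrable lebesgue {0<..} (\<lambda>x. SUP t\<in>{-M..M}. \<bar>g x t\<bar>)) \<or>
         (\<forall>x>0. \<forall>t. g x t * t \<ge> 0)"
    and mu_growth: "\<exists>C>0. \<forall>R\<ge>1. (LINT x:{0<..<R}|lebesgue. \<mu> x) \<le> C * R\<^sup>2"
begin

lemma G_continuous: "continuous_on half_space G"
  using H by (meson continuous_at_imp_continuous_on has_derivative_continuous)

lemma u_continuous: "continuous_on half_space u"
  using G unfolding gderiv_def by (meson continuous_at_imp_continuous_on has_derivative_continuous)

lemma grad_u: "z \<in> half_space \<Longrightarrow> grad u z = G z" by (rule grad_eqI[OF G])

lemma weight: "locally_bounded_weight \<mu>" and A2: "A2_weight \<mu>"
  and g_lip: "0 < x \<Longrightarrow> locally_lipschitz_on UNIV (g x)" and f_lip: "locally_lipschitz_on UNIV f"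
  using struct by (auto simp: structural_assumptions_def)

lemma mu_bounds: assumes "0 < a" shows "\<exists>m1>0. \<exists>m2>0. \<forall>x\<in>{a..b}. m1 \<le> \<mu> x \<and> \<mu> x \<le> m2"
proof -
  have "compact ({0::real^2} \<times> {a..b})" by (intro compact_Times) auto
  then have "compact (closure ({0::real^2} \<times> {a..b}))" "closure ({0::real^2} \<times> {a..b}) \<subseteq> half_space"
    using assms by (auto simp: compact_imp_closed closure_closed)
  then obtain m1 m2 where "m1 > 0" "m2 > 0" "\<forall>(y, x)\<in>{0::real^2} \<times> {a..b}. \<mu> x \<in> {m1..m2}"
    using weight unfolding locally_bounded_weight_def by meson
  then show ?thesis by (intro exI[of _ m1] exI[of _ m2] conjI) auto
qed

lemma mu_pos: assumes "0 < x" shows "0 < \<mu> x"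
  using mu_bounds[OF assms, of x] by force

lemma mu_set_integrable: "0 < r \<Longrightarrow> set_integrable lebesgue {0<..<r} \<mu>"
  using weight by (simp add: locally_bounded_weight_def)

lemma mu_measurable: "(\<lambda>x. indicator {0<..} x * \<mu> x) \<in> borel_measurable lebesgue"
proof (rule borel_measurable_LIMSEQ_real)
  show "(\<lambda>n. indicator {0<..<real (Suc n)} x * \<mu> x) \<longlonglongrightarrow> indicator {0<..} x * \<mu> x" for x
  proof (rule tendsto_eventually)
    obtain N where "x < real N" using reals_Archimedean2 by blast
    then show "\<forall>\<^sub>F n in sequentially. indicator {0<..<real (Suc n)} x * \<mu> x = indicator {0<..} x * \<mu> x"
      by (intro eventually_sequentiallyI[of N]) (auto simp: indicator_def)
  qed
  show "(\<lambda>x. indicator {0<..<real (Suc n)} x * \<mu> x) \<in> borel_measurable lebesgue" for n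
    using mu_set_integrable[of "real (Suc n)"] unfolding set_integrable_def by (auto dest: borel_measurable_integrable)
qed

text \<open>A Borel representative of \<open>\<mu>\<close> on the positive axis:
  \<open>\<mu>\<close> is known to be Lebesgue measurable, whereas Tonelli's theorem for the product
  of the \<open>lborel\<close> measures asks for Borel functions.\<close>

definition m :: "real \<Rightarrow> real" where
  "m = (SOME h. h \<in> borel_measurable borel \<and> (\<forall>x. 0 \<le> h x) \<and> (AE x in lborel. 0 < x \<longrightarrow> \<mu> x = h x))"

lemma m_props: "m \<in> borel_measurable borel" "0 \<le> m x" "AE x in lborel. 0 < x \<longrightarrow> \<mu> x = m x"
proof -
  obtain h where h: "h \<in> borel_measurable lborel" "AE x in lborel. indicator {0<..} x * \<mu> x = h x"
    using completion_ex_borel_measurable_real[OF mu_measurable] by auto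
  have "(\<lambda>x. max 0 (h x)) \<in> borel_measurable borel \<and> (\<forall>x. 0 \<le> max 0 (h x)) \<and> (AE x in lborel. 0 < x \<longrightarrow> \<mu> x = max 0 (h x))"
  proof (intro conjI)
    show "AE x in lborel. 0 < x \<longrightarrow> \<mu> x = max 0 (h x)"
      using h(2)
    proof eventually_elim
      case (elim x)
      then show ?case using mu_pos[of x] by (auto simp: max_def)
    qed
  qed (use h in auto)
  from someI[of "\<lambda>h. h \<in> borel_measurable borel \<and> (\<forall>x. 0 \<le> h x) \<and> (AE x in lborel. 0 < x \<longrightarrow> \<mu> x = h x)", OF this]
  show "m \<in> borel_measurable borel" "0 \<le> m x" "AE x in lborel. 0 < x \<longrightarrow> \<mu> x = m x"
    unfolding m_def by auto
qed

lemmas m_borel [measurable] = m_props(1)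

lemma AE_mu_m: "AE z in lborel. z \<in> half_space \<longrightarrow> \<mu> (snd z) = m (snd z)"
  using AE_snd[OF m_props(3)] by eventually_elim (simp add: half_space_def)

lemma m_snd_measurable: "(\<lambda>z. m (snd z)) \<in> borel_measurable HM"
proof -
  have "(\<lambda>z::point. m (snd z)) \<in> borel_measurable lborel" by measurable
  then have "(\<lambda>z::point. m (snd z)) \<in> borel_measurable lebesgue" by (rule measurable_completion)
  then show ?thesis by (rule measurable_restrict_space1)
qed

lemma rho_measurable [measurable]: "(\<lambda>z. \<mu> (snd z)) \<in> borel_measurable HM"
proof -
  have a: "AE z in lebesgue. indicator half_space z *\<^sub>R m (snd z) = indicator half_space z *\<^sub>R \<mu> (snd z)"
    using AE_completion[OF AE_mu_m] by eventually_elim (auto simp: indicator_def)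
  have b: "(\<lambda>z. indicator half_space z *\<^sub>R m (snd z)) \<in> borel_measurable lebesgue"
    using m_snd_measurable unfolding HM_measurable_iff .
  show ?thesis unfolding HM_measurable_iff
    by (rule borel_measurable_AE[OF b a])
qed

lemma nn_mu_interval: assumes "0 < R"
  shows "(\<integral>\<^sup>+x. ennreal (m x) * indicator {0<..<R} x \<partial>lborel) = ennreal (LINT x:{0<..<R}|lebesgue. \<mu> x)"
proof -
  have "(\<integral>\<^sup>+x. ennreal (m x) * indicator {0<..<R} x \<partial>lborel) = (\<integral>\<^sup>+x. ennreal (indicator {0<..<R} x *\<^sub>R \<mu> x) \<partial>lborel)"
    by (rule nn_integral_cong_AE, use m_props(3) in eventually_elim) (auto simp: indicator_def)
  also have "\<dots> = (\<integral>\<^sup>+x. ennreal (indicator {0<..<R} x *\<^sub>R \<mu> x) \<partial>lebesgue)" by (simp add: nn_integral_completion)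
  also have "\<dots> = ennreal (LINT x:{0<..<R}|lebesgue. \<mu> x)"
    unfolding set_lebesgue_integral_def
    by (rule nn_integral_eq_integral)
       (use mu_set_integrable[OF assms] mu_pos in \<open>auto simp: set_integrable_def indicator_def less_imp_le\<close>)
  finally show ?thesis .
qed

lemma nn_cylinder:
  fixes h :: "real \<Rightarrow> ennreal"
  assumes [measurable]: "h \<in> borel_measurable borel"
  shows "(\<integral>\<^sup>+z. indicator (ball 0 R) (fst z) * h (snd z) \<partial>(lborel :: point measure)) =
     emeasure lborel (ball 0 R :: (real^2) set) * (\<integral>\<^sup>+x. h x \<partial>lborel)"
proof -
  have [measurable]: "(\<lambda>z::point. h (snd z)) \<in> borel_measurable (lborel \<Otimes>\<^sub>M lborel)"
    by (rule measurable_compose[OF measurable_snd]) (simp add: assms)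
  have [measurable]: "(\<lambda>z::point. indicator (ball (0::real^2) R) (fst z) :: ennreal) \<in> borel_measurable (lborel \<Otimes>\<^sub>M lborel)"
    by (rule measurable_compose[OF measurable_fst]) (rule borel_measurable_indicator, simp)
  have "(\<integral>\<^sup>+z. indicator (ball 0 R) (fst z) * h (snd z) \<partial>(lborel :: point measure)) =
    (\<integral>\<^sup>+z. indicator (ball 0 R) (fst z) * h (snd z) \<partial>((lborel :: (real^2) measure) \<Otimes>\<^sub>M lborel))" by (simp add: lborel_prod)
  also have "\<dots> = (\<integral>\<^sup>+y. (\<integral>\<^sup>+x. indicator (ball 0 R :: (real^2) set) y * h x \<partial>lborel) \<partial>lborel)"
    by (subst lborel.nn_integral_fst[symmetric]) (measurable, simp_all)
  also have "\<dots> = (\<integral>\<^sup>+y. indicator (ball 0 R :: (real^2) set) y * (\<integral>\<^sup>+x. h x \<partial>lborel) \<partial>lborel)"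
    by (simp add: nn_integral_cmult)
  also have "\<dots> = emeasure lborel (ball 0 R :: (real^2) set) * (\<integral>\<^sup>+x. h x \<partial>lborel)"
    by (subst nn_integral_multc[OF borel_measurable_indicator]) simp_all
  finally show ?thesis .
qed

definition discc :: real where "discc = measure lborel (ball (0::real^2) 1)"

lemma emeasure_disc: "0 \<le> R \<Longrightarrow> emeasure lborel (ball (0::real^2) R) = ennreal (discc * R\<^sup>2)"
  using content_ball_conv_unit_ball[of R "0::real^2"] emeasure_lborel_ball_finite[of "0::real^2" R]
  by (simp add: emeasure_eq_ennreal_measure discc_def mult.commute)

lemma discc_nonneg: "0 \<le> discc" by (simp add: discc_def)

lemma ball_subset_cylinder: "z \<in> ball 0 R \<Longrightarrow> fst z \<in> ball 0 R \<and> snd z < R" for z :: point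
  using norm_fst_le[of "fst z" "snd z"] norm_snd_le[of "snd z" "fst z"] by (auto simp: abs_le_iff)

text \<open>The half-ball lies in the cylinder of height \<open>R\<close> over the disc of radius
  \<open>R\<close>. With the growth hypothesis the bound is of order \<open>R ^ 4\<close>, so a
  cutoff with gradient of order \<open>1 / R\<close> costs an energy of order
  \<open>R\<^sup>2\<close>.\<close>

lemma mu_ball:
  assumes "0 < R"
  shows "integrable HM (\<lambda>z. \<mu> (snd z) * indicator (ball 0 R) z)"
    and "(\<integral>z. \<mu> (snd z) * indicator (ball 0 R) z \<partial>HM) \<le> discc * R\<^sup>2 * (LINT x:{0<..<R}|lebesgue. \<mu> x)"
proof -
  let ?I = "LINT x:{0<..<R}|lebesgue. \<mu> x"
  have I0: "0 \<le> ?I" unfolding set_lebesgue_integral_def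
    by (rule integral_nonneg_AE) (auto simp: indicator_def mu_pos less_imp_le)
  have nn: "0 \<le> \<mu> (snd z) * indicator (ball 0 R) z" if "z \<in> half_space" for z
    using mu_pos[of "snd z"] that by (auto simp: half_space_def)
  have "(\<integral>\<^sup>+z. ennreal (\<mu> (snd z) * indicator (ball 0 R) z) \<partial>HM) =
     (\<integral>\<^sup>+z. ennreal (\<mu> (snd z) * indicator (ball 0 R) z) * indicator half_space z \<partial>lborel)"
    by (rule HM_nn_integral)
  also have "\<dots> \<le> (\<integral>\<^sup>+z. indicator (ball 0 R) (fst z) * (ennreal (m (snd z)) * indicator {0<..<R} (snd z)) \<partial>(lborel :: point measure))"
  proof (rule nn_integral_mono_AE, rule AE_mp[OF AE_mu_m], rule AE_I2, rule impI)
    fix z :: point assume "z \<in> half_space \<longrightarrow> \<mu> (snd z) = m (snd z)"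
    then show "ennreal (\<mu> (snd z) * indicator (ball 0 R) z) * indicator half_space z \<le>
       indicator (ball 0 R) (fst z) * (ennreal (m (snd z)) * indicator {0<..<R} (snd z))"
      using ball_subset_cylinder[of z R] by (cases "z \<in> half_space"; cases "z \<in> ball 0 R") (auto simp: half_space_def)
  qed
  also have "\<dots> = emeasure lborel (ball 0 R :: (real^2) set) * (\<integral>\<^sup>+x. ennreal (m x) * indicator {0<..<R} x \<partial>lborel)"
    by (rule nn_cylinder) measurable
  also have "\<dots> = ennreal (discc * R\<^sup>2 * ?I)"
    using assms discc_nonneg I0 by (simp add: emeasure_disc nn_mu_interval ennreal_mult)
  finally have le: "(\<integral>\<^sup>+z. ennreal (\<mu> (snd z) * indicator (ball 0 R) z) \<partial>HM) \<le> ennreal (discc * R\<^sup>2 * ?I)" .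
  have ms: "(\<lambda>z. \<mu> (snd z) * indicator (ball 0 R) z) \<in> borel_measurable HM"
    by (intro borel_measurable_times rho_measurable indicator_ball_measurable)
  show int: "integrable HM (\<lambda>z. \<mu> (snd z) * indicator (ball 0 R) z)"
    by (rule integrableI_nonneg[OF ms]) (use nn le in \<open>auto intro!: AE_HM_I simp: le_less_trans\<close>)
  have "ennreal (\<integral>z. \<mu> (snd z) * indicator (ball 0 R) z \<partial>HM) \<le> ennreal (discc * R\<^sup>2 * ?I)"
    using nn_integral_eq_integral[OF int] nn le by (simp add: AE_HM_I)
  then show "(\<integral>z. \<mu> (snd z) * indicator (ball 0 R) z \<partial>HM) \<le> discc * R\<^sup>2 * ?I"
    using discc_nonneg I0 by (simp add: ennreal_le_iff)
qed

lemma integrable_mu_bounded: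
  assumes X: "X \<in> borel_measurable HM" and R: "0 < R" and C: "\<And>z. z \<in> half_space \<Longrightarrow> z \<in> ball 0 R \<Longrightarrow> \<bar>X z\<bar> \<le> C"
    and 0: "\<And>z. z \<in> half_space \<Longrightarrow> z \<notin> ball 0 R \<Longrightarrow> X z = 0"
  shows "integrable HM (\<lambda>z. \<mu> (snd z) * X z)"
proof (rule Bochner_Integration.integrable_bound)
  show "integrable HM (\<lambda>z. C * (\<mu> (snd z) * indicator (ball 0 R) z))" using mu_ball(1)[OF R] by simp
  show "AE z in HM. norm (\<mu> (snd z) * X z) \<le> norm (C * (\<mu> (snd z) * indicator (ball 0 R) z))"
  proof (rule AE_HM_I)
    fix z assume z: "z \<in> half_space"
    have p: "0 < \<mu> (snd z)" using z mu_pos by (auto simp: half_space_def)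
    show "norm (\<mu> (snd z) * X z) \<le> norm (C * (\<mu> (snd z) * indicator (ball 0 R) z))"
    proof (cases "z \<in> ball 0 R")
      case True
      then have "\<bar>X z\<bar> \<le> \<bar>C\<bar>" using C[OF z True] by linarith
      then show ?thesis using True p by (simp add: abs_mult mult.commute)
    qed (use 0[OF z] in simp)
  qed
qed (use X rho_measurable in measurable)

text \<open>The \<open>A2\<close> condition bounds the product of the integrals of the weight and of
  its reciprocal, and the first factor is not 0. Integrability of the reciprocal up to
  \<open>x = 0\<close> is what produces traces.\<close>

lemma nn_inv_mu: assumes "0 < r" shows "(\<integral>\<^sup>+x. ennreal (1 / m x) * indicator {0<..<r} x \<partial>lborel) < \<infinity>"
proof -
  obtain \<kappa> where k: "\<kappa> > 0" "\<And>a b. 0 \<le> a \<Longrightarrow> a \<le> b \<Longrightarrow> (\<integral>\<^sup>+x\<in>{a<..<b}. ennreal (\<mu> x) \<partial>lebesgue) * (\<integral>\<^sup>+x\<in>{a<..<b}. ennreal (1 / \<mu> x) \<partial>lebesgue)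
          \<le> ennreal (\<kappa> * (b - a)\<^sup>2)"
    using A2 unfolding A2_weight_def by blast
  have 1: "(\<integral>\<^sup>+x\<in>{0<..<r}. ennreal (\<mu> x) \<partial>lebesgue) = (\<integral>\<^sup>+x. ennreal (m x) * indicator {0<..<r} x \<partial>lborel)"
    unfolding nn_integral_completion
    by (rule nn_integral_cong_AE, use m_props(3) in eventually_elim) (auto simp: indicator_def)
  have 2: "(\<integral>\<^sup>+x\<in>{0<..<r}. ennreal (1 / \<mu> x) \<partial>lebesgue) = (\<integral>\<^sup>+x. ennreal (1 / m x) * indicator {0<..<r} x \<partial>lborel)"
    unfolding nn_integral_completion
    by (rule nn_integral_cong_AE, use m_props(3) in eventually_elim) (auto simp: indicator_def)
  have "(\<integral>\<^sup>+x. ennreal (m x) * indicator {0<..<r} x \<partial>lborel) \<noteq> 0"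
  proof
    assume "(\<integral>\<^sup>+x. ennreal (m x) * indicator {0<..<r} x \<partial>lborel) = 0"
    then have "AE x in lborel. ennreal (m x) * indicator {0<..<r} x = 0"
      by (subst (asm) nn_integral_0_iff_AE) auto
    then have "AE x in lborel. x \<notin> {0<..<r}"
      using m_props(3)
    proof eventually_elim
      case (elim x)
      then show ?case using mu_pos[of x] by (auto simp: indicator_def)
    qed
    then have "{0<..<r} \<in> null_sets lborel" by (subst (asm) AE_iff_null_sets[symmetric]) auto
    then show False using assms by (simp add: null_sets_def)
  qed
  moreover have "(\<integral>\<^sup>+x. ennreal (m x) * indicator {0<..<r} x \<partial>lborel) * (\<integral>\<^sup>+x. ennreal (1 / m x) * indicator {0<..<r} x \<partial>lborel) < \<infinity>"
    using k(2)[of 0 r] assms unfolding 1 2 by (auto intro: le_less_trans)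
  ultimately show ?thesis by (auto simp: ennreal_mult_less_top ennreal_mult_eq_top_iff less_top top.not_eq_extremum)
qed

end

subsection \<open>Traces\<close>

lemma GDERIV_line:
  assumes "GDERIV v (z + t *\<^sub>R e) :> X"
  shows "((\<lambda>t. v (z + t *\<^sub>R e)) has_real_derivative e \<bullet> X) (at t)"
proof -
  have "((\<lambda>t. v (z + t *\<^sub>R e)) has_derivative (\<lambda>h. (h *\<^sub>R e) \<bullet> X)) (at t)"
    by (rule has_derivative_compose[of "\<lambda>t. z + t *\<^sub>R e" "\<lambda>h. h *\<^sub>R e" t UNIV v, OF _ assms[unfolded gderiv_def]])
       (auto intro!: derivative_eq_intros)
  moreover have "(\<lambda>h. (h *\<^sub>R e) \<bullet> X) = (*) (e \<bullet> X)" by (auto simp: mult.commute)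
  ultimately show ?thesis by (simp add: has_field_derivative_def)
qed

lemma tendsto_at_right_0_of_integrable_derivative:
  fixes w h :: "real \<Rightarrow> real"
  assumes w: "\<And>x. 0 < x \<Longrightarrow> (w has_real_derivative h x) (at x)"
    and h: "continuous_on {0<..} h"
    and fin: "(\<integral>\<^sup>+x. ennreal \<bar>h x\<bar> * indicator {0<..<1} x \<partial>lborel) < \<infinity>"
  shows "\<exists>l. (w \<longlongrightarrow> l) (at_right 0)"
proof -
  define k where "k x = indicator {0<..<1} x *\<^sub>R h x" for x :: real
  have [measurable]: "k \<in> borel_measurable borel"
    unfolding k_def[abs_def]
    by (rule borel_measurable_continuous_on_indicator) (auto intro: continuous_on_subset[OF h])
  have k: "integrable lborel k"
  proof (rule integrableI_bounded)
    have "(\<integral>\<^sup>+x. ennreal (norm (k x)) \<partial>lborel) = (\<integral>\<^sup>+x. ennreal \<bar>h x\<bar> * indicator {0<..<1} x \<partial>lborel)"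
      by (rule nn_integral_cong) (auto simp: k_def indicator_def)
    then show "(\<integral>\<^sup>+x. ennreal (norm (k x)) \<partial>lborel) < \<infinity>" using fin by simp
  qed simp
  define l where "l = w (1/2) - (\<integral>x. indicator {0<..1/2} x *\<^sub>R k x \<partial>lborel)"
  have "(w \<longlongrightarrow> l) (at_right 0)"
    unfolding tendsto_at_iff_sequentially
  proof safe
    fix X :: "nat \<Rightarrow> real" assume X: "\<forall>i. X i \<in> {0<..} - {0}" "X \<longlonglongrightarrow> 0"
    have "(\<lambda>n. w (1/2) - (\<integral>x. indicator {X n..1/2} x *\<^sub>R k x \<partial>lborel)) \<longlonglongrightarrow> l"
      unfolding l_def
    proof (intro tendsto_diff tendsto_const integral_dominated_convergence[where w = "\<lambda>x. norm (k x)"])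
      show "AE x in lborel. (\<lambda>n. indicator {X n..1/2} x *\<^sub>R k x) \<longlonglongrightarrow> indicator {0<..1/2} x *\<^sub>R k x"
      proof (rule AE_I2, rule tendsto_eventually)
        fix x :: real
        show "\<forall>\<^sub>F n in sequentially. indicator {X n..1/2} x *\<^sub>R k x = indicator {0<..1/2} x *\<^sub>R k x"
        proof (cases "0 < x")
          case True
          then have "\<forall>\<^sub>F n in sequentially. X n < x" using X(2) order_tendstoD(2) by blast
          then show ?thesis by eventually_elim (use True in \<open>auto simp: indicator_def\<close>)
        qed (auto simp: k_def)
      qed
    qed (use k in \<open>auto simp: indicator_def\<close>)
    moreover have "\<forall>\<^sub>F n in sequentially. w (1/2) - (\<integral>x. indicator {X n..1/2} x *\<^sub>R k x \<partial>lborel) = (w \<circ> X) n"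
    proof -
      have "\<forall>\<^sub>F n in sequentially. X n < 1/2" using X(2) order_tendstoD(2)[of X 0 sequentially "1/2"] by simp
      then show ?thesis
      proof eventually_elim
        case (elim n)
        have Xn: "0 < X n" using X(1) by auto
        have "(\<integral>x. indicator {X n..1/2} x *\<^sub>R h x \<partial>lborel) = w (1/2) - w (X n)"
          by (rule integral_FTC_Icc)
             (use elim Xn w in \<open>auto intro!: continuous_on_subset[OF h] intro: has_vector_derivative_at_within
                simp: has_real_derivative_iff_has_vector_derivative\<close>)
        moreover have "(\<lambda>x. indicator {X n..1/2} x *\<^sub>R h x) = (\<lambda>x. indicator {X n..1/2} x *\<^sub>R k x)"
          using Xn by (auto simp: k_def indicator_def)
        ultimately show ?case by simp
      qed
    qed
    ultimately show "(w \<circ> X) \<longlonglongrightarrow> l" by (rule Lim_transform_eventually)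
  qed
  then show ?thesis by blast
qed

text \<open>A function uniformly close to convergent ones is Cauchy along the filter. This carries
  limits from almost every vertical line to every vertical line.\<close>

lemma tendsto_of_approx:
  fixes w :: "'a \<Rightarrow> real"
  assumes F: "F \<noteq> bot"
    and a: "\<And>\<epsilon>. 0 < \<epsilon> \<Longrightarrow> \<exists>w' l'. (w' \<longlongrightarrow> l') F \<and> (\<forall>\<^sub>F x in F. \<bar>w x - w' x\<bar> \<le> \<epsilon>)"
  shows "\<exists>l. (w \<longlongrightarrow> l) F"
proof -
  have "\<exists>l'. \<forall>\<^sub>F x in F. \<bar>w x - l'\<bar> \<le> 1 / real (Suc n)" for n
  proof -
    obtain w' l' where w': "(w' \<longlongrightarrow> l') F" "\<forall>\<^sub>F x in F. \<bar>w x - w' x\<bar> \<le> 1 / (2 * real (Suc n))"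
      using a[of "1 / (2 * real (Suc n))"] by auto
    have "\<forall>\<^sub>F x in F. dist (w' x) l' < 1 / (2 * real (Suc n))" using w'(1) by (rule tendstoD) simp
    with w'(2) have "\<forall>\<^sub>F x in F. \<bar>w x - l'\<bar> \<le> 1 / real (Suc n)"
    proof eventually_elim
      case (elim x)
      then have "\<bar>w x - l'\<bar> \<le> 1 / (2 * real (Suc n)) + 1 / (2 * real (Suc n))" unfolding dist_real_def by linarith
      also have "\<dots> = 1 / real (Suc n)" by (simp add: field_simps)
      finally show ?case .
    qed
    then show ?thesis by blast
  qed
  then obtain l where l: "\<And>n. \<forall>\<^sub>F x in F. \<bar>w x - l n\<bar> \<le> 1 / real (Suc n)" by metis
  have ll: "\<bar>l n - l k\<bar> \<le> 1 / real (Suc n) + 1 / real (Suc k)" for n k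
  proof -
    have "\<forall>\<^sub>F x in F. \<bar>l n - l k\<bar> \<le> 1 / real (Suc n) + 1 / real (Suc k)"
      using l[of n] l[of k] by eventually_elim linarith
    then show ?thesis using F eventually_happens' by blast
  qed
  have "Cauchy l"
  proof (rule metric_CauchyI)
    fix e :: real assume "0 < e"
    then obtain N where N: "1 / real (Suc N) < e / 2" using nat_approx_posE[of "e/2"] by auto
    have "1 / real (Suc k) < e / 2" if "k \<ge> N" for k
      by (rule le_less_trans[OF _ N]) (use that in \<open>auto simp: divide_simps\<close>)
    then show "\<exists>M. \<forall>m\<ge>M. \<forall>n\<ge>M. dist (l m) (l n) < e"
      using ll unfolding dist_real_def by (intro exI[of _ N]) (smt (verit) field_sum_of_halves)
  qed
  then obtain L where L: "l \<longlonglongrightarrow> L" using convergent_eq_Cauchy by blast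
  have "(w \<longlongrightarrow> L) F"
  proof (rule tendstoI)
    fix e :: real assume e: "0 < e"
    obtain N where N: "1 / real (Suc N) < e / 2" using nat_approx_posE[of "e/2"] e by auto
    obtain N' where N': "\<And>n. n \<ge> N' \<Longrightarrow> \<bar>l n - L\<bar> < e / 2" using LIMSEQ_D[OF L, of "e/2"] e by auto
    define n where "n = max N N'"
    have n1: "1 / real (Suc n) < e / 2"
      by (rule le_less_trans[OF _ N]) (auto simp: n_def divide_simps)
    show "\<forall>\<^sub>F x in F. dist (w x) L < e"
      using l[of n]
    proof eventually_elim
      case (elim x)
      then show ?case using n1 N'[of n] unfolding dist_real_def n_def by linarith
    qed
  qed
  then show ?thesis by blast
qed

text \<open>Without a derivative the choice in \<open>deriv\<close> is made from the empty
  predicate, hence always yields the same number. So the potential \<open>c\<close> stays bounded in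
  spite of its default values.\<close>

lemma deriv_of_not_differentiable:
  fixes f :: "real \<Rightarrow> real"
  assumes "\<not> (\<exists>D. (f has_real_derivative D) (at t))"
  shows "deriv f t = (SOME D. False)"
  using assms by (simp add: deriv_def)

context stable_layer
begin

definition uB :: real where "uB = (SOME B. B > 0 \<and> (\<forall>z\<in>half_space. \<bar>u z\<bar> \<le> B))"

lemma uB: "uB > 0" "z \<in> half_space \<Longrightarrow> \<bar>u z\<bar> \<le> uB"
proof -
  obtain B where "B > 0" "\<forall>z\<in>half_space. \<bar>u z\<bar> \<le> B"
    using u_bounded by (auto simp: bounded_pos)
  then have "\<exists>B. B > 0 \<and> (\<forall>z\<in>half_space. \<bar>u z\<bar> \<le> B)" by blast
  from someI_ex[OF this] show "uB > 0" "z \<in> half_space \<Longrightarrow> \<bar>u z\<bar> \<le> uB" unfolding uB_def by auto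
qed

lemma grad_y_bound: assumes "0 < r" shows "\<exists>C\<ge>0. \<forall>z\<in>half_ball r. norm (fst (G z)) \<le> C"
proof -
  obtain C where C: "AE z in lebesgue. z \<in> closure (half_ball r) \<longrightarrow> norm (fst (grad u z)) \<le> C"
    using grad_y_Linfty assms unfolding Linfty_on_def by blast
  have ae: "AE z in lebesgue. z \<in> half_ball r \<longrightarrow> norm (fst (G z)) \<le> \<bar>C\<bar>"
    using C
  proof eventually_elim
    case (elim z)
    then show ?case using closure_subset[of "half_ball r"] grad_u[of z] by (auto simp: half_ball_def)
  qed
  have "open (half_ball r)" "continuous_on (half_ball r) (\<lambda>z. norm (fst (G z)))"
    unfolding half_ball_def using open_half_space G_continuous
    by (auto intro!: continuous_intros elim: continuous_on_subset)
  from AE_bound_imp_bound[OF this ae] show ?thesis by (intro exI[of _ "\<bar>C\<bar>"]) auto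
qed

lemma convex_half_ball: "convex (half_ball r)"
  unfolding half_ball_def by (intro convex_Int convex_half_space convex_ball)

lemma u_diff_y:
  assumes C: "\<And>z. z \<in> half_ball r \<Longrightarrow> norm (fst (G z)) \<le> C" and z: "z \<in> half_ball r" "z + (d, 0) \<in> half_ball r"
  shows "\<bar>u (z + (d, 0)) - u z\<bar> \<le> C * norm d"
proof -
  have seg: "z + t *\<^sub>R (d, 0) \<in> half_ball r" if "0 \<le> t" "t \<le> 1" for t
  proof -
    have "(1 - t) *\<^sub>R z + t *\<^sub>R (z + (d, 0)) \<in> half_ball r"
      using convexD_alt[OF convex_half_ball z that] .
    then show ?thesis by (simp add: algebra_simps)
  qed
  then have "((\<lambda>t. u (z + t *\<^sub>R (d, 0))) has_real_derivative (d, 0) \<bullet> G (z + t *\<^sub>R (d, 0))) (at t)" if "0 \<le> t" "t \<le> 1" for t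
    using that by (intro GDERIV_line G) (auto simp: half_ball_def)
  from MVT2[of 0 1, OF _ this] obtain t where t: "0 < t" "t < 1"
    "u (z + 1 *\<^sub>R (d, 0)) - u (z + 0 *\<^sub>R (d, 0)) = (1 - 0) * ((d, 0) \<bullet> G (z + t *\<^sub>R (d, 0)))" by auto
  have "\<bar>u (z + (d, 0)) - u z\<bar> = \<bar>d \<bullet> fst (G (z + t *\<^sub>R (d, 0)))\<bar>" using t(3) by (simp add: inner_prod_def flip: zero_prod_def)
  also have "\<dots> \<le> norm d * norm (fst (G (z + t *\<^sub>R (d, 0))))" by (rule Cauchy_Schwarz_ineq2)
  also have "\<dots> \<le> norm d * C" using C[OF seg[of t]] t by (intro mult_left_mono) auto
  finally show ?thesis by (simp add: mult.commute)
qed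

text \<open>The norm of the gradient is at most the weight times its square plus the reciprocal of
  the weight, and both are integrable on bounded cylinders. By Tonelli the vertical derivative is
  integrable near \<open>x = 0\<close> on almost every vertical line, where \<open>v\<close>
  therefore has a limit.\<close>

lemma trace_exists_AE:
  assumes v: "\<And>z. z \<in> half_space \<Longrightarrow> GDERIV v z :> X z" and X: "continuous_on half_space X"
    and int: "\<And>R. 0 < R \<Longrightarrow> integrable HM (\<lambda>z. \<mu> (snd z) * (norm (X z))\<^sup>2 * indicator (ball 0 R) z)"
  shows "AE y in lebesgue. \<exists>l. ((\<lambda>x. v (y, x)) \<longlongrightarrow> l) (at_right 0)"
proof -
  define Y where "Y z = indicator half_space z *\<^sub>R X z" for z
  have Y[measurable]: "Y \<in> borel_measurable borel"
    unfolding Y_def[abs_def] by (rule borel_measurable_continuous_on_indicator) (use X in auto)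
  have box: "AE y in lborel. y \<in> ball 0 (real n) \<longrightarrow> (\<integral>\<^sup>+x. ennreal (norm (Y (y, x))) * indicator {0<..<1} x \<partial>lborel) < \<infinity>" for n
  proof -
    define D :: "(real^2) set" where "D = ball 0 (real n)"
    have [measurable]: "D \<in> sets borel" by (simp add: D_def)
    define I where "I = (\<integral>\<^sup>+z. ennreal (norm (Y z)) * (indicator D (fst z) * indicator {0<..<1} (snd z)) \<partial>lborel)"
    \<comment> \<open>A ball of radius \<open>n + 2\<close> contains the cylinder of height 1 over
      the disc of radius \<open>n\<close>.\<close>
    have R: "0 < real n + 2" by simp
    have "I \<le> (\<integral>\<^sup>+z. ennreal (\<mu> (snd z) * (norm (X z))\<^sup>2 * indicator (ball 0 (real n + 2)) z) * indicator half_space z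
        + indicator (ball 0 (real n)) (fst z) * (ennreal (1 / m (snd z)) * indicator {0<..<1} (snd z)) \<partial>lborel)"
      unfolding I_def
    proof (rule nn_integral_mono_AE, rule AE_mp[OF AE_mu_m], rule AE_I2, rule impI)
      fix z :: point assume mu: "z \<in> half_space \<longrightarrow> \<mu> (snd z) = m (snd z)"
      show "ennreal (norm (Y z)) * (indicator D (fst z) * indicator {0<..<1} (snd z)) \<le>
          ennreal (\<mu> (snd z) * (norm (X z))\<^sup>2 * indicator (ball 0 (real n + 2)) z) * indicator half_space z
        + indicator (ball 0 (real n)) (fst z) * (ennreal (1 / m (snd z)) * indicator {0<..<1} (snd z))"
      proof (cases "fst z \<in> D \<and> snd z \<in> {0<..<1}")
        case True
        then have z: "z \<in> half_space" by (simp add: half_space_def)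
        have "norm z \<le> norm (fst z) + norm (snd z)" by (metis norm_Pair_le prod.collapse)
        then have zb: "z \<in> ball 0 (real n + 2)" using True by (auto simp: D_def)
        have m0: "0 < m (snd z)" using mu z mu_pos[of "snd z"] by (auto simp: half_space_def)
        have "norm (X z) \<le> m (snd z) * (norm (X z))\<^sup>2 + 1 / m (snd z)"
        proof -
          \<comment> \<open>Reads \<open>p\<^sup>2 - p + 1 \<ge> 0\<close> for
            \<open>p = m (snd z) * norm (X z)\<close>; division by the weight follows.\<close>
          have "0 \<le> (m (snd z) * norm (X z) - 1)\<^sup>2 + m (snd z) * norm (X z)" using m0 by simp
          then have "m (snd z) * norm (X z) \<le> (m (snd z) * norm (X z))\<^sup>2 + 1" by (simp add: power2_diff mult.commute)
          then have "m (snd z) * norm (X z) / m (snd z) \<le> ((m (snd z) * norm (X z))\<^sup>2 + 1) / m (snd z)"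
            using m0 by (intro divide_right_mono) auto
          then show ?thesis using m0 by (simp add: power2_eq_square add_divide_distrib mult_ac)
        qed
        then have "ennreal (norm (X z)) \<le> ennreal (m (snd z) * (norm (X z))\<^sup>2) + ennreal (1 / m (snd z))"
          using m0 by (subst ennreal_plus[symmetric]) (auto simp del: ennreal_plus)
        then show ?thesis using True z zb mu by (simp add: Y_def D_def)
      qed (auto simp: indicator_def)
    qed
    also have "\<dots> = (\<integral>\<^sup>+z. ennreal (\<mu> (snd z) * (norm (X z))\<^sup>2 * indicator (ball 0 (real n + 2)) z) * indicator half_space z \<partial>lebesgue)
        + (\<integral>\<^sup>+z. indicator (ball 0 (real n)) (fst z) * (ennreal (1 / m (snd z)) * indicator {0<..<1} (snd z)) \<partial>(lborel :: point measure))"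
    proof -
      have m1: "(\<lambda>z. ennreal (\<mu> (snd z) * (norm (X z))\<^sup>2 * indicator (ball 0 (real n + 2)) z) * indicator half_space z) \<in> borel_measurable lebesgue"
      proof -
        have "(\<lambda>z. indicator half_space z *\<^sub>R (\<mu> (snd z) * (norm (X z))\<^sup>2 * indicator (ball 0 (real n + 2)) z)) \<in> borel_measurable lebesgue"
          using int[OF R] unfolding HM_measurable_iff[symmetric] by (rule borel_measurable_integrable)
        then have "(\<lambda>z. ennreal (indicator half_space z *\<^sub>R (\<mu> (snd z) * (norm (X z))\<^sup>2 * indicator (ball 0 (real n + 2)) z))) \<in> borel_measurable lebesgue"
          by measurable
        then show ?thesis by (rule measurable_cong[THEN iffD1, rotated]) (auto simp: indicator_def)
      qed
      have m2: "(\<lambda>z::point. indicator (ball 0 (real n)) (fst z) * (ennreal (1 / m (snd z)) * indicator {0<..<1} (snd z))) \<in> borel_measurable lebesgue"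
      proof (rule measurable_completion, rule borel_measurable_times_ennreal)
        have "fst \<in> (lborel :: point measure) \<rightarrow>\<^sub>M (borel :: (real^2) measure)" "snd \<in> (lborel :: point measure) \<rightarrow>\<^sub>M borel"
          using point_borel by auto
        note * = this
        show "(\<lambda>z::point. indicator (ball 0 (real n)) (fst z) :: ennreal) \<in> borel_measurable lborel"
          by (rule measurable_compose[OF *(1)]) (rule borel_measurable_indicator, simp)
        show "(\<lambda>z::point. ennreal (1 / m (snd z)) * indicator {0<..<1} (snd z)) \<in> borel_measurable lborel"
          by (rule measurable_compose[OF *(2)]) measurable
      qed
      show ?thesis using nn_integral_add[OF m1 m2] by (simp add: nn_integral_completion)
    qed
    also have "\<dots> < \<infinity>"
    proof -
      have "(\<integral>\<^sup>+z. ennreal (\<mu> (snd z) * (norm (X z))\<^sup>2 * indicator (ball 0 (real n + 2)) z) * indicator half_space z \<partial>lebesgue) =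
         (\<integral>\<^sup>+z. ennreal (\<mu> (snd z) * (norm (X z))\<^sup>2 * indicator (ball 0 (real n + 2)) z) \<partial>HM)"
        by (simp add: HM_nn_integral nn_integral_completion)
      also have "\<dots> < \<infinity>"
        using integrableD(2)[OF int[OF R]] by (simp add: less_top)
      finally show ?thesis
        using nn_inv_mu[of 1] emeasure_disc[of "real n"]
        by (subst nn_cylinder) (auto simp: ennreal_mult_less_top)
    qed
    finally have "I < \<infinity>" .
    moreover have "I = (\<integral>\<^sup>+y. (\<integral>\<^sup>+x. ennreal (norm (Y (y, x))) * (indicator D y * indicator {0<..<1} x) \<partial>lborel) \<partial>lborel)"
      unfolding I_def lborel_prod[symmetric] by (subst lborel.nn_integral_fst[symmetric]) (simp_all add: lborel_prod)
    ultimately have fin: "(\<integral>\<^sup>+y. (\<integral>\<^sup>+x. ennreal (norm (Y (y, x))) * (indicator D y * indicator {0<..<1} x) \<partial>lborel) \<partial>lborel) \<noteq> \<infinity>" by simp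
    have "(\<lambda>y. \<integral>\<^sup>+x. ennreal (norm (Y (y, x))) * (indicator D y * indicator {0<..<1} x) \<partial>lborel) \<in> borel_measurable lborel"
      by (rule lborel.borel_measurable_nn_integral) (simp add: split_def lborel_prod)
    from nn_integral_noteq_infinite[OF this fin] show ?thesis
    proof eventually_elim
      case (elim y)
      then show ?case by (auto simp: D_def less_top top.not_eq_extremum)
    qed
  qed
  have "AE y in lborel. \<forall>n. y \<in> ball 0 (real n) \<longrightarrow> (\<integral>\<^sup>+x. ennreal (norm (Y (y, x))) * indicator {0<..<1} x \<partial>lborel) < \<infinity>"
    unfolding AE_all_countable using box by blast
  then have "AE y in lborel. \<exists>l. ((\<lambda>x. v (y, x)) \<longlongrightarrow> l) (at_right 0)"
  proof eventually_elim
    case (elim y)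
    obtain n where "norm y < real n" using reals_Archimedean2 by blast
    then have fin: "(\<integral>\<^sup>+x. ennreal (norm (Y (y, x))) * indicator {0<..<1} x \<partial>lborel) < \<infinity>" by (intro elim[rule_format]) simp
    show ?case
    proof (rule tendsto_at_right_0_of_integrable_derivative)
      show "((\<lambda>x. v (y, x)) has_real_derivative snd (X (y, x))) (at x)" if "0 < x" for x
        using GDERIV_line[of v "(y, 0)" x "(0, 1)" "X (y, x)"] v[of "(y, x)"] that by (simp add: inner_prod_def)
      show "continuous_on {0<..} (\<lambda>x. snd (X (y, x)))"
        by (intro continuous_on_snd continuous_on_compose2[OF X]) (auto intro!: continuous_intros)
      show "(\<integral>\<^sup>+x. ennreal \<bar>snd (X (y, x))\<bar> * indicator {0<..<1} x \<partial>lborel) < \<infinity>"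
      proof (rule le_less_trans[OF nn_integral_mono fin])
        fix x :: real
        show "ennreal \<bar>snd (X (y, x))\<bar> * indicator {0<..<1} x \<le> ennreal (norm (Y (y, x))) * indicator {0<..<1} x"
          using norm_snd_le[of "snd (X (y, x))" "fst (X (y, x))"] by (auto simp: Y_def indicator_def intro!: ennreal_leI)
      qed
    qed
  qed
  then show ?thesis by (rule AE_completion)
qed

end

subsection \<open>Test functions\<close>

lemma AE_ex_ball:
  fixes y :: "'a::euclidean_space"
  assumes "AE z in lebesgue. P z" "0 < \<delta>"
  obtains z where "z \<in> ball y \<delta>" "P z"
proof -
  have "\<exists>z\<in>ball y \<delta>. P z"
  proof (rule ccontr)
    assume "\<not> ?thesis"
    then have "AE z in lebesgue. z \<notin> ball y \<delta>" using assms(1) by (auto elim!: eventually_mono)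
    then have "negligible (ball y \<delta>)" by (simp add: negligible_iff_null_sets AE_iff_null_sets)
    then show False using open_not_negligible[of "ball y \<delta>"] assms(2) by auto
  qed
  then show thesis using that by blast
qed

lemma eventually_at_right_0_1: "\<forall>\<^sub>F x in at_right (0::real). 0 < x \<and> x < 1"
  unfolding eventually_at_right_field by (intro exI[of _ 1]) auto

lemma norm_point_less: "norm y < r - 1 \<Longrightarrow> 0 < x \<Longrightarrow> x < 1 \<Longrightarrow> (y, x) \<in> half_ball r"
  using norm_Pair_le[of y x] by (auto simp: half_ball_def)

context stable_layer
begin

lemma integrable_mu_G: assumes "0 < R"
  shows "integrable HM (\<lambda>z. \<mu> (snd z) * (norm (G z))\<^sup>2 * indicator (ball 0 R) z)"
proof -
  have "set_integrable lebesgue (half_ball R) (\<lambda>z. \<mu> (snd z) * (norm (grad u z))\<^sup>2)"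
    using weak assms by (simp add: weak_solution_def)
  moreover have "(\<lambda>z. indicator (half_ball R) z *\<^sub>R (\<mu> (snd z) * (norm (grad u z))\<^sup>2))
    = (\<lambda>z. indicator (half_ball R) z *\<^sub>R (\<mu> (snd z) * (norm (G z))\<^sup>2 * indicator (ball 0 R) z))"
    using grad_u by (auto simp: half_ball_def indicator_def)
  ultimately have "set_integrable lebesgue (half_ball R) (\<lambda>z. \<mu> (snd z) * (norm (G z))\<^sup>2 * indicator (ball 0 R) z)"
    unfolding set_integrable_def by (simp only:)
  then show ?thesis
    using HM_set_ball(1)[of R "\<lambda>z. \<mu> (snd z) * (norm (G z))\<^sup>2 * indicator (ball 0 R) z"] by simp
qed

definition U :: "real^2 \<Rightarrow> real" where "U = trace0 u"

text \<open>The weighted energy gives the limit for almost every \<open>y\<close> only. The bound on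
  the horizontal gradient makes \<open>u\<close> on neighbouring vertical lines uniformly close,
  which yields the limit for every \<open>y\<close> and makes \<open>U\<close> a continuous
  function.\<close>

lemma U_lim: "((\<lambda>x. u (y, x)) \<longlongrightarrow> U y) (at_right 0)"
proof -
  have ae: "AE y in lebesgue. \<exists>l. ((\<lambda>x. u (y, x)) \<longlongrightarrow> l) (at_right 0)"
    using trace_exists_AE[OF G G_continuous integrable_mu_G] .
  \<comment> \<open>Leaves room for a base point moved by at most 1 and for heights below 1.\<close>
  define r where "r = norm y + 3"
  have "0 < r" using norm_ge_zero[of y] unfolding r_def by linarith
  then obtain C where C: "C \<ge> 0" "\<And>z. z \<in> half_ball r \<Longrightarrow> norm (fst (G z)) \<le> C" using grad_y_bound by blast
  have "\<exists>l. ((\<lambda>x. u (y, x)) \<longlongrightarrow> l) (at_right 0)"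
  proof (rule tendsto_of_approx)
    fix \<epsilon> :: real assume e: "0 < \<epsilon>"
    define \<delta> where "\<delta> = min 1 (\<epsilon> / (C + 1))"
    have d: "0 < \<delta>" using e C by (simp add: \<delta>_def)
    obtain y' l' where y': "y' \<in> ball y \<delta>" "((\<lambda>x. u (y', x)) \<longlongrightarrow> l') (at_right 0)"
      using AE_ex_ball[OF ae d, of y] by blast
    have yn: "norm (y - y') < \<delta>" using y' by (simp add: dist_norm)
    then have yr: "norm y' < r - 1" using norm_triangle_ineq2[of y' y] by (auto simp: r_def \<delta>_def norm_minus_commute)
    have "\<forall>\<^sub>F x in at_right 0. \<bar>u (y, x) - u (y', x)\<bar> \<le> \<epsilon>"
      using eventually_at_right_0_1
    proof eventually_elim
      case (elim x)
      have "\<bar>u ((y', x) + (y - y', 0)) - u (y', x)\<bar> \<le> C * norm (y - y')"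
        using norm_point_less[OF yr, of x] norm_point_less[of y r x] elim
        by (intro u_diff_y[of r C]) (auto simp: C r_def)
      also have "\<dots> \<le> C * (\<epsilon> / (C + 1))" using yn C by (intro mult_left_mono) (auto simp: \<delta>_def)
      also have "\<dots> \<le> \<epsilon>" using e C by (simp add: field_simps)
      finally show ?case by simp
    qed
    then show "\<exists>w' l'. (w' \<longlongrightarrow> l') (at_right 0) \<and> (\<forall>\<^sub>F x in at_right 0. \<bar>u (y, x) - w' x\<bar> \<le> \<epsilon>)"
      using y'(2) by blast
  qed (simp add: trivial_limit_at_right_real)
  then show ?thesis using trace0_eqI unfolding U_def by blast
qed

lemma U_bound: "\<bar>U y\<bar> \<le> uB"
proof (rule tendsto_upperbound)
  show "((\<lambda>x. \<bar>u (y, x)\<bar>) \<longlongrightarrow> \<bar>U y\<bar>) (at_right 0)" by (intro tendsto_rabs U_lim)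
  show "\<forall>\<^sub>F x in at_right 0. \<bar>u (y, x)\<bar> \<le> uB"
    using eventually_at_right_0_1 by eventually_elim (rule uB, simp)
qed (simp add: trivial_limit_at_right_real)

lemma U_diff:
  assumes C: "\<And>z. z \<in> half_ball r \<Longrightarrow> norm (fst (G z)) \<le> C" and y: "norm y < r - 1" "norm (y + d) < r - 1"
  shows "\<bar>U (y + d) - U y\<bar> \<le> C * norm d"
proof (rule tendsto_upperbound)
  show "((\<lambda>x. \<bar>u (y + d, x) - u (y, x)\<bar>) \<longlongrightarrow> \<bar>U (y + d) - U y\<bar>) (at_right 0)" by (intro tendsto_intros U_lim)
  show "\<forall>\<^sub>F x in at_right 0. \<bar>u (y + d, x) - u (y, x)\<bar> \<le> C * norm d"
    using eventually_at_right_0_1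
  proof eventually_elim
    case (elim x)
    then show ?case using u_diff_y[of r C "(y, x)" d] C norm_point_less[OF y(1)] norm_point_less[OF y(2)] by simp
  qed
qed (simp add: trivial_limit_at_right_real)

lemma U_continuous: "continuous_on UNIV U"
proof (rule continuous_at_imp_continuous_on, safe)
  fix y :: "real^2"
  define r where "r = norm y + 3"
  have "0 < r" using norm_ge_zero[of y] unfolding r_def by linarith
  then obtain C where C: "C \<ge> 0" "\<And>z. z \<in> half_ball r \<Longrightarrow> norm (fst (G z)) \<le> C" using grad_y_bound by blast
  have "C-lipschitz_on (ball y 1) U"
  proof (rule lipschitz_onI)
    fix a b assume ab: "a \<in> ball y 1" "b \<in> ball y 1"
    have "norm a < r - 1" "norm b < r - 1"
      using ab norm_triangle_ineq2[of a y] norm_triangle_ineq2[of b y] by (auto simp: r_def dist_norm norm_minus_commute)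
    then show "dist (U a) (U b) \<le> C * dist a b"
      using U_diff[of r C b "a - b"] C by (simp add: dist_norm)
  qed (rule C)
  then have "continuous_on (ball y 1) U" by (rule lipschitz_on_continuous_on)
  then show "isCont U y" by (simp add: continuous_on_eq_continuous_at)
qed

lemma f_continuous: "continuous_on UNIV f" by (rule locally_lipschitz_on_imp_continuous_on[OF f_lip])

text \<open>An admissible function bundled with a measurable representative \<open>X\<close> of its
  gradient and with its trace \<open>T\<close>. Both are required almost everywhere only:
  \<open>w\<close> times a cutoff may lack a gradient on a null set, and its trace is known for
  almost every \<open>y\<close>.\<close>

definition test :: "real \<Rightarrow> (point \<Rightarrow> real) \<Rightarrow> (point \<Rightarrow> point) \<Rightarrow> (real^2 \<Rightarrow> real) \<Rightarrow> bool" where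
  "test R \<xi> X T \<longleftrightarrow> 0 < R \<and> bounded (\<xi> ` half_space) \<and> locally_lipschitz_on half_space \<xi> \<and>
     (\<forall>z\<in>half_space. z \<notin> ball 0 R \<longrightarrow> \<xi> z = 0 \<and> X z = 0) \<and> X \<in> borel_measurable HM \<and>
     (AE z in HM. GDERIV \<xi> z :> X z) \<and> integrable HM (\<lambda>z. \<mu> (snd z) * (norm (X z))\<^sup>2) \<and>
     (AE y in lebesgue. ((\<lambda>x. \<xi> (y, x)) \<longlongrightarrow> T y) (at_right 0))"

lemma test_grad: "test R \<xi> X T \<Longrightarrow> AE z in lebesgue. z \<in> half_space \<longrightarrow> grad \<xi> z = X z"
  unfolding test_def AE_HM_iff by (auto elim!: eventually_mono intro: grad_eqI)

lemma test_trace: "test R \<xi> X T \<Longrightarrow> AE y in lebesgue. trace0 \<xi> y = T y"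
  unfolding test_def by (auto elim!: eventually_mono intro: trace0_eqI)

text \<open>Completeness of \<open>lebesgue\<close> transports measurability along equality almost
  everywhere, in both directions.\<close>

lemma integrable_cong_AE_complete:
  fixes F F' :: "'a::euclidean_space \<Rightarrow> real"
  assumes "AE z in lebesgue. F z = F' z"
  shows "integrable lebesgue F \<longleftrightarrow> integrable lebesgue F'" "(\<integral>z. F z \<partial>lebesgue) = (\<integral>z. F' z \<partial>lebesgue)"
proof -
  have s: "AE z in lebesgue. F' z = F z" using assms by eventually_elim simp
  have m: "F \<in> borel_measurable lebesgue \<longleftrightarrow> F' \<in> borel_measurable lebesgue"
    using borel_measurable_AE[OF _ assms] borel_measurable_AE[OF _ s] by blast
  show i: "integrable lebesgue F \<longleftrightarrow> integrable lebesgue F'"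
    using integrable_cong_AE[OF _ _ assms] m borel_measurable_integrable by blast
  show "(\<integral>z. F z \<partial>lebesgue) = (\<integral>z. F' z \<partial>lebesgue)"
  proof (cases "integrable lebesgue F")
    case True
    then show ?thesis using integral_cong_AE[OF _ _ assms] m borel_measurable_integrable by blast
  next
    case False
    then show ?thesis using i by (simp add: not_integrable_integral_eq)
  qed
qed

lemma test_admissible: assumes t: "test R \<xi> X T" shows "admissible \<mu> R \<xi>"
  unfolding admissible_def
proof (intro conjI)
  have "integrable HM (\<lambda>z. \<mu> (snd z) * (norm (X z))\<^sup>2)" using t by (simp add: test_def)
  then have 1: "integrable lebesgue (\<lambda>z. indicator (half_ball R) z *\<^sub>R (\<mu> (snd z) * (norm (X z))\<^sup>2))"
    using HM_set_ball(1)[of R "\<lambda>z. \<mu> (snd z) * (norm (X z))\<^sup>2"] t by (simp add: test_def set_integrable_def)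
  have "AE z in lebesgue. indicator (half_ball R) z *\<^sub>R (\<mu> (snd z) * (norm (grad \<xi> z))\<^sup>2)
    = indicator (half_ball R) z *\<^sub>R (\<mu> (snd z) * (norm (X z))\<^sup>2)"
    using test_grad[OF t] by eventually_elim (auto simp: indicator_def half_ball_def)
  from integrable_cong_AE_complete(1)[OF this] 1
  show "set_integrable lebesgue (half_ball R) (\<lambda>z. \<mu> (snd z) * (norm (grad \<xi> z))\<^sup>2)"
    by (simp add: set_integrable_def)
qed (use t in \<open>auto simp: test_def\<close>)

lemma weak_test:
  assumes t: "test R \<xi> X T"
  shows "integrable HM (\<lambda>z. \<mu> (snd z) * (G z \<bullet> X z))" "integrable HM (\<lambda>z. g (snd z) (u z) * \<xi> z)"
    "integrable lebesgue (\<lambda>y. f (U y) * T y)"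
    "(\<integral>z. \<mu> (snd z) * (G z \<bullet> X z) \<partial>HM) + (\<integral>z. g (snd z) (u z) * \<xi> z \<partial>HM) = (\<integral>y. f (U y) * T y \<partial>lebesgue)"
proof -
  have w: "set_integrable lebesgue half_space (\<lambda>z. \<mu> (snd z) * (grad u z \<bullet> grad \<xi> z))"
    "set_integrable lebesgue half_space (\<lambda>z. g (snd z) (u z) * \<xi> z)"
    "integrable lebesgue (\<lambda>y. f (trace0 u y) * trace0 \<xi> y)"
    "(LINT z:half_space|lebesgue. \<mu> (snd z) * (grad u z \<bullet> grad \<xi> z)) +
        (LINT z:half_space|lebesgue. g (snd z) (u z) * \<xi> z) =
        (LINT y|lebesgue. f (trace0 u y) * trace0 \<xi> y)"
    using weak test_admissible[OF t] unfolding weak_solution_def by blast+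
  have "AE z in lebesgue. indicator half_space z *\<^sub>R (\<mu> (snd z) * (grad u z \<bullet> grad \<xi> z))
    = indicator half_space z *\<^sub>R (\<mu> (snd z) * (G z \<bullet> X z))"
    using test_grad[OF t] by eventually_elim (auto simp: indicator_def grad_u)
  note 1 = integrable_cong_AE_complete[OF this]
  have "AE y in lebesgue. f (trace0 u y) * trace0 \<xi> y = f (U y) * T y"
    using test_trace[OF t] by eventually_elim (simp add: U_def)
  note 2 = integrable_cong_AE_complete[OF this]
  show "integrable HM (\<lambda>z. \<mu> (snd z) * (G z \<bullet> X z))" "integrable HM (\<lambda>z. g (snd z) (u z) * \<xi> z)"
    "integrable lebesgue (\<lambda>y. f (U y) * T y)"
    "(\<integral>z. \<mu> (snd z) * (G z \<bullet> X z) \<partial>HM) + (\<integral>z. g (snd z) (u z) * \<xi> z \<partial>HM) = (\<integral>y. f (U y) * T y \<partial>lebesgue)"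
    using w 1 2 unfolding HM_integrable_iff HM_integral_eq set_integrable_def set_lebesgue_integral_def by simp_all
qed

abbreviation c :: "point \<Rightarrow> real" where "c z \<equiv> deriv (g (snd z)) (u z)"

lemma stable_test:
  assumes t: "test R \<xi> X T"
  shows "integrable HM (\<lambda>z. c z * (\<xi> z)\<^sup>2)" "integrable lebesgue (\<lambda>y. deriv f (U y) * (T y)\<^sup>2)"
    "0 \<le> (\<integral>z. \<mu> (snd z) * (norm (X z))\<^sup>2 \<partial>HM) + (\<integral>z. c z * (\<xi> z)\<^sup>2 \<partial>HM) - (\<integral>y. deriv f (U y) * (T y)\<^sup>2 \<partial>lebesgue)"
proof -
  have s: "set_integrable lebesgue (half_ball R) (\<lambda>z. c z * (\<xi> z)\<^sup>2)"
     "set_integrable lebesgue (boundary_disc R) (\<lambda>y. deriv f (trace0 u y) * (trace0 \<xi> y)\<^sup>2)"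
     "0 \<le> (LINT z:half_ball R|lebesgue. \<mu> (snd z) * (norm (grad \<xi> z))\<^sup>2) +
        (LINT z:half_ball R|lebesgue. c z * (\<xi> z)\<^sup>2) -
        (LINT y:boundary_disc R|lebesgue. deriv f (trace0 u y) * (trace0 \<xi> y)\<^sup>2)"
    using stable test_admissible[OF t] unfolding stable_solution_def by blast+
  have z: "\<And>z. z \<in> half_space \<Longrightarrow> z \<notin> ball 0 R \<Longrightarrow> c z * (\<xi> z)\<^sup>2 = 0"
    "\<And>z. z \<in> half_space \<Longrightarrow> z \<notin> ball 0 R \<Longrightarrow> \<mu> (snd z) * (norm (X z))\<^sup>2 = 0"
    using t by (auto simp: test_def)
  show "integrable HM (\<lambda>z. c z * (\<xi> z)\<^sup>2)" using s(1) HM_set_ball(1)[OF z(1)] by simp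
  have "AE z in lebesgue. indicator (half_ball R) z *\<^sub>R (\<mu> (snd z) * (norm (grad \<xi> z))\<^sup>2)
    = indicator (half_ball R) z *\<^sub>R (\<mu> (snd z) * (norm (X z))\<^sup>2)"
    using test_grad[OF t] by eventually_elim (auto simp: indicator_def half_ball_def)
  note 1 = integrable_cong_AE_complete[OF this]
  have "AE y in lebesgue. indicator (boundary_disc R) y *\<^sub>R (deriv f (trace0 u y) * (trace0 \<xi> y)\<^sup>2) = deriv f (U y) * (T y)\<^sup>2"
    using test_trace[OF t]
  proof eventually_elim
    case (elim y)
    show ?case
    proof (cases "y \<in> boundary_disc R")
      \<comment> \<open>Moving up from a point of the boundary plane increases the norm, so over a
        point outside the disc \<open>\<xi>\<close> vanishes on the whole vertical line.\<close>
      case False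
      have "\<xi> (y, x) = 0" if "0 < x" for x
      proof -
        have "norm (y, 0::real) \<le> norm (y, x)" by (simp add: norm_Pair)
        then show ?thesis using t False that by (auto simp: test_def boundary_disc_def)
      qed
      then have "trace0 \<xi> y = 0"
        by (intro trace0_eqI tendsto_eventually) (use eventually_at_right_0_1 in \<open>auto elim!: eventually_mono\<close>)
      then show ?thesis using elim by simp
    qed (use elim in \<open>simp add: U_def\<close>)
  qed
  note 2 = integrable_cong_AE_complete[OF this]
  show "integrable lebesgue (\<lambda>y. deriv f (U y) * (T y)\<^sup>2)" using s(2) 2(1) by (simp add: set_integrable_def)
  show "0 \<le> (\<integral>z. \<mu> (snd z) * (norm (X z))\<^sup>2 \<partial>HM) + (\<integral>z. c z * (\<xi> z)\<^sup>2 \<partial>HM) - (\<integral>y. deriv f (U y) * (T y)\<^sup>2 \<partial>lebesgue)"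
    using s(3) 1(2) 2(2) HM_set_ball(2)[OF z(1)] HM_set_ball(2)[OF z(2)] by (simp add: set_lebesgue_integral_def)
qed

lemma test_C1:
  assumes "0 < R" and X: "\<And>z. z \<in> half_space \<Longrightarrow> GDERIV \<xi> z :> X z" "continuous_on half_space X"
    and "\<And>z. z \<in> half_space \<Longrightarrow> \<bar>\<xi> z\<bar> \<le> K"
    and "\<And>z. z \<in> half_space \<Longrightarrow> z \<notin> ball 0 R \<Longrightarrow> \<xi> z = 0 \<and> X z = 0"
    and "integrable HM (\<lambda>z. \<mu> (snd z) * (norm (X z))\<^sup>2)"
    and "AE y in lebesgue. ((\<lambda>x. \<xi> (y, x)) \<longlongrightarrow> T y) (at_right 0)"
  shows "test R \<xi> X T"
  unfolding test_def
proof (intro conjI)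
  show "bounded (\<xi> ` half_space)" 
  proof (rule boundedI[where B = K])
    fix r assume "r \<in> \<xi> ` half_space"
    then show "norm r \<le> K" using assms(4) by (elim imageE) simp
  qed
  show "locally_lipschitz_on half_space \<xi>" using locally_lipschitz_on_GDERIV[OF open_half_space X] .
qed (use assms HM_measurable_continuous[OF X(2)] in \<open>auto simp: AE_HM_iff\<close>)

lemma test_shift:
  assumes t: "test R \<xi> X T"
  shows "test (R + norm d) (\<lambda>z. \<xi> (z + (d, 0))) (\<lambda>z. X (z + (d, 0))) (\<lambda>y. T (y + d))"
  unfolding test_def
proof (intro conjI)
  show "0 < R + norm d" using t norm_ge_zero[of d] unfolding test_def by linarith
  show "bounded ((\<lambda>z. \<xi> (z + (d, 0))) ` half_space)"
    by (rule bounded_subset[of "\<xi> ` half_space"]) (use t in \<open>auto simp: test_def\<close>)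
  show "locally_lipschitz_on half_space (\<lambda>z. \<xi> (z + (d, 0)))"
    unfolding locally_lipschitz_on_iff
  proof
    fix x :: point assume "x \<in> half_space"
    then have "x + (d, 0) \<in> half_space" by simp
    then obtain e L where e: "e > 0" "L-lipschitz_on (cball (x + (d, 0)) e \<inter> half_space) \<xi>"
      using t unfolding test_def locally_lipschitz_on_iff by blast
    have "L-lipschitz_on (cball x e \<inter> half_space) (\<lambda>z. \<xi> (z + (d, 0)))"
    proof (rule lipschitz_onI)
      fix a b assume "a \<in> cball x e \<inter> half_space" "b \<in> cball x e \<inter> half_space"
      then have "dist (\<xi> (a + (d, 0))) (\<xi> (b + (d, 0))) \<le> L * dist (a + (d, 0)) (b + (d, 0))"
        by (intro lipschitz_onD[OF e(2)]) (auto simp: dist_norm)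
      then show "dist (\<xi> (a + (d, 0))) (\<xi> (b + (d, 0))) \<le> L * dist a b" by (simp add: dist_norm)
    qed (use e(2) lipschitz_on_nonneg in blast)
    then show "\<exists>e>0. \<exists>L. L-lipschitz_on (cball x e \<inter> half_space) (\<lambda>z. \<xi> (z + (d, 0)))" using e by blast
  qed
  show "\<forall>z\<in>half_space. z \<notin> ball 0 (R + norm d) \<longrightarrow> \<xi> (z + (d, 0)) = 0 \<and> X (z + (d, 0)) = 0"
  proof (intro ballI impI)
    fix z assume z: "z \<in> half_space" "z \<notin> ball 0 (R + norm d)"
    have "norm z - norm d \<le> norm (z + (d, 0))"
      using norm_diff_ineq[of z "(d, 0::real)"] by (simp add: norm_Pair)
    then have "z + (d, 0) \<notin> ball 0 R" using z by simp
    then show "\<xi> (z + (d, 0)) = 0 \<and> X (z + (d, 0)) = 0" using t z unfolding test_def by (meson half_space_shift)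
  qed
  show "(\<lambda>z. X (z + (d, 0))) \<in> borel_measurable HM" using t by (intro HM_shift_measurable) (simp add: test_def)
  have "AE z in HM. GDERIV \<xi> z :> X z" using t by (simp add: test_def)
  from HM_shift_AE[OF this, of d] show "AE z in HM. GDERIV (\<lambda>z. \<xi> (z + (d, 0))) z :> X (z + (d, 0))"
    by eventually_elim (rule GDERIV_shift)
  have "integrable HM (\<lambda>z. \<mu> (snd z) * (norm (X z))\<^sup>2)" using t by (simp add: test_def)
  from HM_shift_integrable[OF this, of d] show "integrable HM (\<lambda>z. \<mu> (snd z) * (norm (X (z + (d, 0))))\<^sup>2)" by simp
  have "AE y in lebesgue. ((\<lambda>x. \<xi> (y, x)) \<longlongrightarrow> T y) (at_right 0)" using t by (simp add: test_def)
  from AE_lebesgue_translate[OF this, of d]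
  show "AE y in lebesgue. ((\<lambda>x. \<xi> ((y, x) + (d, 0))) \<longlongrightarrow> T (y + d)) (at_right 0)" by simp
qed

lemma tendsto_at_right_continuous:
  assumes "continuous_on UNIV \<phi>" shows "((\<lambda>x. \<phi> (y, x)) \<longlongrightarrow> \<phi> (y, 0 :: real)) (at_right 0)"
proof -
  have "continuous_on UNIV (\<lambda>x. \<phi> (y, x))" by (intro continuous_on_compose2[OF assms] continuous_intros) auto
  then have "continuous (at 0) (\<lambda>x. \<phi> (y, x))" by (simp add: continuous_on_eq_continuous_at)
  then have "((\<lambda>x. \<phi> (y, x)) \<longlongrightarrow> \<phi> (y, 0)) (at 0)" by (simp add: continuous_at)
  then show ?thesis by (rule filterlim_mono) (auto simp: at_le)
qed

lemma test_cut: assumes "0 < R"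
  shows "test (2 * R) (cut R) (cutg R) (\<lambda>y. cut R (y, 0::real))"
proof (rule test_C1)
  show "integrable HM (\<lambda>z. \<mu> (snd z) * (norm (cutg R z))\<^sup>2)"
  proof (rule integrable_mu_bounded[where R = "2 * R" and C = "(6 / R)\<^sup>2"])
    show "(\<lambda>z. (norm (cutg R z))\<^sup>2) \<in> borel_measurable HM"
      by (intro HM_measurable_continuous continuous_intros continuous_on_cutg)
    show "\<bar>(norm (cutg R z))\<^sup>2\<bar> \<le> (6 / R)\<^sup>2" for z :: point
      using power_mono[OF norm_cutg_le[OF assms, of z], of 2] by simp
  qed (use assms in \<open>auto simp: cutg_eq_0\<close>)
  show "\<bar>cut R z\<bar> \<le> 1" for z :: point using cut_bounds[of R z] by simp
  show "AE y in lebesgue. ((\<lambda>x. cut R (y :: real^2, x :: real)) \<longlongrightarrow> cut R (y, 0 :: real)) (at_right 0)"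
    by (intro AE_I2 tendsto_at_right_continuous[of "cut R"] continuous_on_cut)
qed (use assms GDERIV_cut continuous_on_cutg in \<open>auto simp: cut_eq_0 cutg_eq_0\<close>)

lemma HM_measurable_cut_limit:
  fixes F :: "point \<Rightarrow> real"
  assumes "\<And>n. (\<lambda>z. F z * cut (real (Suc n)) z) \<in> borel_measurable HM"
  shows "F \<in> borel_measurable HM"
proof (rule borel_measurable_LIMSEQ_real[OF _ assms])
  fix z :: point
  obtain N where N: "norm z < real N" using reals_Archimedean2 by blast
  show "(\<lambda>n. F z * cut (real (Suc n)) z) \<longlonglongrightarrow> F z"
    by (rule tendsto_eventually, rule eventually_sequentiallyI[of N]) (use N in \<open>simp add: cut_eq_1\<close>)
qed

text \<open>No joint measurability of \<open>g\<close> is assumed. Measurability of the composition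
  is part of what the weak formulation asserts for the test functions \<open>cut\<close>, and these
  exhaust the half-space.\<close>

lemma gu_measurable: "(\<lambda>z. g (snd z) (u z)) \<in> borel_measurable HM"
  by (rule HM_measurable_cut_limit, rule borel_measurable_integrable, rule weak_test(2)[OF test_cut]) simp

lemma c_measurable: "c \<in> borel_measurable HM"
proof (rule HM_measurable_cut_limit)
  fix n
  \<comment> \<open>The stability form supplies \<open>c\<close> times a square only. The cutoff
    with double radius equals 1 on the support of the smaller one, so its square drops out of the
    product.\<close>
  have "(\<lambda>z. c z * (cut (2 * real (Suc n)) z)\<^sup>2) \<in> borel_measurable HM"
    by (rule borel_measurable_integrable, rule stable_test(1)[OF test_cut]) simp
  from borel_measurable_times[OF this HM_measurable_continuous[OF continuous_on_cut]]
  have "(\<lambda>z. c z * (cut (2 * real (Suc n)) z)\<^sup>2 * cut (real (Suc n)) z) \<in> borel_measurable HM" .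
  moreover have "c z * (cut (2 * real (Suc n)) z)\<^sup>2 * cut (real (Suc n)) z = c z * cut (real (Suc n)) z" for z
    using cut_eq_1[of z "2 * real (Suc n)"] cut_eq_0[of "real (Suc n)" z] by (cases "norm z \<le> 2 * real (Suc n)") auto
  ultimately show "(\<lambda>z. c z * cut (real (Suc n)) z) \<in> borel_measurable HM" by (simp only:)
qed

lemma fU'_measurable: "(\<lambda>y. deriv f (U y)) \<in> borel_measurable lebesgue"
proof (rule borel_measurable_LIMSEQ_real)
  show "(\<lambda>y. deriv f (U y) * (cut (real (Suc n)) (y, 0::real))\<^sup>2) \<in> borel_measurable lebesgue" for n
    by (rule borel_measurable_integrable, rule stable_test(2)[OF test_cut]) simp
  fix y :: "real^2"
  obtain N where N: "norm y < real N" using reals_Archimedean2 by blast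
  show "(\<lambda>n. deriv f (U y) * (cut (real (Suc n)) (y, 0::real))\<^sup>2) \<longlonglongrightarrow> deriv f (U y)"
    by (rule tendsto_eventually, rule eventually_sequentiallyI[of N]) (use N in \<open>simp add: cut_eq_1 norm_Pair\<close>)
qed

lemma gu_bound: assumes "0 < R" "0 < K"
  obtains C where "C > 0"
    "\<And>x t D. 0 < x \<Longrightarrow> x < R \<Longrightarrow> \<bar>t\<bar> < K \<Longrightarrow> (g x has_real_derivative D) (at t) \<Longrightarrow> \<bar>D\<bar> \<le> C"
proof -
  have "\<forall>R>0. \<forall>M>0. \<exists>C>0. \<forall>x t D. 0 < x \<and> x < R \<and> \<bar>t\<bar> < M \<and> (g x has_real_derivative D) (at t) \<longrightarrow> \<bar>D\<bar> \<le> C"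
    using struct unfolding structural_assumptions_def by (elim conjE)
  from this[rule_format, OF assms] show thesis using that by blast
qed

lemma c_bound: assumes "0 < R"
  shows "\<exists>C\<ge>0. \<forall>z\<in>half_space. snd z < R \<longrightarrow> \<bar>c z\<bar> \<le> C"
proof -
  have p: "0 < uB + 1" using uB(1) by simp
  obtain C where C: "C > 0" "\<And>x t D. 0 < x \<Longrightarrow> x < R \<Longrightarrow> \<bar>t\<bar> < uB + 1 \<Longrightarrow> (g x has_real_derivative D) (at t) \<Longrightarrow> \<bar>D\<bar> \<le> C"
    using gu_bound[OF assms p] by blast
  have "\<bar>c z\<bar> \<le> max C \<bar>SOME D::real. False\<bar>" if z: "z \<in> half_space" "snd z < R" for z
  proof (cases "\<exists>D. (g (snd z) has_real_derivative D) (at (u z))")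
    case True
    then have "(g (snd z) has_real_derivative c z) (at (u z))" using DERIV_imp_deriv by blast
    then have "\<bar>c z\<bar> \<le> C" using C(2)[of "snd z" "u z" "c z"] z uB(2)[OF z(1)] by (simp add: half_space_def)
    then show ?thesis by simp
  qed (simp add: deriv_of_not_differentiable)
  then show ?thesis using C(1) by (intro exI[of _ "max C \<bar>SOME D::real. False\<bar>"]) auto
qed

lemma g_lipschitz: assumes "0 < R"
  shows "\<exists>C\<ge>0. \<forall>x s t. 0 < x \<longrightarrow> x < R \<longrightarrow> \<bar>s\<bar> \<le> uB \<longrightarrow> \<bar>t\<bar> \<le> uB \<longrightarrow> \<bar>g x s - g x t\<bar> \<le> C * \<bar>s - t\<bar>"
proof -
  obtain C where C: "C > 0" "\<And>x t D. 0 < x \<Longrightarrow> x < R \<Longrightarrow> \<bar>t\<bar> < uB \<Longrightarrow> (g x has_real_derivative D) (at t) \<Longrightarrow> \<bar>D\<bar> \<le> C"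
    using gu_bound[OF assms uB(1)] by blast
  have "\<bar>g x s - g x t\<bar> \<le> C * \<bar>s - t\<bar>" if "0 < x" "x < R" "\<bar>s\<bar> \<le> uB" "\<bar>t\<bar> \<le> uB" for x s t
    using that by (intro locally_lipschitz_derivative_bound[OF g_lip, of x s "- uB" uB]) (auto intro!: C(2)[of x])
  then show ?thesis using C(1) by (intro exI[of _ C]) auto
qed

lemma f_lipschitz: "\<exists>C\<ge>0. \<forall>s t. \<bar>s\<bar> \<le> uB \<longrightarrow> \<bar>t\<bar> \<le> uB \<longrightarrow> \<bar>f s - f t\<bar> \<le> C * \<bar>s - t\<bar>"
proof -
  obtain L where L: "L-lipschitz_on UNIV (\<lambda>t. f (min uB (max (- uB) t)))"
    using locally_lipschitz_on_clamp[OF f_lip, of "- uB" uB] uB(1) by auto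
  have "\<bar>f s - f t\<bar> \<le> L * \<bar>s - t\<bar>" if "\<bar>s\<bar> \<le> uB" "\<bar>t\<bar> \<le> uB" for s t
  proof -
    have "min uB (max (- uB) r) = r" if "\<bar>r\<bar> \<le> uB" for r using that by auto
    then show ?thesis using lipschitz_onD[OF L, of s t] that by (simp add: dist_real_def)
  qed
  then show ?thesis using lipschitz_on_nonneg[OF L] by blast
qed

end

subsection \<open>Difference quotients in horizontal directions\<close>

lemma LIMSEQ_has_derivative:
  fixes F :: "'a::real_normed_vector \<Rightarrow> 'b::real_normed_vector"
  assumes F: "(F has_derivative F') (at z)"
  shows "(\<lambda>n. real (Suc n) *\<^sub>R (F (z + E /\<^sub>R real (Suc n)) - F z)) \<longlonglongrightarrow> F' E"
proof -
  have lin: "bounded_linear F'" using F by (rule has_derivative_bounded_linear)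
  have "((\<lambda>t. F (z + t *\<^sub>R E)) has_derivative (\<lambda>t. F' (t *\<^sub>R E))) (at 0)"
    by (rule has_derivative_compose[of "\<lambda>t. z + t *\<^sub>R E" "\<lambda>t. t *\<^sub>R E" 0 UNIV F]) (use F in \<open>auto intro!: derivative_eq_intros\<close>)
  then have v: "((\<lambda>t. F (z + t *\<^sub>R E)) has_vector_derivative F' E) (at 0)"
    by (simp add: has_vector_derivative_def linear_cmul[OF bounded_linear.linear[OF lin]])
  have "((\<lambda>t. (F (z + t *\<^sub>R E) - F (z + 0 *\<^sub>R E)) /\<^sub>R (t - 0)) \<longlongrightarrow> F' E) (at 0)"
    using v[unfolded has_vector_derivative_def]
  proof -
    have "((\<lambda>t. ((F (z + t *\<^sub>R E) - F (z + 0 *\<^sub>R E)) - (t - 0) *\<^sub>R F' E) /\<^sub>R norm (t - 0)) \<longlongrightarrow> 0) (at 0)"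
      using v unfolding has_vector_derivative_def has_derivative_def by (simp add: Lim_ident_at)
    then have "((\<lambda>t. norm (((F (z + t *\<^sub>R E) - F (z + 0 *\<^sub>R E)) - (t - 0) *\<^sub>R F' E) /\<^sub>R norm (t - 0))) \<longlongrightarrow> 0) (at 0)"
      by (rule tendsto_norm_zero)
    moreover have "\<forall>\<^sub>F t in at 0. norm (((F (z + t *\<^sub>R E) - F (z + 0 *\<^sub>R E)) - (t - 0) *\<^sub>R F' E) /\<^sub>R norm (t - 0))
       = norm ((F (z + t *\<^sub>R E) - F (z + 0 *\<^sub>R E)) /\<^sub>R (t - 0) - F' E)"
    proof (rule eventually_at_filter[THEN iffD2], rule always_eventually, intro allI impI)
      fix t :: real assume t: "t \<noteq> 0"
      have "(F (z + t *\<^sub>R E) - F (z + 0 *\<^sub>R E)) /\<^sub>R (t - 0) - F' E = ((F (z + t *\<^sub>R E) - F (z + 0 *\<^sub>R E)) - (t - 0) *\<^sub>R F' E) /\<^sub>R t"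
        using t by (simp add: scaleR_diff_right)
      then show "norm (((F (z + t *\<^sub>R E) - F (z + 0 *\<^sub>R E)) - (t - 0) *\<^sub>R F' E) /\<^sub>R norm (t - 0))
       = norm ((F (z + t *\<^sub>R E) - F (z + 0 *\<^sub>R E)) /\<^sub>R (t - 0) - F' E)" by simp
    qed
    ultimately have "((\<lambda>t. norm ((F (z + t *\<^sub>R E) - F (z + 0 *\<^sub>R E)) /\<^sub>R (t - 0) - F' E)) \<longlongrightarrow> 0) (at 0)"
      by (rule Lim_transform_eventually)
    then show ?thesis by (simp add: tendsto_norm_zero_iff LIM_zero_iff)
  qed
  moreover have "filterlim (\<lambda>n. inverse (real (Suc n))) (at 0) sequentially"
    by (intro filterlim_atI LIMSEQ_inverse_real_of_nat always_eventually) simp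
  ultimately have "(\<lambda>n. (F (z + inverse (real (Suc n)) *\<^sub>R E) - F (z + 0 *\<^sub>R E)) /\<^sub>R (inverse (real (Suc n)) - 0)) \<longlonglongrightarrow> F' E"
    by (rule filterlim_compose)
  then show ?thesis by (simp del: of_nat_Suc)
qed

text \<open>Common interface of \<open>cut\<close>, which serves the energy estimates, and
  \<open>lcut\<close>, which serves the limit. Values in \<open>{0..1}\<close> keep the squared
  cutoff in the same class.\<close>

definition cutoff :: "real \<Rightarrow> (point \<Rightarrow> real) \<Rightarrow> (point \<Rightarrow> point) \<Rightarrow> bool" where
  "cutoff R \<Phi> \<Phi>g \<longleftrightarrow> 0 < R \<and> (\<forall>z. GDERIV \<Phi> z :> \<Phi>g z) \<and> continuous_on UNIV \<Phi>g \<and>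
     (\<forall>z. 0 \<le> \<Phi> z \<and> \<Phi> z \<le> 1) \<and> (\<forall>z. z \<notin> ball 0 R \<longrightarrow> \<Phi> z = 0 \<and> \<Phi>g z = 0)"

lemma cutoff_continuous: "cutoff R \<Phi> \<Phi>g \<Longrightarrow> continuous_on S \<Phi>"
  unfolding cutoff_def gderiv_def by (meson continuous_at_imp_continuous_on has_derivative_continuous)

lemma cutoff_cut: "0 < R \<Longrightarrow> cutoff (2 * R) (cut R) (cutg R)"
  unfolding cutoff_def
  by (intro conjI allI impI GDERIV_cut continuous_on_cutg cut_bounds cut_eq_0 cutg_eq_0) (simp_all add: not_less)

lemma cutoff_lcut: "cutoff (2 ^ (m + N)) (lcut m N) (lcutg m N)"
  unfolding cutoff_def
  by (intro conjI allI impI GDERIV_lcut continuous_on_lcutg lcut_bounds lcut_eq_0) (simp_all add: not_less)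

lemma cutoff_bound: assumes "cutoff R \<Phi> \<Phi>g" shows "\<exists>K\<ge>0. \<forall>z. norm (\<Phi>g z) \<le> K"
proof -
  have "continuous_on UNIV \<Phi>g" using assms unfolding cutoff_def by blast
  then have "continuous_on (cball 0 R) \<Phi>g" by (rule continuous_on_subset) simp
  then have "compact (\<Phi>g ` cball 0 R)" by (rule compact_continuous_image) simp
  then have "bounded (\<Phi>g ` cball 0 R)" by (rule compact_imp_bounded)
  then obtain K where K: "\<And>z. z \<in> cball 0 R \<Longrightarrow> norm (\<Phi>g z) \<le> K"
    unfolding bounded_iff by blast
  have "norm (\<Phi>g z) \<le> max K 0" for z
  proof (cases "z \<in> ball 0 R")
    case True
    then show ?thesis using K[of z] by (simp add: le_max_iff_disj)
  next
    case False
    then have "\<Phi>g z = 0" using assms unfolding cutoff_def by blast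
    then show ?thesis by simp
  qed
  then show ?thesis by (intro exI[of _ "max K 0"]) auto
qed

lemma norm_add_sq_le: "(norm (a + b))\<^sup>2 \<le> 2 * (norm a)\<^sup>2 + 2 * (norm b)\<^sup>2" for a b :: "'a::real_normed_vector"
proof -
  have "(norm (a + b))\<^sup>2 \<le> (norm a + norm b)\<^sup>2" by (intro power_mono norm_triangle_ineq) auto
  also have "\<dots> \<le> 2 * (norm a)\<^sup>2 + 2 * (norm b)\<^sup>2"
    using sum_squares_bound[of "norm a" "norm b"] by (simp add: power2_sum)
  finally show ?thesis .
qed

context stable_layer
begin

lemma mu_nonneg: "z \<in> half_space \<Longrightarrow> 0 \<le> \<mu> (snd z)"
  using mu_pos[of "snd z"] by (auto simp: half_space_def)

lemma HM_integrable_bound: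
  fixes F B :: "point \<Rightarrow> real"
  assumes "integrable HM B" "F \<in> borel_measurable HM" "\<And>z. z \<in> half_space \<Longrightarrow> \<bar>F z\<bar> \<le> B z"
  shows "integrable HM F"
  by (rule Bochner_Integration.integrable_bound[OF assms(1,2)]) (auto intro!: AE_HM_I order_trans[OF assms(3)])

lemma test_mult:
  assumes co: "cutoff R \<Phi> \<Phi>g"
    and v: "\<And>z. z \<in> half_space \<Longrightarrow> GDERIV v z :> W z" and W: "continuous_on half_space W"
    and K: "\<And>z. z \<in> half_ball R \<Longrightarrow> \<bar>v z\<bar> \<le> K"
    and int: "integrable HM (\<lambda>z. \<mu> (snd z) * (norm (W z))\<^sup>2 * indicator (ball 0 R) z)"
    and T: "AE y in lebesgue. ((\<lambda>x. v (y, x)) \<longlongrightarrow> T y) (at_right 0)"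
  shows "test R (\<lambda>z. v z * \<Phi> z) (\<lambda>z. \<Phi> z *\<^sub>R W z + v z *\<^sub>R \<Phi>g z) (\<lambda>y. T y * \<Phi> (y, 0))"
proof (rule test_C1)
  have c: "\<And>z. GDERIV \<Phi> z :> \<Phi>g z" "continuous_on UNIV \<Phi>g" "\<And>z. 0 \<le> \<Phi> z" "\<And>z. \<Phi> z \<le> 1" "0 < R"
    "\<And>z. z \<notin> ball 0 R \<Longrightarrow> \<Phi> z = 0" "\<And>z. z \<notin> ball 0 R \<Longrightarrow> \<Phi>g z = 0"
    using co unfolding cutoff_def by blast+
  have vc: "continuous_on half_space v"
    using v unfolding gderiv_def by (meson continuous_at_imp_continuous_on has_derivative_continuous)
  have cc: "continuous_on half_space \<Phi>" "continuous_on half_space \<Phi>g"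
    using cutoff_continuous[OF co] c(2) continuous_on_subset by blast+
  show "0 < R" by (rule c)
  show "GDERIV (\<lambda>z. v z * \<Phi> z) z :> \<Phi> z *\<^sub>R W z + v z *\<^sub>R \<Phi>g z" if "z \<in> half_space" for z
    using GDERIV_mult[OF v[OF that] c(1)[of z]] by (simp add: add.commute)
  show Xc: "continuous_on half_space (\<lambda>z. \<Phi> z *\<^sub>R W z + v z *\<^sub>R \<Phi>g z)"
    by (intro continuous_intros cc vc W)
  show "\<bar>v z * \<Phi> z\<bar> \<le> \<bar>K\<bar>" if z: "z \<in> half_space" for z
  proof (cases "z \<in> ball 0 R")
    case True
    then have "\<bar>v z\<bar> \<le> \<bar>K\<bar>" using K[of z] z by (auto simp: half_ball_def)
    then have "\<bar>v z\<bar> * \<bar>\<Phi> z\<bar> \<le> \<bar>K\<bar> * 1" using c(3,4)[of z] by (intro mult_mono) auto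
    then show ?thesis by (simp add: abs_mult)
  qed (use c(6) in simp)
  show "v z * \<Phi> z = 0 \<and> \<Phi> z *\<^sub>R W z + v z *\<^sub>R \<Phi>g z = 0" if "z \<notin> ball 0 R" for z
    using c(6,7)[OF that] by simp
  obtain L where L: "L \<ge> 0" "\<And>z. norm (\<Phi>g z) \<le> L" using cutoff_bound[OF co] by blast
  have i2: "integrable HM (\<lambda>z. \<mu> (snd z) * (K\<^sup>2 * L\<^sup>2 * indicator (ball 0 R) z))"
    by (rule integrable_mu_bounded[where R = R and C = "K\<^sup>2 * L\<^sup>2"]) (use c(5) in auto)
  show "integrable HM (\<lambda>z. \<mu> (snd z) * (norm (\<Phi> z *\<^sub>R W z + v z *\<^sub>R \<Phi>g z))\<^sup>2)"
  proof (rule HM_integrable_bound)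
    show "integrable HM (\<lambda>z. 2 * (\<mu> (snd z) * (norm (W z))\<^sup>2 * indicator (ball 0 R) z) + 2 * (\<mu> (snd z) * (K\<^sup>2 * L\<^sup>2 * indicator (ball 0 R) z)))"
      using int i2 by simp
    show "(\<lambda>z. \<mu> (snd z) * (norm (\<Phi> z *\<^sub>R W z + v z *\<^sub>R \<Phi>g z))\<^sup>2) \<in> borel_measurable HM"
      using HM_measurable_continuous[OF Xc] by measurable
    fix z assume z: "z \<in> half_space"
    show "\<bar>\<mu> (snd z) * (norm (\<Phi> z *\<^sub>R W z + v z *\<^sub>R \<Phi>g z))\<^sup>2\<bar>
      \<le> 2 * (\<mu> (snd z) * (norm (W z))\<^sup>2 * indicator (ball 0 R) z) + 2 * (\<mu> (snd z) * (K\<^sup>2 * L\<^sup>2 * indicator (ball 0 R) z))"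
    proof (cases "z \<in> ball 0 R")
      case True
      have a: "(norm (\<Phi> z *\<^sub>R W z))\<^sup>2 \<le> (norm (W z))\<^sup>2"
        using c(3,4)[of z] by (intro power_mono) (auto simp: mult_left_le_one_le)
      have "\<bar>v z\<bar> \<le> \<bar>K\<bar>" using K[of z] True z by (auto simp: half_ball_def)
      then have "norm (v z *\<^sub>R \<Phi>g z) \<le> \<bar>K\<bar> * L"
        unfolding norm_scaleR by (intro mult_mono L) auto
      then have b: "(norm (v z *\<^sub>R \<Phi>g z))\<^sup>2 \<le> K\<^sup>2 * L\<^sup>2"
        using power_mono[of "norm (v z *\<^sub>R \<Phi>g z)" "\<bar>K\<bar> * L" 2] by (simp add: power_mult_distrib)
      have "(norm (\<Phi> z *\<^sub>R W z + v z *\<^sub>R \<Phi>g z))\<^sup>2 \<le> 2 * (norm (W z))\<^sup>2 + 2 * (K\<^sup>2 * L\<^sup>2)"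
        using norm_add_sq_le[of "\<Phi> z *\<^sub>R W z" "v z *\<^sub>R \<Phi>g z"] a b by linarith
      then have "\<mu> (snd z) * (norm (\<Phi> z *\<^sub>R W z + v z *\<^sub>R \<Phi>g z))\<^sup>2 \<le> \<mu> (snd z) * (2 * (norm (W z))\<^sup>2 + 2 * (K\<^sup>2 * L\<^sup>2))"
        using mu_nonneg[OF z] by (intro mult_left_mono)
      then show ?thesis using True mu_nonneg[OF z] by (simp add: algebra_simps)
    next
      case False
      then show ?thesis using c(6,7) by simp
    qed
  qed
  show "AE y in lebesgue. ((\<lambda>x. v (y, x) * \<Phi> (y, x)) \<longlongrightarrow> T y * \<Phi> (y, 0)) (at_right 0)"
    using T by eventually_elim (intro tendsto_mult tendsto_at_right_continuous[OF cutoff_continuous[OF co]])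
qed

definition V :: "real^2 \<Rightarrow> point \<Rightarrow> real" where "V e z = e \<bullet> fst (G z)"

definition HE :: "real^2 \<Rightarrow> point \<Rightarrow> point" where "HE e z = blinfun_apply (H z) (e, 0)"

lemma V_eq: "V e z = (e, 0) \<bullet> G z" by (simp add: V_def inner_prod_def)

text \<open>The gradient of a component of \<open>G\<close> is a row of the Hessian, while
  \<open>HE e\<close> is a column, the one that occurs as limit of the difference quotients of
  \<open>G\<close>. Symmetry identifies the two.\<close>

lemma GDERIV_V: assumes "z \<in> half_space" shows "GDERIV (V e) z :> HE e z"
proof -
  have "((\<lambda>z. (e, 0) \<bullet> G z) has_derivative (\<lambda>h. (e, 0) \<bullet> H z h)) (at z)"
    by (rule has_derivative_inner_right[OF H[OF assms]])
  moreover have "(e, 0) \<bullet> H z h = h \<bullet> HE e z" for h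
    unfolding HE_def by (rule second_derivative_symmetric[OF open_half_space assms G H H_continuous])
  ultimately show ?thesis by (simp add: gderiv_def V_eq[abs_def])
qed

lemma HE_continuous: "continuous_on half_space (HE e)"
  unfolding HE_def[abs_def] by (intro continuous_intros H_continuous)

lemma V_continuous: "continuous_on half_space (V e)"
  unfolding V_def[abs_def] by (intro continuous_intros G_continuous)

definition step :: "real^2 \<Rightarrow> nat \<Rightarrow> real^2" where "step e n = e /\<^sub>R real (Suc n)"

definition Dq :: "real^2 \<Rightarrow> nat \<Rightarrow> point \<Rightarrow> real" where
  "Dq e n z = real (Suc n) * (u (z + (step e n, 0)) - u z)"

definition DG :: "real^2 \<Rightarrow> nat \<Rightarrow> point \<Rightarrow> point" where
  "DG e n z = real (Suc n) *\<^sub>R (G (z + (step e n, 0)) - G z)"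

lemma step_pair: "(step e n, 0) = (e, 0::real) /\<^sub>R real (Suc n)" by (simp add: step_def)

lemma Dq_lim: "z \<in> half_space \<Longrightarrow> (\<lambda>n. Dq e n z) \<longlonglongrightarrow> V e z"
  using LIMSEQ_has_derivative[of u "\<lambda>h. h \<bullet> G z" z "(e, 0)"] G[of z]
  unfolding Dq_def step_pair V_eq gderiv_def by simp

lemma DG_lim: "z \<in> half_space \<Longrightarrow> (\<lambda>n. DG e n z) \<longlonglongrightarrow> HE e z"
  using LIMSEQ_has_derivative[OF H, of z "(e, 0)"] unfolding DG_def step_pair HE_def by simp

lemma GDERIV_Dq: "z \<in> half_space \<Longrightarrow> GDERIV (Dq e n) z :> DG e n z"
proof -
  assume z: "z \<in> half_space"
  have "GDERIV (\<lambda>z. u (z + (step e n, 0))) z :> G (z + (step e n, 0))" by (rule GDERIV_shift, rule G) (use z in simp)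
  from GDERIV_mult[OF GDERIV_const GDERIV_diff[OF this G[OF z]], of "real (Suc n)"]
  show ?thesis unfolding Dq_def[abs_def] DG_def by simp
qed

lemma DG_continuous: "continuous_on half_space (DG e n)"
proof -
  have "continuous_on half_space (\<lambda>z. G (z + (step e n, 0)))"
    by (rule continuous_on_compose2[OF G_continuous]) (auto intro!: continuous_intros)
  then show ?thesis unfolding DG_def[abs_def] by (intro continuous_intros G_continuous)
qed

lemma Dq_bound:
  assumes e: "norm e = 1" and R: "0 < R"
  obtains C where "C \<ge> 0" "\<And>n z. z \<in> half_ball R \<Longrightarrow> \<bar>Dq e n z\<bar> \<le> C" "\<And>z. z \<in> half_ball R \<Longrightarrow> \<bar>V e z\<bar> \<le> C"
    "\<And>n y. norm y < R \<Longrightarrow> \<bar>real (Suc n) * (U (y + step e n) - U y)\<bar> \<le> C"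
proof -
  have "0 < R + 3" using R by simp
  then obtain C where C: "C \<ge> 0" "\<And>z. z \<in> half_ball (R + 3) \<Longrightarrow> norm (fst (G z)) \<le> C" using grad_y_bound by blast
  have s: "norm (step e n) = 1 / real (Suc n)" for n by (simp add: step_def e divide_inverse del: of_nat_Suc)
  have s1: "norm (step e n) \<le> 1" for n unfolding s by simp
  show thesis
  proof (rule that[OF C(1)])
    fix n z assume z: "z \<in> half_ball R"
    have "norm (z + (step e n, 0)) \<le> norm z + norm (step e n)"
      using norm_triangle_ineq[of z "(step e n, 0)"] by (simp add: norm_Pair)
    then have "z \<in> half_ball (R + 3)" "z + (step e n, 0) \<in> half_ball (R + 3)"
      using z s1[of n] by (auto simp: half_ball_def)
    then have "\<bar>u (z + (step e n, 0)) - u z\<bar> \<le> C * norm (step e n)" by (intro u_diff_y C)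
    then have "real (Suc n) * \<bar>u (z + (step e n, 0)) - u z\<bar> \<le> real (Suc n) * (C * norm (step e n))"
      by (intro mult_left_mono) auto
    then show "\<bar>Dq e n z\<bar> \<le> C" by (simp add: Dq_def abs_mult s del: of_nat_Suc)
  next
    fix z assume z: "z \<in> half_ball R"
    then have "norm (fst (G z)) \<le> C" by (intro C) (auto simp: half_ball_def)
    then show "\<bar>V e z\<bar> \<le> C" using Cauchy_Schwarz_ineq2[of e "fst (G z)"] e by (simp add: V_def)
  next
    fix n and y :: "real^2" assume y: "norm y < R"
    have "norm (y + step e n) \<le> norm y + norm (step e n)" by (rule norm_triangle_ineq)
    then have "\<bar>U (y + step e n) - U y\<bar> \<le> C * norm (step e n)"
      using y s1[of n] by (intro U_diff[of "R + 3"] C) auto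
    then have "real (Suc n) * \<bar>U (y + step e n) - U y\<bar> \<le> real (Suc n) * (C * norm (step e n))"
      by (intro mult_left_mono) auto
    then show "\<bar>real (Suc n) * (U (y + step e n) - U y)\<bar> \<le> C" by (simp add: abs_mult s del: of_nat_Suc)
  qed
qed

text \<open>The coefficients depend on the height only, so the weak formulation is invariant under
  horizontal translations. Testing with \<open>\<xi>\<close> shifted back by the step and
  substituting moves the shift onto \<open>u\<close>; then the equation for \<open>u\<close> itself
  is subtracted.\<close>

lemma diff_eq:
  assumes t: "test R \<xi> X T"
  shows "integrable HM (\<lambda>z. \<mu> (snd z) * (DG e n z \<bullet> X z))"
    "integrable HM (\<lambda>z. real (Suc n) * (g (snd z) (u (z + (step e n, 0))) - g (snd z) (u z)) * \<xi> z)"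
    "integrable lebesgue (\<lambda>y. real (Suc n) * (f (U (y + step e n)) - f (U y)) * T y)"
    "(\<integral>z. \<mu> (snd z) * (DG e n z \<bullet> X z) \<partial>HM) +
     (\<integral>z. real (Suc n) * (g (snd z) (u (z + (step e n, 0))) - g (snd z) (u z)) * \<xi> z \<partial>HM)
     = (\<integral>y. real (Suc n) * (f (U (y + step e n)) - f (U y)) * T y \<partial>lebesgue)"
proof -
  define d where "d = step e n"
  note w1 = weak_test[OF t]
  note w2 = weak_test[OF test_shift[OF t, of "- d"]]
  have cancel: "z + (d, 0) + (- d, 0) = z" for z :: point by (cases z) simp
  note i1 = HM_shift_integrable[OF w2(1), of d, unfolded cancel]
  note i2 = HM_shift_integrable[OF w2(2), of d, unfolded cancel]
  note i3 = integrable_lebesgue_translation[OF w2(3), of d]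
  have e1: "(\<integral>z. \<mu> (snd z) * (G z \<bullet> X (z + (- d, 0))) \<partial>HM) = (\<integral>z. \<mu> (snd (z + (d, 0))) * (G (z + (d, 0)) \<bullet> X z) \<partial>HM)"
    using HM_shift_integral[OF borel_measurable_integrable[OF w2(1)], of d] by (simp add: cancel)
  have e2: "(\<integral>z. g (snd z) (u z) * \<xi> (z + (- d, 0)) \<partial>HM) = (\<integral>z. g (snd (z + (d, 0))) (u (z + (d, 0))) * \<xi> z \<partial>HM)"
    using HM_shift_integral[OF borel_measurable_integrable[OF w2(2)], of d] by (simp add: cancel)
  have e3: "(\<integral>y. f (U y) * T (y + - d) \<partial>lebesgue) = (\<integral>y. f (U (y + d)) * T y \<partial>lebesgue)"
    using integral_lebesgue_translation[OF borel_measurable_integrable[OF w2(3)], of d] by simp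
  have i1': "integrable HM (\<lambda>z. \<mu> (snd z) * (G (z + (d, 0)) \<bullet> X z))" using i1 by simp
  have i2': "integrable HM (\<lambda>z. g (snd z) (u (z + (d, 0))) * \<xi> z)" using i2 by simp
  have i3': "integrable lebesgue (\<lambda>y. f (U (y + d)) * T y)" using i3 by simp
  have r1: "\<mu> (snd z) * (DG e n z \<bullet> X z) = real (Suc n) * (\<mu> (snd z) * (G (z + (d, 0)) \<bullet> X z) - \<mu> (snd z) * (G z \<bullet> X z))" for z
    by (simp add: DG_def d_def inner_diff_left algebra_simps)
  have r2: "real (Suc n) * (g (snd z) (u (z + (d, 0))) - g (snd z) (u z)) * \<xi> z
     = real (Suc n) * (g (snd z) (u (z + (d, 0))) * \<xi> z - g (snd z) (u z) * \<xi> z)" for z by (simp add: algebra_simps)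
  have r3: "real (Suc n) * (f (U (y + d)) - f (U y)) * T y = real (Suc n) * (f (U (y + d)) * T y - f (U y) * T y)" for y
    by (simp add: algebra_simps)
  show "integrable HM (\<lambda>z. \<mu> (snd z) * (DG e n z \<bullet> X z))"
    unfolding r1 by (intro integrable_mult_right Bochner_Integration.integrable_diff i1' w1)
  show "integrable HM (\<lambda>z. real (Suc n) * (g (snd z) (u (z + (step e n, 0))) - g (snd z) (u z)) * \<xi> z)"
    unfolding d_def[symmetric] r2 by (intro integrable_mult_right Bochner_Integration.integrable_diff i2' w1)
  show "integrable lebesgue (\<lambda>y. real (Suc n) * (f (U (y + step e n)) - f (U y)) * T y)"
    unfolding d_def[symmetric] r3 by (intro integrable_mult_right Bochner_Integration.integrable_diff i3' w1)
  have c1: "(\<integral>z. \<mu> (snd z) * (DG e n z \<bullet> X z) \<partial>HM) = real (Suc n) * ((\<integral>z. \<mu> (snd z) * (G (z + (d, 0)) \<bullet> X z) \<partial>HM) - (\<integral>z. \<mu> (snd z) * (G z \<bullet> X z) \<partial>HM))"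
    unfolding r1 integral_mult_right_zero by (subst Bochner_Integration.integral_diff[OF i1' w1(1)]) simp
  have c2: "(\<integral>z. real (Suc n) * (g (snd z) (u (z + (d, 0))) - g (snd z) (u z)) * \<xi> z \<partial>HM)
     = real (Suc n) * ((\<integral>z. g (snd z) (u (z + (d, 0))) * \<xi> z \<partial>HM) - (\<integral>z. g (snd z) (u z) * \<xi> z \<partial>HM))"
    unfolding r2 integral_mult_right_zero by (subst Bochner_Integration.integral_diff[OF i2' w1(2)]) simp
  have c3: "(\<integral>y. real (Suc n) * (f (U (y + d)) - f (U y)) * T y \<partial>lebesgue)
     = real (Suc n) * ((\<integral>y. f (U (y + d)) * T y \<partial>lebesgue) - (\<integral>y. f (U y) * T y \<partial>lebesgue))"
    unfolding r3 integral_mult_right_zero by (subst Bochner_Integration.integral_diff[OF i3' w1(3)]) simp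
  have c4: "(\<integral>z. \<mu> (snd z) * (G (z + (d, 0)) \<bullet> X z) \<partial>HM) + (\<integral>z. g (snd z) (u (z + (d, 0))) * \<xi> z \<partial>HM) = (\<integral>y. f (U (y + d)) * T y \<partial>lebesgue)"
    using w2(4) e1 e2 e3 by simp
  show "(\<integral>z. \<mu> (snd z) * (DG e n z \<bullet> X z) \<partial>HM) +
     (\<integral>z. real (Suc n) * (g (snd z) (u (z + (step e n, 0))) - g (snd z) (u z)) * \<xi> z \<partial>HM)
     = (\<integral>y. real (Suc n) * (f (U (y + step e n)) - f (U y)) * T y \<partial>lebesgue)"
    unfolding d_def[symmetric] c1 c2 c3 distrib_left[symmetric]
    by (rule arg_cong[where f = "(*) (real (Suc n))"]) (use w1(4) c4 in linarith)
qed

end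

section \<open>Uniform energy bounds for the difference quotients\<close>

lemma integrable_Fatou:
  fixes F :: "nat \<Rightarrow> 'a \<Rightarrow> real"
  assumes F: "\<And>n. integrable M (F n)" and nn: "\<And>n z. z \<in> space M \<Longrightarrow> 0 \<le> F n z" and K: "\<And>n. (\<integral>z. F n z \<partial>M) \<le> K"
    and lim: "\<And>z. z \<in> space M \<Longrightarrow> (\<lambda>n. F n z) \<longlonglongrightarrow> f z"
  shows "integrable M f"
proof -
  have f[measurable]: "f \<in> borel_measurable M"
    by (rule borel_measurable_LIMSEQ_real[of M "\<lambda>n z. F n z"]) (use lim F in auto)
  have f0: "0 \<le> f z" if "z \<in> space M" for z
    by (rule LIMSEQ_le_const[OF lim[OF that]]) (use nn that in auto)
  have "(\<integral>\<^sup>+z. ennreal (f z) \<partial>M) = (\<integral>\<^sup>+z. liminf (\<lambda>n. ennreal (F n z)) \<partial>M)"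
  proof (rule nn_integral_cong)
    fix z assume "z \<in> space M"
    then have "(\<lambda>n. ennreal (F n z)) \<longlonglongrightarrow> ennreal (f z)" by (intro tendsto_ennrealI lim)
    then show "ennreal (f z) = liminf (\<lambda>n. ennreal (F n z))" by (simp add: lim_imp_Liminf)
  qed
  also have "\<dots> \<le> liminf (\<lambda>n. (\<integral>\<^sup>+z. ennreal (F n z) \<partial>M))"
    using F by (intro nn_integral_liminf) auto
  also have "\<dots> \<le> ennreal K"
  proof (rule Liminf_le)
    show "\<forall>\<^sub>F n in sequentially. (\<integral>\<^sup>+z. ennreal (F n z) \<partial>M) \<le> ennreal K"
    proof (rule always_eventually, rule allI)
      fix n
      have "(\<integral>\<^sup>+z. ennreal (F n z) \<partial>M) = ennreal (\<integral>z. F n z \<partial>M)"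
        by (rule nn_integral_eq_integral[OF F]) (use nn in auto)
      then show "(\<integral>\<^sup>+z. ennreal (F n z) \<partial>M) \<le> ennreal K" using K[of n] by (simp add: ennreal_leI)
    qed
  qed simp
  finally show ?thesis using f0 by (intro integrableI_nonneg) (auto simp: le_less_trans)
qed

lemma cutoff_sq: assumes "cutoff R \<Phi> \<Phi>g" shows "cutoff R (\<lambda>z. (\<Phi> z)\<^sup>2) (\<lambda>z. (2 * \<Phi> z) *\<^sub>R \<Phi>g z)"
proof -
  have c: "\<And>z. GDERIV \<Phi> z :> \<Phi>g z" "continuous_on UNIV \<Phi>g" "\<And>z. 0 \<le> \<Phi> z" "\<And>z. \<Phi> z \<le> 1" "0 < R"
    "\<And>z. z \<notin> ball 0 R \<Longrightarrow> \<Phi> z = 0" "\<And>z. z \<notin> ball 0 R \<Longrightarrow> \<Phi>g z = 0"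
    using assms unfolding cutoff_def by blast+
  show ?thesis unfolding cutoff_def
  proof (intro conjI allI impI)
    show "GDERIV (\<lambda>z. (\<Phi> z)\<^sup>2) z :> (2 * \<Phi> z) *\<^sub>R \<Phi>g z" for z
      using GDERIV_mult[OF c(1)[of z] c(1)[of z]] by (simp add: power2_eq_square scaleR_add_left[symmetric])
    show "continuous_on UNIV (\<lambda>z. (2 * \<Phi> z) *\<^sub>R \<Phi>g z)"
      by (intro continuous_intros c cutoff_continuous[OF assms])
    show "0 \<le> (\<Phi> z)\<^sup>2" "(\<Phi> z)\<^sup>2 \<le> 1" for z using c(3,4)[of z] by (auto simp: power_le_one)
  qed (use c in simp_all)
qed

lemma AE_completeI: "negligible {z. \<not> P z} \<Longrightarrow> AE z in lebesgue. P z"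
  by (rule AE_I'[of "{z. \<not> P z}"]) (simp_all add: negligible_iff_null_sets)

text \<open>Supplies the measurability that \<open>negligible_lines\<close> demands of the set where
  difference quotients fail to converge.\<close>

lemma LIMSEQ_set_measurable:
  fixes F :: "nat \<Rightarrow> 'a::euclidean_space \<Rightarrow> real"
  assumes [measurable]: "\<And>n. F n \<in> borel_measurable lebesgue" "f \<in> borel_measurable lebesgue"
  shows "{z. \<not> (\<lambda>n. F n z) \<longlonglongrightarrow> f z} \<in> sets lebesgue"
proof -
  have eq: "(\<lambda>n. F n z) \<longlonglongrightarrow> f z \<longleftrightarrow> (\<forall>k. \<exists>N. \<forall>n. N \<le> n \<longrightarrow> \<bar>F n z - f z\<bar> < 1 / real (Suc k))" for z
  proof
    assume "(\<lambda>n. F n z) \<longlonglongrightarrow> f z"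
    then show "\<forall>k. \<exists>N. \<forall>n. N \<le> n \<longrightarrow> \<bar>F n z - f z\<bar> < 1 / real (Suc k)"
      unfolding LIMSEQ_iff by (simp del: of_nat_Suc)
  next
    assume r: "\<forall>k. \<exists>N. \<forall>n. N \<le> n \<longrightarrow> \<bar>F n z - f z\<bar> < 1 / real (Suc k)"
    show "(\<lambda>n. F n z) \<longlonglongrightarrow> f z"
    proof (rule LIMSEQ_I)
      fix \<epsilon> :: real assume "0 < \<epsilon>"
      then obtain k where k: "1 / real (Suc k) < \<epsilon>" using nat_approx_posE by blast
      obtain N where "\<And>n. N \<le> n \<Longrightarrow> \<bar>F n z - f z\<bar> < 1 / real (Suc k)" using r by blast
      then show "\<exists>no. \<forall>n\<ge>no. norm (F n z - f z) < \<epsilon>" using k by (intro exI[of _ N]) fastforce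
    qed
  qed
  have "{z \<in> space lebesgue. \<not> (\<forall>k. \<exists>N. \<forall>n. N \<le> n \<longrightarrow> \<bar>F n z - f z\<bar> < 1 / real (Suc k))} \<in> sets lebesgue"
    by measurable
  then show ?thesis unfolding eq space_completion space_lborel space_borel by (simp only: UNIV_I simp_thms)
qed

context stable_layer
begin

lemma integrable_indicator_ball: "integrable HM (\<lambda>z. indicator (ball 0 R) z :: real)"
proof -
  have "ball 0 R \<inter> half_space \<in> sets (lborel :: point measure)" using half_space_sets(2) by auto
  then have "integrable lborel (indicator (ball (0::point) R \<inter> half_space) :: point \<Rightarrow> real)"
    using emeasure_lborel_ball_finite[of "0::point" R]
    by (intro integrable_real_indicator) (auto intro: le_less_trans[OF emeasure_mono])
  then have "integrable lebesgue (indicator (ball (0::point) R \<inter> half_space) :: point \<Rightarrow> real)"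
    by (simp add: integrable_completion)
  then show ?thesis unfolding HM_integrable_iff set_integrable_def
    by (rule Bochner_Integration.integrable_cong[THEN iffD1, rotated -1]) (auto simp: indicator_def)
qed

lemma integrable_indicator_disc: "integrable lebesgue (\<lambda>y::real^2. indicator (ball 0 R) y :: real)"
  using lmeasurable_ball[of "0::real^2" R] by (intro integrable_real_indicator) (auto simp: fmeasurable_def less_top)

lemma integrable_mu_DG: assumes "norm e = 1" "0 < R"
  shows "integrable HM (\<lambda>z. \<mu> (snd z) * (norm (DG e n z))\<^sup>2 * indicator (ball 0 R) z)"
proof (rule HM_integrable_bound)
  let ?B = "\<lambda>z. \<mu> (snd z) * (norm (G z))\<^sup>2 * indicator (ball 0 (R + 1)) z"
  let ?N = "real (Suc n)"
  have R1: "0 < R + 1" using assms by simp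
  show "integrable HM (\<lambda>z. 2 * ?N\<^sup>2 * ?B (z + (step e n, 0)) + 2 * ?N\<^sup>2 * ?B z)"
    using integrable_mu_G[OF R1] HM_shift_integrable[OF integrable_mu_G[OF R1], of "step e n"]
    by (intro Bochner_Integration.integrable_add integrable_mult_right)
  show "(\<lambda>z. \<mu> (snd z) * (norm (DG e n z))\<^sup>2 * indicator (ball 0 R) z) \<in> borel_measurable HM"
    using HM_measurable_continuous[OF DG_continuous] by measurable
  fix z assume z: "z \<in> half_space"
  have mu: "0 \<le> \<mu> (snd z)" by (rule mu_nonneg[OF z])
  show "\<bar>\<mu> (snd z) * (norm (DG e n z))\<^sup>2 * indicator (ball 0 R) z\<bar> \<le> 2 * ?N\<^sup>2 * ?B (z + (step e n, 0)) + 2 * ?N\<^sup>2 * ?B z"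
  proof (cases "z \<in> ball 0 R")
    case True
    have "norm (step e n) = 1 / ?N" using assms by (simp add: step_def divide_inverse del: of_nat_Suc)
    then have "norm (step e n) \<le> 1" by simp
    then have b: "z + (step e n, 0) \<in> ball 0 (R + 1)" "z \<in> ball 0 (R + 1)"
      using True norm_triangle_ineq[of z "(step e n, 0)"] by (auto simp: norm_Pair)
    have "(norm (DG e n z))\<^sup>2 = ?N\<^sup>2 * (norm (G (z + (step e n, 0)) + (- G z)))\<^sup>2"
      by (simp add: DG_def power_mult_distrib del: of_nat_Suc)
    also have "\<dots> \<le> ?N\<^sup>2 * (2 * (norm (G (z + (step e n, 0))))\<^sup>2 + 2 * (norm (- G z))\<^sup>2)"
      by (intro mult_left_mono norm_add_sq_le) auto
    finally have "\<mu> (snd z) * (norm (DG e n z))\<^sup>2 \<le> \<mu> (snd z) * (?N\<^sup>2 * (2 * (norm (G (z + (step e n, 0))))\<^sup>2 + 2 * (norm (G z))\<^sup>2))"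
      using mu by (intro mult_left_mono) auto
    then show ?thesis using b True mu by (simp add: algebra_simps del: of_nat_Suc)
  next
    case False
    have "0 \<le> ?B (z + (step e n, 0))" "0 \<le> ?B z"
      using mu by (auto intro!: mult_nonneg_nonneg)
    then show ?thesis using False by (simp del: of_nat_Suc)
  qed
qed

lemma test_Dq:
  assumes e: "norm e = 1" and co: "cutoff R \<Phi> \<Phi>g"
  shows "test R (\<lambda>z. Dq e n z * \<Phi> z) (\<lambda>z. \<Phi> z *\<^sub>R DG e n z + Dq e n z *\<^sub>R \<Phi>g z)
     (\<lambda>y. real (Suc n) * (U (y + step e n) - U y) * \<Phi> (y, 0))"
proof -
  have R: "0 < R" using co by (simp add: cutoff_def)
  obtain C where C: "C \<ge> 0" "\<And>n z. z \<in> half_ball R \<Longrightarrow> \<bar>Dq e n z\<bar> \<le> C" "\<And>z. z \<in> half_ball R \<Longrightarrow> \<bar>V e z\<bar> \<le> C"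
    "\<And>n y. norm y < R \<Longrightarrow> \<bar>real (Suc n) * (U (y + step e n) - U y)\<bar> \<le> C"
    by (rule Dq_bound[OF e R]) (rule that)
  have T: "AE y in lebesgue. ((\<lambda>x. Dq e n (y, x)) \<longlongrightarrow> real (Suc n) * (U (y + step e n) - U y)) (at_right 0)"
    unfolding Dq_def by (intro AE_I2) (auto intro!: tendsto_intros U_lim simp del: of_nat_Suc)
  show ?thesis
    by (rule test_mult[OF co GDERIV_Dq DG_continuous C(2) integrable_mu_DG[OF e R] T])
qed

text \<open>The differenced equation is tested with \<open>Dq e n\<close> times a squared cutoff.
  The bound on the horizontal gradient bounds \<open>Dq e n\<close> uniformly in \<open>n\<close>,
  and local Lipschitz constants of \<open>f\<close> and \<open>g\<close> then bound the boundary
  term and the zeroth order term.\<close>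

lemma caccioppoli_uniform:
  assumes e: "norm e = 1" and co: "cutoff R \<Phi> \<Phi>g"
  obtains K where "\<And>n. integrable HM (\<lambda>z. \<mu> (snd z) * (\<Phi> z)\<^sup>2 * (norm (DG e n z))\<^sup>2)"
    "\<And>n. (\<integral>z. \<mu> (snd z) * (\<Phi> z)\<^sup>2 * (norm (DG e n z))\<^sup>2 \<partial>HM) \<le> K"
proof -
  have c: "\<And>z. 0 \<le> \<Phi> z" "\<And>z. \<Phi> z \<le> 1" "0 < R"
    "\<And>z. z \<notin> ball 0 R \<Longrightarrow> \<Phi> z = 0" "\<And>z. z \<notin> ball 0 R \<Longrightarrow> \<Phi>g z = 0"
    using co unfolding cutoff_def by blast+
  have sq: "(\<Phi> z)\<^sup>2 \<le> 1" for z using c(1,2)[of z] by (simp add: power_le_one)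
  obtain C where C: "C \<ge> 0" "\<And>n z. z \<in> half_ball R \<Longrightarrow> \<bar>Dq e n z\<bar> \<le> C" "\<And>z. z \<in> half_ball R \<Longrightarrow> \<bar>V e z\<bar> \<le> C"
    "\<And>n y. norm y < R \<Longrightarrow> \<bar>real (Suc n) * (U (y + step e n) - U y)\<bar> \<le> C"
    by (rule Dq_bound[OF e c(3)]) (rule that)
  obtain Cg where Cg: "Cg \<ge> 0" "\<And>x s t. 0 < x \<Longrightarrow> x < R \<Longrightarrow> \<bar>s\<bar> \<le> uB \<Longrightarrow> \<bar>t\<bar> \<le> uB \<Longrightarrow> \<bar>g x s - g x t\<bar> \<le> Cg * \<bar>s - t\<bar>"
    using g_lipschitz[OF c(3)] by blast
  obtain Lf where Lf: "Lf \<ge> 0" "\<And>s t. \<bar>s\<bar> \<le> uB \<Longrightarrow> \<bar>t\<bar> \<le> uB \<Longrightarrow> \<bar>f s - f t\<bar> \<le> Lf * \<bar>s - t\<bar>"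
    using f_lipschitz by blast
  obtain L where L: "L \<ge> 0" "\<And>z. norm (\<Phi>g z) \<le> L" using cutoff_bound[OF co] by blast
  have iC: "integrable HM (\<lambda>z. \<mu> (snd z) * (C\<^sup>2 * L\<^sup>2 * indicator (ball 0 R) z))"
    by (rule integrable_mu_bounded[where R = R and C = "C\<^sup>2 * L\<^sup>2"]) (use c(3) in auto)
  define K where "K = 2 * ((\<integral>y. Lf * C * C * indicator (ball 0 R) (y::real^2) \<partial>lebesgue) + (\<integral>z. Cg * C * C * indicator (ball 0 R) z \<partial>HM))
     + 4 * (\<integral>z. \<mu> (snd z) * (C\<^sup>2 * L\<^sup>2 * indicator (ball 0 R) z) \<partial>HM)"
  have main: "integrable HM (\<lambda>z. \<mu> (snd z) * (\<Phi> z)\<^sup>2 * (norm (DG e n z))\<^sup>2) \<and> (\<integral>z. \<mu> (snd z) * (\<Phi> z)\<^sup>2 * (norm (DG e n z))\<^sup>2 \<partial>HM) \<le> K" for n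
  proof
    let ?N = "real (Suc n)"
    let ?X = "\<lambda>z. (\<Phi> z)\<^sup>2 *\<^sub>R DG e n z + Dq e n z *\<^sub>R ((2 * \<Phi> z) *\<^sub>R \<Phi>g z)"
    let ?\<xi> = "\<lambda>z. Dq e n z * (\<Phi> z)\<^sup>2"
    note d = diff_eq[OF test_Dq[OF e cutoff_sq[OF co], of n], where e = e and n = n]
    show i: "integrable HM (\<lambda>z. \<mu> (snd z) * (\<Phi> z)\<^sup>2 * (norm (DG e n z))\<^sup>2)"
    proof (rule HM_integrable_bound[OF integrable_mu_DG[OF e c(3), of n]])
      show "(\<lambda>z. \<mu> (snd z) * (\<Phi> z)\<^sup>2 * (norm (DG e n z))\<^sup>2) \<in> borel_measurable HM"
        using HM_measurable_continuous[OF DG_continuous[of e n]] HM_measurable_continuous[OF cutoff_continuous[OF co]] by measurable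
      fix z assume z: "z \<in> half_space"
      show "\<bar>\<mu> (snd z) * (\<Phi> z)\<^sup>2 * (norm (DG e n z))\<^sup>2\<bar> \<le> \<mu> (snd z) * (norm (DG e n z))\<^sup>2 * indicator (ball 0 R) z"
      proof (cases "z \<in> ball 0 R")
        case True
        have "\<mu> (snd z) * (norm (DG e n z))\<^sup>2 * (\<Phi> z)\<^sup>2 \<le> \<mu> (snd z) * (norm (DG e n z))\<^sup>2 * 1"
          using sq[of z] mu_nonneg[OF z] by (intro mult_left_mono) auto
        then show ?thesis using True mu_nonneg[OF z] by (simp add: mult_ac)
      qed (use c(4) in simp)
    qed
    have pt: "\<mu> (snd z) * (\<Phi> z)\<^sup>2 * (norm (DG e n z))\<^sup>2 \<le> 2 * (\<mu> (snd z) * (DG e n z \<bullet> ?X z)) + 4 * (\<mu> (snd z) * (C\<^sup>2 * L\<^sup>2 * indicator (ball 0 R) z))"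
      if z: "z \<in> half_space" for z
    proof (cases "z \<in> ball 0 R")
      case True
      define a where "a = \<Phi> z *\<^sub>R DG e n z"
      define b where "b = Dq e n z *\<^sub>R \<Phi>g z"
      have "\<bar>Dq e n z\<bar> \<le> C" using C(2)[of z n] True z by (simp add: half_ball_def)
      then have "norm b \<le> C * L" unfolding b_def norm_scaleR using C(1) L by (intro mult_mono) auto
      then have b2: "(norm b)\<^sup>2 \<le> C\<^sup>2 * L\<^sup>2" using power_mono[of "norm b" "C * L" 2] by (simp add: power_mult_distrib)
      \<comment> \<open>This square absorbs the mixed term: the tested gradient is the square of
        \<open>a\<close> plus twice its product with \<open>b\<close>. The factors 2 and 4 in
        \<open>K\<close> originate here.\<close>
      have "0 \<le> (norm (a + 2 *\<^sub>R b))\<^sup>2" by simp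
      also have "\<dots> = (norm a)\<^sup>2 + 4 * (a \<bullet> b) + 4 * (norm b)\<^sup>2"
        by (simp add: power2_norm_eq_inner inner_add_left inner_add_right inner_commute)
      finally have 1: "(norm a)\<^sup>2 \<le> 2 * ((norm a)\<^sup>2 + 2 * (a \<bullet> b)) + 4 * (norm b)\<^sup>2" by simp
      have 2: "DG e n z \<bullet> ?X z = (norm a)\<^sup>2 + 2 * (a \<bullet> b)"
        unfolding power2_norm_eq_inner a_def b_def by (simp add: inner_add_right) (simp add: power2_eq_square)
      have 3: "(norm a)\<^sup>2 = (\<Phi> z)\<^sup>2 * (norm (DG e n z))\<^sup>2" by (simp add: a_def power_mult_distrib)
      have lin: "w \<le> 2 * x + 4 * k" if "p \<le> 2 * (p + 2 * q) + 4 * s" "x = p + 2 * q" "p = w" "s \<le> k" for p q s x w k :: real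
        using that by simp
      have "(\<Phi> z)\<^sup>2 * (norm (DG e n z))\<^sup>2 \<le> 2 * (DG e n z \<bullet> ?X z) + 4 * (C\<^sup>2 * L\<^sup>2)"
        by (rule lin[OF 1 2 3 b2])
      then have "\<mu> (snd z) * ((\<Phi> z)\<^sup>2 * (norm (DG e n z))\<^sup>2) \<le> \<mu> (snd z) * (2 * (DG e n z \<bullet> ?X z) + 4 * (C\<^sup>2 * L\<^sup>2))"
        by (intro mult_left_mono mu_nonneg[OF z])
      then show ?thesis using True by (simp add: algebra_simps)
    qed (use c(4,5) in simp)
    have "(\<integral>z. \<mu> (snd z) * (\<Phi> z)\<^sup>2 * (norm (DG e n z))\<^sup>2 \<partial>HM)
        \<le> (\<integral>z. 2 * (\<mu> (snd z) * (DG e n z \<bullet> ?X z)) + 4 * (\<mu> (snd z) * (C\<^sup>2 * L\<^sup>2 * indicator (ball 0 R) z)) \<partial>HM)"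
      by (rule integral_mono[OF i]) (use d(1) iC pt in auto)
    also have "\<dots> = 2 * (\<integral>z. \<mu> (snd z) * (DG e n z \<bullet> ?X z) \<partial>HM) + 4 * (\<integral>z. \<mu> (snd z) * (C\<^sup>2 * L\<^sup>2 * indicator (ball 0 R) z) \<partial>HM)"
      using d(1) iC by (subst Bochner_Integration.integral_add) auto
    also have "(\<integral>z. \<mu> (snd z) * (DG e n z \<bullet> ?X z) \<partial>HM)
       = (\<integral>y. ?N * (f (U (y + step e n)) - f (U y)) * (?N * (U (y + step e n) - U y) * (\<Phi> (y, 0))\<^sup>2) \<partial>lebesgue)
         - (\<integral>z. ?N * (g (snd z) (u (z + (step e n, 0))) - g (snd z) (u z)) * ?\<xi> z \<partial>HM)"
      using d(4) by simp
    finally have s1: "(\<integral>z. \<mu> (snd z) * (\<Phi> z)\<^sup>2 * (norm (DG e n z))\<^sup>2 \<partial>HM) \<le> 2 * ((\<integral>y. ?N * (f (U (y + step e n)) - f (U y)) * (?N * (U (y + step e n) - U y) * (\<Phi> (y, 0))\<^sup>2) \<partial>lebesgue)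
         - (\<integral>z. ?N * (g (snd z) (u (z + (step e n, 0))) - g (snd z) (u z)) * ?\<xi> z \<partial>HM)) + 4 * (\<integral>z. \<mu> (snd z) * (C\<^sup>2 * L\<^sup>2 * indicator (ball 0 R) z) \<partial>HM)" .
    have s2: "(\<integral>y. ?N * (f (U (y + step e n)) - f (U y)) * (?N * (U (y + step e n) - U y) * (\<Phi> (y, 0))\<^sup>2) \<partial>lebesgue)
       \<le> (\<integral>y. Lf * C * C * indicator (ball 0 R) (y::real^2) \<partial>lebesgue)"
    proof (rule integral_mono[OF d(3)])
      fix y :: "real^2"
      show "?N * (f (U (y + step e n)) - f (U y)) * (?N * (U (y + step e n) - U y) * (\<Phi> (y, 0))\<^sup>2) \<le> Lf * C * C * indicator (ball 0 R) y"
      proof (cases "y \<in> ball 0 R")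
        case True
        have q: "\<bar>?N * (U (y + step e n) - U y)\<bar> \<le> C" using C(4)[of y n] True by simp
        have "\<bar>?N * (f (U (y + step e n)) - f (U y))\<bar> \<le> ?N * (Lf * \<bar>U (y + step e n) - U y\<bar>)"
          unfolding abs_mult using Lf(2)[OF U_bound U_bound, of "y + step e n" y] by (simp del: of_nat_Suc)
        also have "\<dots> = Lf * \<bar>?N * (U (y + step e n) - U y)\<bar>" by (simp add: abs_mult del: of_nat_Suc)
        also have "\<dots> \<le> Lf * C" using q Lf(1) by (rule mult_left_mono)
        finally have "\<bar>?N * (f (U (y + step e n)) - f (U y)) * (?N * (U (y + step e n) - U y) * (\<Phi> (y, 0))\<^sup>2)\<bar> \<le> (Lf * C) * (C * 1)"
          unfolding abs_mult[of "?N * (f (U (y + step e n)) - f (U y))"] abs_mult[of _ "(\<Phi> (y, 0))\<^sup>2"]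
          using q sq[of "(y, 0)"] C(1) Lf(1) by (intro mult_mono) auto
        then show ?thesis using True by simp
      next
        case False
        then have "(y, 0::real) \<notin> ball 0 R" by (simp add: norm_Pair)
        then have "\<Phi> (y, 0) = 0" by (rule c(4))
        then show ?thesis using False by simp
      qed
    qed (use integrable_indicator_disc in simp)
    have s3: "- (\<integral>z. ?N * (g (snd z) (u (z + (step e n, 0))) - g (snd z) (u z)) * ?\<xi> z \<partial>HM) \<le> (\<integral>z. Cg * C * C * indicator (ball 0 R) z \<partial>HM)"
    proof -
      have "\<bar>\<integral>z. ?N * (g (snd z) (u (z + (step e n, 0))) - g (snd z) (u z)) * ?\<xi> z \<partial>HM\<bar>
         \<le> (\<integral>z. \<bar>?N * (g (snd z) (u (z + (step e n, 0))) - g (snd z) (u z)) * ?\<xi> z\<bar> \<partial>HM)" by (rule integral_abs_bound)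
      also have "\<dots> \<le> (\<integral>z. Cg * C * C * indicator (ball 0 R) z \<partial>HM)"
      proof (rule integral_mono)
        fix z assume "z \<in> space HM"
        then have z: "z \<in> half_space" by simp
        show "\<bar>?N * (g (snd z) (u (z + (step e n, 0))) - g (snd z) (u z)) * ?\<xi> z\<bar> \<le> Cg * C * C * indicator (ball 0 R) z"
        proof (cases "z \<in> ball 0 R")
          case True
          have q: "\<bar>Dq e n z\<bar> \<le> C" using C(2)[of z n] True z by (simp add: half_ball_def)
          have zx: "0 < snd z" "snd z < R" using z ball_subset_cylinder[OF True] by (auto simp: half_space_def)
          have "\<bar>?N * (g (snd z) (u (z + (step e n, 0))) - g (snd z) (u z))\<bar> \<le> ?N * (Cg * \<bar>u (z + (step e n, 0)) - u z\<bar>)"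
            unfolding abs_mult using Cg(2)[OF zx uB(2) uB(2), of "z + (step e n, 0)" z] z by (simp del: of_nat_Suc)
          also have "\<dots> = Cg * \<bar>Dq e n z\<bar>" by (simp add: Dq_def abs_mult del: of_nat_Suc)
          also have "\<dots> \<le> Cg * C" using q Cg(1) by (rule mult_left_mono)
          finally have "\<bar>?N * (g (snd z) (u (z + (step e n, 0))) - g (snd z) (u z)) * ?\<xi> z\<bar> \<le> (Cg * C) * (C * 1)"
            unfolding abs_mult[of "?N * (g (snd z) (u (z + (step e n, 0))) - g (snd z) (u z))"] abs_mult[of _ "(\<Phi> z)\<^sup>2"]
            using q sq[of z] C(1) Cg(1) by (intro mult_mono) auto
          then show ?thesis using True by simp
        next
          case False
          then show ?thesis using c(4)[OF False] by simp
        qed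
      qed (use d(2) integrable_indicator_ball in auto)
      finally show ?thesis by linarith
    qed
    have lin: "a \<le> 2 * (j + k) + 4 * w" if "a \<le> 2 * (x - y) + 4 * w" "x \<le> j" "- y \<le> k" for a j k w x y :: real
      using that by argo
    show "(\<integral>z. \<mu> (snd z) * (\<Phi> z)\<^sup>2 * (norm (DG e n z))\<^sup>2 \<partial>HM) \<le> K"
      unfolding K_def by (rule lin[OF s1 s2 s3])
  qed
  then show thesis using that by blast
qed

lemma caccioppoli:
  assumes e: "norm e = 1" and co: "cutoff R \<Phi> \<Phi>g"
  shows "integrable HM (\<lambda>z. \<mu> (snd z) * (\<Phi> z)\<^sup>2 * (norm (HE e z))\<^sup>2)"
proof -
  obtain K where K: "\<And>n. integrable HM (\<lambda>z. \<mu> (snd z) * (\<Phi> z)\<^sup>2 * (norm (DG e n z))\<^sup>2)"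
    "\<And>n. (\<integral>z. \<mu> (snd z) * (\<Phi> z)\<^sup>2 * (norm (DG e n z))\<^sup>2 \<partial>HM) \<le> K" by (rule caccioppoli_uniform[OF e co]) (rule that)
  show ?thesis
  proof (rule integrable_Fatou[OF K(1) _ K(2)])
    fix z assume "z \<in> space HM"
    then have z: "z \<in> half_space" by simp
    show "0 \<le> \<mu> (snd z) * (\<Phi> z)\<^sup>2 * (norm (DG e n z))\<^sup>2" for n using mu_nonneg[OF z] by simp
    show "(\<lambda>n. \<mu> (snd z) * (\<Phi> z)\<^sup>2 * (norm (DG e n z))\<^sup>2) \<longlonglongrightarrow> \<mu> (snd z) * (\<Phi> z)\<^sup>2 * (norm (HE e z))\<^sup>2"
      by (intro tendsto_intros DG_lim z)
  qed
qed

lemma integrable_mu_HE: assumes e: "norm e = 1" and R: "0 < R"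
  shows "integrable HM (\<lambda>z. \<mu> (snd z) * (norm (HE e z))\<^sup>2 * indicator (ball 0 R) z)"
proof (rule HM_integrable_bound[OF caccioppoli[OF e cutoff_cut[OF R]]])
  show "(\<lambda>z. \<mu> (snd z) * (norm (HE e z))\<^sup>2 * indicator (ball 0 R) z) \<in> borel_measurable HM"
    using HM_measurable_continuous[OF HE_continuous[of e]] by measurable
  fix z assume z: "z \<in> half_space"
  show "\<bar>\<mu> (snd z) * (norm (HE e z))\<^sup>2 * indicator (ball 0 R) z\<bar> \<le> \<mu> (snd z) * (cut R z)\<^sup>2 * (norm (HE e z))\<^sup>2"
    using mu_nonneg[OF z] cut_eq_1[of z R] by (cases "z \<in> ball 0 R") (auto simp: abs_mult)
qed

definition Vt :: "real^2 \<Rightarrow> real^2 \<Rightarrow> real" where "Vt e = trace0 (V e)"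

lemma Vt_lim: assumes "norm e = 1" shows "AE y in lebesgue. ((\<lambda>x. V e (y, x)) \<longlongrightarrow> Vt e y) (at_right 0)"
proof -
  have "AE y in lebesgue. \<exists>l. ((\<lambda>x. V e (y, x)) \<longlongrightarrow> l) (at_right 0)"
    by (rule trace_exists_AE[OF GDERIV_V HE_continuous integrable_mu_HE[OF assms]])
  then show ?thesis
  proof eventually_elim
    case (elim y)
    then show ?case unfolding Vt_def using trace0_eqI by blast
  qed
qed

lemma at_right_seq: "filterlim (\<lambda>k. inverse (real (Suc k))) (at_right 0) sequentially"
  by (rule tendsto_imp_filterlim_at_right[OF LIMSEQ_inverse_real_of_nat]) simp

lemma V_line_continuous: "0 < x \<Longrightarrow> continuous_on UNIV (\<lambda>y. V e (y, x))"
  by (rule continuous_on_compose2[OF V_continuous]) (auto intro!: continuous_intros)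

lemma Vt_measurable: assumes "norm e = 1" shows "Vt e \<in> borel_measurable lebesgue"
proof -
  have m: "(\<lambda>y. lim (\<lambda>k. V e (y, inverse (real (Suc k))))) \<in> borel_measurable lebesgue"
  proof (rule borel_measurable_lim_metric)
    show "(\<lambda>y. V e (y, inverse (real (Suc k)))) \<in> borel_measurable lebesgue" for k
      by (rule measurable_completion, simp, rule borel_measurable_continuous_onI, rule V_line_continuous) simp
  qed
  have "AE y in lebesgue. lim (\<lambda>k. V e (y, inverse (real (Suc k)))) = Vt e y"
    using Vt_lim[OF assms]
  proof eventually_elim
    case (elim y)
    from filterlim_compose[OF elim at_right_seq] show ?case by (rule limI)
  qed
  from borel_measurable_AE[OF m this] show ?thesis .
qed

end

subsection \<open>The linearized equation\<close>

lemma abs_mult_inner_le: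
  fixes a b :: "'a::euclidean_space"
  assumes "0 \<le> w" shows "\<bar>w * (a \<bullet> b)\<bar> \<le> w * (norm a)\<^sup>2 + w * (norm b)\<^sup>2"
proof -
  have "\<bar>a \<bullet> b\<bar> \<le> norm a * norm b" by (rule Cauchy_Schwarz_ineq2)
  also have "\<dots> \<le> (norm a)\<^sup>2 + (norm b)\<^sup>2"
    using sum_squares_bound[of "norm a" "norm b"] mult_nonneg_nonneg[OF norm_ge_zero[of a] norm_ge_zero[of b]] by linarith
  finally have "w * \<bar>a \<bullet> b\<bar> \<le> w * ((norm a)\<^sup>2 + (norm b)\<^sup>2)" using assms by (intro mult_left_mono) auto
  then show ?thesis using assms by (simp add: abs_mult distrib_left)
qed

context stable_layer
begin

text \<open>On a horizontal line \<open>g (snd z)\<close> is a single function of one variable,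
  differentiable off a null set \<open>N\<close>. Parameters at which \<open>u\<close> takes a value
  in \<open>N\<close> with nonzero derivative along the line form a null set. Where that derivative
  is 0, both sides vanish by the Lipschitz bound, whatever value \<open>c\<close> has there.\<close>

lemma chain_g:
  assumes e: "norm e = 1"
  shows "AE z in lebesgue. z \<in> half_space \<longrightarrow>
    (\<lambda>n. real (Suc n) * (g (snd z) (u (z + (step e n, 0))) - g (snd z) (u z))) \<longlonglongrightarrow> c z * V e z"
proof -
  define Fn where "Fn n z = indicator half_space z *\<^sub>R (real (Suc n) * (g (snd z) (u (z + (step e n, 0))) - g (snd z) (u z)))" for n z
  define F where "F z = indicator half_space z *\<^sub>R (c z * V e z)" for z
  have Fn_m: "Fn n \<in> borel_measurable lebesgue" for n
    unfolding Fn_def[abs_def] HM_measurable_iff[symmetric]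
  proof -
    have "(\<lambda>z. g (snd z) (u (z + (step e n, 0)))) \<in> borel_measurable HM"
      using HM_shift_measurable[OF gu_measurable, of "step e n"] by simp
    then show "(\<lambda>z. real (Suc n) * (g (snd z) (u (z + (step e n, 0))) - g (snd z) (u z))) \<in> borel_measurable HM"
      by (intro borel_measurable_times borel_measurable_const borel_measurable_diff gu_measurable)
  qed
  have F_m: "F \<in> borel_measurable lebesgue"
    unfolding F_def[abs_def] HM_measurable_iff[symmetric]
    using c_measurable HM_measurable_continuous[OF V_continuous[of e]] by measurable
  define S where "S = {z. \<not> (\<lambda>n. Fn n z) \<longlonglongrightarrow> F z}"
  have "negligible S"
  proof (rule negligible_lines[where e = "(e, 0)"])
    show "S \<in> sets lebesgue" unfolding S_def by (rule LIMSEQ_set_measurable[OF Fn_m F_m])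
    show "AE z in lebesgue. negligible {t. z + t *\<^sub>R (e, 0) \<in> S}"
    proof (rule AE_I2)
      fix z :: point
      show "negligible {t. z + t *\<^sub>R (e, 0) \<in> S}"
      proof (cases "z \<in> half_space")
        case False
        then have "{t. z + t *\<^sub>R (e, 0) \<in> S} = {}" by (auto simp: S_def Fn_def F_def half_space_def)
        then show ?thesis by (simp only: negligible_empty)
      next
        case True
        then have x: "0 < snd z" by (simp add: half_space_def)
        define \<phi> where "\<phi> t = u (z + t *\<^sub>R (e, 0))" for t
        have zt: "z + t *\<^sub>R (e, 0) \<in> half_space" for t using x by (simp add: half_space_def)
        have d\<phi>: "(\<phi> has_real_derivative V e (z + t *\<^sub>R (e, 0))) (at t)" for t
          unfolding \<phi>_def[abs_def] V_eq by (rule GDERIV_line[OF G[OF zt]])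
        define N where "N = {t. \<not> (g (snd z) has_real_derivative deriv (g (snd z)) t) (at t)}"
        have nN: "negligible N" unfolding N_def by (rule negligible_not_differentiable_locally_lipschitz[OF g_lip[OF x]])
        have "{t. z + t *\<^sub>R (e, 0) \<in> S} \<subseteq> {t. \<phi> t \<in> N \<and> (\<exists>D. D \<noteq> 0 \<and> (\<phi> has_real_derivative D) (at t))}"
        proof (rule subsetI, rule ccontr)
          fix t assume tS: "t \<in> {t. z + t *\<^sub>R (e, 0) \<in> S}" and tn: "t \<notin> {t. \<phi> t \<in> N \<and> (\<exists>D. D \<noteq> 0 \<and> (\<phi> has_real_derivative D) (at t))}"
          define z' where "z' = z + t *\<^sub>R (e, 0)"
          have z': "z' \<in> half_space" "snd z' = snd z" "\<phi> t = u z'" using zt by (auto simp: z'_def \<phi>_def)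
          have lim: "(\<lambda>n. real (Suc n) * (u (z' + (step e n, 0)) - u z')) \<longlonglongrightarrow> V e z'"
            using Dq_lim[OF z'(1), of e] unfolding Dq_def .
          have "(\<lambda>n. real (Suc n) * (g (snd z') (u (z' + (step e n, 0))) - g (snd z') (u z'))) \<longlonglongrightarrow> c z' * V e z'"
          proof (cases "\<phi> t \<in> N")
            case False
            then have "(g (snd z') has_real_derivative c z') (at (u z'))" using z' by (simp add: N_def)
            then show ?thesis using lim by (rule LIMSEQ_difference_quotient)
          next
            case True
            then have "V e z' = 0" using tn d\<phi>[of t] by (auto simp: z'_def)
            then show ?thesis using LIMSEQ_difference_quotient_0[OF g_lip, of "snd z'" "\<lambda>n. u (z' + (step e n, 0))" "u z'"] lim x z'(2) by simp
          qed
          then have "(\<lambda>n. Fn n z') \<longlonglongrightarrow> F z'" using z'(1) by (simp add: Fn_def F_def)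
          then show False using tS by (simp add: S_def z'_def)
        qed
        then show ?thesis using negligible_vimage_DERIV_nonzero[OF nN] negligible_subset by blast
      qed
    qed
  qed
  then have "AE z in lebesgue. (\<lambda>n. Fn n z) \<longlonglongrightarrow> F z" unfolding S_def by (rule AE_completeI)
  then show ?thesis
  proof (eventually_elim, intro impI)
    fix z assume "(\<lambda>n. Fn n z) \<longlonglongrightarrow> F z" "z \<in> half_space"
    then show "(\<lambda>n. real (Suc n) * (g (snd z) (u (z + (step e n, 0))) - g (snd z) (u z))) \<longlonglongrightarrow> c z * V e z"
      unfolding Fn_def F_def by (simp del: of_nat_Suc)
  qed
qed

text \<open>On almost every line the derivatives of \<open>u\<close> at the heights
  \<open>x k\<close> converge to \<open>Vt e\<close> off a null set of parameters and under a common
  bound. So the fundamental theorem of calculus survives as the height tends to 0 and exhibits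
  \<open>Vt e\<close> as the derivative of \<open>U\<close>.\<close>

lemma U_line:
  assumes e: "norm e = 1"
  shows "AE y in lebesgue. \<forall>a b. a \<le> b \<longrightarrow> ((\<lambda>t. Vt e (y + t *\<^sub>R e)) has_integral (U (y + b *\<^sub>R e) - U (y + a *\<^sub>R e))) {a..b}"
  using AE_lebesgue_lines[OF Vt_lim[OF e], of e]
proof eventually_elim
  case (elim y)
  show ?case
  proof (intro allI impI)
    fix a b :: real assume ab: "a \<le> b"
    define N where "N = {t. \<not> ((\<lambda>x. V e (y + t *\<^sub>R e, x)) \<longlongrightarrow> Vt e (y + t *\<^sub>R e)) (at_right 0)}"
    have N: "negligible N"
      using elim unfolding N_def by (simp add: negligible_iff_null_sets AE_iff_null_sets[symmetric] completion.AE_iff_null_sets)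
    define x where "x k = inverse (real (Suc k))" for k
    have x: "0 < x k" "x k \<le> 1" for k by (auto simp: x_def divide_simps)
    define r where "r = norm y + \<bar>a\<bar> + \<bar>b\<bar> + 3"
    have "0 < r" using norm_ge_zero[of y] unfolding r_def by linarith
    then obtain C where C: "C \<ge> 0" "\<And>z. z \<in> half_ball r \<Longrightarrow> norm (fst (G z)) \<le> C" using grad_y_bound by blast
    have bd: "\<bar>V e (y + t *\<^sub>R e, x k)\<bar> \<le> C" if t: "t \<in> {a..b}" for t k
    proof -
      have "norm (y + t *\<^sub>R e) \<le> norm y + \<bar>t\<bar>" using norm_triangle_ineq[of y "t *\<^sub>R e"] e by simp
      moreover have "norm (y + t *\<^sub>R e, x k) \<le> norm (y + t *\<^sub>R e) + x k" using norm_Pair_le[of "y + t *\<^sub>R e" "x k"] x(1)[of k] by simp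
      ultimately have "(y + t *\<^sub>R e, x k) \<in> half_ball r" using t x[of k] by (auto simp: half_ball_def r_def)
      then have "norm (fst (G (y + t *\<^sub>R e, x k))) \<le> C" by (rule C)
      then show ?thesis using Cauchy_Schwarz_ineq2[of e "fst (G (y + t *\<^sub>R e, x k))"] e by (simp add: V_def)
    qed
    have ftc: "((\<lambda>t. V e (y + t *\<^sub>R e, x k)) has_integral (u (y + b *\<^sub>R e, x k) - u (y + a *\<^sub>R e, x k))) {a..b}" for k
    proof (rule fundamental_theorem_of_calculus[OF ab])
      fix t
      have "((\<lambda>t. u ((y, x k) + t *\<^sub>R (e, 0))) has_real_derivative (e, 0) \<bullet> G ((y, x k) + t *\<^sub>R (e, 0))) (at t)"
        using x(1)[of k] by (intro GDERIV_line G) simp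
      then have "((\<lambda>t. u (y + t *\<^sub>R e, x k)) has_real_derivative V e (y + t *\<^sub>R e, x k)) (at t)"
        by (simp add: V_def inner_prod_def)
      then show "((\<lambda>t. u (y + t *\<^sub>R e, x k)) has_vector_derivative V e (y + t *\<^sub>R e, x k)) (at t within {a..b})"
        by (simp add: has_real_derivative_iff_has_vector_derivative has_vector_derivative_at_within)
    qed
    have I: "((\<lambda>t. if t \<in> N then 0 else V e (y + t *\<^sub>R e, x k)) has_integral (u (y + b *\<^sub>R e, x k) - u (y + a *\<^sub>R e, x k))) {a..b}" for k
      by (rule has_integral_spike[OF N _ ftc[of k]]) auto
    have lims: "(\<lambda>k. w (x k)) \<longlonglongrightarrow> l" if "(w \<longlongrightarrow> l) (at_right 0)" for w :: "real \<Rightarrow> real" and l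
      using filterlim_compose[OF that at_right_seq] unfolding x_def .
    have "((\<lambda>t. if t \<in> N then 0 else Vt e (y + t *\<^sub>R e)) has_integral (U (y + b *\<^sub>R e) - U (y + a *\<^sub>R e))) {a..b}"
    proof (rule has_integral_dominated_convergence[OF I, where h = "\<lambda>t. C"])
      show "(\<lambda>t. C) integrable_on {a..b}" by (rule integrable_const_ivl)
      show "\<forall>t\<in>{a..b}. norm (if t \<in> N then 0 else V e (y + t *\<^sub>R e, x k)) \<le> C" for k using bd C(1) by auto
      show "\<forall>t\<in>{a..b}. (\<lambda>k. if t \<in> N then 0 else V e (y + t *\<^sub>R e, x k)) \<longlonglongrightarrow> (if t \<in> N then 0 else Vt e (y + t *\<^sub>R e))"
        using lims by (auto simp: N_def)
      show "(\<lambda>k. u (y + b *\<^sub>R e, x k) - u (y + a *\<^sub>R e, x k)) \<longlonglongrightarrow> U (y + b *\<^sub>R e) - U (y + a *\<^sub>R e)"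
        by (intro tendsto_diff lims U_lim)
    qed
    then show "((\<lambda>t. Vt e (y + t *\<^sub>R e)) has_integral (U (y + b *\<^sub>R e) - U (y + a *\<^sub>R e))) {a..b}"
      by (rule has_integral_spike[OF N, rotated]) auto
  qed
qed

lemma U_measurable: "U \<in> borel_measurable lebesgue" "(\<lambda>y. f (U y)) \<in> borel_measurable lebesgue"
  using U_continuous continuous_on_compose2[OF f_continuous U_continuous]
  by (auto intro!: measurable_completion borel_measurable_continuous_onI)

text \<open>As for \<open>g\<close>, except that \<open>Vt e\<close> is a trace and not yet a
  derivative of \<open>U\<close>: \<open>U_line\<close> and Lebesgue differentiation identify the
  two off a null set of parameters.\<close>

lemma chain_f:
  assumes e: "norm e = 1"
  shows "AE y in lebesgue. (\<lambda>n. real (Suc n) * (f (U (y + step e n)) - f (U y))) \<longlonglongrightarrow> deriv f (U y) * Vt e y"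
proof -
  define Fn where "Fn n y = real (Suc n) * (f (U (y + step e n)) - f (U y))" for n y
  define F where "F y = deriv f (U y) * Vt e y" for y
  have Fn_m: "Fn n \<in> borel_measurable lebesgue" for n
    unfolding Fn_def[abs_def] using U_measurable(2) borel_measurable_lebesgue_translation[OF U_measurable(2), of "step e n"] by measurable
  have F_m: "F \<in> borel_measurable lebesgue"
    unfolding F_def[abs_def] using fU'_measurable Vt_measurable[OF e] by measurable
  define S where "S = {y. \<not> (\<lambda>n. Fn n y) \<longlonglongrightarrow> F y}"
  define N where "N = {t. \<not> (f has_real_derivative deriv f t) (at t)}"
  have nN: "negligible N" unfolding N_def by (rule negligible_not_differentiable_locally_lipschitz[OF f_lip])
  have "negligible S"
  proof (rule negligible_lines[where e = e])
    show "S \<in> sets lebesgue" unfolding S_def by (rule LIMSEQ_set_measurable[OF Fn_m F_m])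
    show "AE y in lebesgue. negligible {t. y + t *\<^sub>R e \<in> S}"
      using U_line[OF e]
    proof eventually_elim
      case (elim y)
      define W where "W t = U (y + t *\<^sub>R e)" for t
      define h where "h t = Vt e (y + t *\<^sub>R e)" for t
      have n1: "negligible {t. \<not> (W has_real_derivative h t) (at t)}"
        by (rule negligible_not_DERIV_integral) (use elim in \<open>simp add: W_def h_def\<close>)
      have n2: "negligible {t. W t \<in> N \<and> (\<exists>D. D \<noteq> 0 \<and> (W has_real_derivative D) (at t))}"
        by (rule negligible_vimage_DERIV_nonzero[OF nN])
      have "{t. y + t *\<^sub>R e \<in> S} \<subseteq> {t. \<not> (W has_real_derivative h t) (at t)} \<union> {t. W t \<in> N \<and> (\<exists>D. D \<noteq> 0 \<and> (W has_real_derivative D) (at t))}"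
      proof (rule subsetI, rule ccontr)
        fix t assume tS: "t \<in> {t. y + t *\<^sub>R e \<in> S}"
          and "t \<notin> {t. \<not> (W has_real_derivative h t) (at t)} \<union> {t. W t \<in> N \<and> (\<exists>D. D \<noteq> 0 \<and> (W has_real_derivative D) (at t))}"
        then have d: "(W has_real_derivative h t) (at t)" and tn: "W t \<in> N \<Longrightarrow> h t = 0" by auto
        have "(\<lambda>n. real (Suc n) * (W (t + inverse (real (Suc n))) - W t)) \<longlonglongrightarrow> h t"
          using LIMSEQ_has_derivative[of W "(*) (h t)" t 1] d by (simp add: has_field_derivative_def)
        moreover have "W (t + inverse (real (Suc n))) = U (y + t *\<^sub>R e + step e n)" for n
          by (simp add: W_def step_def scaleR_add_left add.assoc)
        ultimately have lim: "(\<lambda>n. real (Suc n) * (U (y + t *\<^sub>R e + step e n) - U (y + t *\<^sub>R e))) \<longlonglongrightarrow> h t"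
          by (simp add: W_def)
        have "(\<lambda>n. Fn n (y + t *\<^sub>R e)) \<longlonglongrightarrow> F (y + t *\<^sub>R e)"
        proof (cases "W t \<in> N")
          case False
          then have "(f has_real_derivative deriv f (U (y + t *\<^sub>R e))) (at (U (y + t *\<^sub>R e)))" by (simp add: N_def W_def)
          from LIMSEQ_difference_quotient[OF this lim] show ?thesis by (simp add: Fn_def F_def h_def)
        next
          case True
          then have "h t = 0" by (rule tn)
          then show ?thesis using LIMSEQ_difference_quotient_0[OF f_lip, of "\<lambda>n. U (y + t *\<^sub>R e + step e n)" "U (y + t *\<^sub>R e)"] lim
            by (simp add: Fn_def F_def h_def)
        qed
        then show False using tS by (simp add: S_def)
      qed
      then show ?case using n1 n2 negligible_subset negligible_Un by blast
    qed
  qed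
  then have "AE y in lebesgue. (\<lambda>n. Fn n y) \<longlonglongrightarrow> F y" unfolding S_def by (rule AE_completeI)
  then show ?thesis by (simp add: Fn_def F_def)
qed

lemma Vt_bound:
  assumes e: "norm e = 1" and C: "\<And>z. z \<in> half_ball (R + 1) \<Longrightarrow> \<bar>V e z\<bar> \<le> C"
  shows "AE y in lebesgue. norm y < R \<longrightarrow> \<bar>Vt e y\<bar> \<le> C"
  using Vt_lim[OF e]
proof eventually_elim
  case (elim y)
  show ?case
  proof
    assume y: "norm y < R"
    show "\<bar>Vt e y\<bar> \<le> C"
    proof (rule tendsto_upperbound)
      show "((\<lambda>x. \<bar>V e (y, x)\<bar>) \<longlongrightarrow> \<bar>Vt e y\<bar>) (at_right 0)" by (intro tendsto_rabs elim)
      show "\<forall>\<^sub>F x in at_right 0. \<bar>V e (y, x)\<bar> \<le> C"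
        using eventually_at_right_0_1 by eventually_elim (intro C norm_point_less, use y in auto)
    qed (simp add: trivial_limit_at_right_real)
  qed
qed

text \<open>Limit of the differenced equation for a test function that does not depend on
  \<open>n\<close>. The terms with \<open>f\<close> and \<open>g\<close> converge by the chain rules
  and domination. The gradients are merely bounded in weighted \<open>L2\<close> and converge
  pointwise, so their term needs weak convergence.\<close>

lemma linearized:
  assumes e: "norm e = 1" and co: "cutoff R \<Phi> \<Phi>g"
  defines "X \<equiv> \<lambda>z. (\<Phi> z)\<^sup>2 *\<^sub>R HE e z + V e z *\<^sub>R ((2 * \<Phi> z) *\<^sub>R \<Phi>g z)"
  shows "integrable HM (\<lambda>z. \<mu> (snd z) * (HE e z \<bullet> X z))"
    "integrable HM (\<lambda>z. c z * V e z * (V e z * (\<Phi> z)\<^sup>2))"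
    "integrable lebesgue (\<lambda>y. deriv f (U y) * Vt e y * (Vt e y * (\<Phi> (y, 0))\<^sup>2))"
    "(\<integral>z. \<mu> (snd z) * (HE e z \<bullet> X z) \<partial>HM) + (\<integral>z. c z * V e z * (V e z * (\<Phi> z)\<^sup>2) \<partial>HM)
      = (\<integral>y. deriv f (U y) * Vt e y * (Vt e y * (\<Phi> (y, 0))\<^sup>2) \<partial>lebesgue)"
proof -
  have cc: "\<And>z. 0 \<le> \<Phi> z" "\<And>z. \<Phi> z \<le> 1" "0 < R" "continuous_on UNIV \<Phi>g"
    "\<And>z. z \<notin> ball 0 R \<Longrightarrow> \<Phi> z = 0" "\<And>z. z \<notin> ball 0 R \<Longrightarrow> \<Phi>g z = 0"
    using co unfolding cutoff_def by blast+
  have sq: "(\<Phi> z)\<^sup>2 \<le> 1" "0 \<le> (\<Phi> z)\<^sup>2" for z using cc(1,2)[of z] by (simp_all add: power_le_one)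
  have R1: "0 < R + 1" using cc(3) by simp
  obtain C where C: "C \<ge> 0" "\<And>n z. z \<in> half_ball (R + 1) \<Longrightarrow> \<bar>Dq e n z\<bar> \<le> C" "\<And>z. z \<in> half_ball (R + 1) \<Longrightarrow> \<bar>V e z\<bar> \<le> C"
    "\<And>n y. norm y < R + 1 \<Longrightarrow> \<bar>real (Suc n) * (U (y + step e n) - U y)\<bar> \<le> C"
    by (rule Dq_bound[OF e R1]) (rule that)
  have inb: "z \<in> half_ball (R + 1)" if "z \<in> half_space" "z \<in> ball 0 R" for z using that by (auto simp: half_ball_def)
  have VC: "\<bar>V e z\<bar> \<le> C" if "z \<in> half_ball R" for z using that by (intro C(3) inb) (auto simp: half_ball_def)
  obtain Cg where Cg: "Cg \<ge> 0" "\<And>x s t. 0 < x \<Longrightarrow> x < R \<Longrightarrow> \<bar>s\<bar> \<le> uB \<Longrightarrow> \<bar>t\<bar> \<le> uB \<Longrightarrow> \<bar>g x s - g x t\<bar> \<le> Cg * \<bar>s - t\<bar>"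
    using g_lipschitz[OF cc(3)] by blast
  obtain Lf where Lf: "Lf \<ge> 0" "\<And>s t. \<bar>s\<bar> \<le> uB \<Longrightarrow> \<bar>t\<bar> \<le> uB \<Longrightarrow> \<bar>f s - f t\<bar> \<le> Lf * \<bar>s - t\<bar>"
    using f_lipschitz by blast
  obtain L where L: "L \<ge> 0" "\<And>z. norm (\<Phi>g z) \<le> L" using cutoff_bound[OF co] by blast
  have t: "test R (\<lambda>z. V e z * (\<Phi> z)\<^sup>2) X (\<lambda>y. Vt e y * (\<Phi> (y, 0))\<^sup>2)"
    unfolding X_def
    by (rule test_mult[OF cutoff_sq[OF co] GDERIV_V HE_continuous VC integrable_mu_HE[OF e cc(3)] Vt_lim[OF e]])
  note d = diff_eq[OF t, where e = e]
  have \<Phi>c: "continuous_on half_space \<Phi>" "continuous_on half_space \<Phi>g"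
    using cutoff_continuous[OF co] continuous_on_subset[OF cc(4)] by auto
  have [measurable]: "\<Phi> \<in> borel_measurable HM" "\<Phi>g \<in> borel_measurable HM" "V e \<in> borel_measurable HM" "HE e \<in> borel_measurable HM"
    "DG e n \<in> borel_measurable HM" for n
    by (intro HM_measurable_continuous \<Phi>c V_continuous HE_continuous DG_continuous)+
  have cm[measurable]: "c \<in> borel_measurable HM" by (rule c_measurable)
  show i1: "integrable HM (\<lambda>z. \<mu> (snd z) * (HE e z \<bullet> X z))"
  proof (rule HM_integrable_bound)
    show "integrable HM (\<lambda>z. \<mu> (snd z) * (norm (HE e z))\<^sup>2 * indicator (ball 0 R) z + \<mu> (snd z) * (norm (X z))\<^sup>2)"
      using integrable_mu_HE[OF e cc(3)] t by (simp add: test_def)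
    show "(\<lambda>z. \<mu> (snd z) * (HE e z \<bullet> X z)) \<in> borel_measurable HM" unfolding X_def by measurable
    fix z assume z: "z \<in> half_space"
    show "\<bar>\<mu> (snd z) * (HE e z \<bullet> X z)\<bar> \<le> \<mu> (snd z) * (norm (HE e z))\<^sup>2 * indicator (ball 0 R) z + \<mu> (snd z) * (norm (X z))\<^sup>2"
    proof (cases "z \<in> ball 0 R")
      case True
      then show ?thesis using abs_mult_inner_le[of "\<mu> (snd z)" "HE e z" "X z"] mu_nonneg[OF z] by simp
    next
      case False
      then show ?thesis using cc(5,6)[OF False] by (simp add: X_def)
    qed
  qed
  have gb: "\<bar>real (Suc n) * (g (snd z) (u (z + (step e n, 0))) - g (snd z) (u z)) * (V e z * (\<Phi> z)\<^sup>2)\<bar> \<le> Cg * C * C * indicator (ball 0 R) z"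
    if z: "z \<in> half_space" for z n
  proof (cases "z \<in> ball 0 R")
    case True
    have q: "\<bar>Dq e n z\<bar> \<le> C" "\<bar>V e z\<bar> \<le> C" using C(2,3)[OF inb[OF z True]] by auto
    have zx: "0 < snd z" "snd z < R" using z ball_subset_cylinder[OF True] by (auto simp: half_space_def)
    have "\<bar>real (Suc n) * (g (snd z) (u (z + (step e n, 0))) - g (snd z) (u z))\<bar> \<le> real (Suc n) * (Cg * \<bar>u (z + (step e n, 0)) - u z\<bar>)"
      unfolding abs_mult using Cg(2)[OF zx uB(2) uB(2), of "z + (step e n, 0)" z] z by (simp del: of_nat_Suc)
    also have "\<dots> = Cg * \<bar>Dq e n z\<bar>" by (simp add: Dq_def abs_mult del: of_nat_Suc)
    also have "\<dots> \<le> Cg * C" using q(1) Cg(1) by (rule mult_left_mono)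
    finally have "\<bar>real (Suc n) * (g (snd z) (u (z + (step e n, 0))) - g (snd z) (u z)) * (V e z * (\<Phi> z)\<^sup>2)\<bar> \<le> (Cg * C) * (C * 1)"
      unfolding abs_mult[of "real (Suc n) * (g (snd z) (u (z + (step e n, 0))) - g (snd z) (u z))"] abs_mult[of _ "(\<Phi> z)\<^sup>2"]
      using q sq[of z] C(1) Cg(1) by (intro mult_mono) auto
    then show ?thesis using True by simp
  qed (use cc(5) in simp)
  have fb: "\<bar>real (Suc n) * (f (U (y + step e n)) - f (U y)) * (Vt e y * (\<Phi> (y, 0))\<^sup>2)\<bar> \<le> Lf * C * C * indicator (ball 0 R) y"
    if vy: "norm y < R \<longrightarrow> \<bar>Vt e y\<bar> \<le> C" for y n
  proof (cases "y \<in> ball 0 R")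
    case True
    have q: "\<bar>real (Suc n) * (U (y + step e n) - U y)\<bar> \<le> C" "\<bar>Vt e y\<bar> \<le> C" using C(4)[of y n] True vy by auto
    have "\<bar>real (Suc n) * (f (U (y + step e n)) - f (U y))\<bar> \<le> real (Suc n) * (Lf * \<bar>U (y + step e n) - U y\<bar>)"
      unfolding abs_mult using Lf(2)[OF U_bound U_bound, of "y + step e n" y] by (simp del: of_nat_Suc)
    also have "\<dots> = Lf * \<bar>real (Suc n) * (U (y + step e n) - U y)\<bar>" by (simp add: abs_mult del: of_nat_Suc)
    also have "\<dots> \<le> Lf * C" using q(1) Lf(1) by (rule mult_left_mono)
    finally have "\<bar>real (Suc n) * (f (U (y + step e n)) - f (U y)) * (Vt e y * (\<Phi> (y, 0))\<^sup>2)\<bar> \<le> (Lf * C) * (C * 1)"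
      unfolding abs_mult[of "real (Suc n) * (f (U (y + step e n)) - f (U y))"] abs_mult[of _ "(\<Phi> (y, 0))\<^sup>2"]
      using q sq[of "(y, 0)"] C(1) Lf(1) by (intro mult_mono) auto
    then show ?thesis using True by simp
  next
    case False
    then have "(y, 0::real) \<notin> ball 0 R" by (simp add: norm_Pair)
    then have "\<Phi> (y, 0) = 0" by (rule cc(5))
    then show ?thesis using False by simp
  qed
  have gdom: "integrable HM (\<lambda>z. Cg * C * C * indicator (ball 0 R) z)" using integrable_indicator_ball by simp
  have fdom: "integrable lebesgue (\<lambda>y::real^2. Lf * C * C * indicator (ball 0 R) y)" using integrable_indicator_disc by simp
  have gAE: "AE z in HM. (\<lambda>n. real (Suc n) * (g (snd z) (u (z + (step e n, 0))) - g (snd z) (u z)) * (V e z * (\<Phi> z)\<^sup>2)) \<longlonglongrightarrow> c z * V e z * (V e z * (\<Phi> z)\<^sup>2)"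
    unfolding AE_HM_iff using chain_g[OF e] by eventually_elim (auto intro: tendsto_mult_right)
  have fAE: "AE y in lebesgue. (\<lambda>n. real (Suc n) * (f (U (y + step e n)) - f (U y)) * (Vt e y * (\<Phi> (y, 0))\<^sup>2)) \<longlonglongrightarrow> deriv f (U y) * Vt e y * (Vt e y * (\<Phi> (y, 0))\<^sup>2)"
    using chain_f[OF e] by eventually_elim (rule tendsto_mult_right)
  have vb: "AE y in lebesgue. norm y < R \<longrightarrow> \<bar>Vt e y\<bar> \<le> C" by (rule Vt_bound[OF e C(3)])
  have fbAE: "AE y in lebesgue. norm (real (Suc n) * (f (U (y + step e n)) - f (U y)) * (Vt e y * (\<Phi> (y, 0))\<^sup>2)) \<le> Lf * C * C * indicator (ball 0 R) y" for n
    using vb by eventually_elim (use fb in auto)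
  have gm: "(\<lambda>z. c z * V e z * (V e z * (\<Phi> z)\<^sup>2)) \<in> borel_measurable HM" by measurable
  have "(\<lambda>y. \<Phi> (y, 0)) \<in> borel_measurable lebesgue"
    by (rule measurable_completion, simp, rule borel_measurable_continuous_onI, rule continuous_on_compose2[OF cutoff_continuous[OF co]])
       (auto intro!: continuous_intros)
  then have fm: "(\<lambda>y. deriv f (U y) * Vt e y * (Vt e y * (\<Phi> (y, 0))\<^sup>2)) \<in> borel_measurable lebesgue"
    using fU'_measurable Vt_measurable[OF e] by measurable
  have gbAE: "AE z in HM. norm (real (Suc n) * (g (snd z) (u (z + (step e n, 0))) - g (snd z) (u z)) * (V e z * (\<Phi> z)\<^sup>2)) \<le> Cg * C * C * indicator (ball 0 R) z" for n
    by (rule AE_HM_I) (use gb in simp)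
  note gc = integral_dominated_convergence[OF gm borel_measurable_integrable[OF d(2)] gdom gAE gbAE]
  note fc = integral_dominated_convergence[OF fm borel_measurable_integrable[OF d(3)] fdom fAE fbAE]
  show "integrable HM (\<lambda>z. c z * V e z * (V e z * (\<Phi> z)\<^sup>2))"
    by (rule integrable_dominated_convergence[OF gm borel_measurable_integrable[OF d(2)] gdom gAE gbAE])
  show "integrable lebesgue (\<lambda>y. deriv f (U y) * Vt e y * (Vt e y * (\<Phi> (y, 0))\<^sup>2))"
    by (rule integrable_dominated_convergence[OF fm borel_measurable_integrable[OF d(3)] fdom fAE fbAE])
  obtain K where K: "\<And>n. integrable HM (\<lambda>z. \<mu> (snd z) * (\<Phi> z)\<^sup>2 * (norm (DG e n z))\<^sup>2)"
    "\<And>n. (\<integral>z. \<mu> (snd z) * (\<Phi> z)\<^sup>2 * (norm (DG e n z))\<^sup>2 \<partial>HM) \<le> K" by (rule caccioppoli_uniform[OF e co]) (rule that)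
  \<comment> \<open>The square root of the weight is split between the two factors. Each summand of
    \<open>X\<close> contains a factor \<open>\<Phi>\<close>; moved into \<open>A\<close>, it
    produces the quantity that \<open>caccioppoli_uniform\<close> bounds.\<close>
  define A where "A Y z = (sqrt (\<mu> (snd z)) * \<Phi> z) *\<^sub>R Y z" for Y :: "point \<Rightarrow> point" and z
  define B where "B z = sqrt (\<mu> (snd z)) *\<^sub>R (\<Phi> z *\<^sub>R HE e z + (2 * V e z) *\<^sub>R \<Phi>g z)" for z
  have nA: "(norm (A Y z))\<^sup>2 = \<mu> (snd z) * (\<Phi> z)\<^sup>2 * (norm (Y z))\<^sup>2" if "z \<in> half_space" for Y z
    using mu_nonneg[OF that] by (simp add: A_def power_mult_distrib)
  have AB: "A Y z \<bullet> B z = \<mu> (snd z) * (Y z \<bullet> X z)" if "z \<in> half_space" for Y z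
  proof -
    have s: "sqrt (\<mu> (snd z)) * sqrt (\<mu> (snd z)) = \<mu> (snd z)" using mu_nonneg[OF that] by simp
    have "A Y z \<bullet> B z = (sqrt (\<mu> (snd z)) * sqrt (\<mu> (snd z))) * (Y z \<bullet> X z)"
      by (simp add: A_def B_def X_def inner_add_right power2_eq_square algebra_simps del: real_sqrt_mult_self)
    then show ?thesis using s by simp
  qed
  have l1: "(\<lambda>n. \<integral>z. \<mu> (snd z) * (DG e n z \<bullet> X z) \<partial>HM) \<longlonglongrightarrow> (\<integral>z. \<mu> (snd z) * (HE e z \<bullet> X z) \<partial>HM)"
  proof -
    have "(\<lambda>n. \<integral>z. A (DG e n) z \<bullet> B z \<partial>HM) \<longlonglongrightarrow> (\<integral>z. A (HE e) z \<bullet> B z \<partial>HM)"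
    proof (rule tendsto_integral_inner_L2_bounded)
      show "A (DG e n) \<in> borel_measurable HM" "A (HE e) \<in> borel_measurable HM" "B \<in> borel_measurable HM" for n
        unfolding A_def[abs_def] B_def[abs_def] by measurable
      show "AE z in HM. (\<lambda>n. A (DG e n) z) \<longlonglongrightarrow> A (HE e) z"
        by (rule AE_HM_I) (auto simp: A_def intro!: tendsto_intros DG_lim)
      show "integrable HM (\<lambda>z. (norm (A (DG e n) z))\<^sup>2)" for n
        using K(1)[of n] by (rule Bochner_Integration.integrable_cong[THEN iffD1, rotated -1]) (auto simp: nA)
      show "(\<integral>z. (norm (A (DG e n) z))\<^sup>2 \<partial>HM) \<le> K" for n
        using K(2)[of n] by (subst Bochner_Integration.integral_cong[where g = "\<lambda>z. \<mu> (snd z) * (\<Phi> z)\<^sup>2 * (norm (DG e n z))\<^sup>2"]) (auto simp: nA)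
      show "integrable HM (\<lambda>z. (norm (A (HE e) z))\<^sup>2)"
        using caccioppoli[OF e co] by (rule Bochner_Integration.integrable_cong[THEN iffD1, rotated -1]) (auto simp: nA)
      have iC: "integrable HM (\<lambda>z. \<mu> (snd z) * (C\<^sup>2 * L\<^sup>2 * indicator (ball 0 R) z))"
        by (rule integrable_mu_bounded[where R = R and C = "C\<^sup>2 * L\<^sup>2"]) (use cc(3) in auto)
      show "integrable HM (\<lambda>z. (norm (B z))\<^sup>2)"
      proof (rule HM_integrable_bound)
        show "integrable HM (\<lambda>z. 2 * (\<mu> (snd z) * (\<Phi> z)\<^sup>2 * (norm (HE e z))\<^sup>2) + 8 * (\<mu> (snd z) * (C\<^sup>2 * L\<^sup>2 * indicator (ball 0 R) z)))"
          using caccioppoli[OF e co] iC by simp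
        show "(\<lambda>z. (norm (B z))\<^sup>2) \<in> borel_measurable HM" unfolding B_def by measurable
        fix z assume z: "z \<in> half_space"
        have b: "(norm ((2 * V e z) *\<^sub>R \<Phi>g z))\<^sup>2 \<le> 4 * (C\<^sup>2 * L\<^sup>2 * indicator (ball 0 R) z)"
        proof (cases "z \<in> ball 0 R")
          case True
          have "\<bar>V e z\<bar> * norm (\<Phi>g z) \<le> C * L" using C(1) C(3)[OF inb[OF z True]] L by (intro mult_mono) auto
          then have "(\<bar>V e z\<bar> * norm (\<Phi>g z))\<^sup>2 \<le> (C * L)\<^sup>2" by (intro power_mono) auto
          then show ?thesis using True by (simp add: power_mult_distrib)
        qed (use cc(6) in simp)
        have "(norm (B z))\<^sup>2 = \<mu> (snd z) * (norm (\<Phi> z *\<^sub>R HE e z + (2 * V e z) *\<^sub>R \<Phi>g z))\<^sup>2"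
          using mu_nonneg[OF z] by (simp add: B_def power_mult_distrib)
        also have "\<dots> \<le> \<mu> (snd z) * (2 * (norm (\<Phi> z *\<^sub>R HE e z))\<^sup>2 + 2 * (4 * (C\<^sup>2 * L\<^sup>2 * indicator (ball 0 R) z)))"
          using norm_add_sq_le[of "\<Phi> z *\<^sub>R HE e z" "(2 * V e z) *\<^sub>R \<Phi>g z"] b by (intro mult_left_mono mu_nonneg[OF z]) linarith
        finally show "\<bar>(norm (B z))\<^sup>2\<bar> \<le> 2 * (\<mu> (snd z) * (\<Phi> z)\<^sup>2 * (norm (HE e z))\<^sup>2) + 8 * (\<mu> (snd z) * (C\<^sup>2 * L\<^sup>2 * indicator (ball 0 R) z))"
          by (simp add: power_mult_distrib algebra_simps)
      qed
    qed
    moreover have "(\<integral>z. A (DG e n) z \<bullet> B z \<partial>HM) = (\<integral>z. \<mu> (snd z) * (DG e n z \<bullet> X z) \<partial>HM)" for n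
      by (rule Bochner_Integration.integral_cong) (auto simp: AB)
    moreover have "(\<integral>z. A (HE e) z \<bullet> B z \<partial>HM) = (\<integral>z. \<mu> (snd z) * (HE e z \<bullet> X z) \<partial>HM)"
      by (rule Bochner_Integration.integral_cong) (auto simp: AB)
    ultimately show ?thesis by simp
  qed
  have "(\<lambda>n. (\<integral>z. \<mu> (snd z) * (DG e n z \<bullet> X z) \<partial>HM) + (\<integral>z. real (Suc n) * (g (snd z) (u (z + (step e n, 0))) - g (snd z) (u z)) * (V e z * (\<Phi> z)\<^sup>2) \<partial>HM))
      \<longlonglongrightarrow> (\<integral>z. \<mu> (snd z) * (HE e z \<bullet> X z) \<partial>HM) + (\<integral>z. c z * V e z * (V e z * (\<Phi> z)\<^sup>2) \<partial>HM)"
    by (intro tendsto_add l1 gc)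
  then have "(\<lambda>n. \<integral>y. real (Suc n) * (f (U (y + step e n)) - f (U y)) * (Vt e y * (\<Phi> (y, 0))\<^sup>2) \<partial>lebesgue)
      \<longlonglongrightarrow> (\<integral>z. \<mu> (snd z) * (HE e z \<bullet> X z) \<partial>HM) + (\<integral>z. c z * V e z * (V e z * (\<Phi> z)\<^sup>2) \<partial>HM)"
    unfolding d(4) .
  from LIMSEQ_unique[OF this fc]
  show "(\<integral>z. \<mu> (snd z) * (HE e z \<bullet> X z) \<partial>HM) + (\<integral>z. c z * V e z * (V e z * (\<Phi> z)\<^sup>2) \<partial>HM)
      = (\<integral>y. deriv f (U y) * Vt e y * (Vt e y * (\<Phi> (y, 0))\<^sup>2) \<partial>lebesgue)" .
qed

subsection \<open>Growth of the energy\<close>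


lemma measure_disc: "0 \<le> R \<Longrightarrow> (\<integral>y. indicator (ball 0 R) (y::real^2) \<partial>lebesgue) = discc * R\<^sup>2"
  using emeasure_disc[of R] discc_nonneg by (simp add: measure_def)

text \<open>Integrability over all heights leaves only the area of the disc, hence quadratic growth
  in \<open>R\<close>.\<close>

lemma cylinder_integral_bound:
  fixes F :: "point \<Rightarrow> real" and h :: "real \<Rightarrow> real"
  assumes h: "set_integrable lebesgue {0<..} h" and R: "0 < R" and F: "F \<in> borel_measurable HM"
    and b: "\<And>z. z \<in> half_space \<Longrightarrow> \<bar>F z\<bar> \<le> h (snd z) * indicator (ball 0 R) z"
  shows "\<bar>\<integral>z. F z \<partial>HM\<bar> \<le> discc * R\<^sup>2 * (LINT x:{0<..}|lebesgue. \<bar>h x\<bar>)"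
proof -
  have hm: "(\<lambda>x. indicator {0<..} x *\<^sub>R h x) \<in> borel_measurable lebesgue"
    using h unfolding set_integrable_def by (rule borel_measurable_integrable)
  obtain k where k: "k \<in> borel_measurable lborel" "AE x in lborel. indicator {0<..} x *\<^sub>R h x = k x"
    using completion_ex_borel_measurable_real[OF hm] by auto
  have [measurable]: "k \<in> borel_measurable borel" using k(1) by simp
  let ?I = "LINT x:{0<..}|lebesgue. \<bar>h x\<bar>"
  have I0: "0 \<le> ?I" unfolding set_lebesgue_integral_def by (rule integral_nonneg_AE) (auto simp: indicator_def)
  have kI: "(\<integral>\<^sup>+x. ennreal \<bar>k x\<bar> \<partial>lborel) = ennreal ?I"
  proof -
    have "(\<integral>\<^sup>+x. ennreal \<bar>k x\<bar> \<partial>lborel) = (\<integral>\<^sup>+x. ennreal (indicator {0<..} x *\<^sub>R \<bar>h x\<bar>) \<partial>lborel)"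
      by (rule nn_integral_cong_AE, use k(2) in eventually_elim) (auto simp: indicator_def)
    also have "\<dots> = (\<integral>\<^sup>+x. ennreal (indicator {0<..} x *\<^sub>R \<bar>h x\<bar>) \<partial>lebesgue)" by (simp add: nn_integral_completion)
    also have "\<dots> = ennreal ?I"
      unfolding set_lebesgue_integral_def
      by (rule nn_integral_eq_integral) (use set_integrable_abs[OF h] in \<open>auto simp: set_integrable_def indicator_def\<close>)
    finally show ?thesis .
  qed
  have "(\<integral>\<^sup>+z. ennreal (norm (F z)) \<partial>HM) = (\<integral>\<^sup>+z. ennreal (norm (F z)) * indicator half_space z \<partial>lborel)"
    by (rule HM_nn_integral)
  also have "\<dots> \<le> (\<integral>\<^sup>+z. indicator (ball 0 R) (fst z) * ennreal \<bar>k (snd z)\<bar> \<partial>(lborel :: point measure))"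
  proof (rule nn_integral_mono_AE, rule AE_mp[OF AE_snd[OF k(2)]], rule AE_I2, rule impI)
    fix z :: point assume kz: "indicator {0<..} (snd z) *\<^sub>R h (snd z) = k (snd z)"
    show "ennreal (norm (F z)) * indicator half_space z \<le> indicator (ball 0 R) (fst z) * ennreal \<bar>k (snd z)\<bar>"
    proof (cases "z \<in> half_space \<and> z \<in> ball 0 R")
      case True
      then have "\<bar>F z\<bar> \<le> h (snd z)" "h (snd z) = k (snd z)" using b[of z] kz by (auto simp: half_space_def)
      then show ?thesis using ball_subset_cylinder[of z R] True by (auto intro!: ennreal_leI)
    next
      case False
      then have "ennreal (norm (F z)) * indicator half_space z = 0" using b[of z] by (cases "z \<in> half_space") auto
      then show ?thesis by (simp only: zero_le)
    qed
  qed
  also have "\<dots> = emeasure lborel (ball 0 R :: (real^2) set) * (\<integral>\<^sup>+x. ennreal \<bar>k x\<bar> \<partial>lborel)"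
    by (rule nn_cylinder) measurable
  also have "\<dots> = ennreal (discc * R\<^sup>2 * ?I)"
    using R discc_nonneg I0 by (simp add: emeasure_disc kI ennreal_mult)
  finally have le: "(\<integral>\<^sup>+z. ennreal (norm (F z)) \<partial>HM) \<le> ennreal (discc * R\<^sup>2 * ?I)" .
  have int: "integrable HM F" by (rule integrableI_bounded[OF F]) (use le in \<open>auto intro: le_less_trans\<close>)
  have "ennreal \<bar>\<integral>z. F z \<partial>HM\<bar> \<le> (\<integral>\<^sup>+z. ennreal (norm (F z)) \<partial>HM)"
    using integral_norm_bound_ennreal[OF int] by simp
  then have "ennreal \<bar>\<integral>z. F z \<partial>HM\<bar> \<le> ennreal (discc * R\<^sup>2 * ?I)" using le by (rule order_trans)
  then show ?thesis using discc_nonneg I0 by (simp add: ennreal_le_iff)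
qed

text \<open>Under the first alternative the integrand is dominated by an integrable function of the
  height; under the second it is nonnegative. A lower bound is wanted, because the term enters the
  energy estimate with a minus sign.\<close>

lemma g_term_bound:
  "\<exists>K\<ge>0. \<forall>R>0. \<forall>\<Phi> \<Phi>g. cutoff R \<Phi> \<Phi>g \<longrightarrow> - K * R\<^sup>2 \<le> (\<integral>z. g (snd z) (u z) * (u z * (\<Phi> z)\<^sup>2) \<partial>HM)"
  using g_alternative
proof
  assume A: "\<forall>M>0. set_integrable lebesgue {0<..} (\<lambda>x. SUP t\<in>{-M..M}. \<bar>g x t\<bar>)"
  define h where "h x = uB * (SUP t\<in>{-uB..uB}. \<bar>g x t\<bar>)" for x
  have hi: "set_integrable lebesgue {0<..} h" unfolding h_def[abs_def] using A uB(1) by (intro set_integrable_mult_right) auto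
  have gb: "\<bar>g x t * t\<bar> \<le> h x" if "0 < x" "\<bar>t\<bar> \<le> uB" for x t
  proof -
    \<comment> \<open>Boundedness above has to be shown first: the supremum of an unbounded set of
      reals would be an arbitrary number.\<close>
    have "compact ((\<lambda>t. \<bar>g x t\<bar>) ` {-uB..uB})"
      by (intro compact_continuous_image continuous_intros continuous_on_subset[OF locally_lipschitz_on_imp_continuous_on[OF g_lip[OF that(1)]]]) auto
    then have "bdd_above ((\<lambda>t. \<bar>g x t\<bar>) ` {-uB..uB})" by (intro bounded_imp_bdd_above compact_imp_bounded)
    then have "\<bar>g x t\<bar> \<le> (SUP t\<in>{-uB..uB}. \<bar>g x t\<bar>)" using that(2) by (intro cSUP_upper) (auto simp: abs_le_iff)
    then have "\<bar>t\<bar> * \<bar>g x t\<bar> \<le> uB * (SUP t\<in>{-uB..uB}. \<bar>g x t\<bar>)" using that(2) uB(1) by (intro mult_mono) auto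
    then show ?thesis by (simp add: h_def abs_mult mult.commute)
  qed
  define K where "K = discc * (LINT x:{0<..}|lebesgue. \<bar>h x\<bar>)"
  have K0: "0 \<le> K" unfolding K_def set_lebesgue_integral_def
    by (intro mult_nonneg_nonneg discc_nonneg integral_nonneg_AE) (auto simp: indicator_def)
  have "- K * R\<^sup>2 \<le> (\<integral>z. g (snd z) (u z) * (u z * (\<Phi> z)\<^sup>2) \<partial>HM)" if R: "0 < R" and co: "cutoff R \<Phi> \<Phi>g" for R \<Phi> \<Phi>g
  proof -
    have "\<bar>\<integral>z. g (snd z) (u z) * (u z * (\<Phi> z)\<^sup>2) \<partial>HM\<bar> \<le> discc * R\<^sup>2 * (LINT x:{0<..}|lebesgue. \<bar>h x\<bar>)"
    proof (rule cylinder_integral_bound[OF hi R])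
      show "(\<lambda>z. g (snd z) (u z) * (u z * (\<Phi> z)\<^sup>2)) \<in> borel_measurable HM"
        using gu_measurable HM_measurable_continuous[OF u_continuous] HM_measurable_continuous[OF cutoff_continuous[OF co]] by measurable
      fix z assume z: "z \<in> half_space"
      show "\<bar>g (snd z) (u z) * (u z * (\<Phi> z)\<^sup>2)\<bar> \<le> h (snd z) * indicator (ball 0 R) z"
      proof (cases "z \<in> ball 0 R")
        case True
        have "0 \<le> \<Phi> z" "\<Phi> z \<le> 1" using co unfolding cutoff_def by blast+
        then have "\<bar>g (snd z) (u z) * u z\<bar> * (\<Phi> z)\<^sup>2 \<le> h (snd z) * 1"
          using gb[OF _ uB(2)[OF z], of "snd z"] z by (intro mult_mono) (auto simp: half_space_def power_le_one intro: order_trans[OF abs_ge_zero])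
        then show ?thesis using True by (simp add: abs_mult mult.assoc)
      next
        case False
        then have "\<Phi> z = 0" using co unfolding cutoff_def by blast
        then show ?thesis using False by simp
      qed
    qed
    then show ?thesis by (simp add: K_def mult_ac abs_le_iff)
  qed
  then show ?thesis using K0 by blast
next
  assume B: "\<forall>x>0. \<forall>t. 0 \<le> g x t * t"
  have "0 \<le> (\<integral>z. g (snd z) (u z) * (u z * (\<Phi> z)\<^sup>2) \<partial>HM)" for \<Phi>
  proof (rule integral_nonneg_AE, rule AE_HM_I)
    fix z assume "z \<in> half_space"
    then have "0 \<le> g (snd z) (u z) * u z" using B by (simp add: half_space_def)
    from mult_nonneg_nonneg[OF this zero_le_power2] have "0 \<le> g (snd z) (u z) * u z * (\<Phi> z)\<^sup>2" .
    then show "0 \<le> g (snd z) (u z) * (u z * (\<Phi> z)\<^sup>2)" by (simp add: mult.assoc)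
  qed
  then show ?thesis by (intro exI[of _ 0]) auto
qed

lemma energy_growth:
  "\<exists>C\<ge>0. \<forall>R\<ge>1. (\<integral>z. \<mu> (snd z) * (norm (G z))\<^sup>2 * indicator (ball 0 R) z \<partial>HM) \<le> C * R\<^sup>2"
proof -
  obtain K where K: "K \<ge> 0" "\<And>R \<Phi> \<Phi>g. 0 < R \<Longrightarrow> cutoff R \<Phi> \<Phi>g \<Longrightarrow> - K * R\<^sup>2 \<le> (\<integral>z. g (snd z) (u z) * (u z * (\<Phi> z)\<^sup>2) \<partial>HM)"
    using g_term_bound by blast
  obtain C0 where C0: "C0 > 0" "\<And>R. R \<ge> 1 \<Longrightarrow> (LINT x:{0<..<R}|lebesgue. \<mu> x) \<le> C0 * R\<^sup>2" using mu_growth by blast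
  have "bounded (f ` {-uB..uB})"
    by (intro compact_imp_bounded compact_continuous_image continuous_on_subset[OF f_continuous]) auto
  then obtain F0 where "\<forall>x\<in>f ` {-uB..uB}. norm x \<le> F0" unfolding bounded_iff by blast
  then have F0: "\<bar>f t\<bar> \<le> F0" if "\<bar>t\<bar> \<le> uB" for t
  proof -
    have "t \<in> {-uB..uB}" using that by (simp add: abs_le_iff)
    with \<open>\<forall>x\<in>f ` {-uB..uB}. norm x \<le> F0\<close> show ?thesis by fastforce
  qed
  have F00: "F0 \<ge> 0" using F0[of 0] uB(1) by simp
  \<comment> \<open>The inner factors 4 come from the radius \<open>2 * R\<close> of the support, 36
    from the square of the gradient bound \<open>6 / R\<close>, and
    \<open>discc * 4 * (C0 * 4)\<close> from the weighted volume in \<open>mu_ball\<close>. The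
    outer 2 and 4 stem from absorbing the mixed term.\<close>
  define C where "C = 2 * (F0 * uB * discc * 4 + K * 4) + 4 * (uB\<^sup>2 * 36 * (discc * 4 * (C0 * 4)))"
  have C: "C \<ge> 0" unfolding C_def using F00 uB(1) discc_nonneg K(1) C0(1) by simp
  have "(\<integral>z. \<mu> (snd z) * (norm (G z))\<^sup>2 * indicator (ball 0 R) z \<partial>HM) \<le> C * R\<^sup>2" if R1: "R \<ge> 1" for R
  proof -
    have R: "0 < R" "0 < 2 * R" using R1 by auto
    define \<Phi> :: "point \<Rightarrow> real" where "\<Phi> = cut R"
    define \<Phi>g :: "point \<Rightarrow> point" where "\<Phi>g = cutg R"
    have co: "cutoff (2 * R) \<Phi> \<Phi>g" unfolding \<Phi>_def \<Phi>g_def by (rule cutoff_cut[OF R(1)])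
    have c: "\<And>z. 0 \<le> \<Phi> z" "\<And>z. \<Phi> z \<le> 1" "\<And>z. z \<notin> ball 0 (2 * R) \<Longrightarrow> \<Phi> z = 0" "\<And>z. z \<notin> ball 0 (2 * R) \<Longrightarrow> \<Phi>g z = 0"
      using co unfolding cutoff_def by blast+
    have sq: "(\<Phi> z)\<^sup>2 \<le> 1" "0 \<le> (\<Phi> z)\<^sup>2" for z using c(1,2)[of z] by (simp_all add: power_le_one)
    let ?X = "\<lambda>z. (\<Phi> z)\<^sup>2 *\<^sub>R G z + u z *\<^sub>R ((2 * \<Phi> z) *\<^sub>R \<Phi>g z)"
    have t: "test (2 * R) (\<lambda>z. u z * (\<Phi> z)\<^sup>2) ?X (\<lambda>y. U y * (\<Phi> (y, 0))\<^sup>2)"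
      by (rule test_mult[OF cutoff_sq[OF co] G G_continuous uB(2) integrable_mu_G[OF R(2)]]) (auto simp: half_ball_def U_lim)
    note w = weak_test[OF t]
    define B :: "point \<Rightarrow> real" where "B z = \<mu> (snd z) * (uB\<^sup>2 * (36 / R\<^sup>2) * indicator (ball 0 (2 * R)) z)" for z
    have iB: "integrable HM B"
      unfolding B_def[abs_def] by (rule integrable_mu_bounded[where R = "2 * R" and C = "uB\<^sup>2 * (36 / R\<^sup>2)"]) (use R in auto)
    have B: "(\<integral>z. B z \<partial>HM) \<le> uB\<^sup>2 * 36 * (discc * 4 * (C0 * 4)) * R\<^sup>2"
    proof -
      have e: "(\<integral>z. B z \<partial>HM) = uB\<^sup>2 * (36 / R\<^sup>2) * (\<integral>z. \<mu> (snd z) * indicator (ball 0 (2 * R)) z \<partial>HM)"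
        unfolding B_def by (subst integral_mult_right_zero[symmetric]) (simp add: mult_ac)
      have l: "(\<integral>z. \<mu> (snd z) * indicator (ball 0 (2 * R)) z \<partial>HM) \<le> discc * (2 * R)\<^sup>2 * (C0 * (2 * R)\<^sup>2)"
        by (rule order_trans[OF mu_ball(2)[OF R(2)] mult_left_mono[OF C0(2)]]) (use R1 discc_nonneg in simp_all)
      have "(\<integral>z. B z \<partial>HM) \<le> uB\<^sup>2 * (36 / R\<^sup>2) * (discc * (2 * R)\<^sup>2 * (C0 * (2 * R)\<^sup>2))"
        unfolding e by (rule mult_left_mono[OF l]) simp
      also have "\<dots> = uB\<^sup>2 * 36 * (discc * 4 * (C0 * 4)) * R\<^sup>2" using R by (simp add: field_simps power2_eq_square)
      finally show ?thesis .
    qed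
    have iG: "integrable HM (\<lambda>z. \<mu> (snd z) * (\<Phi> z)\<^sup>2 * (norm (G z))\<^sup>2)"
    proof (rule HM_integrable_bound[OF integrable_mu_G[OF R(2)]])
      show "(\<lambda>z. \<mu> (snd z) * (\<Phi> z)\<^sup>2 * (norm (G z))\<^sup>2) \<in> borel_measurable HM"
        using HM_measurable_continuous[OF G_continuous] HM_measurable_continuous[OF cutoff_continuous[OF co]] by measurable
      fix z assume z: "z \<in> half_space"
      show "\<bar>\<mu> (snd z) * (\<Phi> z)\<^sup>2 * (norm (G z))\<^sup>2\<bar> \<le> \<mu> (snd z) * (norm (G z))\<^sup>2 * indicator (ball 0 (2 * R)) z"
      proof (cases "z \<in> ball 0 (2 * R)")
        case True
        have "\<mu> (snd z) * (norm (G z))\<^sup>2 * (\<Phi> z)\<^sup>2 \<le> \<mu> (snd z) * (norm (G z))\<^sup>2 * 1"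
          using sq[of z] mu_nonneg[OF z] by (intro mult_left_mono) auto
        then show ?thesis using True mu_nonneg[OF z] by (simp add: mult_ac)
      qed (use c(3) in simp)
    qed
    have pt: "\<mu> (snd z) * (\<Phi> z)\<^sup>2 * (norm (G z))\<^sup>2 \<le> 2 * (\<mu> (snd z) * (G z \<bullet> ?X z)) + 4 * B z" if z: "z \<in> half_space" for z
    proof (cases "z \<in> ball 0 (2 * R)")
      case True
      define a where "a = \<Phi> z *\<^sub>R G z"
      define b where "b = u z *\<^sub>R \<Phi>g z"
      have "norm b \<le> uB * (6 / R)" unfolding b_def norm_scaleR \<Phi>g_def
        using uB(1) uB(2)[OF z] norm_cutg_le[OF R(1), of z] by (intro mult_mono) auto
      then have b2: "(norm b)\<^sup>2 \<le> uB\<^sup>2 * (36 / R\<^sup>2)"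
        using power_mono[of "norm b" "uB * (6 / R)" 2] by (simp add: power_mult_distrib power_divide)
      have "0 \<le> (norm (a + 2 *\<^sub>R b))\<^sup>2" by simp
      also have "\<dots> = (norm a)\<^sup>2 + 4 * (a \<bullet> b) + 4 * (norm b)\<^sup>2"
        by (simp add: power2_norm_eq_inner inner_add_left inner_add_right inner_commute)
      finally have 1: "(norm a)\<^sup>2 \<le> 2 * ((norm a)\<^sup>2 + 2 * (a \<bullet> b)) + 4 * (norm b)\<^sup>2" by simp
      have 2: "G z \<bullet> ?X z = (norm a)\<^sup>2 + 2 * (a \<bullet> b)"
        unfolding power2_norm_eq_inner a_def b_def by (simp add: inner_add_right) (simp add: power2_eq_square)
      have 3: "(norm a)\<^sup>2 = (\<Phi> z)\<^sup>2 * (norm (G z))\<^sup>2" by (simp add: a_def power_mult_distrib)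
      have lin: "w \<le> 2 * x + 4 * k" if "p \<le> 2 * (p + 2 * q) + 4 * s" "x = p + 2 * q" "p = w" "s \<le> k" for p q s x w k :: real
        using that by simp
      have "(\<Phi> z)\<^sup>2 * (norm (G z))\<^sup>2 \<le> 2 * (G z \<bullet> ?X z) + 4 * (uB\<^sup>2 * (36 / R\<^sup>2))"
        by (rule lin[OF 1 2 3 b2])
      then have "\<mu> (snd z) * ((\<Phi> z)\<^sup>2 * (norm (G z))\<^sup>2) \<le> \<mu> (snd z) * (2 * (G z \<bullet> ?X z) + 4 * (uB\<^sup>2 * (36 / R\<^sup>2)))"
        by (intro mult_left_mono mu_nonneg[OF z])
      then show ?thesis using True by (simp add: B_def algebra_simps)
    qed (use c(3,4) in \<open>simp add: B_def\<close>)
    have s0: "(\<integral>z. \<mu> (snd z) * (\<Phi> z)\<^sup>2 * (norm (G z))\<^sup>2 \<partial>HM) \<le> 2 * (\<integral>z. \<mu> (snd z) * (G z \<bullet> ?X z) \<partial>HM) + 4 * (\<integral>z. B z \<partial>HM)"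
    proof -
      have "(\<integral>z. \<mu> (snd z) * (\<Phi> z)\<^sup>2 * (norm (G z))\<^sup>2 \<partial>HM) \<le> (\<integral>z. 2 * (\<mu> (snd z) * (G z \<bullet> ?X z)) + 4 * B z \<partial>HM)"
        by (rule integral_mono[OF iG]) (use w(1) iB pt in auto)
      also have "\<dots> = 2 * (\<integral>z. \<mu> (snd z) * (G z \<bullet> ?X z) \<partial>HM) + 4 * (\<integral>z. B z \<partial>HM)"
        using w(1) iB by (subst Bochner_Integration.integral_add) auto
      finally show ?thesis .
    qed
    have s1: "(\<integral>y. f (U y) * (U y * (\<Phi> (y, 0))\<^sup>2) \<partial>lebesgue) \<le> F0 * uB * (discc * 4 * R\<^sup>2)"
    proof -
      have "(\<integral>y. f (U y) * (U y * (\<Phi> (y, 0))\<^sup>2) \<partial>lebesgue) \<le> (\<integral>y. F0 * uB * indicator (ball 0 (2 * R)) (y::real^2) \<partial>lebesgue)"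
      proof (rule integral_mono[OF w(3)])
        fix y :: "real^2"
        show "f (U y) * (U y * (\<Phi> (y, 0))\<^sup>2) \<le> F0 * uB * indicator (ball 0 (2 * R)) y"
        proof (cases "y \<in> ball 0 (2 * R)")
          case True
          have "\<bar>f (U y)\<bar> * (\<bar>U y\<bar> * (\<Phi> (y, 0))\<^sup>2) \<le> F0 * (uB * 1)"
            using F0[OF U_bound] U_bound[of y] sq[of "(y, 0)"] F00 uB(1) by (intro mult_mono) auto
          then have "\<bar>f (U y) * (U y * (\<Phi> (y, 0))\<^sup>2)\<bar> \<le> F0 * uB" by (simp add: abs_mult)
          then show ?thesis using True by simp
        next
          case False
          then have "(y, 0::real) \<notin> ball 0 (2 * R)" by (simp add: norm_Pair)
          then have "\<Phi> (y, 0) = 0" by (rule c(3))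
          then show ?thesis using False by simp
        qed
      qed (use integrable_indicator_disc in simp)
      also have "\<dots> = F0 * uB * (discc * (2 * R)\<^sup>2)"
        using measure_disc[of "2 * R"] R by simp
      finally show ?thesis by (simp add: power_mult_distrib)
    qed
    have s2: "- (K * (4 * R\<^sup>2)) \<le> (\<integral>z. g (snd z) (u z) * (u z * (\<Phi> z)\<^sup>2) \<partial>HM)"
      using K(2)[OF R(2) co] by (simp add: power_mult_distrib)
    have lin: "a \<le> 2 * (p + q) + 4 * r" if "a \<le> 2 * x + 4 * b" "x + gg = ff" "ff \<le> p" "- q \<le> gg" "b \<le> r" for a p q r x b gg ff :: real
      using that by argo
    have fin: "(\<integral>z. \<mu> (snd z) * (\<Phi> z)\<^sup>2 * (norm (G z))\<^sup>2 \<partial>HM) \<le> 2 * (F0 * uB * (discc * 4 * R\<^sup>2) + K * (4 * R\<^sup>2)) + 4 * (uB\<^sup>2 * 36 * (discc * 4 * (C0 * 4)) * R\<^sup>2)"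
      by (rule lin[OF s0 w(4) s1 s2 B])
    have "(\<integral>z. \<mu> (snd z) * (norm (G z))\<^sup>2 * indicator (ball 0 R) z \<partial>HM) \<le> (\<integral>z. \<mu> (snd z) * (\<Phi> z)\<^sup>2 * (norm (G z))\<^sup>2 \<partial>HM)"
    proof (rule integral_mono[OF integrable_mu_G[OF R(1)] iG])
      fix z assume "z \<in> space HM"
      then show "\<mu> (snd z) * (norm (G z))\<^sup>2 * indicator (ball 0 R) z \<le> \<mu> (snd z) * (\<Phi> z)\<^sup>2 * (norm (G z))\<^sup>2"
        using mu_nonneg[of z] cut_eq_1[of z R] by (cases "z \<in> ball 0 R") (auto simp: \<Phi>_def)
    qed
    also note fin
    also have "2 * (F0 * uB * (discc * 4 * R\<^sup>2) + K * (4 * R\<^sup>2)) + 4 * (uB\<^sup>2 * 36 * (discc * 4 * (C0 * 4)) * R\<^sup>2) = C * R\<^sup>2"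
      by (simp add: C_def algebra_simps)
    finally show ?thesis .
  qed
  then show ?thesis using C by blast
qed

end

subsection \<open>The stability inequality\<close>

text \<open>The norm has a corner at 0, but a map that vanishes together with its derivative has a
  norm of smaller than first order. This is the situation at almost every zero of
  \<open>w\<close>.\<close>

lemma has_derivative_norm_0:
  fixes F :: "'a::real_normed_vector \<Rightarrow> 'b::real_normed_vector"
  assumes F: "(F has_derivative (\<lambda>_. 0)) (at z)" and 0: "F z = 0"
  shows "((\<lambda>z. norm (F z)) has_derivative (\<lambda>_. 0)) (at z)"
  using F by (simp add: has_derivative_iff_norm 0)

lemma real2_inner: "(a :: real^2) \<bullet> b = (a \<bullet> axis 1 1) * (b \<bullet> axis 1 1) + (a \<bullet> axis 2 1) * (b \<bullet> axis 2 1)"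
  by (simp add: inner_axis inner_vec_def sum_2 axis_def)

context stable_layer
begin

abbreviation v1 :: "point \<Rightarrow> real" where "v1 \<equiv> V (axis 1 1)"
abbreviation v2 :: "point \<Rightarrow> real" where "v2 \<equiv> V (axis 2 1)"
abbreviation h1 :: "point \<Rightarrow> point" where "h1 \<equiv> HE (axis 1 1)"
abbreviation h2 :: "point \<Rightarrow> point" where "h2 \<equiv> HE (axis 2 1)"

lemma ax: "norm (axis i (1::real) :: real^2) = 1" by simp

definition w :: "point \<Rightarrow> real" where "w z = norm (fst (G z))"

text \<open>The chain rule for the norm off the zeros of \<open>w\<close>. At a zero
  \<open>inverse 0 = 0\<close> gives the value 0, which is the gradient of \<open>w\<close> at
  almost every zero.\<close>

definition Dw :: "point \<Rightarrow> point" where "Dw z = (v1 z *\<^sub>R h1 z + v2 z *\<^sub>R h2 z) /\<^sub>R w z"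

text \<open>If the horizontal gradient is written in polar form with angle \<open>\<alpha>\<close>,
  this is \<open>w\<^sup>2\<close> times the gradient of \<open>\<alpha>\<close>. Unlike that
  gradient, it is defined and continuous at zeros of \<open>w\<close> as well.\<close>

definition cross :: "point \<Rightarrow> point" where "cross z = v1 z *\<^sub>R h2 z - v2 z *\<^sub>R h1 z"

text \<open>Lagrange's identity turns this into \<open>\<bar>cross\<bar>\<^sup>2 / w\<^sup>2\<close>, the squared gradient of the direction
  of the horizontal gradient weighted with its squared length.\<close>

definition defect :: "point \<Rightarrow> real" where
  "defect z = (norm (h1 z))\<^sup>2 + (norm (h2 z))\<^sup>2 - (norm (Dw z))\<^sup>2"

lemma w_sq: "(w z)\<^sup>2 = (v1 z)\<^sup>2 + (v2 z)\<^sup>2"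
  unfolding w_def power2_norm_eq_inner real2_inner[of "fst (G z)" "fst (G z)"]
  by (simp add: V_def power2_eq_square inner_commute)

lemma w_sqrt: "w z = sqrt ((v1 z)\<^sup>2 + (v2 z)\<^sup>2)"
  by (metis w_sq w_def norm_ge_zero real_sqrt_unique)

lemma w_nonneg: "0 \<le> w z" by (simp add: w_def)

lemma w_zero: "w z = 0 \<Longrightarrow> v1 z = 0 \<and> v2 z = 0"
  using w_sq[of z] by (simp add: sum_power2_eq_zero_iff)

lemma w_continuous: "continuous_on half_space w"
  unfolding w_def[abs_def] by (intro continuous_intros G_continuous)

lemma w_Dw: "w z *\<^sub>R Dw z = v1 z *\<^sub>R h1 z + v2 z *\<^sub>R h2 z"
  using w_zero[of z] by (cases "w z = 0") (auto simp: Dw_def)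

lemma cross_sq: "(norm (cross z))\<^sup>2 = (w z)\<^sup>2 * defect z"
proof -
  have "(norm (cross z))\<^sup>2 = ((v1 z)\<^sup>2 + (v2 z)\<^sup>2) * ((norm (h1 z))\<^sup>2 + (norm (h2 z))\<^sup>2) - (norm (v1 z *\<^sub>R h1 z + v2 z *\<^sub>R h2 z))\<^sup>2"
    unfolding cross_def power2_norm_eq_inner
    by (simp add: inner_add_left inner_add_right inner_diff_left inner_diff_right inner_commute power2_eq_square algebra_simps)
  also have "\<dots> = (w z)\<^sup>2 * defect z"
    unfolding w_Dw[symmetric] by (simp add: w_sq defect_def power_mult_distrib algebra_simps)
  finally show ?thesis .
qed

lemma defect_nonneg: "0 \<le> defect z"
proof (cases "w z = 0")
  case True
  then show ?thesis by (simp add: defect_def Dw_def)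
next
  case False
  then have "0 < (w z)\<^sup>2" by simp
  moreover have "0 \<le> (w z)\<^sup>2 * defect z" using cross_sq[of z] by (metis zero_le_power2)
  ultimately show ?thesis by (simp add: zero_le_mult_iff)
qed

lemma norm_Dw_le: "(norm (Dw z))\<^sup>2 \<le> (norm (h1 z))\<^sup>2 + (norm (h2 z))\<^sup>2"
  using defect_nonneg[of z] by (simp add: defect_def)

lemma Dw_measurable [measurable]: "Dw \<in> borel_measurable HM"
proof -
  have [measurable]: "v1 \<in> borel_measurable HM" "v2 \<in> borel_measurable HM" "h1 \<in> borel_measurable HM" "h2 \<in> borel_measurable HM" "w \<in> borel_measurable HM"
    by (intro HM_measurable_continuous V_continuous HE_continuous w_continuous)+
  show ?thesis unfolding Dw_def[abs_def] by measurable
qed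

text \<open>On each line the zeros with nonzero derivative form a null set, and
  \<open>negligible_lines\<close> collects the lines of one direction. Taking the basis directions
  one after the other makes the whole gradient vanish at almost every zero.\<close>

lemma critical_null:
  "AE z in HM. V e z = 0 \<longrightarrow> HE e z = 0"
proof -
  have "AE z in HM. V e z = 0 \<longrightarrow> HE e z \<bullet> k = 0" for k
  proof -
    define S where "S = {z \<in> space HM. V e z = 0 \<and> HE e z \<bullet> k \<noteq> 0}"
    have [measurable]: "V e \<in> borel_measurable HM" "HE e \<in> borel_measurable HM"
      by (intro HM_measurable_continuous V_continuous HE_continuous)+
    have "S \<in> sets HM" unfolding S_def by measurable
    then have Sm: "S \<in> sets lebesgue" by (simp add: sets_restrict_space_iff)
    have "negligible S"
    proof (rule negligible_lines[OF Sm, of k], rule AE_I2)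
      fix z :: point
      define \<phi> where "\<phi> t = V e (z + t *\<^sub>R k)" for t
      have "{t. z + t *\<^sub>R k \<in> S} \<subseteq> {t. \<phi> t \<in> {0} \<and> (\<exists>D. D \<noteq> 0 \<and> (\<phi> has_real_derivative D) (at t))}"
      proof safe
        fix t assume t: "z + t *\<^sub>R k \<in> S"
        then have h: "z + t *\<^sub>R k \<in> half_space" by (simp add: S_def)
        show "\<phi> t = 0" using t by (simp add: S_def \<phi>_def)
        show "\<exists>D. D \<noteq> 0 \<and> (\<phi> has_real_derivative D) (at t)"
          using t GDERIV_line[OF GDERIV_V[OF h], of e] unfolding \<phi>_def[abs_def] S_def by (auto simp: inner_commute)
      qed
      then show "negligible {t. z + t *\<^sub>R k \<in> S}"
        using negligible_vimage_DERIV_nonzero[of "{0::real}" \<phi>] negligible_subset by (metis (no_types, lifting) negligible_sing)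
    qed
    then have "AE z in lebesgue. z \<notin> S" by (intro AE_completeI) simp
    then show ?thesis unfolding AE_HM_iff by eventually_elim (auto simp: S_def)
  qed
  then have "AE z in HM. \<forall>k\<in>Basis. V e z = 0 \<longrightarrow> HE e z \<bullet> k = 0" by (subst AE_finite_all) auto
  then show ?thesis by eventually_elim (auto simp: euclidean_all_zero_iff)
qed

lemma GDERIV_w_nonzero:
  assumes z: "z \<in> half_space" and nz: "w z \<noteq> 0"
  shows "GDERIV w z :> Dw z"
proof -
  have s: "0 < (v1 z)\<^sup>2 + (v2 z)\<^sup>2" using nz w_sq[of z] by (metis zero_less_power2)
  have d: "GDERIV (\<lambda>z. (v1 z)\<^sup>2 + (v2 z)\<^sup>2) z :> (2 * v1 z) *\<^sub>R h1 z + (2 * v2 z) *\<^sub>R h2 z"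
    using GDERIV_add[OF GDERIV_mult[OF GDERIV_V[OF z] GDERIV_V[OF z], of "axis 1 1" "axis 1 1"]
        GDERIV_mult[OF GDERIV_V[OF z] GDERIV_V[OF z], of "axis 2 1" "axis 2 1"]]
    by (simp add: power2_eq_square scaleR_add_left[symmetric])
  from GDERIV_DERIV_compose[OF d DERIV_real_sqrt[OF s]]
  have "GDERIV w z :> (inverse (sqrt ((v1 z)\<^sup>2 + (v2 z)\<^sup>2)) / 2) *\<^sub>R ((2 * v1 z) *\<^sub>R h1 z + (2 * v2 z) *\<^sub>R h2 z)"
    unfolding w_sqrt[abs_def] .
  moreover have "(inverse (sqrt ((v1 z)\<^sup>2 + (v2 z)\<^sup>2)) / 2) *\<^sub>R ((2 * v1 z) *\<^sub>R h1 z + (2 * v2 z) *\<^sub>R h2 z) = Dw z"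
    unfolding Dw_def w_sqrt by (simp add: scaleR_add_right)
  ultimately show ?thesis by simp
qed

text \<open>At almost every zero of \<open>w\<close> both \<open>h1\<close> and \<open>h2\<close>
  vanish. By symmetry of the Hessian the horizontal gradient then has derivative 0, so its norm is
  differentiable there with gradient 0.\<close>

lemma GDERIV_w: "AE z in HM. GDERIV w z :> Dw z"
proof -
  have "AE z in HM. z \<in> half_space" by (rule AE_HM_I)
  with critical_null[of "axis 1 1"] critical_null[of "axis 2 1"] show ?thesis
  proof eventually_elim
    case (elim z)
    show ?case
    proof (cases "w z = 0")
      case True
      then have v0: "v1 z = 0" "v2 z = 0" using w_zero by auto
      then have h0: "h1 z = 0" "h2 z = 0" using elim by auto
      have "fst (H z k) = 0" for k
      proof -
        have "(axis i 1, 0) \<bullet> H z k = k \<bullet> HE (axis i 1) z" for i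
          unfolding HE_def by (rule second_derivative_symmetric[OF open_half_space elim(3) G H H_continuous])
        then have "axis i 1 \<bullet> fst (H z k) = k \<bullet> HE (axis i 1) z" for i by (simp add: inner_prod_def)
        from this[of 1] this[of 2] h0 have "fst (H z k) \<bullet> fst (H z k) = 0"
          unfolding real2_inner[of "fst (H z k)" "fst (H z k)"] by (simp add: inner_commute)
        then show ?thesis by simp
      qed
      then have "((\<lambda>z. fst (G z)) has_derivative (\<lambda>_. 0)) (at z)"
        using has_derivative_fst[OF H[OF elim(3)]] by simp
      moreover have "fst (G z) = 0" using True by (simp add: w_def)
      ultimately have "(w has_derivative (\<lambda>_. 0)) (at z)" unfolding w_def[abs_def] by (rule has_derivative_norm_0)
      then show ?thesis by (simp add: gderiv_def Dw_def v0)
    next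
      case False
      then show ?thesis by (rule GDERIV_w_nonzero[OF elim(3)])
    qed
  qed
qed

lemma locally_lipschitz_w: "locally_lipschitz_on half_space w"
  unfolding locally_lipschitz_on_iff
proof
  fix x assume "x \<in> half_space"
  then obtain e L where e: "e > 0" "L-lipschitz_on (cball x e \<inter> half_space) G"
    using lipschitz_on_cball_C1[OF open_half_space, of x G "\<lambda>z. blinfun_apply (H z)" "\<lambda>z. norm (H z)", OF _ H _ continuous_on_norm[OF H_continuous]]
    by (metis norm_blinfun.rep_eq order_refl)
  have "L-lipschitz_on (cball x e \<inter> half_space) w"
  proof (rule lipschitz_onI)
    fix a b assume ab: "a \<in> cball x e \<inter> half_space" "b \<in> cball x e \<inter> half_space"
    have "dist (w a) (w b) \<le> dist (fst (G a)) (fst (G b))"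
      unfolding w_def dist_real_def dist_norm by (rule norm_triangle_ineq3)
    also have "\<dots> \<le> dist (G a) (G b)" by (rule dist_fst_le)
    also have "\<dots> \<le> L * dist a b" by (rule lipschitz_onD[OF e(2) ab])
    finally show "dist (w a) (w b) \<le> L * dist a b" .
  qed (use e(2) lipschitz_on_nonneg in blast)
  then show "\<exists>e>0. \<exists>L. L-lipschitz_on (cball x e \<inter> half_space) w" using e by blast
qed

definition Wt :: "real^2 \<Rightarrow> real" where "Wt y = sqrt ((Vt (axis 1 1) y)\<^sup>2 + (Vt (axis 2 1) y)\<^sup>2)"

lemma Wt_lim: "AE y in lebesgue. ((\<lambda>x. w (y, x)) \<longlongrightarrow> Wt y) (at_right 0)"
  using Vt_lim[OF ax, of 1] Vt_lim[OF ax, of 2]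
  by eventually_elim (auto simp: w_sqrt Wt_def intro!: tendsto_intros)

lemma test_w:
  assumes co: "cutoff R \<Phi> \<Phi>g"
  shows "test R (\<lambda>z. w z * \<Phi> z) (\<lambda>z. \<Phi> z *\<^sub>R Dw z + w z *\<^sub>R \<Phi>g z) (\<lambda>y. Wt y * \<Phi> (y, 0))"
    and "integrable HM (\<lambda>z. \<mu> (snd z) * ((w z)\<^sup>2 * (norm (\<Phi>g z))\<^sup>2))"
proof -
  have c: "\<And>z. GDERIV \<Phi> z :> \<Phi>g z" "continuous_on UNIV \<Phi>g" "\<And>z. 0 \<le> \<Phi> z" "\<And>z. \<Phi> z \<le> 1" "0 < R"
    "\<And>z. z \<notin> ball 0 R \<Longrightarrow> \<Phi> z = 0" "\<And>z. z \<notin> ball 0 R \<Longrightarrow> \<Phi>g z = 0"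
    using co unfolding cutoff_def by blast+
  have \<Phi>c: "continuous_on half_space \<Phi>" "continuous_on half_space \<Phi>g"
    using cutoff_continuous[OF co] continuous_on_subset[OF c(2)] by auto
  have [measurable]: "\<Phi> \<in> borel_measurable HM" "\<Phi>g \<in> borel_measurable HM" "w \<in> borel_measurable HM"
    by (intro HM_measurable_continuous \<Phi>c w_continuous)+
  obtain C where C: "C \<ge> 0" "\<And>z. z \<in> half_ball R \<Longrightarrow> w z \<le> C" using grad_y_bound[OF c(5)] unfolding w_def by blast
  obtain L where L: "L \<ge> 0" "\<And>z. norm (\<Phi>g z) \<le> L" using cutoff_bound[OF co] by blast
  have wb: "(w z)\<^sup>2 * (norm (\<Phi>g z))\<^sup>2 \<le> C\<^sup>2 * L\<^sup>2" if "z \<in> half_space" "z \<in> ball 0 R" for z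
    using C(2)[of z] that w_nonneg[of z] L by (intro mult_mono power_mono) (auto simp: half_ball_def)
  show iw: "integrable HM (\<lambda>z. \<mu> (snd z) * ((w z)\<^sup>2 * (norm (\<Phi>g z))\<^sup>2))"
    by (rule integrable_mu_bounded[where R = R and C = "C\<^sup>2 * L\<^sup>2"]) (use c(5,7) wb in \<open>measurable, auto\<close>)
  show "test R (\<lambda>z. w z * \<Phi> z) (\<lambda>z. \<Phi> z *\<^sub>R Dw z + w z *\<^sub>R \<Phi>g z) (\<lambda>y. Wt y * \<Phi> (y, 0))"
    unfolding test_def
  proof (intro conjI ballI impI)
    show "bounded ((\<lambda>z. w z * \<Phi> z) ` half_space)"
    proof (rule boundedI[where B = C])
      fix r assume "r \<in> (\<lambda>z. w z * \<Phi> z) ` half_space"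
      then obtain z where z: "z \<in> half_space" "r = w z * \<Phi> z" by blast
      show "norm r \<le> C"
      proof (cases "z \<in> ball 0 R")
        case True
        then have "w z * \<Phi> z \<le> C * 1" using C z c(3,4)[of z] by (intro mult_mono) (auto simp: half_ball_def)
        then show ?thesis using z w_nonneg[of z] c(3)[of z] by simp
      qed (use z c(6) C(1) in simp)
    qed
    show "locally_lipschitz_on half_space (\<lambda>z. w z * \<Phi> z)"
      by (rule locally_lipschitz_on_mult[OF locally_lipschitz_w locally_lipschitz_on_GDERIV[OF open_half_space c(1) \<Phi>c(2)]])
    show "AE z in HM. GDERIV (\<lambda>z. w z * \<Phi> z) z :> \<Phi> z *\<^sub>R Dw z + w z *\<^sub>R \<Phi>g z"
      using GDERIV_w
    proof eventually_elim
      case (elim z)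
      from GDERIV_mult[OF elim c(1)[of z]] show ?case by (simp add: add.commute)
    qed
    show "integrable HM (\<lambda>z. \<mu> (snd z) * (norm (\<Phi> z *\<^sub>R Dw z + w z *\<^sub>R \<Phi>g z))\<^sup>2)"
    proof (rule HM_integrable_bound)
      show "integrable HM (\<lambda>z. 2 * (\<mu> (snd z) * (\<Phi> z)\<^sup>2 * (norm (h1 z))\<^sup>2 + \<mu> (snd z) * (\<Phi> z)\<^sup>2 * (norm (h2 z))\<^sup>2) + 2 * (\<mu> (snd z) * ((w z)\<^sup>2 * (norm (\<Phi>g z))\<^sup>2)))"
        using caccioppoli[OF ax co, of 1] caccioppoli[OF ax co, of 2] iw by simp
      fix z assume z: "z \<in> half_space"
      have "(norm (\<Phi> z *\<^sub>R Dw z + w z *\<^sub>R \<Phi>g z))\<^sup>2 \<le> 2 * ((\<Phi> z)\<^sup>2 * (norm (Dw z))\<^sup>2) + 2 * ((w z)\<^sup>2 * (norm (\<Phi>g z))\<^sup>2)"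
        using norm_add_sq_le[of "\<Phi> z *\<^sub>R Dw z" "w z *\<^sub>R \<Phi>g z"] by (simp add: power_mult_distrib)
      also have "(\<Phi> z)\<^sup>2 * (norm (Dw z))\<^sup>2 \<le> (\<Phi> z)\<^sup>2 * ((norm (h1 z))\<^sup>2 + (norm (h2 z))\<^sup>2)" by (intro mult_left_mono norm_Dw_le) auto
      finally have "\<mu> (snd z) * (norm (\<Phi> z *\<^sub>R Dw z + w z *\<^sub>R \<Phi>g z))\<^sup>2
         \<le> \<mu> (snd z) * (2 * ((\<Phi> z)\<^sup>2 * ((norm (h1 z))\<^sup>2 + (norm (h2 z))\<^sup>2)) + 2 * ((w z)\<^sup>2 * (norm (\<Phi>g z))\<^sup>2))"
        by (intro mult_left_mono mu_nonneg[OF z]) simp_all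
      then show "\<bar>\<mu> (snd z) * (norm (\<Phi> z *\<^sub>R Dw z + w z *\<^sub>R \<Phi>g z))\<^sup>2\<bar>
        \<le> 2 * (\<mu> (snd z) * (\<Phi> z)\<^sup>2 * (norm (h1 z))\<^sup>2 + \<mu> (snd z) * (\<Phi> z)\<^sup>2 * (norm (h2 z))\<^sup>2) + 2 * (\<mu> (snd z) * ((w z)\<^sup>2 * (norm (\<Phi>g z))\<^sup>2))"
        using mu_nonneg[OF z] by (simp add: algebra_simps)
    qed measurable
    show "AE y in lebesgue. ((\<lambda>x. w (y, x) * \<Phi> (y, x)) \<longlongrightarrow> Wt y * \<Phi> (y, 0)) (at_right 0)"
      using Wt_lim by eventually_elim (intro tendsto_mult tendsto_at_right_continuous[OF cutoff_continuous[OF co]])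
    show "(\<lambda>z. \<Phi> z *\<^sub>R Dw z + w z *\<^sub>R \<Phi>g z) \<in> borel_measurable HM" by measurable
  qed (use c(5,6,7) in simp_all)
qed

text \<open>The linearized equations of the two components, added, eliminate \<open>c\<close> and
  the boundary term from the stability form at \<open>w * \<Phi>\<close>; the rest is pointwise
  algebra. The equality serves twice: with the form nonnegative it bounds \<open>defect\<close>, and
  with \<open>defect\<close> nonnegative it shows that the form is small at
  \<open>w * \<Phi>\<close>.\<close>

lemma stability_identity:
  assumes co: "cutoff R \<Phi> \<Phi>g"
  shows "integrable HM (\<lambda>z. \<mu> (snd z) * ((\<Phi> z)\<^sup>2 * defect z))"
    and "(\<integral>z. \<mu> (snd z) * (norm (\<Phi> z *\<^sub>R Dw z + w z *\<^sub>R \<Phi>g z))\<^sup>2 \<partial>HM) + (\<integral>z. c z * (w z * \<Phi> z)\<^sup>2 \<partial>HM)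
       - (\<integral>y. deriv f (U y) * (Wt y * \<Phi> (y, 0))\<^sup>2 \<partial>lebesgue)
     = (\<integral>z. \<mu> (snd z) * ((w z)\<^sup>2 * (norm (\<Phi>g z))\<^sup>2) \<partial>HM) - (\<integral>z. \<mu> (snd z) * ((\<Phi> z)\<^sup>2 * defect z) \<partial>HM)"
proof -
  define X where "X e z = (\<Phi> z)\<^sup>2 *\<^sub>R HE e z + V e z *\<^sub>R ((2 * \<Phi> z) *\<^sub>R \<Phi>g z)" for e z
  note l1 = linearized[OF ax[of 1] co, folded X_def]
  note l2 = linearized[OF ax[of 2] co, folded X_def]
  note t = test_w[OF co]
  have iX: "integrable HM (\<lambda>z. \<mu> (snd z) * (norm (\<Phi> z *\<^sub>R Dw z + w z *\<^sub>R \<Phi>g z))\<^sup>2)" using t(1) by (simp add: test_def)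
  have pt: "\<mu> (snd z) * ((\<Phi> z)\<^sup>2 * defect z) = \<mu> (snd z) * ((w z)\<^sup>2 * (norm (\<Phi>g z))\<^sup>2)
     - \<mu> (snd z) * (norm (\<Phi> z *\<^sub>R Dw z + w z *\<^sub>R \<Phi>g z))\<^sup>2 + \<mu> (snd z) * (h1 z \<bullet> X (axis 1 1) z) + \<mu> (snd z) * (h2 z \<bullet> X (axis 2 1) z)" for z
  proof -
    have 1: "(norm (\<Phi> z *\<^sub>R Dw z + w z *\<^sub>R \<Phi>g z))\<^sup>2 = (\<Phi> z)\<^sup>2 * (norm (Dw z))\<^sup>2 + 2 * \<Phi> z * ((w z *\<^sub>R Dw z) \<bullet> \<Phi>g z) + (w z)\<^sup>2 * (norm (\<Phi>g z))\<^sup>2"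
      unfolding power2_norm_eq_inner by (simp add: inner_add_left inner_add_right inner_commute power2_eq_square algebra_simps)
    have 2: "h1 z \<bullet> X (axis 1 1) z + h2 z \<bullet> X (axis 2 1) z = (\<Phi> z)\<^sup>2 * ((norm (h1 z))\<^sup>2 + (norm (h2 z))\<^sup>2) + 2 * \<Phi> z * ((v1 z *\<^sub>R h1 z + v2 z *\<^sub>R h2 z) \<bullet> \<Phi>g z)"
      unfolding X_def power2_norm_eq_inner by (simp add: inner_add_left inner_add_right algebra_simps)
    have "(\<Phi> z)\<^sup>2 * defect z = (w z)\<^sup>2 * (norm (\<Phi>g z))\<^sup>2 - (norm (\<Phi> z *\<^sub>R Dw z + w z *\<^sub>R \<Phi>g z))\<^sup>2 + (h1 z \<bullet> X (axis 1 1) z + h2 z \<bullet> X (axis 2 1) z)"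
      unfolding 1 2 w_Dw defect_def by (simp add: algebra_simps)
    then show ?thesis by (simp only: distrib_left right_diff_distrib add.assoc)
  qed
  show "integrable HM (\<lambda>z. \<mu> (snd z) * ((\<Phi> z)\<^sup>2 * defect z))"
    unfolding pt by (intro Bochner_Integration.integrable_add Bochner_Integration.integrable_diff t(2) iX l1(1) l2(1))
  have e1: "(\<integral>z. \<mu> (snd z) * ((\<Phi> z)\<^sup>2 * defect z) \<partial>HM) = (\<integral>z. \<mu> (snd z) * ((w z)\<^sup>2 * (norm (\<Phi>g z))\<^sup>2) \<partial>HM)
     - (\<integral>z. \<mu> (snd z) * (norm (\<Phi> z *\<^sub>R Dw z + w z *\<^sub>R \<Phi>g z))\<^sup>2 \<partial>HM) + (\<integral>z. \<mu> (snd z) * (h1 z \<bullet> X (axis 1 1) z) \<partial>HM) + (\<integral>z. \<mu> (snd z) * (h2 z \<bullet> X (axis 2 1) z) \<partial>HM)"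
    unfolding pt
    by (simp add: t(2) iX l1(1) l2(1) Bochner_Integration.integral_add Bochner_Integration.integral_diff)
  have e2: "(\<integral>z. c z * (w z * \<Phi> z)\<^sup>2 \<partial>HM) = (\<integral>z. c z * v1 z * (v1 z * (\<Phi> z)\<^sup>2) \<partial>HM) + (\<integral>z. c z * v2 z * (v2 z * (\<Phi> z)\<^sup>2) \<partial>HM)"
  proof -
    have "c z * (w z * \<Phi> z)\<^sup>2 = c z * v1 z * (v1 z * (\<Phi> z)\<^sup>2) + c z * v2 z * (v2 z * (\<Phi> z)\<^sup>2)" for z
      unfolding power_mult_distrib w_sq by (simp add: power2_eq_square algebra_simps)
    then show ?thesis using Bochner_Integration.integral_add[OF l1(2) l2(2)] by simp
  qed
  have e3: "(\<integral>y. deriv f (U y) * (Wt y * \<Phi> (y, 0))\<^sup>2 \<partial>lebesgue)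
     = (\<integral>y. deriv f (U y) * Vt (axis 1 1) y * (Vt (axis 1 1) y * (\<Phi> (y, 0))\<^sup>2) \<partial>lebesgue) + (\<integral>y. deriv f (U y) * Vt (axis 2 1) y * (Vt (axis 2 1) y * (\<Phi> (y, 0))\<^sup>2) \<partial>lebesgue)"
  proof -
    have "(Wt y)\<^sup>2 = (Vt (axis 1 1) y)\<^sup>2 + (Vt (axis 2 1) y)\<^sup>2" for y by (simp add: Wt_def)
    then have "deriv f (U y) * (Wt y * \<Phi> (y, 0))\<^sup>2 = deriv f (U y) * Vt (axis 1 1) y * (Vt (axis 1 1) y * (\<Phi> (y, 0))\<^sup>2) + deriv f (U y) * Vt (axis 2 1) y * (Vt (axis 2 1) y * (\<Phi> (y, 0))\<^sup>2)" for y
      unfolding power_mult_distrib by (simp add: power2_eq_square algebra_simps)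
    then show ?thesis using Bochner_Integration.integral_add[OF l1(3) l2(3)] by simp
  qed
  have lin: "x + cc - ff = a - d" if "d = a - x + p + q" "cc = c1 + c2" "ff = f1 + f2" "p + c1 = f1" "q + c2 = f2"
    for x cc ff a d p q c1 c2 f1 f2 :: real using that by argo
  show "(\<integral>z. \<mu> (snd z) * (norm (\<Phi> z *\<^sub>R Dw z + w z *\<^sub>R \<Phi>g z))\<^sup>2 \<partial>HM) + (\<integral>z. c z * (w z * \<Phi> z)\<^sup>2 \<partial>HM)
       - (\<integral>y. deriv f (U y) * (Wt y * \<Phi> (y, 0))\<^sup>2 \<partial>lebesgue)
     = (\<integral>z. \<mu> (snd z) * ((w z)\<^sup>2 * (norm (\<Phi>g z))\<^sup>2) \<partial>HM) - (\<integral>z. \<mu> (snd z) * ((\<Phi> z)\<^sup>2 * defect z) \<partial>HM)"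
    by (rule lin[OF e1 e2 e3 l1(4) l2(4)])
qed

text \<open>Each of the \<open>N\<close> dyadic pieces contributes at most a constant over
  \<open>N\<^sup>2\<close>, because the quadratic growth of the energy cancels the factor
  \<open>36 / 4 ^ (m + k)\<close>. The constant is independent of \<open>m\<close>, so the ball on
  which the cutoff is 1 can be chosen freely.\<close>

lemma log_cutoff_energy:
  "\<exists>C\<ge>0. \<forall>m N. 0 < N \<longrightarrow> (\<integral>z. \<mu> (snd z) * ((w z)\<^sup>2 * (norm (lcutg m N z))\<^sup>2) \<partial>HM) \<le> C / real N"
proof -
  obtain C where C: "C \<ge> 0" "\<And>R. R \<ge> 1 \<Longrightarrow> (\<integral>z. \<mu> (snd z) * (norm (G z))\<^sup>2 * indicator (ball 0 R) z \<partial>HM) \<le> C * R\<^sup>2"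
    using energy_growth by blast
  have "(\<integral>z. \<mu> (snd z) * ((w z)\<^sup>2 * (norm (lcutg m N z))\<^sup>2) \<partial>HM) \<le> 144 * C / real N" if N: "0 < N" for m N
  proof -
    let ?E = "\<lambda>k z. \<mu> (snd z) * (norm (G z))\<^sup>2 * indicator (ball 0 (2 * 2 ^ (m + k))) z :: real"
    have iE: "integrable HM (?E k)" for k by (rule integrable_mu_G) simp
    have "(\<integral>z. \<mu> (snd z) * ((w z)\<^sup>2 * (norm (lcutg m N z))\<^sup>2) \<partial>HM) \<le> (\<integral>z. (\<Sum>k<N. (36 / 4 ^ (m + k) / (real N)\<^sup>2) * ?E k z) \<partial>HM)"
    proof (rule integral_mono)
      show "integrable HM (\<lambda>z. \<mu> (snd z) * ((w z)\<^sup>2 * (norm (lcutg m N z))\<^sup>2))" by (rule test_w(2)[OF cutoff_lcut])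
      show "integrable HM (\<lambda>z. \<Sum>k<N. (36 / 4 ^ (m + k) / (real N)\<^sup>2) * ?E k z)" using iE by simp
      fix z assume "z \<in> space HM"
      then have z: "z \<in> half_space" by simp
      have "w z \<le> norm (G z)" unfolding w_def using norm_fst_le[of "fst (G z)" "snd (G z)"] by simp
      then have "(w z)\<^sup>2 \<le> (norm (G z))\<^sup>2" using w_nonneg by (intro power_mono)
      then have "(w z)\<^sup>2 * (norm (lcutg m N z))\<^sup>2 \<le> (norm (G z))\<^sup>2 * ((\<Sum>k<N. 36 / 4 ^ (m + k) * indicator (ball 0 (2 * 2 ^ (m + k))) z) / (real N)\<^sup>2)"
        by (intro mult_mono norm_lcutg_le) auto
      then have "\<mu> (snd z) * ((w z)\<^sup>2 * (norm (lcutg m N z))\<^sup>2) \<le> \<mu> (snd z) * ((norm (G z))\<^sup>2 * ((\<Sum>k<N. 36 / 4 ^ (m + k) * indicator (ball 0 (2 * 2 ^ (m + k))) z) / (real N)\<^sup>2))"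
        by (intro mult_left_mono mu_nonneg[OF z])
      also have "\<dots> = (\<Sum>k<N. (36 / 4 ^ (m + k) / (real N)\<^sup>2) * ?E k z)"
        by (simp add: sum_distrib_left sum_divide_distrib mult_ac)
      finally show "\<mu> (snd z) * ((w z)\<^sup>2 * (norm (lcutg m N z))\<^sup>2) \<le> (\<Sum>k<N. (36 / 4 ^ (m + k) / (real N)\<^sup>2) * ?E k z)" .
    qed
    also have "\<dots> = (\<Sum>k<N. (36 / 4 ^ (m + k) / (real N)\<^sup>2) * (\<integral>z. ?E k z \<partial>HM))"
      using iE by (subst Bochner_Integration.integral_sum) auto
    also have "\<dots> \<le> (\<Sum>k<N. 144 * C / (real N)\<^sup>2)"
    proof (rule sum_mono)
      fix k
      have "(1::real) \<le> 2 * 2 ^ (m + k)" using one_le_power[of "2::real" "Suc (m + k)"] by (simp only: power_Suc)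
      then have "(\<integral>z. ?E k z \<partial>HM) \<le> C * (2 * 2 ^ (m + k))\<^sup>2" by (rule C(2))
      \<comment> \<open>This factor 4 times the 36 of the gradient bound gives 144.\<close>
      also have "\<dots> = 4 * C * 4 ^ (m + k)" by (simp add: power_mult_distrib power2_eq_square flip: power_mult_distrib)
      finally have "(36 / 4 ^ (m + k) / (real N)\<^sup>2) * (\<integral>z. ?E k z \<partial>HM) \<le> (36 / 4 ^ (m + k) / (real N)\<^sup>2) * (4 * C * 4 ^ (m + k))"
        by (intro mult_left_mono) auto
      then show "(36 / 4 ^ (m + k) / (real N)\<^sup>2) * (\<integral>z. ?E k z \<partial>HM) \<le> 144 * C / (real N)\<^sup>2" by simp
    qed
    also have "\<dots> = 144 * C / real N" using N by (simp add: power2_eq_square)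
    finally show ?thesis .
  qed
  then show ?thesis using C(1) by (intro exI[of _ "144 * C"]) auto
qed

text \<open>For fixed \<open>m\<close> the cutoffs are 1 on the ball of radius \<open>2 ^ m\<close>
  while \<open>N\<close> tends to infinity, so \<open>defect\<close> vanishes almost everywhere. It
  may be discontinuous at zeros of \<open>w\<close>, but \<open>cross\<close> is continuous, which
  gives the claim at every point.\<close>

lemma cross_eq_0: assumes "z \<in> half_space" shows "cross z = 0"
proof -
  obtain C where C: "C \<ge> 0" "\<And>m N. 0 < N \<Longrightarrow> (\<integral>z. \<mu> (snd z) * ((w z)\<^sup>2 * (norm (lcutg m N z))\<^sup>2) \<partial>HM) \<le> C / real N"
    using log_cutoff_energy by blast
  have AEm: "AE z in HM. norm z < 2 ^ m \<longrightarrow> defect z = 0" for m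
  proof -
    define D where "D z = \<mu> (snd z) * (defect z * indicator (ball 0 (2 ^ m)) z)" for z
    have dm: "defect \<in> borel_measurable HM"
    proof -
      have [measurable]: "h1 \<in> borel_measurable HM" "h2 \<in> borel_measurable HM" by (intro HM_measurable_continuous HE_continuous)+
      show ?thesis unfolding defect_def[abs_def] by measurable
    qed
    have bd: "0 \<le> D z \<and> D z \<le> \<mu> (snd z) * ((lcut m N z)\<^sup>2 * defect z)" if "z \<in> half_space" "0 < N" for z N
    proof -
      have "defect z * indicator (ball 0 (2 ^ m)) z \<le> (lcut m N z)\<^sup>2 * defect z"
        using lcut_eq_1[of z m N] that(2) defect_nonneg[of z] by (cases "z \<in> ball 0 (2 ^ m)") auto
      then show ?thesis unfolding D_def using mu_nonneg[OF that(1)] defect_nonneg[of z] by (auto intro!: mult_nonneg_nonneg mult_left_mono)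
    qed
    have iD: "integrable HM D"
      by (rule HM_integrable_bound[OF stability_identity(1)[OF cutoff_lcut[of m 1]]])
         (use bd[of _ 1] dm in \<open>auto simp: D_def[abs_def]\<close>)
    have le: "(\<integral>z. D z \<partial>HM) \<le> C / real N" if N: "0 < N" for N
    proof -
      have "(\<integral>z. D z \<partial>HM) \<le> (\<integral>z. \<mu> (snd z) * ((lcut m N z)\<^sup>2 * defect z) \<partial>HM)"
        by (rule integral_mono[OF iD stability_identity(1)[OF cutoff_lcut]]) (use bd N in simp)
      also have "\<dots> \<le> (\<integral>z. \<mu> (snd z) * ((w z)\<^sup>2 * (norm (lcutg m N z))\<^sup>2) \<partial>HM)"
        using stable_test(3)[OF test_w(1)[OF cutoff_lcut[of m N]]] stability_identity(2)[OF cutoff_lcut[of m N]] by linarith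
      also have "\<dots> \<le> C / real N" by (rule C(2)[OF N])
      finally show ?thesis .
    qed
    have "(\<integral>z. D z \<partial>HM) \<le> 0"
    proof (rule LIMSEQ_le_const)
      show "(\<lambda>n. C * inverse (real (Suc n))) \<longlonglongrightarrow> 0" using tendsto_mult_right_zero[OF LIMSEQ_inverse_real_of_nat] .
      show "\<exists>N. \<forall>n\<ge>N. (\<integral>z. D z \<partial>HM) \<le> C * inverse (real (Suc n))" using le[of "Suc n" for n] by (auto simp: divide_inverse)
    qed
    moreover have D0: "AE z in HM. 0 \<le> D z" by (rule AE_HM_I) (use bd[of _ 1] in auto)
    ultimately have "(\<integral>z. D z \<partial>HM) = 0" using integral_nonneg_AE[OF D0] by linarith
    then have "AE z in HM. D z = 0" using integral_nonneg_eq_0_iff_AE[OF iD D0] by simp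
    moreover have "AE z in HM. z \<in> half_space" by (rule AE_HM_I)
    ultimately show ?thesis
    proof eventually_elim
      case (elim z)
      have "0 < \<mu> (snd z)" using elim(2) mu_pos by (simp add: half_space_def)
      then show ?case using elim(1) by (auto simp: D_def)
    qed
  qed
  then have "AE z in HM. \<forall>m. norm z < 2 ^ m \<longrightarrow> defect z = 0" by (simp only: AE_all_countable) blast
  then have "AE z in lebesgue. z \<in> half_space \<longrightarrow> norm (cross z) \<le> 0"
    unfolding AE_HM_iff
  proof (eventually_elim, intro impI)
    fix z :: point assume *: "z \<in> half_space \<longrightarrow> (\<forall>m. norm z < 2 ^ m \<longrightarrow> defect z = 0)" "z \<in> half_space"
    obtain m where "norm z < 2 ^ m" using real_arch_pow[of 2 "norm z"] by auto
    then have "defect z = 0" using * by blast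
    then have "(norm (cross z))\<^sup>2 = 0" by (simp add: cross_sq)
    then show "norm (cross z) \<le> 0" by simp
  qed
  moreover have "continuous_on half_space (\<lambda>z. norm (cross z))"
    unfolding cross_def[abs_def] by (intro continuous_intros V_continuous HE_continuous)
  ultimately have "norm (cross z) \<le> 0" using AE_bound_imp_bound[OF open_half_space _ _ assms] by blast
  then show ?thesis by simp
qed

end

section \<open>The equation for the length of the horizontal gradient\<close>

lemma lcutg_eq_0': assumes "norm z \<le> 2 ^ m" shows "lcutg m N z = 0"
proof -
  have "norm z \<le> 2 ^ (m + k)" for k
    using assms order_trans power_increasing[of m "m + k" "2::real"] by fastforce
  then show ?thesis by (simp add: lcutg_def cutg_eq_0')
qed

lemma quadratic_nonneg_imp_0:
  fixes B Q :: real
  assumes "\<And>s. 0 \<le> 2 * s * B + s\<^sup>2 * Q"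
  shows "B = 0"
proof (rule ccontr)
  assume B: "B \<noteq> 0"
  \<comment> \<open>A small \<open>s\<close> of the sign opposite to \<open>B\<close>, where the
    linear term outweighs the quadratic one; the \<open>+ 1\<close> covers
    \<open>Q = 0\<close>.\<close>
  define s where "s = - B / (\<bar>Q\<bar> + 1)"
  have q: "0 < \<bar>Q\<bar> + 1" by simp
  have sB: "s * (\<bar>Q\<bar> + 1) = - B" using q by (simp add: s_def)
  have s0: "s \<noteq> 0" using B q by (simp add: s_def)
  have B': "B = - (s * (\<bar>Q\<bar> + 1))" using sB by simp
  have "2 * s * (- (s * P)) = - 2 * s\<^sup>2 * P" for P by (simp add: power2_eq_square)
  from this[of "\<bar>Q\<bar> + 1"] have "2 * s * B = - 2 * s\<^sup>2 * (\<bar>Q\<bar> + 1)" by (simp only: B'[symmetric])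
  then have "0 \<le> - 2 * s\<^sup>2 * (\<bar>Q\<bar> + 1) + s\<^sup>2 * Q" using assms[of s] by (simp only:)
  also have "\<dots> = s\<^sup>2 * (Q - 2 * \<bar>Q\<bar> - 2)" by (simp add: algebra_simps)
  also have "\<dots> < 0" using s0 by (intro mult_pos_neg) (simp_all add: abs_if)
  finally show False by simp
qed

context stable_layer
begin

lemma test_add_scaled:
  assumes t: "test R \<xi> X T" "test R \<psi> Y S"
  shows "test R (\<lambda>z. \<xi> z + s * \<psi> z) (\<lambda>z. X z + s *\<^sub>R Y z) (\<lambda>y. T y + s * S y)"
  unfolding test_def
proof (intro conjI)
  note d = t[unfolded test_def]
  have [measurable]: "X \<in> borel_measurable HM" "Y \<in> borel_measurable HM" using d by blast+
  show "0 < R" using d by blast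
  show "bounded ((\<lambda>z. \<xi> z + s * \<psi> z) ` half_space)"
  proof -
    obtain A B where A: "\<And>z. z \<in> half_space \<Longrightarrow> norm (\<xi> z) \<le> A" and B: "\<And>z. z \<in> half_space \<Longrightarrow> norm (\<psi> z) \<le> B"
      using d unfolding bounded_iff by (metis imageI)
    have "norm (\<xi> z + s * \<psi> z) \<le> A + \<bar>s\<bar> * B" if "z \<in> half_space" for z
      using norm_triangle_mono[OF A[OF that], of "s * \<psi> z" "\<bar>s\<bar> * B"] B[OF that] by (simp add: abs_mult mult_left_mono)
    then show ?thesis by (intro boundedI[where B = "A + \<bar>s\<bar> * B"]) blast
  qed
  show "locally_lipschitz_on half_space (\<lambda>z. \<xi> z + s * \<psi> z)"
    by (intro locally_lipschitz_on_add locally_lipschitz_on_mult locally_lipschitz_on_const) (use d in blast)+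
  show "\<forall>z\<in>half_space. z \<notin> ball 0 R \<longrightarrow> \<xi> z + s * \<psi> z = 0 \<and> X z + s *\<^sub>R Y z = 0" using d by auto
  show "(\<lambda>z. X z + s *\<^sub>R Y z) \<in> borel_measurable HM" by measurable
  have "AE z in HM. GDERIV \<xi> z :> X z" "AE z in HM. GDERIV \<psi> z :> Y z" using d by blast+
  then show "AE z in HM. GDERIV (\<lambda>z. \<xi> z + s * \<psi> z) z :> X z + s *\<^sub>R Y z"
  proof eventually_elim
    case (elim z)
    from GDERIV_add[OF elim(1) GDERIV_mult[OF GDERIV_const elim(2), of s]] show ?case by simp
  qed
  show "integrable HM (\<lambda>z. \<mu> (snd z) * (norm (X z + s *\<^sub>R Y z))\<^sup>2)"
  proof (rule HM_integrable_bound)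
    show "integrable HM (\<lambda>z. 2 * (\<mu> (snd z) * (norm (X z))\<^sup>2) + 2 * s\<^sup>2 * (\<mu> (snd z) * (norm (Y z))\<^sup>2))"
      using d by simp
    fix z assume z: "z \<in> half_space"
    have "\<mu> (snd z) * (norm (X z + s *\<^sub>R Y z))\<^sup>2 \<le> \<mu> (snd z) * (2 * (norm (X z))\<^sup>2 + 2 * (norm (s *\<^sub>R Y z))\<^sup>2)"
      by (intro mult_left_mono norm_add_sq_le mu_nonneg z)
    then show "\<bar>\<mu> (snd z) * (norm (X z + s *\<^sub>R Y z))\<^sup>2\<bar> \<le> 2 * (\<mu> (snd z) * (norm (X z))\<^sup>2) + 2 * s\<^sup>2 * (\<mu> (snd z) * (norm (Y z))\<^sup>2)"
      using mu_nonneg[OF z] by (simp add: power_mult_distrib algebra_simps)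
  qed measurable
  have "AE y in lebesgue. ((\<lambda>x. \<xi> (y, x)) \<longlongrightarrow> T y) (at_right 0)" "AE y in lebesgue. ((\<lambda>x. \<psi> (y, x)) \<longlongrightarrow> S y) (at_right 0)"
    using d by blast+
  then show "AE y in lebesgue. ((\<lambda>x. \<xi> (y, x) + s * \<psi> (y, x)) \<longlongrightarrow> T y + s * S y) (at_right 0)"
    by eventually_elim (intro tendsto_intros)
qed

lemma test_mono: "test R \<xi> X T \<Longrightarrow> R \<le> R' \<Longrightarrow> test R' \<xi> X T"
  unfolding test_def by (meson less_le_trans subset_ball subsetD)

text \<open>The stability form is nonnegative and nearly vanishes at \<open>w\<close> times a logarithmic cutoff,
  so its polar form vanishes there.\<close>

lemma weak_w:
  assumes t: "test R \<psi> Y (\<lambda>y. 0)"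
  shows "integrable HM (\<lambda>z. \<mu> (snd z) * (Dw z \<bullet> Y z))" "integrable HM (\<lambda>z. c z * (w z * \<psi> z))"
    "(\<integral>z. \<mu> (snd z) * (Dw z \<bullet> Y z) \<partial>HM) + (\<integral>z. c z * (w z * \<psi> z) \<partial>HM) = 0"
proof -
  \<comment> \<open>With this \<open>m\<close> the logarithmic cutoff is 1 and its gradient 0 on the
    support of \<open>\<psi>\<close> for every positive \<open>N\<close>, so the terms mixed between
    \<open>\<xi> N\<close> and \<open>\<psi>\<close> do not depend on \<open>N\<close>.\<close>
  obtain m where m: "R < 2 ^ m" using real_arch_pow[of 2 R] by auto
  define \<xi> where "\<xi> N z = w z * lcut m N z" for N z
  define X where "X N z = lcut m N z *\<^sub>R Dw z + w z *\<^sub>R lcutg m N z" for N z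
  define T where "T N y = Wt y * lcut m N (y, 0::real)" for N y
  have tw: "test (2 ^ (m + N)) (\<xi> N) (X N) (T N)" for N
    unfolding \<xi>_def X_def T_def by (rule test_w(1)[OF cutoff_lcut])
  have t': "test (2 ^ (m + N)) \<psi> Y (\<lambda>y. 0)" for N
  proof (rule test_mono[OF t])
    show "R \<le> 2 ^ (m + N)" by (rule order_trans[OF less_imp_le[OF m] power_increasing]) simp_all
  qed
  have Y0: "Y z = 0 \<and> \<psi> z = 0" if "z \<in> half_space" "\<not> norm z \<le> 2 ^ m" for z
    using t that m unfolding test_def by auto
  have XY: "X N z \<bullet> Y z = Dw z \<bullet> Y z" if "z \<in> half_space" "0 < N" for N z
    using Y0[OF that(1)] lcut_eq_1[of z m N] lcutg_eq_0'[of z m N] that(2) by (cases "norm z \<le> 2 ^ m") (auto simp: X_def)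
  have x\<psi>: "\<xi> N z * \<psi> z = w z * \<psi> z" if "z \<in> half_space" "0 < N" for N z
    using Y0[OF that(1)] lcut_eq_1[of z m N] that(2) by (cases "norm z \<le> 2 ^ m") (auto simp: \<xi>_def)
  note st = stable_test(3)[OF test_add_scaled[OF tw t']]
  have iX: "integrable HM (\<lambda>z. \<mu> (snd z) * (norm (X N z))\<^sup>2)" for N using tw[of N] unfolding test_def by blast
  have iY: "integrable HM (\<lambda>z. \<mu> (snd z) * (norm (Y z))\<^sup>2)" using t unfolding test_def by blast
  have iXY: "integrable HM (\<lambda>z. \<mu> (snd z) * (norm (X N z + 1 *\<^sub>R Y z))\<^sup>2)" for N
    using test_add_scaled[OF tw t', of N 1] unfolding test_def by blast
  have ic: "integrable HM (\<lambda>z. c z * (\<xi> N z)\<^sup>2)" for N by (rule stable_test(1)[OF tw])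
  have i\<psi>: "integrable HM (\<lambda>z. c z * (\<psi> z)\<^sup>2)" by (rule stable_test(1)[OF t])
  have ic\<psi>: "integrable HM (\<lambda>z. c z * (\<xi> N z + 1 * \<psi> z)\<^sup>2)" for N by (rule stable_test(1)[OF test_add_scaled[OF tw t']])
  \<comment> \<open>Polarization: the mixed term is half of the square of the sum minus both
    squares, and all three squares are integrable because sums of test functions are test
    functions.\<close>
  have "integrable HM (\<lambda>z. (\<mu> (snd z) * (norm (X 1 z + 1 *\<^sub>R Y z))\<^sup>2 - \<mu> (snd z) * (norm (X 1 z))\<^sup>2 - \<mu> (snd z) * (norm (Y z))\<^sup>2) / 2)"
    using iX iY iXY by simp
  moreover have "(\<mu> (snd z) * (norm (X 1 z + 1 *\<^sub>R Y z))\<^sup>2 - \<mu> (snd z) * (norm (X 1 z))\<^sup>2 - \<mu> (snd z) * (norm (Y z))\<^sup>2) / 2 = \<mu> (snd z) * (Dw z \<bullet> Y z)"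
    if "z \<in> half_space" for z
    unfolding XY[OF that zero_less_one, symmetric] power2_norm_eq_inner
    by (simp add: inner_add_left inner_add_right inner_commute algebra_simps)
  ultimately show iA: "integrable HM (\<lambda>z. \<mu> (snd z) * (Dw z \<bullet> Y z))"
    by (subst Bochner_Integration.integrable_cong[OF refl]) auto
  have "integrable HM (\<lambda>z. (c z * (\<xi> 1 z + 1 * \<psi> z)\<^sup>2 - c z * (\<xi> 1 z)\<^sup>2 - c z * (\<psi> z)\<^sup>2) / 2)"
    using ic i\<psi> ic\<psi> by simp
  moreover have "(c z * (\<xi> 1 z + 1 * \<psi> z)\<^sup>2 - c z * (\<xi> 1 z)\<^sup>2 - c z * (\<psi> z)\<^sup>2) / 2 = c z * (w z * \<psi> z)"
    if "z \<in> half_space" for z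
    unfolding x\<psi>[OF that zero_less_one, symmetric] by (simp add: power2_eq_square algebra_simps)
  ultimately show iB: "integrable HM (\<lambda>z. c z * (w z * \<psi> z))"
    by (subst Bochner_Integration.integrable_cong[OF refl]) auto
  define a where "a = (\<integral>z. \<mu> (snd z) * (Dw z \<bullet> Y z) \<partial>HM)"
  define b where "b = (\<integral>z. c z * (w z * \<psi> z) \<partial>HM)"
  define q where "q = (\<integral>z. \<mu> (snd z) * (norm (Y z))\<^sup>2 \<partial>HM) + (\<integral>z. c z * (\<psi> z)\<^sup>2 \<partial>HM)"
  obtain C where C: "C \<ge> 0" "\<And>N. 0 < N \<Longrightarrow> (\<integral>z. \<mu> (snd z) * ((w z)\<^sup>2 * (norm (lcutg m N z))\<^sup>2) \<partial>HM) \<le> C / real N"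
    using log_cutoff_energy by blast
  \<comment> \<open>The form at \<open>\<xi> N + s * \<psi>\<close> is nonnegative, and its part of
    order 0 in \<open>s\<close> is at most \<open>C / N\<close>. Letting \<open>N\<close> tend to
    infinity leaves a quadratic polynomial in \<open>s\<close> without constant term.\<close>
  have key: "0 \<le> C / real N + 2 * s * (a + b) + s\<^sup>2 * q" if N: "0 < N" for N s
  proof -
    have e1: "(\<integral>z. \<mu> (snd z) * (norm (X N z + s *\<^sub>R Y z))\<^sup>2 \<partial>HM)
      = (\<integral>z. \<mu> (snd z) * (norm (X N z))\<^sup>2 \<partial>HM) + 2 * s * a + s\<^sup>2 * (\<integral>z. \<mu> (snd z) * (norm (Y z))\<^sup>2 \<partial>HM)"
    proof -
      have "(\<integral>z. \<mu> (snd z) * (norm (X N z + s *\<^sub>R Y z))\<^sup>2 \<partial>HM)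
        = (\<integral>z. \<mu> (snd z) * (norm (X N z))\<^sup>2 + 2 * s * (\<mu> (snd z) * (Dw z \<bullet> Y z)) + s\<^sup>2 * (\<mu> (snd z) * (norm (Y z))\<^sup>2) \<partial>HM)"
      proof (rule Bochner_Integration.integral_cong[OF refl])
        fix z assume "z \<in> space HM"
        then have z: "z \<in> half_space" by simp
        show "\<mu> (snd z) * (norm (X N z + s *\<^sub>R Y z))\<^sup>2 = \<mu> (snd z) * (norm (X N z))\<^sup>2 + 2 * s * (\<mu> (snd z) * (Dw z \<bullet> Y z)) + s\<^sup>2 * (\<mu> (snd z) * (norm (Y z))\<^sup>2)"
          unfolding XY[OF z N, symmetric] power2_norm_eq_inner
          by (simp add: inner_add_left inner_add_right inner_commute power2_eq_square algebra_simps)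
      qed
      also have "\<dots> = (\<integral>z. \<mu> (snd z) * (norm (X N z))\<^sup>2 \<partial>HM) + 2 * s * a + s\<^sup>2 * (\<integral>z. \<mu> (snd z) * (norm (Y z))\<^sup>2 \<partial>HM)"
        using iX iA iY by (simp add: a_def)
      finally show ?thesis .
    qed
    have e2: "(\<integral>z. c z * (\<xi> N z + s * \<psi> z)\<^sup>2 \<partial>HM) = (\<integral>z. c z * (\<xi> N z)\<^sup>2 \<partial>HM) + 2 * s * b + s\<^sup>2 * (\<integral>z. c z * (\<psi> z)\<^sup>2 \<partial>HM)"
    proof -
      have "(\<integral>z. c z * (\<xi> N z + s * \<psi> z)\<^sup>2 \<partial>HM) = (\<integral>z. c z * (\<xi> N z)\<^sup>2 + 2 * s * (c z * (w z * \<psi> z)) + s\<^sup>2 * (c z * (\<psi> z)\<^sup>2) \<partial>HM)"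
      proof (rule Bochner_Integration.integral_cong[OF refl])
        fix z assume "z \<in> space HM"
        then have z: "z \<in> half_space" by simp
        show "c z * (\<xi> N z + s * \<psi> z)\<^sup>2 = c z * (\<xi> N z)\<^sup>2 + 2 * s * (c z * (w z * \<psi> z)) + s\<^sup>2 * (c z * (\<psi> z)\<^sup>2)"
          unfolding x\<psi>[OF z N, symmetric] by (simp add: power2_eq_square algebra_simps)
      qed
      also have "\<dots> = (\<integral>z. c z * (\<xi> N z)\<^sup>2 \<partial>HM) + 2 * s * b + s\<^sup>2 * (\<integral>z. c z * (\<psi> z)\<^sup>2 \<partial>HM)"
        using ic iB i\<psi> by (simp add: b_def)
      finally show ?thesis .
    qed
    have e3: "(\<integral>z. \<mu> (snd z) * (norm (X N z))\<^sup>2 \<partial>HM) + (\<integral>z. c z * (\<xi> N z)\<^sup>2 \<partial>HM) - (\<integral>y. deriv f (U y) * (T N y)\<^sup>2 \<partial>lebesgue) \<le> C / real N"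
    proof -
      have "0 \<le> (\<integral>z. \<mu> (snd z) * ((lcut m N z)\<^sup>2 * defect z) \<partial>HM)"
        by (intro integral_nonneg_AE AE_HM_I mult_nonneg_nonneg mu_nonneg defect_nonneg) simp_all
      then show ?thesis using stability_identity(2)[OF cutoff_lcut[of m N]] C(2)[OF N] unfolding X_def \<xi>_def T_def by linarith
    qed
    have lin: "0 \<le> C' + 2 * s * (a + b) + s2 * (y + p)"
      if "x + 2 * s * a + s2 * y = x'" "k + 2 * s * b + s2 * p = k'" "x + k - d \<le> C'" "0 \<le> x' + k' - d" for x y k p d x' k' C' s2 :: real
      using that by (simp add: algebra_simps)
    show ?thesis unfolding q_def
      by (rule lin[OF e1[symmetric] e2[symmetric] e3]) (use st[of N s] in simp)
  qed
  have "0 \<le> 2 * s * (a + b) + s\<^sup>2 * q" for s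
  proof (rule LIMSEQ_le_const)
    have "(\<lambda>n. C * inverse (real (Suc n)) + (2 * s * (a + b) + s\<^sup>2 * q)) \<longlonglongrightarrow> C * 0 + (2 * s * (a + b) + s\<^sup>2 * q)"
      by (intro tendsto_intros LIMSEQ_inverse_real_of_nat)
    then show "(\<lambda>n. C * inverse (real (Suc n)) + (2 * s * (a + b) + s\<^sup>2 * q)) \<longlonglongrightarrow> 2 * s * (a + b) + s\<^sup>2 * q" by simp
    show "\<exists>N. \<forall>n\<ge>N. 0 \<le> C * inverse (real (Suc n)) + (2 * s * (a + b) + s\<^sup>2 * q)"
      using key[of "Suc n" s for n] by (simp only: divide_inverse add.assoc) blast
  qed
  then have "a + b = 0" by (rule quadratic_nonneg_imp_0)
  then show "(\<integral>z. \<mu> (snd z) * (Dw z \<bullet> Y z) \<partial>HM) + (\<integral>z. c z * (w z * \<psi> z) \<partial>HM) = 0" by (simp add: a_def b_def)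
qed

end

subsection \<open>Integrals over horizontal slices\<close>

text \<open>Applied to the reciprocal of \<open>\<mu>\<close> on an interval, this yields the
  vertical coordinate in which \<open>slice_inequality\<close> builds its test function.\<close>

lemma bounded_primitive:
  fixes h :: "real \<Rightarrow> real"
  assumes h: "h \<in> borel_measurable lebesgue" and b: "\<And>x. 0 \<le> h x" "\<And>x. h x \<le> K * indicator {a<..<b} x"
  obtains S where "\<And>p q. p \<le> q \<Longrightarrow> (h has_integral (S q - S p)) {p..q}" "\<And>x. x \<le> a \<Longrightarrow> S x = 0"
    "\<And>x. b \<le> x \<Longrightarrow> S x = S b" "mono S" "\<bar>K\<bar>-lipschitz_on UNIV S"
proof -
  have h0: "h x = 0" if "x \<notin> {a<..<b}" for x using b[of x] that by simp
  have hK: "h x \<le> \<bar>K\<bar>" for x using b(2)[of x] by (cases "x \<in> {a<..<b}") auto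
  have "integrable lebesgue h"
  proof (rule Bochner_Integration.integrable_bound[OF _ h])
    show "integrable lebesgue (\<lambda>x. \<bar>K\<bar> * indicator {a<..<b} x :: real)"
      by (intro integrable_mult_right integrable_real_indicator) (simp_all add: emeasure_completion emeasure_bounded_finite flip: infinity_ennreal_def)
    have "norm (h x) \<le> norm (\<bar>K\<bar> * indicator {a<..<b} x)" for x
      using h0[of x] hK[of x] b(1)[of x] by (cases "x \<in> {a<..<b}") simp_all
    then show "AE x in lebesgue. norm (h x) \<le> norm (\<bar>K\<bar> * indicator {a<..<b} x)" by simp
  qed
  then have "h integrable_on UNIV" by (rule integrable_on_lebesgue)
  then have io: "h integrable_on {p..q}" for p q using integrable_on_subcbox[of h UNIV p q] by simp
  define S where "S x = integral {a..x} h" for x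
  have S0: "S x = 0" if "x \<le> a" for x using that by (cases "x = a") (auto simp: S_def)
  have int: "(h has_integral (S q - S p)) {p..q}" if pq: "p \<le> q" for p q
  proof -
    have ih: "(h has_integral integral {p..q} h) {p..q}" by (rule integrable_integral[OF io])
    have "integral {p..q} h = S q - S p"
    proof (cases "a \<le> p")
      case True
      then show ?thesis unfolding S_def using Henstock_Kurzweil_Integration.integral_combine[OF True pq io] by simp
    next
      case False
      have z: "integral {p..r} h = 0" if "r \<le> a" for r
        by (rule integral_unique, rule has_integral_is_0) (use that h0 in auto)
      show ?thesis
      proof (cases "a \<le> q")
        case True
        then show ?thesis using Henstock_Kurzweil_Integration.integral_combine[OF _ True io, of p] False z[of a] S0[of p]
          by (simp add: S_def)
      qed (use z[of q] False S0[of p] S0[of q] in simp)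
    qed
    then show ?thesis using ih by simp
  qed
  have Sb: "S x = S b" if "b \<le> x" for x
  proof -
    have "(h has_integral 0) {b..x}" by (rule has_integral_is_0) (use h0 in auto)
    then show ?thesis using has_integral_unique[OF int[OF that], of 0] by simp
  qed
  have mono: "S p \<le> S q" if "p \<le> q" for p q using has_integral_nonneg[OF int[OF that]] b(1) by simp
  have le: "S q - S p \<le> \<bar>K\<bar> * (q - p)" if "p \<le> q" for p q
    using has_integral_le[OF int[OF that] has_integral_const_real[of "\<bar>K\<bar>" p q]] hK that by (simp add: mult.commute)
  have "\<bar>K\<bar>-lipschitz_on UNIV S"
  proof (rule lipschitz_onI)
    fix x y :: real
    show "dist (S x) (S y) \<le> \<bar>K\<bar> * dist x y"
      using mono[of x y] le[of x y] mono[of y x] le[of y x] by (cases "x \<le> y") (auto simp: dist_real_def abs_if)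
  qed simp
  then show thesis using that[OF int S0 Sb] mono by (simp add: mono_def)
qed

lemma integrable_indicator_Icc: "integrable lborel (indicator {p..q} :: real \<Rightarrow> real)"
  by (rule integrable_real_indicator) (simp_all add: emeasure_lborel_Icc_eq)

lemma integrable_bounded_box:
  fixes F :: "point \<Rightarrow> real"
  assumes F: "F \<in> borel_measurable borel" and b: "\<And>z. \<bar>F z\<bar> \<le> K * indicator (cball 0 r \<times> {p..q}) z"
  shows "integrable lborel F"
proof (rule Bochner_Integration.integrable_bound)
  have "compact (cball (0::real^2) r \<times> {p..q})" by (intro compact_Times) auto
  from borel_integrable_compact[OF this continuous_on_const, of K]
  show "integrable lborel (\<lambda>z. K * indicator (cball (0::real^2) r \<times> {p..q}) z)" by (simp add: mult.commute)
  show "AE z in lborel. norm (F z) \<le> norm (K * indicator (cball 0 r \<times> {p..q}) z)"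
    using order_trans[OF b abs_ge_self] by (intro AE_I2) simp
qed (use F in simp)

lemma HM_integral_box:
  fixes F :: "point \<Rightarrow> real"
  assumes F: "F \<in> borel_measurable borel" and b: "\<And>z. \<bar>F z\<bar> \<le> K * indicator (cball 0 r \<times> {p..q}) z" and p: "0 < p"
  shows "integrable HM F" "(\<integral>z. F z \<partial>HM) = (\<integral>y. (\<integral>x. F (y, x) \<partial>lborel) \<partial>lborel)"
    "(\<integral>z. F z \<partial>HM) = (\<integral>x. (\<integral>y. F (y, x) \<partial>lborel) \<partial>lborel)"
proof -
  have i: "integrable lborel F" by (rule integrable_bounded_box[OF F b])
  have eq: "indicator half_space z *\<^sub>R F z = F z" for z
  proof (cases "z \<in> half_space")
    case False
    then have "z \<notin> cball 0 r \<times> {p..q}" using p by (cases z) simp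
    then show ?thesis using b[of z] False by simp
  qed simp
  show "integrable HM F" unfolding HM_integrable_iff set_integrable_def eq using i F by (simp add: integrable_completion)
  have "(\<integral>z. F z \<partial>HM) = (\<integral>z. F z \<partial>lborel)"
    unfolding HM_integral_eq set_lebesgue_integral_def eq using F by (simp add: integral_completion)
  moreover have i': "integrable (lborel \<Otimes>\<^sub>M lborel) F" using i by (simp add: lborel_prod)
  ultimately show "(\<integral>z. F z \<partial>HM) = (\<integral>y. (\<integral>x. F (y, x) \<partial>lborel) \<partial>lborel)"
    "(\<integral>z. F z \<partial>HM) = (\<integral>x. (\<integral>y. F (y, x) \<partial>lborel) \<partial>lborel)"
    using lborel_pair.integral_fst'[OF i'] lborel_pair.integral_snd[of "\<lambda>y x. F (y, x)"] i' by (simp_all add: lborel_prod)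
qed

lemma hatg_bounded: "\<exists>C\<ge>0. \<forall>y. norm (hatg r y) \<le> C" if "0 < r"
proof -
  have "compact (hatg r ` cball 0 r)" by (intro compact_continuous_image continuous_on_hatg) simp
  from compact_imp_bounded[OF this] obtain C where C: "\<And>y. y \<in> cball 0 r \<Longrightarrow> norm (hatg r y) \<le> C" unfolding bounded_iff by blast
  have "norm (hatg r y) \<le> max 0 C" for y using hat_eq_0(2)[OF that, of y] C[of y] by (cases "norm y \<le> r") (simp_all add: le_max_iff_disj)
  then show ?thesis by (intro exI[of _ "max 0 C"]) auto
qed

lemma hatd2_bounded: "\<exists>C\<ge>0. \<forall>y. \<bar>hatd2 r e y\<bar> \<le> C" if "0 < r"
proof -
  have "compact (hatd2 r e ` cball 0 r)" by (intro compact_continuous_image continuous_on_hatd2) simp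
  from compact_imp_bounded[OF this] obtain C where C: "\<And>y. y \<in> cball 0 r \<Longrightarrow> norm (hatd2 r e y) \<le> C" unfolding bounded_iff by blast
  have "\<bar>hatd2 r e y\<bar> \<le> max 0 C" for y using hat_eq_0(3)[OF that, of y e] C[of y] by (cases "norm y \<le> r") (simp_all add: le_max_iff_disj)
  then show ?thesis by (intro exI[of _ "max 0 C"]) auto
qed

context stable_layer
begin

lemma box_subset: "0 < a \<Longrightarrow> cball (0::real^2) \<rho> \<times> {a..b} \<subseteq> half_space"
  by auto

lemma continuous_bounded_box:
  fixes \<phi> :: "point \<Rightarrow> 'b::real_normed_vector"
  assumes "continuous_on half_space \<phi>" "0 < a"
  shows "\<exists>K\<ge>0. \<forall>z\<in>cball 0 \<rho> \<times> {a..b}. norm (\<phi> z) \<le> K"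
proof -
  have "compact (\<phi> ` (cball 0 \<rho> \<times> {a..b}))"
    by (intro compact_continuous_image continuous_on_subset[OF assms(1) box_subset] compact_Times assms(2)) auto
  from compact_imp_bounded[OF this] obtain K where K: "\<And>z. z \<in> cball 0 \<rho> \<times> {a..b} \<Longrightarrow> norm (\<phi> z) \<le> K" unfolding bounded_iff by blast
  have "norm (\<phi> z) \<le> max 0 K" if "z \<in> cball 0 \<rho> \<times> {a..b}" for z using K[OF that] by simp
  then show ?thesis by (intro exI[of _ "max 0 K"] conjI ballI) auto
qed

lemma w_lipschitz_box:
  assumes a: "0 < a"
  shows "\<exists>L\<ge>0. \<forall>z\<in>cball 0 \<rho> \<times> {a..b}. \<forall>z'\<in>cball 0 \<rho> \<times> {a..b}. \<bar>w z - w z'\<bar> \<le> L * norm (z - z')"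
proof -
  obtain L where L: "L \<ge> 0" "\<And>z. z \<in> cball 0 \<rho> \<times> {a..b} \<Longrightarrow> norm (H z) \<le> L"
    using continuous_bounded_box[OF H_continuous a, of \<rho> b] by blast
  have "\<bar>w z - w z'\<bar> \<le> L * norm (z - z')" if z: "z \<in> cball 0 \<rho> \<times> {a..b}" "z' \<in> cball 0 \<rho> \<times> {a..b}" for z z'
  proof -
    have "\<bar>w z - w z'\<bar> \<le> norm (fst (G z - G z'))" unfolding w_def fst_diff by (rule norm_triangle_ineq3)
    also have "\<dots> \<le> norm (G z - G z')" using norm_fst_le[of "fst (G z - G z')" "snd (G z - G z')"] by (simp only: prod.collapse)
    also have "\<dots> \<le> L * norm (z - z')"
    proof (rule differentiable_bound[OF _ _ _ z])
      show "convex (cball (0::real^2) \<rho> \<times> {a..b})" by (intro convex_Times) auto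
      fix x assume x: "x \<in> cball (0::real^2) \<rho> \<times> {a..b}"
      then have "x \<in> half_space" using box_subset[OF a] by blast
      then show "(G has_derivative blinfun_apply (H x)) (at x within cball 0 \<rho> \<times> {a..b})" by (rule has_derivative_at_withinI[OF H])
      show "onorm (blinfun_apply (H x)) \<le> L" using L(2)[OF x] by (simp add: norm_blinfun.rep_eq)
    qed
    finally show ?thesis .
  qed
  then show ?thesis using L(1) by blast
qed

text \<open>\<open>Dw\<close> may jump at zeros of \<open>w\<close>, so compactness is applied to
  the continuous \<open>h1\<close> and \<open>h2\<close>, which dominate it.\<close>

lemma norm_Dw_box:
  assumes a: "0 < a"
  shows "\<exists>D\<ge>0. \<forall>z\<in>cball 0 \<rho> \<times> {a..b}. norm (Dw z) \<le> D"
proof -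
  obtain K1 where K1: "K1 \<ge> 0" "\<And>z. z \<in> cball 0 \<rho> \<times> {a..b} \<Longrightarrow> norm (h1 z) \<le> K1"
    using continuous_bounded_box[OF HE_continuous a, of \<rho> b "axis 1 1"] by blast
  obtain K2 where K2: "K2 \<ge> 0" "\<And>z. z \<in> cball 0 \<rho> \<times> {a..b} \<Longrightarrow> norm (h2 z) \<le> K2"
    using continuous_bounded_box[OF HE_continuous a, of \<rho> b "axis 2 1"] by blast
  have "norm (Dw z) \<le> K1 + K2" if z: "z \<in> cball 0 \<rho> \<times> {a..b}" for z
  proof (rule power2_le_imp_le)
    have "(norm (Dw z))\<^sup>2 \<le> (norm (h1 z))\<^sup>2 + (norm (h2 z))\<^sup>2" by (rule norm_Dw_le)
    also have "\<dots> \<le> K1\<^sup>2 + K2\<^sup>2" using K1(2)[OF z] K2(2)[OF z] by (intro add_mono power_mono) auto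
    also have "\<dots> \<le> (K1 + K2)\<^sup>2" using K1(1) K2(1) by (simp add: power2_sum)
    finally show "(norm (Dw z))\<^sup>2 \<le> (K1 + K2)\<^sup>2" .
  qed (use K1 K2 in simp)
  then show ?thesis using K1(1) K2(1) by (intro exI[of _ "K1 + K2"]) auto
qed

lemma Dw_borel: "(\<lambda>z. indicator half_space z *\<^sub>R Dw z) \<in> borel_measurable borel"
proof -
  let ?i = "\<lambda>z. indicator half_space z :: real"
  have [measurable]: "(\<lambda>z. ?i z *\<^sub>R v1 z) \<in> borel_measurable borel" "(\<lambda>z. ?i z *\<^sub>R v2 z) \<in> borel_measurable borel"
    "(\<lambda>z. ?i z *\<^sub>R h1 z) \<in> borel_measurable borel" "(\<lambda>z. ?i z *\<^sub>R h2 z) \<in> borel_measurable borel"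
    "(\<lambda>z. ?i z *\<^sub>R w z) \<in> borel_measurable borel"
    by (intro borel_measurable_continuous_on_indicator V_continuous HE_continuous w_continuous half_space_sets)+
  have "(\<lambda>z. ((?i z *\<^sub>R v1 z) *\<^sub>R (?i z *\<^sub>R h1 z) + (?i z *\<^sub>R v2 z) *\<^sub>R (?i z *\<^sub>R h2 z)) /\<^sub>R (?i z *\<^sub>R w z)) \<in> borel_measurable borel"
    by measurable
  also have "(\<lambda>z. ((?i z *\<^sub>R v1 z) *\<^sub>R (?i z *\<^sub>R h1 z) + (?i z *\<^sub>R v2 z) *\<^sub>R (?i z *\<^sub>R h2 z)) /\<^sub>R (?i z *\<^sub>R w z)) = (\<lambda>z. ?i z *\<^sub>R Dw z)"
    by (auto simp: Dw_def indicator_def)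
  finally show ?thesis .
qed

text \<open>At zeros of \<open>w\<close> the derivative along the line vanishes because \<open>w\<close> has a minimum there;
  this matches \<open>Dw = 0\<close>, which holds there by \<open>inverse 0 = 0\<close>.\<close>

lemma w_vertical_integral:
  assumes p: "0 < p" "p \<le> q"
  shows "((\<lambda>x. snd (Dw (y, x))) has_integral (w (y, q) - w (y, p))) {p..q}"
proof -
  obtain L where L: "L \<ge> 0" "\<And>z z'. z \<in> cball 0 (norm y) \<times> {p..q} \<Longrightarrow> z' \<in> cball 0 (norm y) \<times> {p..q} \<Longrightarrow> \<bar>w z - w z'\<bar> \<le> L * norm (z - z')"
    using w_lipschitz_box[OF p(1), of "norm y" q] by blast
  define \<omega> where "\<omega> x = w (y, min q (max p x))" for x
  have "L-lipschitz_on UNIV \<omega>"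
  proof (rule lipschitz_onI)
    fix s t :: real
    have "dist (\<omega> s) (\<omega> t) \<le> L * norm ((y, min q (max p s)) - (y, min q (max p t)))"
      unfolding \<omega>_def dist_real_def using p by (intro L(2)) auto
    also have "\<dots> = L * \<bar>min q (max p s) - min q (max p t)\<bar>" by (simp add: norm_Pair)
    also have "\<dots> \<le> L * \<bar>s - t\<bar>" by (intro mult_left_mono L(1)) (auto simp: min_def max_def abs_if)
    finally show "dist (\<omega> s) (\<omega> t) \<le> L * dist s t" by (simp add: dist_real_def)
  qed (rule L(1))
  from lipschitz_real_FTC[OF this] obtain h where h: "\<And>a b. a \<le> b \<Longrightarrow> (h has_integral (\<omega> b - \<omega> a)) {a..b}"
     "negligible {x. \<not> (\<omega> has_real_derivative h x) (at x)}" by blast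
  have "(h has_integral (w (y, q) - w (y, p))) {p..q}" using h(1)[OF p(2)] p by (simp add: \<omega>_def)
  then show ?thesis
  proof (rule has_integral_spike[of "{x. \<not> (\<omega> has_real_derivative h x) (at x)} \<union> {p, q}", rotated 2])
    show "negligible ({x. \<not> (\<omega> has_real_derivative h x) (at x)} \<union> {p, q})" using h(2) by (intro negligible_Un) auto
    fix x assume x: "x \<in> {p..q} - ({x. \<not> (\<omega> has_real_derivative h x) (at x)} \<union> {p, q})"
    then have x': "x \<in> {p<..<q}" and d: "(\<omega> has_real_derivative h x) (at x)" by auto
    have z: "(y, x) \<in> half_space" using x' p by simp
    have d': "((\<lambda>x. w (y, x)) has_real_derivative h x) (at x)"
      by (rule has_field_derivative_transform_within_open[OF d, of "{p<..<q}"]) (use x' in \<open>auto simp: \<omega>_def\<close>)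
    show "snd (Dw (y, x)) = h x"
    proof (cases "w (y, x) = 0")
      case True
      have "h x = 0" by (rule DERIV_local_min[OF d' zero_less_one]) (simp add: True w_nonneg)
      then show ?thesis using True by (simp add: Dw_def)
    next
      case False
      have "GDERIV w ((y, 0) + x *\<^sub>R (0, 1)) :> Dw (y, x)" using GDERIV_w_nonzero[OF z False] by simp
      from GDERIV_line[OF this] have "((\<lambda>x. w (y, x)) has_real_derivative snd (Dw (y, x))) (at x)" by (simp add: inner_prod_def)
      then show ?thesis using d' by (rule DERIV_unique)
    qed
  qed
qed

text \<open>Weighted averages of \<open>w\<close> over discs in one slice. The equation for
  \<open>w\<close>, tested with \<open>hat\<close> times a function of the height, becomes an
  inequality between values of \<open>W r\<close> alone, because the Laplacian of \<open>hat\<close>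
  is bounded below by a multiple of \<open>hat\<close>.\<close>

definition W :: "real \<Rightarrow> real \<Rightarrow> real" where "W r x = (\<integral>y. w (y, x) * hat r y \<partial>lborel)"

lemma W_integrable: assumes "0 < r" "0 < x" shows "integrable lborel (\<lambda>y. w (y, x) * hat r y)"
proof -
  have "continuous_on (cball 0 r) (\<lambda>y. w (y, x) * hat r y)"
    by (intro continuous_intros continuous_on_hat continuous_on_compose2[OF w_continuous]) (use assms in auto)
  then have "integrable lborel (\<lambda>y. indicator (cball 0 r) y *\<^sub>R (w (y, x) * hat r y))" by (intro borel_integrable_compact) simp
  moreover have "indicator (cball 0 r) y *\<^sub>R (w (y, x) * hat r y) = w (y, x) * hat r y" for y
    using hat_eq_0(1)[OF assms(1), of y] by (cases "norm y \<le> r") auto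
  ultimately show ?thesis by (simp only: real_scaleR_def)
qed

lemma W_nonneg: "0 \<le> W r x"
  unfolding W_def by (intro integral_nonneg_AE AE_I2 mult_nonneg_nonneg w_nonneg hat_nonneg)

lemma W_continuous: assumes r: "0 < r" shows "continuous_on {0<..} (W r)"
proof (rule continuous_at_imp_continuous_on, rule ballI)
  fix x :: real assume "x \<in> {0<..}"
  then have x: "0 < x" by simp
  define I :: real where "I = (\<integral>y. indicator (cball 0 r) (y::real^2) \<partial>lborel)"
  have iI: "integrable lborel (\<lambda>y. indicator (cball 0 r) (y::real^2) :: real)"
    using borel_integrable_compact[OF compact_cball continuous_on_const, of "0::real^2" r "1::real"] by simp
  obtain L where L: "L \<ge> 0" "\<And>z z'. z \<in> cball 0 r \<times> {x/2..2*x} \<Longrightarrow> z' \<in> cball 0 r \<times> {x/2..2*x} \<Longrightarrow> \<bar>w z - w z'\<bar> \<le> L * norm (z - z')"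
    using w_lipschitz_box[of "x/2" r "2*x"] x by auto
  have le: "\<bar>W r x' - W r x\<bar> \<le> L * \<bar>x' - x\<bar> * I" if x': "x' \<in> {x/2..2*x}" for x'
  proof -
    have x'0: "0 < x'" using x x' by auto
    have "\<bar>W r x' - W r x\<bar> = \<bar>\<integral>y. w (y, x') * hat r y - w (y, x) * hat r y \<partial>lborel\<bar>"
      unfolding W_def using W_integrable[OF r x] W_integrable[OF r x'0] by simp
    also have "\<dots> \<le> (\<integral>y. \<bar>w (y, x') * hat r y - w (y, x) * hat r y\<bar> \<partial>lborel)" by (rule integral_abs_bound)
    also have "\<dots> \<le> (\<integral>y. L * \<bar>x' - x\<bar> * indicator (cball 0 r) (y::real^2) \<partial>lborel)"
    proof (rule integral_mono)
      fix y :: "real^2"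
      show "\<bar>w (y, x') * hat r y - w (y, x) * hat r y\<bar> \<le> L * \<bar>x' - x\<bar> * indicator (cball 0 r) y"
      proof (cases "norm y \<le> r")
        case True
        have "\<bar>w (y, x') - w (y, x)\<bar> \<le> L * norm ((y, x') - (y, x))" by (rule L(2)) (use True x x' in auto)
        also have "norm ((y, x') - (y, x)) = \<bar>x' - x\<bar>" by (simp add: norm_Pair)
        finally have "\<bar>w (y, x') - w (y, x)\<bar> * hat r y \<le> L * \<bar>x' - x\<bar> * 1"
          by (intro mult_mono hat_le_1 hat_nonneg) (use L(1) in auto)
        then show ?thesis using True hat_nonneg[of r y] by (simp add: left_diff_distrib[symmetric] abs_mult)
      qed (use hat_eq_0(1)[OF r, of y] in simp)
    qed (use W_integrable[OF r x] W_integrable[OF r x'0] iI in auto)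
    also have "\<dots> = L * \<bar>x' - x\<bar> * I" unfolding I_def by simp
    finally show ?thesis .
  qed
  have "((\<lambda>x'. W r x' - W r x) \<longlongrightarrow> 0) (at x)"
  proof (rule Lim_null_comparison)
    have "eventually (\<lambda>x'. x' \<in> {x/2<..<2*x}) (at x)" by (rule eventually_at_in_open') (use x in auto)
    then show "eventually (\<lambda>x'. norm (W r x' - W r x) \<le> L * \<bar>x' - x\<bar> * I) (at x)"
      by eventually_elim (use le in auto)
    have "((\<lambda>x'. L * \<bar>x' - x\<bar> * I) \<longlongrightarrow> L * \<bar>x - x\<bar> * I) (at x)" by (intro tendsto_intros)
    then show "((\<lambda>x'. L * \<bar>x' - x\<bar> * I) \<longlongrightarrow> 0) (at x)" by simp
  qed
  then show "isCont (W r) x" unfolding isCont_def by (simp add: LIM_zero_iff)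
qed

lemma W_eq_0_iff: assumes r: "0 < r" and x: "0 < x"
  shows "W r x = 0 \<longleftrightarrow> (\<forall>y. norm y < r \<longrightarrow> w (y, x) = 0)"
proof
  assume "W r x = 0"
  then have "AE y in lborel. w (y, x) * hat r y = 0"
    unfolding W_def by (subst (asm) integral_nonneg_eq_0_iff_AE[OF W_integrable[OF r x]]) (simp_all add: w_nonneg hat_nonneg)
  then have "AE y in lebesgue. y \<in> UNIV \<longrightarrow> w (y, x) * hat r y \<le> 0" by (intro AE_completion) auto
  moreover have "continuous_on UNIV (\<lambda>y. w (y, x) * hat r y)"
    by (intro continuous_intros continuous_on_hat continuous_on_compose2[OF w_continuous]) (use x in auto)
  ultimately have "w (y, x) * hat r y \<le> 0" for y using AE_bound_imp_bound[OF open_UNIV] by blast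
  then have "w (y, x) * hat r y = 0" for y using mult_nonneg_nonneg[OF w_nonneg hat_nonneg, of "(y, x)" r y] by (rule antisym)
  then show "\<forall>y. norm y < r \<longrightarrow> w (y, x) = 0" using hat_pos by (metis less_irrefl mult_eq_0_iff)
next
  assume *: "\<forall>y. norm y < r \<longrightarrow> w (y, x) = 0"
  have "w (y, x) * hat r y = 0" for y using * hat_eq_0(1)[OF r, of y] by (cases "norm y < r") auto
  then show "W r x = 0" by (simp only: W_def integral_zero)
qed

text \<open>Fubini and the fundamental theorem of calculus on vertical lines. The indicator will
  arise as the weight times the derivative of the height factor in the test function.\<close>

lemma vertical_flux:
  assumes r: "0 < r" and p: "0 < p" "p \<le> q"
  shows "integrable HM (\<lambda>z. indicator {p<..<q} (snd z) * (hat r (fst z) * snd (Dw z)))"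
    "(\<integral>z. indicator {p<..<q} (snd z) * (hat r (fst z) * snd (Dw z)) \<partial>HM) = W r q - W r p"
proof -
  define d where "d z = snd (indicator half_space z *\<^sub>R Dw z)" for z
  define F where "F z = indicator {p<..<q} (snd z) * (hat r (fst z) * d z)" for z :: point
  have [measurable]: "hat r \<in> borel_measurable borel" by (intro borel_measurable_continuous_onI continuous_on_hat)
  have [measurable]: "d \<in> borel_measurable borel" unfolding d_def[abs_def] by (rule measurable_compose[OF Dw_borel point_borel(1)])
  have Fm [measurable]: "F \<in> borel_measurable borel" unfolding F_def[abs_def] by measurable
  have F_eq: "F z = indicator {p<..<q} (snd z) * (hat r (fst z) * snd (Dw z))" for z :: point
    using p by (auto simp: F_def d_def half_space_def indicator_def)
  obtain D where D: "D \<ge> 0" "\<And>z. z \<in> cball 0 r \<times> {p..q} \<Longrightarrow> norm (Dw z) \<le> D" using norm_Dw_box[OF p(1), of r q] by blast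
  have sD: "\<bar>snd (Dw z)\<bar> \<le> D" if "z \<in> cball 0 r \<times> {p..q}" for z
    using D(2)[OF that] norm_snd_le[of "snd (Dw z)" "fst (Dw z)"] by simp
  have Fb: "\<bar>F z\<bar> \<le> D * indicator (cball 0 r \<times> {p..q}) z" for z
  proof (cases "z \<in> cball 0 r \<times> {p..q}")
    case True
    have "hat r (fst z) * \<bar>snd (Dw z)\<bar> \<le> 1 * D" by (intro mult_mono hat_le_1 sD[OF True]) auto
    then show ?thesis using True D(1) hat_nonneg[of r "fst z"] by (simp add: F_eq abs_mult indicator_def)
  next
    case False
    then show ?thesis using hat_eq_0(1)[OF r, of "fst z"] by (cases z) (auto simp: F_eq indicator_def)
  qed
  note box = HM_integral_box[OF Fm Fb p(1)]
  show "integrable HM (\<lambda>z. indicator {p<..<q} (snd z) * (hat r (fst z) * snd (Dw z)))" unfolding F_eq[symmetric] by (rule box(1))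
  have in_x: "(\<integral>x. F (y, x) \<partial>lborel) = hat r y * (w (y, q) - w (y, p))" for y
  proof -
    have i: "integrable lborel (\<lambda>x. F (y, x))"
    proof (rule Bochner_Integration.integrable_bound)
      show "integrable lborel (\<lambda>x. D * indicator {p..q} x)" by (intro integrable_mult_right integrable_indicator_Icc)
      show "AE x in lborel. norm (F (y, x)) \<le> norm (D * indicator {p..q} x)"
      proof (rule AE_I2)
        fix x
        have "\<bar>F (y, x)\<bar> \<le> D * indicator (cball 0 r \<times> {p..q}) (y, x)" by (rule Fb)
        also have "\<dots> \<le> D * indicator {p..q} x" using D(1) by (simp add: indicator_def)
        finally show "norm (F (y, x)) \<le> norm (D * indicator {p..q} x)" using D(1) by (simp add: abs_mult)
      qed
    qed measurable
    have "((\<lambda>x. hat r y * snd (Dw (y, x))) has_integral hat r y * (w (y, q) - w (y, p))) {p<..<q}"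
      using has_integral_mult_right[OF w_vertical_integral[OF p]] by (simp add: has_integral_Icc_iff_Ioo)
    then have "((\<lambda>x. if x \<in> {p<..<q} then hat r y * snd (Dw (y, x)) else 0) has_integral hat r y * (w (y, q) - w (y, p))) UNIV"
      by (simp only: has_integral_restrict_UNIV)
    also have "(\<lambda>x. if x \<in> {p<..<q} then hat r y * snd (Dw (y, x)) else 0) = (\<lambda>x. F (y, x))" by (auto simp: F_eq)
    finally show ?thesis using has_integral_integral_lborel[OF i] has_integral_unique by blast
  qed
  have "(\<integral>z. F z \<partial>HM) = (\<integral>y. w (y, q) * hat r y - w (y, p) * hat r y \<partial>lborel)"
    using box(2) by (simp add: in_x algebra_simps)
  also have "\<dots> = W r q - W r p"
    unfolding W_def using W_integrable[OF r] p by (intro Bochner_Integration.integral_diff) auto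
  finally show "(\<integral>z. indicator {p<..<q} (snd z) * (hat r (fst z) * snd (Dw z)) \<partial>HM) = W r q - W r p" unfolding F_eq .
qed

lemma slab_integral:
  assumes r: "0 < r" and p: "0 < p" "p \<le> q" and M: "\<And>x. x \<in> {p..q} \<Longrightarrow> W r x \<le> M"
  shows "integrable HM (\<lambda>z. indicator {p..q} (snd z) * (w z * hat r (fst z)))"
    "(\<integral>z. indicator {p..q} (snd z) * (w z * hat r (fst z)) \<partial>HM) \<le> (q - p) * M"
proof -
  define F where "F z = indicator {p..q} (snd z) * ((indicator half_space z *\<^sub>R w z) * hat r (fst z))" for z :: point
  have [measurable]: "hat r \<in> borel_measurable borel" by (intro borel_measurable_continuous_onI continuous_on_hat)
  have [measurable]: "(\<lambda>z. indicator half_space z *\<^sub>R w z) \<in> borel_measurable borel"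
    by (intro borel_measurable_continuous_on_indicator w_continuous half_space_sets)
  have Fm [measurable]: "F \<in> borel_measurable borel" unfolding F_def[abs_def] by measurable
  have F_eq: "F z = indicator {p..q} (snd z) * (w z * hat r (fst z))" for z :: point
    using p by (auto simp: F_def half_space_def indicator_def)
  obtain D where D: "D \<ge> 0" "\<And>z. z \<in> cball 0 r \<times> {p..q} \<Longrightarrow> norm (w z) \<le> D" using continuous_bounded_box[OF w_continuous p(1), of r q] by blast
  have Fb: "\<bar>F z\<bar> \<le> D * indicator (cball 0 r \<times> {p..q}) z" for z
  proof (cases "z \<in> cball 0 r \<times> {p..q}")
    case True
    have "w z * hat r (fst z) \<le> D * 1" using D(2)[OF True] by (intro mult_mono hat_le_1 hat_nonneg D(1)) auto
    then show ?thesis using True D(1) hat_nonneg[of r "fst z"] w_nonneg[of z] by (simp add: F_eq abs_mult indicator_def)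
  next
    case False
    then show ?thesis using hat_eq_0(1)[OF r, of "fst z"] by (cases z) (auto simp: F_eq indicator_def)
  qed
  note box = HM_integral_box[OF Fm Fb p(1)]
  show "integrable HM (\<lambda>z. indicator {p..q} (snd z) * (w z * hat r (fst z)))" unfolding F_eq[symmetric] by (rule box(1))
  have in_y: "(\<integral>y. F (y, x) \<partial>lborel) = indicator {p..q} x * W r x" for x unfolding W_def F_eq by simp
  have "(\<integral>z. F z \<partial>HM) = (\<integral>x. indicator {p..q} x * W r x \<partial>lborel)" using box(3) by (simp add: in_y)
  also have "\<dots> \<le> (\<integral>x. M * indicator {p..q} x \<partial>lborel)"
  proof (rule integral_mono)
    have "compact {p..q}" "continuous_on {p..q} (W r)" using p by (auto intro: continuous_on_subset[OF W_continuous[OF r]])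
    from borel_integrable_compact[OF this] show "integrable lborel (\<lambda>x. indicator {p..q} x * W r x)" by simp
    show "indicator {p..q} x * W r x \<le> M * indicator {p..q} x" for x using M by (auto simp: indicator_def)
  qed (intro integrable_mult_right integrable_indicator_Icc)
  also have "\<dots> = (q - p) * M" using p by simp
  finally show "(\<integral>z. indicator {p..q} (snd z) * (w z * hat r (fst z)) \<partial>HM) \<le> (q - p) * M" unfolding F_eq .
qed


text \<open>Integration by parts in a horizontal direction, along which \<open>\<kappa>\<close> is
  constant, so its regularity in the height is irrelevant. \<open>w\<close> may have corners at its
  zeros, so its difference quotients are dominated through a Lipschitz constant.\<close>

lemma tangential_flux:
  assumes r: "0 < r" and a: "0 < a" and e: "norm e = 1"
    and \<kappa>: "(\<lambda>z. \<kappa> (snd z)) \<in> borel_measurable HM" "\<And>x. \<bar>\<kappa> x\<bar> \<le> K * indicator {a..b} x"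
  shows "integrable HM (\<lambda>z. \<kappa> (snd z) * ((e \<bullet> fst (Dw z)) * (hatg r (fst z) \<bullet> e)))"
    "integrable HM (\<lambda>z. \<kappa> (snd z) * (w z * hatd2 r e (fst z)))"
    "(\<integral>z. \<kappa> (snd z) * ((e \<bullet> fst (Dw z)) * (hatg r (fst z) \<bullet> e)) \<partial>HM) = - (\<integral>z. \<kappa> (snd z) * (w z * hatd2 r e (fst z)) \<partial>HM)"
proof -
  obtain Gb where Gb: "Gb \<ge> 0" "\<And>y. norm (hatg r y) \<le> Gb" using hatg_bounded[OF r] by blast
  obtain D2 where D2: "D2 \<ge> 0" "\<And>y. \<bar>hatd2 r e y\<bar> \<le> D2" using hatd2_bounded[OF r, of e] by blast
  obtain L where L: "L \<ge> 0" "\<And>z z'. z \<in> cball 0 (r + 2) \<times> {a..b} \<Longrightarrow> z' \<in> cball 0 (r + 2) \<times> {a..b} \<Longrightarrow> \<bar>w z - w z'\<bar> \<le> L * norm (z - z')"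
    using w_lipschitz_box[OF a, of "r + 2" b] by blast
  obtain Wb where Wb: "Wb \<ge> 0" "\<And>z. z \<in> cball 0 (r + 2) \<times> {a..b} \<Longrightarrow> norm (w z) \<le> Wb"
    using continuous_bounded_box[OF w_continuous a, of "r + 2" b] by blast
  obtain D where D: "D \<ge> 0" "\<And>z. z \<in> cball 0 (r + 2) \<times> {a..b} \<Longrightarrow> norm (Dw z) \<le> D"
    using norm_Dw_box[OF a, of "r + 2" b] by blast
  have ge: "\<bar>hatg r y \<bullet> e\<bar> \<le> Gb" for y
    using Cauchy_Schwarz_ineq2[of "hatg r y" e] Gb(2)[of y] e by simp
  have K0: "\<kappa> x = 0" if "x \<notin> {a..b}" for x using \<kappa>(2)[of x] that by simp
  have KK: "\<bar>\<kappa> x\<bar> \<le> \<bar>K\<bar>" for x using \<kappa>(2)[of x] by (cases "x \<in> {a..b}") auto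
  \<comment> \<open>The radius \<open>r + 1\<close> catches the support of \<open>hatg\<close> moved
    by a step of length at most 1. The bounds on \<open>w\<close> are taken for
    \<open>r + 2\<close>, so that shifted points of \<open>box\<close> are covered too.\<close>
  define box :: "point set" where "box = cball 0 (r + 1) \<times> {a..b}"
  have box: "z \<in> cball 0 (r + 2) \<times> {a..b}" if "z \<in> box" for z using that by (auto simp: box_def)
  have ib: "integrable lborel (\<lambda>z. C * indicator box z :: real)" for C
  proof (rule integrable_bounded_box[where r = "r + 1" and K = "\<bar>C\<bar>"])
    have "box \<in> sets borel" unfolding box_def by (intro borel_closed closed_Times) auto
    then show "(\<lambda>z. C * indicator box z :: real) \<in> borel_measurable borel" by measurable
    show "\<bar>C * indicator box z\<bar> \<le> \<bar>C\<bar> * indicator (cball 0 (r + 1) \<times> {a..b}) z" for z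
      unfolding box_def by (simp add: abs_mult)
  qed
  have ib': "integrable lebesgue (\<lambda>z. C * indicator box z :: real)" for C
    using ib[of C] borel_measurable_integrable[OF ib] by (subst integrable_completion) auto
  have iH: "integrable HM (\<lambda>z. C * indicator box z :: real)" for C
    unfolding HM_integrable_iff set_integrable_def
    by (rule Bochner_Integration.integrable_bound[OF ib'[of C]])
       (use borel_measurable_integrable[OF ib'[of C]] in \<open>auto simp: indicator_def\<close>)
  have [measurable]: "hatg r \<in> borel_measurable borel" "hatd2 r e \<in> borel_measurable borel"
    by (intro borel_measurable_continuous_onI continuous_on_hatg continuous_on_hatd2)+
  have m1: "(\<lambda>z::point. hatg r (fst z)) \<in> borel_measurable HM" "(\<lambda>z::point. hatd2 r e (fst z)) \<in> borel_measurable HM"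
    by (intro HM_measurable_continuous continuous_on_compose2[OF continuous_on_hatg[of UNIV]] continuous_intros, simp)
      (intro HM_measurable_continuous continuous_on_compose2[OF continuous_on_hatd2[of UNIV]] continuous_intros, simp)
  note [measurable] = m1 \<kappa>(1) HM_measurable_continuous[OF w_continuous]
  let ?A = "\<lambda>z. \<kappa> (snd z) * ((e \<bullet> fst (Dw z)) * (hatg r (fst z) \<bullet> e))"
  let ?B = "\<lambda>z. \<kappa> (snd z) * (w z * hatd2 r e (fst z))"
  have eD: "\<bar>e \<bullet> fst (Dw z)\<bar> \<le> norm (Dw z)" for z
    using Cauchy_Schwarz_ineq2[of e "fst (Dw z)"] norm_fst_le[of "fst (Dw z)" "snd (Dw z)"] e by simp
  show iA: "integrable HM ?A"
  proof (rule HM_integrable_bound[OF iH[of "\<bar>K\<bar> * (D * Gb)"]])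
    fix z assume "z \<in> half_space"
    show "\<bar>?A z\<bar> \<le> \<bar>K\<bar> * (D * Gb) * indicator box z"
    proof (cases "z \<in> box")
      case True
      have "\<bar>\<kappa> (snd z)\<bar> * (\<bar>e \<bullet> fst (Dw z)\<bar> * \<bar>hatg r (fst z) \<bullet> e\<bar>) \<le> \<bar>K\<bar> * (D * Gb)"
        by (intro mult_mono KK ge order_trans[OF eD D(2)[OF box[OF True]]]) (use D(1) Gb(1) in auto)
      then show ?thesis using True by (simp add: abs_mult)
    next
      case False
      then show ?thesis using K0[of "snd z"] hat_eq_0(2)[OF r, of "fst z"] by (cases z) (auto simp: box_def)
    qed
  qed measurable
  show iB: "integrable HM ?B"
  proof (rule HM_integrable_bound[OF iH[of "\<bar>K\<bar> * (Wb * D2)"]])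
    fix z assume "z \<in> half_space"
    show "\<bar>?B z\<bar> \<le> \<bar>K\<bar> * (Wb * D2) * indicator box z"
    proof (cases "z \<in> box")
      case True
      have "\<bar>w z\<bar> \<le> Wb" using Wb(2)[OF box[OF True]] by simp
      then have "\<bar>\<kappa> (snd z)\<bar> * (\<bar>w z\<bar> * \<bar>hatd2 r e (fst z)\<bar>) \<le> \<bar>K\<bar> * (Wb * D2)"
        by (intro mult_mono KK D2) (use Wb(1) D2(1) in auto)
      then show ?thesis using True by (simp add: abs_mult)
    next
      case False
      then show ?thesis using K0[of "snd z"] hat_eq_0(3)[OF r, of "fst z" e] by (cases z) (auto simp: box_def)
    qed
  qed measurable
  define F where "F z = indicator half_space z * (\<kappa> (snd z) * (w z * (hatg r (fst z) \<bullet> e)))" for z :: point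
  define F' where "F' z = indicator half_space z * (?A z + ?B z)" for z :: point
  have "(\<integral>z. F' z \<partial>lebesgue) = 0"
  proof (rule integral_directional_derivative_eq_0[where F = F and e = "(e, 0)" and B = "\<lambda>z. \<bar>K\<bar> * (L * Gb + Wb * D2) * indicator box z"])
    show "F' \<in> borel_measurable lebesgue"
      using borel_measurable_integrable[OF Bochner_Integration.integrable_add[OF iA iB]] unfolding HM_measurable_iff F'_def by simp
    show "integrable lebesgue (\<lambda>z. \<bar>K\<bar> * (L * Gb + Wb * D2) * indicator box z)" by (rule ib')
    have "integrable HM (\<lambda>z. \<kappa> (snd z) * (w z * (hatg r (fst z) \<bullet> e)))"
    proof (rule HM_integrable_bound[OF iH[of "\<bar>K\<bar> * (Wb * Gb)"]])
      fix z assume "z \<in> half_space"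
      show "\<bar>\<kappa> (snd z) * (w z * (hatg r (fst z) \<bullet> e))\<bar> \<le> \<bar>K\<bar> * (Wb * Gb) * indicator box z"
      proof (cases "z \<in> box")
        case True
        have "\<bar>w z\<bar> \<le> Wb" using Wb(2)[OF box[OF True]] by simp
        then have "\<bar>\<kappa> (snd z)\<bar> * (\<bar>w z\<bar> * \<bar>hatg r (fst z) \<bullet> e\<bar>) \<le> \<bar>K\<bar> * (Wb * Gb)"
          by (intro mult_mono KK ge) (use Wb(1) Gb(1) in auto)
        then show ?thesis using True by (simp add: abs_mult)
      next
        case False
        then show ?thesis using K0[of "snd z"] hat_eq_0(2)[OF r, of "fst z"] by (cases z) (auto simp: box_def)
      qed
    qed measurable
    then show "integrable lebesgue F" unfolding HM_integrable_iff set_integrable_def F_def[abs_def] by simp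
    show "AE z in lebesgue. (\<lambda>n. real (Suc n) * (F (z + (e, 0) /\<^sub>R real (Suc n)) - F z)) \<longlonglongrightarrow> F' z"
      using GDERIV_w[unfolded AE_HM_iff]
    proof eventually_elim
      case (elim z)
      show ?case
      proof (cases "z \<in> half_space")
        case True
        define \<phi> where "\<phi> t = \<kappa> (snd z) * (w (z + t *\<^sub>R (e, 0)) * (hatg r (fst z + t *\<^sub>R e) \<bullet> e))" for t
        have d1: "((\<lambda>t. w (z + t *\<^sub>R (e, 0))) has_real_derivative e \<bullet> fst (Dw z)) (at 0)"
          using GDERIV_line[of w z 0 "(e, 0)" "Dw z"] elim True by (simp add: inner_prod_def zero_prod_def[symmetric])
        have d2: "((\<lambda>t. hatg r (fst z + t *\<^sub>R e) \<bullet> e) has_real_derivative hatd2 r e (fst z)) (at 0)"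
          using DERIV_hatg_line[of r "fst z" e 0] by simp
        have "(\<phi> has_real_derivative ?A z + ?B z) (at 0)"
          using DERIV_cmult[OF DERIV_mult[OF d1 d2], of "\<kappa> (snd z)"] unfolding \<phi>_def[abs_def] by (simp add: algebra_simps zero_prod_def[symmetric])
        moreover have "(\<lambda>n. real (Suc n) * (inverse (real (Suc n)) - 0)) \<longlonglongrightarrow> 1" by (simp del: of_nat_Suc)
        ultimately have "(\<lambda>n. real (Suc n) * (\<phi> (inverse (real (Suc n))) - \<phi> 0)) \<longlonglongrightarrow> (?A z + ?B z) * 1"
          by (rule LIMSEQ_difference_quotient)
        moreover have "F (z + (e, 0) /\<^sub>R real (Suc n)) - F z = \<phi> (inverse (real (Suc n))) - \<phi> 0" for n
          using True by (simp add: F_def \<phi>_def half_space_def zero_prod_def[symmetric] del: of_nat_Suc)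
        ultimately show ?thesis using True by (simp only: F'_def mult_1_right) simp
      next
        case False
        then have "z + (e, 0) /\<^sub>R real (Suc n) \<notin> half_space" for n by (simp add: half_space_def)
        then show ?thesis using False by (simp add: F_def F'_def)
      qed
    qed
    fix n
    show "AE z in lebesgue. \<bar>real (Suc n) * (F (z + (e, 0) /\<^sub>R real (Suc n)) - F z)\<bar> \<le> \<bar>K\<bar> * (L * Gb + Wb * D2) * indicator box z"
    proof (rule AE_I2)
      fix z :: point
      define s where "s = inverse (real (Suc n))"
      have s: "0 < s" "s \<le> 1" "real (Suc n) * s = 1" by (simp_all add: s_def divide_simps)
      define y' where "y' = fst z + s *\<^sub>R e"
      have z': "z + (e, 0) /\<^sub>R real (Suc n) = (y', snd z)" by (cases z) (simp add: s_def y'_def)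
      have ns: "norm (s *\<^sub>R e) = s" using e s by simp
      show "\<bar>real (Suc n) * (F (z + (e, 0) /\<^sub>R real (Suc n)) - F z)\<bar> \<le> \<bar>K\<bar> * (L * Gb + Wb * D2) * indicator box z"
      proof (cases "z \<in> box")
        case True
        have zb: "z \<in> cball 0 (r + 2) \<times> {a..b}" by (rule box[OF True])
        have y'b: "(y', snd z) \<in> cball 0 (r + 2) \<times> {a..b}"
          using True norm_triangle_ineq[of "fst z" "s *\<^sub>R e"] ns s unfolding box_def y'_def by (cases z) auto
        have h: "z \<in> half_space" "(y', snd z) \<in> half_space" using True a by (auto simp: box_def half_space_def)
        have "\<bar>w (y', snd z) - w z\<bar> \<le> L * norm ((y', snd z) - z)" by (rule L(2)[OF y'b zb])
        also have "norm ((y', snd z) - z) = s" using e s by (cases z) (simp add: y'_def norm_Pair)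
        finally have 1: "\<bar>w (y', snd z) - w z\<bar> \<le> L * s" .
        have 2: "\<bar>hatg r y' \<bullet> e - hatg r (fst z) \<bullet> e\<bar> \<le> D2 * s"
        proof -
          obtain t where "hatg r (fst z + s *\<^sub>R e) \<bullet> e - hatg r (fst z + 0 *\<^sub>R e) \<bullet> e = (s - 0) * hatd2 r e (fst z + t *\<^sub>R e)"
            using MVT2[OF s(1), of "\<lambda>t. hatg r (fst z + t *\<^sub>R e) \<bullet> e" "\<lambda>t. hatd2 r e (fst z + t *\<^sub>R e)"] DERIV_hatg_line by blast
          then have "hatg r y' \<bullet> e - hatg r (fst z) \<bullet> e = s * hatd2 r e (fst z + t *\<^sub>R e)" by (simp add: y'_def)
          then have "\<bar>hatg r y' \<bullet> e - hatg r (fst z) \<bullet> e\<bar> = s * \<bar>hatd2 r e (fst z + t *\<^sub>R e)\<bar>" using s by (simp add: abs_mult)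
          also have "\<dots> \<le> s * D2" using s D2 by (intro mult_left_mono) auto
          finally show ?thesis by (simp add: mult.commute)
        qed
        have "F (y', snd z) - F z = \<kappa> (snd z) * ((w (y', snd z) - w z) * (hatg r y' \<bullet> e) + w z * (hatg r y' \<bullet> e - hatg r (fst z) \<bullet> e))"
          using h by (simp add: F_def algebra_simps)
        then have "\<bar>F (y', snd z) - F z\<bar> = \<bar>\<kappa> (snd z)\<bar> * \<bar>(w (y', snd z) - w z) * (hatg r y' \<bullet> e) + w z * (hatg r y' \<bullet> e - hatg r (fst z) \<bullet> e)\<bar>"
          by (simp add: abs_mult)
        also have "\<dots> \<le> \<bar>K\<bar> * ((L * s) * Gb + Wb * (D2 * s))"
        proof (rule mult_mono[OF KK])
          have "\<bar>(w (y', snd z) - w z) * (hatg r y' \<bullet> e)\<bar> \<le> (L * s) * Gb"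
            unfolding abs_mult by (intro mult_mono 1 ge) (use L(1) s in auto)
          moreover have "\<bar>w z * (hatg r y' \<bullet> e - hatg r (fst z) \<bullet> e)\<bar> \<le> Wb * (D2 * s)"
            unfolding abs_mult by (intro mult_mono 2) (use Wb(1) Wb(2)[OF zb] in auto)
          ultimately show "\<bar>(w (y', snd z) - w z) * (hatg r y' \<bullet> e) + w z * (hatg r y' \<bullet> e - hatg r (fst z) \<bullet> e)\<bar> \<le> L * s * Gb + Wb * (D2 * s)" by linarith
        qed auto
        finally have "real (Suc n) * \<bar>F (y', snd z) - F z\<bar> \<le> real (Suc n) * (\<bar>K\<bar> * ((L * s) * Gb + Wb * (D2 * s)))"
          by (intro mult_left_mono) auto
        also have "\<dots> = (real (Suc n) * s) * (\<bar>K\<bar> * (L * Gb + Wb * D2))" by (simp only: algebra_simps)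
        finally have "real (Suc n) * \<bar>F (y', snd z) - F z\<bar> \<le> \<bar>K\<bar> * (L * Gb + Wb * D2)" unfolding s(3) by simp
        then show ?thesis unfolding z' using True by (simp only: abs_mult) simp
      next
        case False
        show ?thesis
        proof (cases "snd z \<in> {a..b}")
          case True
          then have n: "norm (fst z) > r + 1" using False by (cases z) (auto simp: box_def)
          then have "r \<le> norm y'" using norm_triangle_ineq4[of "y'" "s *\<^sub>R e"] ns s by (simp add: y'_def)
          then have "F (y', snd z) = 0" "F z = 0" using n hat_eq_0(2)[OF r] by (simp_all add: F_def)
          then show ?thesis unfolding z' using False by simp
        next
          case f: False
          then have "F (y', snd z) = 0" "F z = 0" using K0 by (simp_all add: F_def)
          then show ?thesis unfolding z' using False by simp
        qed
      qed
    qed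
  qed
  moreover have "(\<integral>z. F' z \<partial>lebesgue) = (\<integral>z. ?A z + ?B z \<partial>HM)"
    unfolding HM_integral_eq set_lebesgue_integral_def F'_def by simp
  moreover have "\<dots> = (\<integral>z. ?A z \<partial>HM) + (\<integral>z. ?B z \<partial>HM)" using iA iB by (rule Bochner_Integration.integral_add)
  ultimately show "(\<integral>z. ?A z \<partial>HM) = - (\<integral>z. ?B z \<partial>HM)" by linarith
qed

end

section \<open>Zeros of the slice averages\<close>

lemma lipschitz_min:
  fixes F G :: "real \<Rightarrow> real"
  assumes "K-lipschitz_on UNIV F" "L-lipschitz_on UNIV G"
  shows "(K + L)-lipschitz_on UNIV (\<lambda>x. min (F x) (G x))"
proof (rule lipschitz_onI)
  fix x y :: real
  have "\<bar>F x - F y\<bar> \<le> K * dist x y" "\<bar>G x - G y\<bar> \<le> L * dist x y"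
    using lipschitz_onD[OF assms(1), of x y] lipschitz_onD[OF assms(2), of x y] by (simp_all add: dist_real_def)
  then show "dist (min (F x) (G x)) (min (F y) (G y)) \<le> (K + L) * dist x y"
    unfolding dist_real_def[of "min _ _"] distrib_right by (auto simp: min_def)
qed (use assms lipschitz_on_nonneg in \<open>metis add_nonneg_nonneg\<close>)

context stable_layer
begin

text \<open>The equation for \<open>w\<close> is tested with \<open>hat\<close> times a tent over
  \<open>{a..b}\<close> with peak at \<open>x0\<close>. The tent is piecewise linear in a primitive
  of \<open>1 / \<mu>\<close>, so the vertical term consists of exact differences of
  \<open>W r\<close>, which by \<open>W r x0 = 0\<close> are
  \<open>- W r a / T1 - W r b / T2\<close>. The horizontal term and the potential are bounded by
  multiples of the integral of \<open>W r\<close>, at most \<open>(b - a) * M\<close>. The second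
  factor \<open>b - a\<close> is the bound for \<open>T1\<close> and \<open>T2\<close>.\<close>

lemma slice_inequality:
  assumes r: "0 < r" and ab: "0 < a" "a < x0" "x0 < b" and W0: "W r x0 = 0"
    and m: "0 < m1" "\<And>x. x \<in> {a..b} \<Longrightarrow> m1 \<le> \<mu> x \<and> \<mu> x \<le> m2"
    and Cc: "\<And>z. z \<in> half_space \<Longrightarrow> snd z \<le> b \<Longrightarrow> \<bar>c z\<bar> \<le> Cc"
    and M: "\<And>x. x \<in> {a..b} \<Longrightarrow> W r x \<le> M"
  shows "W r a \<le> (14 / r\<^sup>2 * m2 + Cc) / m1 * (b - a)\<^sup>2 * M" "W r b \<le> (14 / r\<^sup>2 * m2 + Cc) / m1 * (b - a)\<^sup>2 * M"
proof -
  define h where "h x = indicator {a<..<b} x / \<mu> x" for x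
  have m12: "m1 \<le> m2" using m(2)[of a] ab by auto
  have m2: "0 < m2" using m12 m(1) by linarith
  have h_eq: "h x = 1 / \<mu> x" if "x \<in> {a<..<b}" for x using that by (simp add: h_def)
  have h_le: "h x \<le> 1 / m1 * indicator {a<..<b} x" for x
    using m(2)[of x] m(1) by (cases "x \<in> {a<..<b}") (auto simp: h_def intro!: divide_left_mono mult_pos_pos)
  have h_ge: "1 / m2 \<le> h x" if "x \<in> {a<..<b}" for x
    using m(2)[of x] m(1) that by (auto simp: h_def intro!: divide_left_mono mult_pos_pos)
  have h_nn: "0 \<le> h x" for x using mu_pos[of x] ab by (cases "x \<in> {a<..<b}") (auto simp: h_def)
  have hm: "h \<in> borel_measurable lebesgue"
  proof -
    have "(\<lambda>x. indicator {a<..<b} x / (indicator {0<..} x * \<mu> x)) \<in> borel_measurable lebesgue"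
      by (intro borel_measurable_divide mu_measurable borel_measurable_indicator) simp
    also have "(\<lambda>x. indicator {a<..<b} x / (indicator {0<..} x * \<mu> x)) = h"
      using ab by (auto simp: h_def indicator_def)
    finally show ?thesis .
  qed
  obtain S where S: "\<And>p q. p \<le> q \<Longrightarrow> (h has_integral (S q - S p)) {p..q}" "\<And>x. x \<le> a \<Longrightarrow> S x = 0"
    "\<And>x. b \<le> x \<Longrightarrow> S x = S b" "mono S" "\<bar>1 / m1\<bar>-lipschitz_on UNIV S"
    using bounded_primitive[OF hm h_nn h_le] by blast
  have S_pos: "0 < S q - S p" if "p < q" "a \<le> p" "q \<le> b" for p q
  proof -
    have "((\<lambda>x. 1 / m2) has_integral (1 / m2 * (q - p))) {p<..<q}"
      using has_integral_const_real[of "1 / m2" p q] that by (simp add: has_integral_Icc_iff_Ioo mult.commute)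
    moreover have "(h has_integral (S q - S p)) {p<..<q}" using S(1)[of p q] that by (simp add: has_integral_Icc_iff_Ioo)
    ultimately have "1 / m2 * (q - p) \<le> S q - S p" by (rule has_integral_le) (use h_ge that in auto)
    moreover have "0 < 1 / m2 * (q - p)" using m2 that by simp
    ultimately show ?thesis by linarith
  qed
  \<comment> \<open>The lengths of \<open>{a..x0}\<close> and \<open>{x0..b}\<close> measured in the
    coordinate \<open>S\<close>.\<close>
  define T1 where "T1 = S x0"
  define T2 where "T2 = S b - S x0"
  have Sa: "S a = 0" by (rule S(2)) simp
  have T: "0 < T1" "0 < T2" using S_pos[of a x0] S_pos[of x0 b] ab Sa by (auto simp: T1_def T2_def)
  have Sb: "S b = T1 + T2" by (simp add: T1_def T2_def)
  have S_le: "S x \<le> S b" for x using monoD[OF S(4), of x b] S(3)[of x] by (cases "x \<le> b") auto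
  have S_nn: "0 \<le> S x" for x using monoD[OF S(4), of a x] S(2)[of x] Sa by (cases "x \<le> a") auto
  have T_le: "T1 \<le> (b - a) / m1" "T2 \<le> (b - a) / m1"
  proof -
    have l: "S q - S p \<le> 1 / m1 * (q - p)" if "p \<le> q" for p q
      using lipschitz_onD[OF S(5), of q p] m(1) that by (simp add: dist_real_def)
    have "1 / m1 * (x0 - a) \<le> 1 / m1 * (b - a)" "1 / m1 * (b - x0) \<le> 1 / m1 * (b - a)"
      by (rule mult_left_mono, use ab m(1) in simp, use m(1) in simp)+
    then show "T1 \<le> (b - a) / m1" "T2 \<le> (b - a) / m1" using l[of a x0] l[of x0 b] ab Sa by (auto simp: T1_def T2_def)
  qed
  \<comment> \<open>The tent: \<open>\<mu> x * \<theta>' x\<close> is \<open>1 / T1\<close> left of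
    \<open>x0\<close> and \<open>- 1 / T2\<close> right of it. Written as a minimum, it inherits a
    Lipschitz constant.\<close>
  define \<theta> where "\<theta> x = min (S x / T1) ((S b - S x) / T2)" for x
  define \<theta>' where "\<theta>' x = (indicator {a<..<x0} x / T1 - indicator {x0<..<b} x / T2) / \<mu> x" for x
  have \<theta>_nn: "0 \<le> \<theta> x" for x using S_nn[of x] S_le[of x] T by (simp add: \<theta>_def)
  have \<theta>_le: "\<theta> x \<le> 1" for x
  proof (cases "S x \<le> T1")
    case True
    then have "S x / T1 \<le> 1" using T by simp
    then show ?thesis unfolding \<theta>_def by linarith
  next
    case False
    then have "(S b - S x) / T2 \<le> 1" using T Sb by simp
    then show ?thesis unfolding \<theta>_def by linarith
  qed
  have \<theta>_0: "\<theta> x = 0" if "x \<notin> {a<..<b}" for x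
  proof -
    have "S x = 0 \<or> S x = S b" using that S(2)[of x] S(3)[of x] by auto
    then show ?thesis using S_nn[of b] T by (auto simp: \<theta>_def)
  qed
  have \<theta>'_0: "\<theta>' x = 0" if "x \<notin> {a<..<b}" for x using that ab by (auto simp: \<theta>'_def)
  have \<theta>_L: "((1 / m1) / T1 + (1 / m1) / T2)-lipschitz_on UNIV \<theta>"
  proof -
    have S5: "\<bar>S x - S y\<bar> \<le> 1 / m1 * dist x y" for x y using lipschitz_onD[OF S(5), of x y] m(1) by (simp add: dist_real_def)
    have "((1 / m1) / T1)-lipschitz_on UNIV (\<lambda>x. S x / T1)"
    proof (rule lipschitz_onI)
      fix x y
      have "dist (S x / T1) (S y / T1) = \<bar>S x - S y\<bar> / T1" using T by (simp add: dist_real_def diff_divide_distrib[symmetric])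
      also have "\<dots> \<le> (1 / m1 * dist x y) / T1" by (intro divide_right_mono S5) (use T in simp)
      finally show "dist (S x / T1) (S y / T1) \<le> (1 / m1) / T1 * dist x y" by simp
    qed (use m T in simp)
    moreover have "((1 / m1) / T2)-lipschitz_on UNIV (\<lambda>x. (S b - S x) / T2)"
    proof (rule lipschitz_onI)
      fix x y
      have "dist ((S b - S x) / T2) ((S b - S y) / T2) = \<bar>S x - S y\<bar> / T2"
        using T by (simp add: dist_real_def diff_divide_distrib[symmetric] abs_minus_commute)
      also have "\<dots> \<le> (1 / m1 * dist x y) / T2" by (intro divide_right_mono S5) (use T in simp)
      finally show "dist ((S b - S x) / T2) ((S b - S y) / T2) \<le> (1 / m1) / T2 * dist x y" by simp
    qed (use m T in simp)
    ultimately show ?thesis unfolding \<theta>_def[abs_def] by (rule lipschitz_min)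
  qed
  have min_eq: "\<theta> x = (if S x \<le> T1 then S x / T1 else (S b - S x) / T2)" for x
  proof -
    have "S x / T1 \<le> (S b - S x) / T2 \<longleftrightarrow> S x * T2 \<le> (T1 + T2 - S x) * T1" using T by (simp add: Sb divide_simps mult.commute)
    also have "\<dots> \<longleftrightarrow> S x * (T1 + T2) \<le> T1 * (T1 + T2)" by (simp add: algebra_simps)
    also have "\<dots> \<longleftrightarrow> S x \<le> T1" using T by (subst mult_le_cancel_right_pos) auto
    finally show ?thesis by (auto simp: \<theta>_def min_def)
  qed
  have \<theta>_deriv: "(\<theta> has_real_derivative \<theta>' x) (at x)" if d: "(S has_real_derivative h x) (at x)" and x: "x \<noteq> x0" for x
  proof (cases "x < x0")
    case True
    have e: "S y / T1 = \<theta> y" if "y \<in> {..<x0}" for y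
      using monoD[OF S(4), of y x0] that by (simp add: min_eq T1_def)
    have "((\<lambda>y. S y / T1) has_real_derivative h x / T1) (at x)" by (rule DERIV_cdivide[OF d])
    then have "(\<theta> has_real_derivative h x / T1) (at x)"
      by (rule has_field_derivative_transform_within_open[of _ _ _ "{..<x0}"]) (use True e in auto)
    moreover have "h x / T1 = \<theta>' x" using True ab by (auto simp: h_def \<theta>'_def indicator_def)
    ultimately show ?thesis by simp
  next
    case False
    have e: "(S b - S y) / T2 = \<theta> y" if "y \<in> {x0<..}" for y
      using monoD[OF S(4), of x0 y] that T Sb by (auto simp: min_eq T1_def)
    have "((\<lambda>y. (S b - S y) / T2) has_real_derivative (0 - h x) / T2) (at x)" by (intro DERIV_cdivide DERIV_diff DERIV_const d)
    then have "(\<theta> has_real_derivative (0 - h x) / T2) (at x)"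
      by (rule has_field_derivative_transform_within_open[of _ _ _ "{x0<..}"]) (use False x e in auto)
    moreover have "(0 - h x) / T2 = \<theta>' x" using False x ab by (auto simp: h_def \<theta>'_def indicator_def)
    ultimately show ?thesis by simp
  qed
  have \<theta>_AE: "AE z in HM. (\<theta> has_real_derivative \<theta>' (snd z)) (at (snd z))"
  proof -
    have "negligible ({x. \<not> (S has_real_derivative h x) (at x)} \<union> {x0})"
      by (intro negligible_Un negligible_not_DERIV_integral S(1)) auto
    then have "AE x in lebesgue. (\<theta> has_real_derivative \<theta>' x) (at x)"
      by (intro AE_completeI, elim negligible_subset) (use \<theta>_deriv in blast)
    then have "AE x in lborel. (\<theta> has_real_derivative \<theta>' x) (at x)" by (simp add: AE_completion_iff)
    from AE_completion[OF AE_snd[OF this]] show ?thesis unfolding AE_HM_iff by eventually_elim simp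
  qed
  define \<psi> where "\<psi> z = hat r (fst z) * \<theta> (snd z)" for z :: point
  define Y where "Y z = (\<theta> (snd z) *\<^sub>R hatg r (fst z), hat r (fst z) * \<theta>' (snd z))" for z :: point
  define R where "R = r + b + 1"
  have R: "0 < R" using r ab by (simp add: R_def)
  have sup: "\<psi> z = 0 \<and> Y z = 0" if z: "z \<in> half_space" "z \<notin> ball 0 R" for z
  proof -
    have "norm z \<le> norm (fst z) + norm (snd z)" by (metis norm_Pair_le prod.collapse)
    then have "r \<le> norm (fst z) \<or> b \<le> snd z" using z by (auto simp: R_def half_space_def)
    then show ?thesis using hat_eq_0(1,2)[OF r, of "fst z"] \<theta>_0[of "snd z"] \<theta>'_0[of "snd z"] by (auto simp: \<psi>_def Y_def zero_prod_def)
  qed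
  have hat_grad: "GDERIV (\<lambda>z::point. hat r (fst z)) z :> (hatg r (fst z), 0)" for z
  proof -
    have "((\<lambda>z::point. hat r (fst z)) has_derivative (\<lambda>h. fst h \<bullet> hatg r (fst z))) (at z)"
      by (rule has_derivative_compose[OF has_derivative_fst[OF has_derivative_ident] GDERIV_hat[unfolded gderiv_def]])
    then show ?thesis unfolding gderiv_def by (simp add: inner_prod_def)
  qed
  have hat_c: "continuous_on A (\<lambda>z::point. hat r (fst z))" for A
    by (intro continuous_on_compose2[OF continuous_on_hat[of UNIV]] continuous_intros) simp
  have hatg_c: "continuous_on A (\<lambda>z::point. hatg r (fst z))" for A
    by (intro continuous_on_compose2[OF continuous_on_hatg[of UNIV]] continuous_intros) simp
  have \<theta>_c: "continuous_on A (\<lambda>z::point. \<theta> (snd z))" for A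
    by (intro continuous_on_compose2[OF lipschitz_on_continuous_on[OF \<theta>_L]] continuous_intros) simp
  note [measurable] = HM_measurable_continuous[OF hat_c] HM_measurable_continuous[OF hatg_c] HM_measurable_continuous[OF \<theta>_c]
    HM_measurable_continuous[OF w_continuous]
  have snd_HM [measurable]: "snd \<in> borel_measurable HM"
    by (rule HM_measurable_continuous) (intro continuous_intros)
  have [measurable]: "(\<lambda>z. \<theta>' (snd z)) \<in> borel_measurable HM" unfolding \<theta>'_def by measurable
  have Ym [measurable]: "Y \<in> borel_measurable HM" unfolding Y_def[abs_def] by measurable
  obtain Gb where Gb: "Gb \<ge> 0" "\<And>y. norm (hatg r y) \<le> Gb" using hatg_bounded[OF r] by blast
  have \<theta>'_b: "\<bar>\<theta>' x\<bar> \<le> (1 / T1 + 1 / T2) / m1" for x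
  proof (cases "x \<in> {a<..<b}")
    case True
    have "\<bar>indicator {a<..<x0} x / T1 - indicator {x0<..<b} x / T2\<bar> \<le> 1 / T1 + 1 / T2" using T by (auto simp: indicator_def)
    then have "\<bar>indicator {a<..<x0} x / T1 - indicator {x0<..<b} x / T2\<bar> / \<mu> x \<le> (1 / T1 + 1 / T2) / m1"
      using m(2)[of x] m(1) True T by (intro frac_le) auto
    then show ?thesis using m(2)[of x] m(1) True by (simp add: \<theta>'_def abs_div)
  qed (use \<theta>'_0 m T in simp)
  have nY: "norm (Y z) \<le> Gb + (1 / T1 + 1 / T2) / m1" for z
  proof -
    have "norm (Y z) \<le> norm (\<theta> (snd z) *\<^sub>R hatg r (fst z)) + norm (hat r (fst z) * \<theta>' (snd z))"
      unfolding Y_def by (rule norm_Pair_le)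
    also have "\<dots> \<le> 1 * Gb + 1 * ((1 / T1 + 1 / T2) / m1)"
    proof (rule add_mono)
      show "norm (\<theta> (snd z) *\<^sub>R hatg r (fst z)) \<le> 1 * Gb"
        unfolding norm_scaleR by (intro mult_mono Gb) (simp_all add: \<theta>_nn \<theta>_le)
      show "norm (hat r (fst z) * \<theta>' (snd z)) \<le> 1 * ((1 / T1 + 1 / T2) / m1)"
        unfolding real_norm_def abs_mult by (intro mult_mono \<theta>'_b) (simp_all add: hat_nonneg hat_le_1)
    qed
    finally show ?thesis by simp
  qed
  have t: "test R \<psi> Y (\<lambda>y. 0)"
    unfolding test_def
  proof (intro conjI ballI impI R Ym)
    show "bounded (\<psi> ` half_space)"
    proof (rule boundedI[where B = 1])
      fix v assume "v \<in> \<psi> ` half_space"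
      then obtain z where z: "v = hat r (fst z) * \<theta> (snd z)" by (auto simp: \<psi>_def)
      have "hat r (fst z) * \<theta> (snd z) \<le> 1 * 1" by (intro mult_mono hat_le_1 \<theta>_le \<theta>_nn) simp
      then show "norm v \<le> 1" using z hat_nonneg[of r "fst z"] \<theta>_nn[of "snd z"] by (simp add: abs_mult)
    qed
    show "locally_lipschitz_on half_space \<psi>"
      unfolding \<psi>_def[abs_def]
    proof (rule locally_lipschitz_on_mult)
      show "locally_lipschitz_on half_space (\<lambda>z::point. hat r (fst z))"
        by (rule locally_lipschitz_on_GDERIV[OF open_half_space hat_grad]) (intro continuous_intros hatg_c)
      have "((1 / m1) / T1 + (1 / m1) / T2)-lipschitz_on (cball z 1 \<inter> half_space) (\<lambda>z::point. \<theta> (snd z))" for z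
      proof (rule lipschitz_onI)
        fix y z :: point
        have "dist (\<theta> (snd y)) (\<theta> (snd z)) \<le> ((1 / m1) / T1 + (1 / m1) / T2) * dist (snd y) (snd z)"
          by (rule lipschitz_onD[OF \<theta>_L]) simp_all
        also have "\<dots> \<le> ((1 / m1) / T1 + (1 / m1) / T2) * dist y z"
          using m(1) T by (intro mult_left_mono dist_snd_le) simp
        finally show "dist (\<theta> (snd y)) (\<theta> (snd z)) \<le> ((1 / m1) / T1 + (1 / m1) / T2) * dist y z" .
      qed (use m(1) T in simp)
      then show "locally_lipschitz_on half_space (\<lambda>z::point. \<theta> (snd z))"
        unfolding locally_lipschitz_on_iff using zero_less_one by blast
    qed
    show "AE z in HM. GDERIV \<psi> z :> Y z"
      using \<theta>_AE
    proof eventually_elim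
      case (elim z)
      have "((\<lambda>z::point. \<theta> (snd z)) has_derivative (\<lambda>h. snd h * \<theta>' (snd z))) (at z)"
        using has_derivative_compose[OF has_derivative_snd[OF has_derivative_ident] elim[unfolded has_field_derivative_def]]
        by (simp add: mult.commute)
      then have "GDERIV (\<lambda>z::point. \<theta> (snd z)) z :> (0, \<theta>' (snd z))"
        unfolding gderiv_def by (simp add: inner_prod_def)
      from GDERIV_mult[OF hat_grad[of z] this] show ?case
        unfolding \<psi>_def[abs_def] Y_def by (simp add: add.commute)
    qed
    show "integrable HM (\<lambda>z. \<mu> (snd z) * (norm (Y z))\<^sup>2)"
    proof (rule integrable_mu_bounded[OF _ R])
      show "\<bar>(norm (Y z))\<^sup>2\<bar> \<le> (Gb + (1 / T1 + 1 / T2) / m1)\<^sup>2" for z using power_mono[OF nY[of z], of 2] by simp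
    qed (use sup in \<open>measurable, simp\<close>)
    \<comment> \<open>The tent vanishes below the height \<open>a\<close>, which is positive, so the
      trace is 0 as \<open>weak_w\<close> requires.\<close>
    show "AE y in lebesgue. ((\<lambda>x. \<psi> (y, x)) \<longlongrightarrow> 0) (at_right 0)"
    proof (rule AE_I2, rule tendsto_eventually)
      fix y
      show "eventually (\<lambda>x. \<psi> (y, x) = 0) (at_right 0)"
        using eventually_at_right_less[of 0] eventually_at_right_real[OF ab(1)]
        by eventually_elim (simp add: \<psi>_def \<theta>_0)
    qed
  qed (use sup in auto)
  note ww = weak_w[OF t]
  define \<kappa> where "\<kappa> x = \<mu> x * \<theta> x" for x
  have \<kappa>m: "(\<lambda>z. \<kappa> (snd z)) \<in> borel_measurable HM" unfolding \<kappa>_def by measurable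
  have \<kappa>b: "\<bar>\<kappa> x\<bar> \<le> m2 * indicator {a..b} x" for x
  proof (cases "x \<in> {a<..<b}")
    case True
    then have mx: "\<mu> x \<le> m2" "0 \<le> \<mu> x" using m(2)[of x] m(1) by auto
    have "\<mu> x * \<theta> x \<le> m2 * 1" by (rule mult_mono[OF mx(1) \<theta>_le]) (use m2 \<theta>_nn in simp_all)
    then show ?thesis using True mx \<theta>_nn[of x] by (simp add: \<kappa>_def abs_mult)
  qed (use \<theta>_0 m2 in \<open>simp add: \<kappa>_def\<close>)
  have \<kappa>nn: "0 \<le> \<kappa> (snd z)" if "z \<in> half_space" for z
    unfolding \<kappa>_def using mu_nonneg[OF that] \<theta>_nn by simp
  define A where "A i z = \<kappa> (snd z) * ((axis i 1 \<bullet> fst (Dw z)) * (hatg r (fst z) \<bullet> axis i 1))" for i and z :: point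
  define B where "B i z = \<kappa> (snd z) * (w z * hatd2 r (axis i 1) (fst z))" for i and z :: point
  note tf = tangential_flux[OF r ab(1) ax \<kappa>m \<kappa>b, folded A_def B_def]
  define P1 where "P1 z = indicator {a<..<x0} (snd z) * (hat r (fst z) * snd (Dw z))" for z
  define P2 where "P2 z = indicator {x0<..<b} (snd z) * (hat r (fst z) * snd (Dw z))" for z
  have p1: "integrable HM P1" "(\<integral>z. P1 z \<partial>HM) = W r x0 - W r a"
    unfolding P1_def[abs_def] using vertical_flux[OF r ab(1), of x0] ab by auto
  have p2: "integrable HM P2" "(\<integral>z. P2 z \<partial>HM) = W r b - W r x0"
    unfolding P2_def[abs_def] using vertical_flux[OF r, of x0 b] ab by auto
  have e1: "(\<integral>z. \<mu> (snd z) * (Dw z \<bullet> Y z) \<partial>HM) = (\<integral>z. A 1 z + A 2 z + P1 z / T1 - P2 z / T2 \<partial>HM)"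
  proof (rule Bochner_Integration.integral_cong[OF refl])
    fix z assume "z \<in> space HM"
    then have mu: "\<mu> (snd z) \<noteq> 0" using mu_pos[of "snd z"] by (simp add: half_space_def)
    have "\<mu> (snd z) * \<theta>' (snd z) = indicator {a<..<x0} (snd z) / T1 - indicator {x0<..<b} (snd z) / T2" using mu by (simp add: \<theta>'_def)
    then have "\<mu> (snd z) * \<theta>' (snd z) * (hat r (fst z) * snd (Dw z))
        = (indicator {a<..<x0} (snd z) / T1 - indicator {x0<..<b} (snd z) / T2) * (hat r (fst z) * snd (Dw z))"
      by (simp only:)
    also have "\<dots> = P1 z / T1 - P2 z / T2" unfolding P1_def P2_def left_diff_distrib by simp
    finally have P: "\<mu> (snd z) * \<theta>' (snd z) * (hat r (fst z) * snd (Dw z)) = P1 z / T1 - P2 z / T2" .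
    have D: "Dw z \<bullet> Y z = \<theta> (snd z) * ((fst (Dw z) \<bullet> axis 1 1) * (hatg r (fst z) \<bullet> axis 1 1) + (fst (Dw z) \<bullet> axis 2 1) * (hatg r (fst z) \<bullet> axis 2 1))
        + snd (Dw z) * (hat r (fst z) * \<theta>' (snd z))"
      unfolding Y_def inner_prod_def fst_conv snd_conv inner_scaleR_right inner_real_def real2_inner[of "fst (Dw z)" "hatg r (fst z)"] by (rule refl)
    have A: "A i z = \<mu> (snd z) * \<theta> (snd z) * ((fst (Dw z) \<bullet> axis i 1) * (hatg r (fst z) \<bullet> axis i 1))" for i
      unfolding A_def \<kappa>_def inner_commute[of "axis i 1" "fst (Dw z)"] by (rule refl)
    \<comment> \<open>The derivative of the tent cancels the weight, so no derivative of
      \<open>\<mu>\<close> is ever taken.\<close>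
    have lin: "\<nu> * (t * (p + q) + s * (k * t')) = \<nu> * t * p + \<nu> * t * q + P - Q" if "\<nu> * t' * (k * s) = P - Q"
      for \<nu> t p q s k t' P Q :: real
    proof -
      have "\<nu> * (t * (p + q) + s * (k * t')) = \<nu> * t * p + \<nu> * t * q + \<nu> * t' * (k * s)" by (simp add: algebra_simps)
      then show ?thesis unfolding that by simp
    qed
    show "\<mu> (snd z) * (Dw z \<bullet> Y z) = A 1 z + A 2 z + P1 z / T1 - P2 z / T2"
      unfolding D A by (rule lin[OF P])
  qed
  also have "\<dots> = (\<integral>z. A 1 z \<partial>HM) + (\<integral>z. A 2 z \<partial>HM) + (W r x0 - W r a) / T1 - (W r b - W r x0) / T2"
    using tf(1)[of 1] tf(1)[of 2] p1 p2 by simp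
  finally have e: "(\<integral>z. \<mu> (snd z) * (Dw z \<bullet> Y z) \<partial>HM) = - (\<integral>z. B 1 z \<partial>HM) - (\<integral>z. B 2 z \<partial>HM) - W r a / T1 - W r b / T2"
    unfolding tf(3) by (simp add: W0)
  define J where "J z = indicator {a..b} (snd z) * (w z * hat r (fst z))" for z
  have j: "integrable HM J" "(\<integral>z. J z \<partial>HM) \<le> (b - a) * M"
    unfolding J_def[abs_def] using slab_integral[OF r ab(1) _ M] ab by auto
  have Jn: "0 \<le> w z * hat r (fst z)" for z by (simp add: w_nonneg hat_nonneg)
  have b1: "- (\<integral>z. B 1 z \<partial>HM) - (\<integral>z. B 2 z \<partial>HM) \<le> 14 / r\<^sup>2 * m2 * (\<integral>z. J z \<partial>HM)"
  proof -
    have "- (\<integral>z. B 1 z \<partial>HM) - (\<integral>z. B 2 z \<partial>HM) = (\<integral>z. - B 1 z - B 2 z \<partial>HM)" using tf(2) by simp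
    also have "\<dots> \<le> (\<integral>z. 14 / r\<^sup>2 * m2 * J z \<partial>HM)"
    proof (rule integral_mono)
      fix z assume "z \<in> space HM"
      then have z: "z \<in> half_space" by simp
      have "- B 1 z - B 2 z = \<kappa> (snd z) * w z * (- (hatd2 r (axis 1 1) (fst z) + hatd2 r (axis 2 1) (fst z)))"
        by (simp add: B_def algebra_simps)
      \<comment> \<open>As \<open>\<kappa>\<close> and \<open>w\<close> are nonnegative, only the
        lower bound on the Laplacian of \<open>hat\<close> matters.\<close>
      also have "\<dots> \<le> \<kappa> (snd z) * w z * (14 / r\<^sup>2 * hat r (fst z))"
        using hat_laplacian_ge[OF r, of "fst z"] by (intro mult_left_mono mult_nonneg_nonneg \<kappa>nn z w_nonneg) simp
      also have "\<dots> = \<kappa> (snd z) * (14 / r\<^sup>2 * (w z * hat r (fst z)))" by simp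
      also have "\<dots> \<le> (m2 * indicator {a..b} (snd z)) * (14 / r\<^sup>2 * (w z * hat r (fst z)))"
        by (rule mult_right_mono[OF order_trans[OF abs_ge_self \<kappa>b]]) (use Jn in simp)
      finally show "- B 1 z - B 2 z \<le> 14 / r\<^sup>2 * m2 * J z" by (simp add: J_def mult_ac)
    qed (use tf(2) j in auto)
    finally show ?thesis by simp
  qed
  have b2: "(\<integral>z. c z * (w z * \<psi> z) \<partial>HM) \<le> Cc * (\<integral>z. J z \<partial>HM)"
  proof -
    have "(\<integral>z. c z * (w z * \<psi> z) \<partial>HM) \<le> (\<integral>z. Cc * J z \<partial>HM)"
    proof (rule integral_mono[OF ww(2)])
      fix z assume "z \<in> space HM"
      then have z: "z \<in> half_space" by simp
      show "c z * (w z * \<psi> z) \<le> Cc * J z"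
      proof (cases "snd z \<in> {a<..<b}")
        case True
        have c: "\<bar>c z\<bar> \<le> Cc" by (rule Cc[OF z]) (use True in simp)
        have "\<psi> z \<le> hat r (fst z) * 1" unfolding \<psi>_def by (intro mult_left_mono \<theta>_le hat_nonneg)
        then have le: "w z * \<psi> z \<le> w z * hat r (fst z)" by (intro mult_left_mono w_nonneg) simp
        have "0 \<le> w z * \<psi> z" by (simp add: \<psi>_def w_nonneg hat_nonneg \<theta>_nn)
        then have "c z * (w z * \<psi> z) \<le> Cc * (w z * hat r (fst z))"
          by (intro mult_mono[OF order_trans[OF abs_ge_self c] le] order_trans[OF abs_ge_zero c])
        then show ?thesis using True by (simp add: J_def)
      next
        case False
        have "0 \<le> Cc" if "snd z \<in> {a..b}" using Cc[OF z] that by auto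
        then have "0 \<le> Cc * J z" using Jn[of z] by (auto simp: J_def indicator_def)
        then show ?thesis using False by (simp add: \<psi>_def \<theta>_0)
      qed
    qed (use j in simp)
    then show ?thesis by simp
  qed
  define K where "K = 14 / r\<^sup>2 * m2 + Cc"
  have Cc0: "0 \<le> Cc" using order_trans[OF abs_ge_zero Cc[of "(0, a)"]] ab by simp
  have K0: "0 \<le> K" unfolding K_def using Cc0 m2 by (intro add_nonneg_nonneg mult_nonneg_nonneg) auto
  have sum: "W r a / T1 + W r b / T2 \<le> K * ((b - a) * M)"
  proof -
    have "W r a / T1 + W r b / T2 \<le> K * (\<integral>z. J z \<partial>HM)" using ww(3) e b1 b2 by (simp add: K_def distrib_right)
    also have "\<dots> \<le> K * ((b - a) * M)" by (intro mult_left_mono j K0)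
    finally show ?thesis .
  qed
  have M0: "0 \<le> M" using M[of a] W_nonneg[of r a] ab by auto
  have fin: "X \<le> K / m1 * (b - a)\<^sup>2 * M" if X: "X / T \<le> K * ((b - a) * M)" and T: "0 < T" "T \<le> (b - a) / m1" for X T
  proof -
    have "X \<le> K * ((b - a) * M) * T" using X T by (simp add: divide_le_eq)
    also have "\<dots> \<le> K * ((b - a) * M) * ((b - a) / m1)" using T K0 M0 ab by (intro mult_left_mono) auto
    finally show ?thesis by (simp add: power2_eq_square mult_ac)
  qed
  have "0 \<le> W r a / T1" "0 \<le> W r b / T2" using W_nonneg T by auto
  then show "W r a \<le> (14 / r\<^sup>2 * m2 + Cc) / m1 * (b - a)\<^sup>2 * M" "W r b \<le> (14 / r\<^sup>2 * m2 + Cc) / m1 * (b - a)\<^sup>2 * M"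
    using fin[of "W r a" T1] fin[of "W r b" T2] sum T T_le unfolding K_def by auto
qed

text \<open>Near a zero \<open>x0\<close> of \<open>W r\<close> the slice inequality at a maximum point of \<open>W r\<close> reads
  \<open>max W \<le> \<theta> max W\<close> with \<open>\<theta> < 1\<close>.\<close>

lemma W_zero_open:
  assumes r: "0 < r" and x0: "0 < x0" and W0: "W r x0 = 0"
  shows "\<exists>d>0. \<forall>x. \<bar>x - x0\<bar> < d \<longrightarrow> W r x = 0"
proof -
  have "0 < x0/2" using x0 by simp
  from mu_bounds[OF this, of "2*x0"] obtain m1 m2 where m: "0 < m1" "\<And>x. x \<in> {x0/2..2*x0} \<Longrightarrow> m1 \<le> \<mu> x \<and> \<mu> x \<le> m2"
    by blast
  obtain Cc where Cc: "Cc \<ge> 0" "\<And>z. z \<in> half_space \<Longrightarrow> snd z < 3*x0 \<Longrightarrow> \<bar>c z\<bar> \<le> Cc"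
    using c_bound[of "3*x0"] x0 by auto
  define K where "K = (14 / r\<^sup>2 * m2 + Cc) / m1"
  have "m1 \<le> m2" using m(2)[of x0] x0 by auto
  then have K0: "0 \<le> K" using m(1) Cc(1) r by (simp add: K_def)
  \<comment> \<open>The first bound keeps the interval inside \<open>{x0/2..2*x0}\<close>, where
    \<open>\<mu>\<close> lies between \<open>m1\<close> and \<open>m2\<close>; the second makes the
    factor \<open>K * (2 * d)\<^sup>2\<close> less than 1.\<close>
  define d where "d = min (x0/2) (1 / (4 * (K + 1)))"
  have d: "0 < d" "d \<le> x0/2" "d \<le> 1 / (4 * (K + 1))" using x0 K0 by (auto simp: d_def)
  have Kd: "K * (2 * d)\<^sup>2 < 1"
  proof -
    have "2 * d \<le> 1 / (2 * (K + 1))" using d(3) K0 by (simp add: field_simps)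
    then have "(2 * d)\<^sup>2 \<le> (1 / (2 * (K + 1)))\<^sup>2" using d(1) by (intro power_mono) auto
    then have "K * (2 * d)\<^sup>2 \<le> K * (1 / (2 * (K + 1)))\<^sup>2" using K0 by (intro mult_left_mono)
    also have "\<dots> < 1"
    proof -
      have "K < (2 * (K + 1))\<^sup>2" using K0 by (simp add: power2_eq_square algebra_simps add_pos_nonneg)
      then show ?thesis using K0 by (simp add: power_divide)
    qed
    finally show ?thesis .
  qed
  let ?I = "{x0 - d..x0 + d}"
  have "continuous_on ?I (W r)" by (rule continuous_on_subset[OF W_continuous[OF r]]) (use d x0 in auto)
  then obtain p where p: "p \<in> ?I" "\<And>x. x \<in> ?I \<Longrightarrow> W r x \<le> W r p"
    using continuous_attains_sup[of ?I "W r"] d(1) by auto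
  have "W r p \<le> K * (2 * d)\<^sup>2 * W r p"
  proof -
    have ineq: "W r a \<le> K * (b - a)\<^sup>2 * W r p \<and> W r b \<le> K * (b - a)\<^sup>2 * W r p"
      if ab: "x0 - d \<le> a" "a < x0" "x0 < b" "b \<le> x0 + d" for a b
    proof -
      have 1: "m1 \<le> \<mu> x \<and> \<mu> x \<le> m2" if "x \<in> {a..b}" for x using m(2)[of x] that ab d by auto
      have 2: "\<bar>c z\<bar> \<le> Cc" if "z \<in> half_space" "snd z \<le> b" for z using Cc(2)[OF that(1)] that(2) ab d x0 by auto
      have 3: "W r x \<le> W r p" if "x \<in> {a..b}" for x using p(2)[of x] that ab by auto
      have a0: "0 < a" using ab d x0 by linarith
      show ?thesis unfolding K_def
        using slice_inequality[OF r a0 ab(2,3) W0 m(1) 1 2 3] by blast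
    qed
    have mono: "K * s\<^sup>2 * W r p \<le> K * (2 * d)\<^sup>2 * W r p" if "0 \<le> s" "s \<le> 2 * d" for s
      using that K0 W_nonneg by (intro mult_right_mono mult_left_mono power_mono) auto
    \<comment> \<open>The slice inequality controls \<open>W r\<close> at the endpoints of an
      interval around \<open>x0\<close>, so the maximum point \<open>p\<close> is made one endpoint
      and the other is put at distance \<open>d\<close> on the far side of
      \<open>x0\<close>.\<close>
    consider "p = x0" | "p < x0" | "x0 < p" by linarith
    then show ?thesis
    proof cases
      case 1
      then show ?thesis using W0 by simp
    next
      case 2
      then show ?thesis using ineq[of p "x0 + d"] mono[of "x0 + d - p"] p(1) d(1) by auto
    next
      case 3
      then show ?thesis using ineq[of "x0 - d" p] mono[of "p - (x0 - d)"] p(1) d(1) by auto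
    qed
  qed
  then have "(1 - K * (2 * d)\<^sup>2) * W r p \<le> 0" by (simp add: left_diff_distrib)
  then have "W r p \<le> 0" using Kd by (simp add: mult_le_0_iff)
  then have "W r x = 0" if "\<bar>x - x0\<bar> < d" for x
    using p(2)[of x] that W_nonneg[of r x] by (simp add: abs_less_iff)
  then show ?thesis using d(1) by blast
qed

text \<open>The zeros of \<open>W r\<close> form an open and closed subset of the positive axis that
  contains \<open>x0\<close>, hence the whole axis. Any \<open>z\<close> is reached by taking
  \<open>r\<close> larger than the norm of its horizontal part.\<close>

lemma w_zero_slice:
  assumes x0: "0 < x0" and w0: "\<And>y. w (y, x0) = 0" and z: "z \<in> half_space"
  shows "w z = 0"
proof -
  define r where "r = norm (fst z) + 1"
  have r: "0 < r" by (simp add: r_def add_nonneg_pos)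
  define Z where "Z = {x \<in> {0<..}. W r x = 0}"
  have "open Z"
    unfolding open_dist
  proof
    fix x assume "x \<in> Z"
    then have x: "0 < x" "W r x = 0" by (auto simp: Z_def)
    obtain d where d: "d > 0" "\<And>y. \<bar>y - x\<bar> < d \<Longrightarrow> W r y = 0" using W_zero_open[OF r x] by blast
    show "\<exists>e>0. \<forall>y. dist y x < e \<longrightarrow> y \<in> Z"
      by (rule exI[of _ "min d x"]) (use d x in \<open>auto simp: Z_def dist_real_def abs_less_iff\<close>)
  qed
  then have "openin (top_of_set {0<..}) Z" by (intro open_subset) (auto simp: Z_def)
  moreover have "closedin (top_of_set {0<..}) Z"
    unfolding Z_def using continuous_closedin_preimage_constant[OF W_continuous[OF r], of 0] by simp
  moreover have "connected {0::real<..}" by (intro convex_connected) simp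
  moreover have "x0 \<in> Z" using x0 w0 W_eq_0_iff[OF r x0] by (simp add: Z_def)
  ultimately have "Z = {0<..}" unfolding connected_clopen by blast
  then have "W r (snd z) = 0" "0 < snd z" using z by (auto simp: half_space_def Z_def)
  then have "\<forall>y. norm y < r \<longrightarrow> w (y, snd z) = 0" using W_eq_0_iff[OF r] by blast
  then show ?thesis by (metis less_add_one prod.collapse r_def)
qed

subsection \<open>One-dimensional symmetry\<close>


lemma V_expand: "V e z = (e \<bullet> axis 1 1) * v1 z + (e \<bullet> axis 2 1) * v2 z"
  unfolding V_def real2_inner[of e "fst (G z)"] by (simp add: inner_commute)

lemma HE_expand: "HE e z = (e \<bullet> axis 1 1) *\<^sub>R h1 z + (e \<bullet> axis 2 1) *\<^sub>R h2 z"
proof -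
  have "(e, 0 :: real) = (e \<bullet> axis 1 1) *\<^sub>R (axis 1 1, 0) + (e \<bullet> axis 2 1) *\<^sub>R (axis 2 1, 0)"
    by (simp add: vec_eq_iff forall_2 inner_axis) (simp add: axis_def)
  then have "HE e z = blinfun_apply (H z) ((e \<bullet> axis 1 1) *\<^sub>R (axis 1 1, 0) + (e \<bullet> axis 2 1) *\<^sub>R (axis 2 1, 0))"
    unfolding HE_def by (simp only:)
  then show ?thesis unfolding HE_def blinfun.add_right blinfun.scaleR_right .
qed

text \<open>\<open>cross = 0\<close> makes \<open>h1\<close> and \<open>h2\<close> proportional to
  \<open>v1\<close> and \<open>v2\<close>, so the gradient of every horizontal derivative points
  along \<open>Dw\<close>. Without it the two sides, multiplied by \<open>(w z)\<^sup>2\<close>,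
  differ by an explicit multiple of \<open>cross\<close>.\<close>

lemma HE_eq:
  assumes z: "z \<in> half_space" and nz: "w z \<noteq> 0"
  shows "HE e z = (V e z / w z) *\<^sub>R Dw z"
proof -
  have "(w z)\<^sup>2 *\<^sub>R HE e z - V e z *\<^sub>R (v1 z *\<^sub>R h1 z + v2 z *\<^sub>R h2 z)
     = (v1 z * (e \<bullet> axis 2 1) - v2 z * (e \<bullet> axis 1 1)) *\<^sub>R cross z"
    unfolding w_sq HE_expand[of e] V_expand[of e] cross_def by (simp add: algebra_simps power2_eq_square)
  then have "(w z)\<^sup>2 *\<^sub>R HE e z = V e z *\<^sub>R (w z *\<^sub>R Dw z)" unfolding cross_eq_0[OF z] w_Dw by simp
  then have "(1 / (w z)\<^sup>2) *\<^sub>R ((w z)\<^sup>2 *\<^sub>R HE e z) = (1 / (w z)\<^sup>2) *\<^sub>R (V e z *\<^sub>R (w z *\<^sub>R Dw z))" by (simp only:)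
  then show ?thesis using nz by (simp add: power2_eq_square)
qed

text \<open>The direction \<open>fst (G z) / w z\<close> is locally constant because its derivative is a multiple of \<open>cross\<close>.\<close>

lemma V_zero_nbhd:
  assumes q: "q \<in> half_space" and nz: "w q \<noteq> 0" and Vq: "V e q = 0"
  shows "\<exists>r>0. \<forall>z\<in>ball q r. z \<in> half_space \<and> w z \<noteq> 0 \<and> V e z = 0"
proof -
  have "open (half_space \<inter> w -` (- {0}))"
    by (rule continuous_open_preimage[OF w_continuous open_half_space]) (simp add: open_Compl)
  then obtain r where r: "r > 0" "ball q r \<subseteq> half_space \<inter> w -` (- {0})"
    using q nz unfolding open_contains_ball by blast
  have hz: "z \<in> half_space" "w z \<noteq> 0" if "z \<in> ball q r" for z using r(2) that by auto
  have "((\<lambda>z. V e z * inverse (w z)) has_derivative (\<lambda>h. 0)) (at z within ball q r)" if z: "z \<in> ball q r" for z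
  proof -
    have "GDERIV (\<lambda>z. V e z * inverse (w z)) z :> V e z *\<^sub>R (- (inverse (w z))\<^sup>2 *\<^sub>R Dw z) + inverse (w z) *\<^sub>R HE e z"
      by (rule GDERIV_mult[OF GDERIV_V[OF hz(1)[OF z]] GDERIV_inverse[OF GDERIV_w_nonzero[OF hz[OF z]] hz(2)[OF z]]])
    also have "V e z *\<^sub>R (- (inverse (w z))\<^sup>2 *\<^sub>R Dw z) + inverse (w z) *\<^sub>R HE e z = 0"
      unfolding HE_eq[OF hz[OF z]] by (simp add: power2_eq_square divide_inverse mult_ac)
    finally show ?thesis unfolding gderiv_def by (simp add: has_derivative_at_withinI)
  qed
  then have "\<exists>k. \<forall>z\<in>ball q r. V e z * inverse (w z) = k" by (rule has_derivative_zero_constant[OF convex_ball])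
  then obtain k where k: "\<And>z. z \<in> ball q r \<Longrightarrow> V e z * inverse (w z) = k" by blast
  have "k = 0" using k[of q] r(1) Vq by simp
  then have "V e z = 0" if "z \<in> ball q r" for z using k[OF that] hz(2)[OF that] by simp
  then show ?thesis using r(1) hz by blast
qed

text \<open>Where \<open>G\<close> still has its value at \<open>p\<close>, \<open>w\<close> is
  nonzero and \<open>V e\<close> is 0. Then \<open>V e\<close> vanishes nearby, and with it, by
  \<open>HE_eq\<close>, the derivative of \<open>G\<close> along the line; so the set of such
  parameters is open, and it is closed by continuity. The vertical component is included because
  \<open>HE e\<close> is the derivative of the full gradient.\<close>

lemma G_constant_on_line:
  assumes p: "p \<in> half_space" and nz: "w p \<noteq> 0" and e: "V e p = 0"
  shows "G (p + t *\<^sub>R (e, 0)) = G p"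
proof -
  define \<phi> where "\<phi> t = G (p + t *\<^sub>R (e, 0))" for t
  have h: "p + t *\<^sub>R (e, 0) \<in> half_space" for t using p by (simp add: half_space_def)
  define T where "T = {t. \<phi> t = \<phi> 0}"
  have d: "(\<phi> has_derivative (\<lambda>s. s *\<^sub>R HE e (p + t *\<^sub>R (e, 0)))) (at t)" for t
  proof -
    have "((\<lambda>t. p + t *\<^sub>R (e, 0)) has_derivative (\<lambda>s. s *\<^sub>R (e, 0))) (at t)" by (auto intro!: derivative_eq_intros)
    from has_derivative_compose[OF this H[OF h]] show ?thesis
      unfolding \<phi>_def[abs_def] HE_def blinfun.scaleR_right .
  qed
  have \<phi>c: "continuous_on UNIV \<phi>"
    using d has_derivative_continuous continuous_at_imp_continuous_on by blast
  have "closed T" unfolding T_def by (intro closed_Collect_eq \<phi>c continuous_intros)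
  moreover have "open T"
    unfolding open_dist
  proof
    fix t assume "t \<in> T"
    then have t: "G (p + t *\<^sub>R (e, 0)) = G p" by (simp add: T_def \<phi>_def zero_prod_def[symmetric])
    have nz': "w (p + t *\<^sub>R (e, 0)) \<noteq> 0" "V e (p + t *\<^sub>R (e, 0)) = 0" using nz e unfolding w_def V_def t by auto
    obtain r where r: "r > 0" "\<And>z. z \<in> ball (p + t *\<^sub>R (e, 0)) r \<Longrightarrow> z \<in> half_space \<and> w z \<noteq> 0 \<and> V e z = 0"
      using V_zero_nbhd[OF h nz'] by blast
    define s where "s = r / (norm e + 1)"
    have n1: "0 < norm e + 1" by (simp add: add_nonneg_pos)
    have s: "s > 0" using r n1 by (simp add: s_def)
    have "(\<phi> has_derivative (\<lambda>h. 0)) (at t' within ball t s)" if t': "t' \<in> ball t s" for t'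
    proof -
      have "dist (p + t *\<^sub>R (e, 0)) (p + t' *\<^sub>R (e, 0)) = norm ((t - t') *\<^sub>R (e, 0 :: real))"
        by (simp add: dist_norm scaleR_left_diff_distrib)
      also have "\<dots> = \<bar>t - t'\<bar> * norm e" by (simp only: norm_scaleR norm_Pair) simp
      also have "\<dots> \<le> \<bar>t - t'\<bar> * (norm e + 1)" by (intro mult_left_mono) auto
      also have "\<dots> < s * (norm e + 1)" using t' n1 by (intro mult_strict_right_mono) (simp_all add: dist_real_def)
      also have "\<dots> = r" using n1 by (simp add: s_def)
      finally have b: "p + t' *\<^sub>R (e, 0) \<in> ball (p + t *\<^sub>R (e, 0)) r" by simp
      have "HE e (p + t' *\<^sub>R (e, 0)) = 0" using HE_eq r(2)[OF b] by simp
      then show ?thesis using has_derivative_at_withinI[OF d[of t']] by simp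
    qed
    then have "\<exists>k. \<forall>t'\<in>ball t s. \<phi> t' = k" by (rule has_derivative_zero_constant[OF convex_ball])
    then obtain k where k: "\<And>t'. t' \<in> ball t s \<Longrightarrow> \<phi> t' = k" by blast
    have "\<phi> t' = \<phi> 0" if "dist t' t < s" for t'
      using k[of t'] k[of t] that s t by (simp add: dist_commute \<phi>_def zero_prod_def[symmetric])
    then show "\<exists>\<epsilon>>0. \<forall>t'. dist t' t < \<epsilon> \<longrightarrow> t' \<in> T" using s by (auto simp: T_def)
  qed
  moreover have "0 \<in> T" by (simp add: T_def)
  ultimately have "T = UNIV" using clopen by blast
  then show ?thesis by (auto simp: T_def \<phi>_def zero_prod_def[symmetric])
qed

text \<open>If the directions at \<open>p\<close> and \<open>q\<close> differed, then the lines through \<open>p\<close> and \<open>q\<close> on which \<open>G\<close>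
  is constant would meet.\<close>

lemma V_zero_slice:
  assumes x: "0 < x" and nz: "w (y, x) \<noteq> 0" and e: "V e (y, x) = 0"
  shows "V e (y', x) = 0"
proof (rule ccontr)
  assume V: "V e (y', x) \<noteq> 0"
  define a where "a = fst (G (y', x))"
  have ea: "e \<bullet> a \<noteq> 0" using V by (simp add: V_def a_def)
  then have nz': "w (y', x) \<noteq> 0" by (auto simp: w_def a_def)
  \<comment> \<open>The parameter at which the line through \<open>y\<close> with direction
    \<open>e\<close> meets the line through \<open>y'\<close> orthogonal to \<open>a\<close>; the
    lines are not parallel because \<open>e \<bullet> a\<close> is not 0.\<close>
  define t where "t = a \<bullet> (y' - y) / (a \<bullet> e)"
  define k where "k = y + t *\<^sub>R e - y'"
  have "a \<bullet> k = 0" using ea by (simp add: k_def t_def inner_diff_right inner_add_right inner_commute[of e])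
  then have "V k (y', x) = 0" by (simp add: V_def a_def inner_commute)
  from G_constant_on_line[OF _ nz' this, of 1] x have "G (y' + k, x) = G (y', x)" by simp
  moreover have "G (y + t *\<^sub>R e, x) = G (y, x)" using G_constant_on_line[OF _ nz e, of t] x by simp
  ultimately have "G (y, x) = G (y', x)" by (simp add: k_def)
  then show False using V e by (simp add: V_def)
qed

lemma one_dimensional:
  assumes V: "\<And>z. z \<in> half_space \<Longrightarrow> V e z = 0"
    and basis: "\<And>y. y = (\<omega> \<bullet> y) *\<^sub>R \<omega> + (e \<bullet> y) *\<^sub>R e" and x: "0 < x"
  shows "u (y, x) = u ((\<omega> \<bullet> y) *\<^sub>R \<omega>, x)"
proof -
  define z where "z = ((\<omega> \<bullet> y) *\<^sub>R \<omega>, x)"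
  have h: "z + t *\<^sub>R (e, 0) \<in> half_space" for t using x by (simp add: z_def)
  have "((\<lambda>t. u (z + t *\<^sub>R (e, 0))) has_real_derivative 0) (at t)" for t
    using GDERIV_line[OF G[OF h[of t]]] V[OF h[of t]] by (simp add: V_eq)
  then have "u (z + (e \<bullet> y) *\<^sub>R (e, 0)) = u (z + 0 *\<^sub>R (e, 0))" by (intro DERIV_isconst_all allI)
  moreover have "z + (e \<bullet> y) *\<^sub>R (e, 0) = (y, x)" using basis[of y] by (simp add: z_def)
  ultimately show ?thesis by (simp add: z_def zero_prod_def[symmetric])
qed

lemma orthonormal_expansion:
  fixes a b :: real
  assumes "a\<^sup>2 + b\<^sup>2 = 1"
  shows "norm (vector [a, b] :: real^2) = 1"
    "y = (vector [a, b] \<bullet> y) *\<^sub>R vector [a, b] + (vector [- b, a] \<bullet> y) *\<^sub>R (vector [- b, a] :: real^2)"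
proof -
  show "norm (vector [a, b] :: real^2) = 1"
    using assms by (simp add: norm_eq_1 inner_vec_def sum_2 power2_eq_square)
  have "(a * y $ 1 + b * y $ 2) * a + (- b * y $ 1 + a * y $ 2) * - b = (a\<^sup>2 + b\<^sup>2) * y $ 1"
    "(a * y $ 1 + b * y $ 2) * b + (- b * y $ 1 + a * y $ 2) * a = (a\<^sup>2 + b\<^sup>2) * y $ 2"
    by (simp_all add: power2_eq_square algebra_simps)
  then show "y = (vector [a, b] \<bullet> y) *\<^sub>R vector [a, b] + (vector [- b, a] \<bullet> y) *\<^sub>R (vector [- b, a] :: real^2)"
    using assms by (simp add: vec_eq_iff forall_2 inner_vec_def sum_2)
qed

text \<open>Near a point of the slice with \<open>w\<close> nonzero \<open>V e\<close> remains 0,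
  and \<open>V_zero_slice\<close> spreads this over each neighbouring slice; so the heights in
  question form an open set, closed by continuity. Across a slice on which \<open>w\<close> vanished
  identically this argument could not transport the direction, whence \<open>nz\<close>.\<close>

lemma V_zero_direction:
  assumes nz: "\<And>x. 0 < x \<Longrightarrow> \<exists>y. w (y, x) \<noteq> 0" and x0: "0 < x0" and e: "\<And>y. V e (y, x0) = 0"
    and z: "z \<in> half_space"
  shows "V e z = 0"
proof -
  define X where "X = {x \<in> {0<..}. \<forall>y. V e (y, x) = 0}"
  have "open X"
    unfolding open_dist
  proof
    fix x assume "x \<in> X"
    then have x: "0 < x" "\<And>y. V e (y, x) = 0" by (auto simp: X_def)
    obtain y where y: "w (y, x) \<noteq> 0" using nz[OF x(1)] by blast
    have h: "(y, x) \<in> half_space" using x by simp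
    obtain r where r: "r > 0" "\<And>z. z \<in> ball (y, x) r \<Longrightarrow> z \<in> half_space \<and> w z \<noteq> 0 \<and> V e z = 0"
      using V_zero_nbhd[OF h y x(2)] by blast
    have "x' \<in> X" if "dist x' x < r" for x'
    proof -
      have "(y, x') \<in> ball (y, x) r" using that by (simp add: dist_Pair_Pair dist_commute)
      from r(2)[OF this] have x': "0 < x'" "w (y, x') \<noteq> 0" "V e (y, x') = 0" by simp_all
      then show ?thesis using V_zero_slice[OF x'] by (simp add: X_def)
    qed
    then show "\<exists>\<epsilon>>0. \<forall>x'. dist x' x < \<epsilon> \<longrightarrow> x' \<in> X" using r(1) by blast
  qed
  then have "openin (top_of_set {0<..}) X" by (intro open_subset) (auto simp: X_def)
  moreover have "closedin (top_of_set {0<..}) X"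
  proof -
    have "closedin (top_of_set {0<..}) {x \<in> {0<..}. V e (y, x) = 0}" for y
      by (intro continuous_closedin_preimage_constant continuous_on_compose2[OF V_continuous] continuous_intros) auto
    then have "closedin (top_of_set {0<..}) (\<Inter>y. {x \<in> {0<..}. V e (y, x) = 0})" by (intro closedin_INT) auto
    moreover have "(\<Inter>y. {x \<in> {0<..}. V e (y, x) = 0}) = X" by (auto simp: X_def)
    ultimately show ?thesis by simp
  qed
  moreover have "connected {0::real<..}" by (intro convex_connected) simp
  moreover have "x0 \<in> X" using x0 e by (simp add: X_def)
  ultimately have "X = {0<..}" unfolding connected_clopen by blast
  then show ?thesis using z by (cases z) (auto simp: X_def)
qed

lemma symmetry:
  "\<exists>(\<omega>::real^2) (uo::real \<Rightarrow> real \<Rightarrow> real). norm \<omega> = 1 \<and> (\<forall>y x. x > 0 \<longrightarrow> u (y, x) = uo (\<omega> \<bullet> y) x)"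
proof -
  have "\<exists>a b. a\<^sup>2 + b\<^sup>2 = 1 \<and> (\<forall>z\<in>half_space. V (vector [- b, a]) z = 0)"
  proof (cases "\<forall>x>0. \<exists>y. w (y, x) \<noteq> 0")
    \<comment> \<open>If \<open>w\<close> vanishes on one slice it vanishes everywhere;
      \<open>u\<close> then depends on the height only, and any direction serves.\<close>
    case False
    then obtain x0 where "0 < x0" "\<And>y. w (y, x0) = 0" by blast
    then have "w z = 0" if "z \<in> half_space" for z using w_zero_slice that by blast
    then have "\<forall>z\<in>half_space. V (vector [- 0, 1]) z = 0" by (simp add: V_def w_def)
    then show ?thesis by (intro exI[of _ 1] exI[of _ 0]) simp
  next
    case True
    then have nz: "\<And>x. 0 < x \<Longrightarrow> \<exists>y. w (y, x) \<noteq> 0" by blast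
    then obtain y where y: "w (y, 1) \<noteq> 0" using zero_less_one by blast
    define p where "p = (y, 1 :: real)"
    \<comment> \<open>The direction of the horizontal gradient at one point is the candidate for
      \<open>\<omega>\<close>; \<open>vector [- b, a]\<close> is the direction orthogonal to
      it.\<close>
    define a where "a = v1 p / w p"
    define b where "b = v2 p / w p"
    have wp: "w p \<noteq> 0" using y by (simp add: p_def)
    have ab: "a\<^sup>2 + b\<^sup>2 = 1"
      using wp by (simp add: a_def b_def power_divide add_divide_distrib[symmetric] w_sq[symmetric])
    have "V (vector [- b, a]) p = 0"
      unfolding V_expand[of "vector [- b, a]"] by (simp add: inner_axis a_def b_def)
    then have "V (vector [- b, a]) (y', 1) = 0" for y'
      using V_zero_slice[of 1 y] y by (simp add: p_def)
    then have "V (vector [- b, a]) z = 0" if "z \<in> half_space" for z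
      using V_zero_direction[OF nz zero_less_one _ that] by blast
    then show ?thesis using ab by blast
  qed
  then obtain a b where ab: "a\<^sup>2 + b\<^sup>2 = 1" "\<And>z. z \<in> half_space \<Longrightarrow> V (vector [- b, a]) z = 0" by blast
  show ?thesis
    using one_dimensional[OF ab(2) orthonormal_expansion(2)[OF ab(1)]] orthonormal_expansion(1)[OF ab(1)]
    by (intro exI[of _ "vector [a, b]"] exI[of _ "\<lambda>s x. u (s *\<^sub>R vector [a, b], x)"]) blast
qed

end

theorem theorem2:
  fixes \<mu> :: "real \<Rightarrow> real" and g :: "real \<Rightarrow> real \<Rightarrow> real" and f :: "real \<Rightarrow> real"
    and u :: "(real^2) \<times> real \<Rightarrow> real"
  assumes "structural_assumptions \<mu> g f"
    and "C2_on half_space u"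
    and "bounded (u ` half_space)"
    and "weak_solution \<mu> g f u"
    and "stable_solution \<mu> g f u"
    and "\<forall>r>0. Linfty_on (closure (half_ball r)) (\<lambda>z. fst (grad u z))"
    and "(\<forall>M>0. set_integrable lebesgue {0<..} (\<lambda>x. SUP t\<in>{-M..M}. \<bar>g x t\<bar>)) \<or>
         (\<forall>x>0. \<forall>t. g x t * t \<ge> 0)"
    and "\<exists>C>0. \<forall>R\<ge>1. (LINT x:{0<..<R}|lebesgue. \<mu> x) \<le> C * R\<^sup>2"
  shows "\<exists>(\<omega>::real^2) (uo::real \<Rightarrow> real \<Rightarrow> real). norm \<omega> = 1 \<and>
           (\<forall>y x. x > 0 \<longrightarrow> u (y, x) = uo (\<omega> \<bullet> y) x)"
proof -
  obtain G and H :: "point \<Rightarrow> point \<Rightarrow>\<^sub>L point" where GH: "\<And>z. z \<in> half_space \<Longrightarrow> GDERIV u z :> G z"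
    "\<And>z. z \<in> half_space \<Longrightarrow> (G has_derivative blinfun_apply (H z)) (at z)" "continuous_on half_space H"
    using assms(2) unfolding C2_on_def by blast
  interpret stable_layer \<mu> g f u G H
    by (unfold_locales) (fact assms GH)+
  show ?thesis by (rule symmetry)
qed

end
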